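(* Assume that the spectral norms of the channel covariances are uniformly bounded: there is a constant $\zeta$ such that $\|\mathbf R_l\|_2<\zeta$ for all $M\in\mathbb Z^+$ and all $l\in\{1,\dots,L\}$. Let $$\alpha_l\triangleq\lim_{M\to\infty}\frac1M\operatorname{tr}\{\mathbf\Xi_j\mathbf R_l\mathbf\Xi_j^H\},\qquad l=1,\dots,L.$$ If $\alpha_j>\alpha_l$ for all $l\neq j$, then the estimation error of $\widehat{\mathbf h}_j^{\mathrm{CA}}$ vanishes, i.e., $$\lim_{M,C\to\infty}\frac{\|\widehat{\mathbf h}_j^{\mathrm{CA}}-\mathbf h_j\|_2^2}{\|\mathbf h_j\|_2^2}=0 .$$
   Context: There are $L$ cells with one user per cell; $j\in\{1,\dots,L\}$ is the target cell, $\sigma_n^2>0$ is the noise variance, and $\mathbf s\in\mathbb C^{\tau}$ with $\mathbf s^T\mathbf s^*=\tau$ is a pilot vector shared by all users. $M$ is the number of antennas of base station $j$ and $C$ is the number of data symbols sent by each user. The channel from the user of cell $l$ to base station $j$ is $\mathbf h_l=\mathbf R_l^{1/2}\mathbf h_{\mathrm W l}\in\mathbb C^M$, with $\mathbf h_{\mathrm W1},\dots,\mathbf h_{\mathrm WL}$ independent $\mathcal{CN}(\mathbf 0,\mathbf I_M)$ vectors and $\mathbf R_l=\mathbb E\{\mathbf h_l\mathbf h_l^H\}$ the $M\times M$ channel covariance matrix (dependence on $M$ suppressed). The channels are constant during the transmission of the pilots and the data. Received training signal: $\mathbf Y=\sum_{l=1}^L\mathbf h_l\mathbf s^T+\mathbf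 N\in\mathbb C^{M\times\tau}$. Received data signal: $\mathbf W=\sum_{l=1}^L\mathbf h_l\mathbf x_l^T+\mathbf Z\in\mathbb C^{M\times C}$, where the transmitted symbols (the entries of $\mathbf x_1,\dots,\mathbf x_L\in\mathbb C^{C}$) are i.i.d. with zero mean and unit variance. $\mathbf N$ and $\mathbf Z$ are white additive Gaussian noise with zero mean and element-wise variance $\sigma_n^2$. Channels, data symbols and noises are mutually independent. Filters: $\mathbf\Xi_j=\big(\sum_{l=1}^L\mathbf R_l+\sigma_n^2\mathbf I_M\big)^{-1}\mathbf R_j$ and $\mathbf\Xi_j'=\mathbf R_j^{\dagger}\big(\sum_{l=1}^L\mathbf R_l+\sigma_n^2\mathbf I_M\big)$, where $\dagger$ is the Moore–Penrose pseudoinverse. Covariance-aided amplitude based (CA) estimator: $\widetilde{\mathbf W}_j=\mathbf\Xi_j\mathbf W$; $\widetilde{\mathbf u}_{j1}$ is the (unit-norm) eigenvector for the largest eigenvalue of $\frac1C\widetilde{\mathbf W}_j\widetilde{\mathbf W}_j^H$; $\overline{\mathbf u}_{j1}=\mathbf\Xi_j'\widetilde{\mathbf u}_{j1}/\|\mathbf\Xi_j'\widetilde{\mathbf u}_{j1}\|_2$; and $\widehat{\mathbf h}_j^{\mathrm{CA}}=\frac1\tau\overline{\mathbf u}_{j1}\overline{\mathbf u}_{j1}^H\mathbf Y\mathbf s^*$. $\|\cdot\|_2$ is the Euclidean norm of a vector and the spectral norm of a matrix. $\lim_{M,C\to\infty}$ is the limit as the number of antennas $M$ and the number of data symbols $C$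 tend to infinity.
   Formalization: With a single cell (L=1) the condition α_j>α_l is vacuous and the claim can fail (e.g. R_1=diag(1,0,…,0), where α_1=0), so α_j>0 is assumed in that case; nothing is added for L≥2. The limit is proved almost surely. *)

theory Defs
  imports
    "HOL-Probability.Probability"
    "Jordan_Normal_Form.Gauss_Jordan_Elimination"
    "Jordan_Normal_Form.Schur_Decomposition"
begin

hide_type (open) Finite_Cartesian_Product.vec
hide_const (open) Finite_Cartesian_Product.vec
unbundle no vec_syntax and no inner_syntax


section \<open>Complex vectors and matrices of variable dimension\<close>

definition norm2 :: "complex vec \<Rightarrow> real" where
  "norm2 v = sqrt (\<Sum>i<dim_vec v. (cmod (v $ i))\<^sup>2)"

definition spectral_norm :: "complex mat \<Rightarrow> real" where
  "spectral_norm A = (SUP v \<in> {v \<in> carrier_vec (dim_col A). norm2 v \<le> 1}. norm2 (A *\<^sub>v v))"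

definition mtrace :: "complex mat \<Rightarrow> complex" where
  "mtrace A = (\<Sum>i<dim_row A. A $$ (i, i))"

text \<open>The matrix \<open>u v\<^sup>T\<close> (no conjugation).\<close>

definition outer :: "complex vec \<Rightarrow> complex vec \<Rightarrow> complex mat" where
  "outer u v = mat (dim_vec u) (dim_vec v) (\<lambda>(i, k). u $ i * v $ k)"

definition mat_sum :: "nat \<Rightarrow> nat \<Rightarrow> ('b \<Rightarrow> complex mat) \<Rightarrow> 'b set \<Rightarrow> complex mat" where
  "mat_sum nr nc A I = mat nr nc (\<lambda>ik. \<Sum>l\<in>I. A l $$ ik)"

text \<open>
  The scalar product \<open>(A v) \<bullet>c v\<close> is \<open>v\<^sup>H A v\<close>, and \<open>0 \<le> z\<close> for complex \<open>z\<close> means that \<open>z\<close> is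
  real and nonnegative.
\<close>

definition psd :: "complex mat \<Rightarrow> bool" where
  "psd A \<longleftrightarrow> square_mat A \<and> mat_adjoint A = A \<and>
     (\<forall>v \<in> carrier_vec (dim_row A). 0 \<le> (A *\<^sub>v v) \<bullet>c v)"

definition psd_sqrt :: "complex mat \<Rightarrow> complex mat" where
  "psd_sqrt A = (THE S. psd S \<and> S * S = A)"

text \<open>The Moore--Penrose pseudoinverse, characterized by the four Penrose equations.\<close>

definition pinv :: "complex mat \<Rightarrow> complex mat" where
  "pinv A = (THE X. X \<in> carrier_mat (dim_col A) (dim_row A) \<and>
     A * X * A = A \<and> X * A * X = X \<and>
     mat_adjoint (A * X) = A * X \<and> mat_adjoint (X * A) = X * A)"

text \<open>
  Intended for Hermitian \<open>A\<close>, whose eigenvalues are real. The vector is determined only up to a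
  factor of modulus one (more if the largest eigenvalue is not simple).
\<close>

definition principal_eigenvector :: "complex mat \<Rightarrow> complex vec \<Rightarrow> bool" where
  "principal_eigenvector A u \<longleftrightarrow> norm2 u = 1 \<and>
     (\<exists>k::real. eigenvector A u (complex_of_real k) \<and>
       (\<forall>k'::real. eigenvalue A (complex_of_real k') \<longrightarrow> k' \<le> k))"


section \<open>Signal model for a fixed number of antennas\<close>

text \<open>Users are numbered \<open>1, \<dots>, L\<close>; antennas, pilot times and data times are numbered from 0.\<close>

definition channel :: "nat \<Rightarrow> complex mat \<Rightarrow> (nat \<Rightarrow> complex) \<Rightarrow> complex vec" where
  "channel M Rl w = psd_sqrt Rl *\<^sub>v vec M w"

definition received ::
  "nat \<Rightarrow> nat \<Rightarrow> nat \<Rightarrow> (nat \<Rightarrow> complex vec) \<Rightarrow> (nat \<Rightarrow> complex vec) \<Rightarrow> (nat \<Rightarrow> nat \<Rightarrow> complex) \<Rightarrow> complex mat"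
where
  "received L M n h x noise =
     mat_sum M n (\<lambda>l. outer (h l) (x l)) {1..L} + mat M n (\<lambda>(i, t). noise i t)"

definition total_cov :: "nat \<Rightarrow> nat \<Rightarrow> real \<Rightarrow> (nat \<Rightarrow> complex mat) \<Rightarrow> complex mat" where
  "total_cov L M \<sigma> R = mat_sum M M R {1..L} + complex_of_real (\<sigma>\<^sup>2) \<cdot>\<^sub>m 1\<^sub>m M"

definition Xi :: "nat \<Rightarrow> nat \<Rightarrow> real \<Rightarrow> (nat \<Rightarrow> complex mat) \<Rightarrow> nat \<Rightarrow> complex mat" where
  "Xi L M \<sigma> R j = the (mat_inverse (total_cov L M \<sigma> R)) * R j"

definition Xi' :: "nat \<Rightarrow> nat \<Rightarrow> real \<Rightarrow> (nat \<Rightarrow> complex mat) \<Rightarrow> nat \<Rightarrow> complex mat" where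
  "Xi' L M \<sigma> R j = pinv (R j) * total_cov L M \<sigma> R"

definition sample_cov :: "nat \<Rightarrow> complex mat \<Rightarrow> complex mat" where
  "sample_cov C W = complex_of_real (1 / real C) \<cdot>\<^sub>m (W * mat_adjoint W)"

definition normalized :: "complex vec \<Rightarrow> complex vec" where
  "normalized v = complex_of_real (1 / norm2 v) \<cdot>\<^sub>v v"

text \<open>
  The covariance-aided amplitude based estimate, from the filter \<open>Xi'\<close>, the training signal \<open>Y\<close>,
  the pilot \<open>s\<close> and an eigenvector \<open>u\<close> of the sample covariance of the filtered data signal.
\<close>

definition CA_estimate ::
  "nat \<Rightarrow> complex mat \<Rightarrow> complex mat \<Rightarrow> complex vec \<Rightarrow> complex vec \<Rightarrow> complex vec"
where
  "CA_estimate \<tau> F Y s u =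
     (let ub = normalized (F *\<^sub>v u)
      in complex_of_real (1 / real \<tau>) \<cdot>\<^sub>v (outer ub (conjugate ub) *\<^sub>v (Y *\<^sub>v conjugate s)))"


section \<open>Randomness\<close>

text \<open>
  Density with respect to Lebesgue measure on the complex plane of the circularly symmetric
  Gaussian law \<open>CN(0, v)\<close>: real and imaginary part are independent with variance \<open>v / 2\<close> each.
\<close>

definition CN_density :: "real \<Rightarrow> complex \<Rightarrow> ennreal" where
  "CN_density v z = ennreal (exp (- (cmod z)\<^sup>2 / v) / (pi * v))"

text \<open>
  Labels for the scalar random variables of the model: entry \<open>i\<close> of the white channel vector of
  user \<open>l\<close>, data symbol \<open>c\<close> of user \<open>l\<close>, and the entries of the two noise matrices.
\<close>

datatype source = Chan nat nat | Sym nat nat | PilotNoise nat nat | DataNoise nat nat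

definition sources :: "nat \<Rightarrow> nat \<Rightarrow> nat \<Rightarrow> nat \<Rightarrow> source set" where
  "sources L M \<tau> C =
     {Chan l i | l i. l \<in> {1..L} \<and> i < M} \<union> {Sym l c | l c. l \<in> {1..L} \<and> c < C} \<union>
     {PilotNoise i t | i t. i < M \<and> t < \<tau>} \<union> {DataNoise i c | i c. i < M \<and> c < C}"

fun source_var ::
  "(nat \<Rightarrow> nat \<Rightarrow> 'a \<Rightarrow> complex) \<Rightarrow> (nat \<Rightarrow> nat \<Rightarrow> 'a \<Rightarrow> complex) \<Rightarrow>
   (nat \<Rightarrow> nat \<Rightarrow> 'a \<Rightarrow> complex) \<Rightarrow> (nat \<Rightarrow> nat \<Rightarrow> 'a \<Rightarrow> complex) \<Rightarrow> source \<Rightarrow> 'a \<Rightarrow> complex"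
where
  "source_var hW x N Z (Chan l i) = hW l i"
| "source_var hW x N Z (Sym l c) = x l c"
| "source_var hW x N Z (PilotNoise i t) = N i t"
| "source_var hW x N Z (DataNoise i c) = Z i c"

text \<open>
  One probability space carries the models for all numbers \<open>M\<close> of antennas and \<open>C\<close> of data symbols,
  so that almost sure limits make sense:

    \<^item> \<open>hW M l i\<close>: white channel coefficients, constant during the transmission, hence the same
      for all \<open>C\<close>;
    \<^item> \<open>x l c\<close>: each user sends one stream of symbols, of which the first \<open>C\<close> are used;
    \<^item> \<open>N M i t\<close>: noise during the training phase, which precedes the data phase;
    \<^item> \<open>Z M C i c\<close>: noise during the data phase.

  Apart from this sharing, nothing is assumed about the joint law for different \<open>(M, C)\<close>.
\<close>

definition mimo_model ::
  "'a measure \<Rightarrow> nat \<Rightarrow> nat \<Rightarrow> real \<Rightarrow> (nat \<Rightarrow> nat \<Rightarrow> nat \<Rightarrow> 'a \<Rightarrow> complex) \<Rightarrow>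
   (nat \<Rightarrow> nat \<Rightarrow> 'a \<Rightarrow> complex) \<Rightarrow> (nat \<Rightarrow> nat \<Rightarrow> nat \<Rightarrow> 'a \<Rightarrow> complex) \<Rightarrow>
   (nat \<Rightarrow> nat \<Rightarrow> nat \<Rightarrow> nat \<Rightarrow> 'a \<Rightarrow> complex) \<Rightarrow> bool"
where
  "mimo_model P L \<tau> \<sigma> hW x N Z \<longleftrightarrow> prob_space P \<and>
     (\<forall>M\<ge>1. \<forall>C\<ge>1. prob_space.indep_vars P (\<lambda>_. borel)
        (source_var (hW M) x (N M) (Z M C)) (sources L M \<tau> C)) \<and>
     (\<forall>M\<ge>1. \<forall>l\<in>{1..L}. \<forall>i<M. distributed P lborel (hW M l i) (CN_density 1)) \<and>
     (\<forall>M\<ge>1. \<forall>i<M. \<forall>t<\<tau>. distributed P lborel (N M i t) (CN_density (\<sigma>\<^sup>2))) \<and>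
     (\<forall>M\<ge>1. \<forall>C\<ge>1. \<forall>i<M. \<forall>c<C. distributed P lborel (Z M C i c) (CN_density (\<sigma>\<^sup>2))) \<and>
     (\<forall>l\<in>{1..L}. \<forall>l'\<in>{1..L}. \<forall>c c'. distr P borel (x l c) = distr P borel (x l' c')) \<and>
     (\<forall>l\<in>{1..L}. \<forall>c. integrable P (\<lambda>\<omega>. (cmod (x l c \<omega>))\<^sup>2) \<and>
        prob_space.expectation P (x l c) = 0 \<and>
        prob_space.expectation P (\<lambda>\<omega>. (cmod (x l c \<omega>))\<^sup>2) = 1)"

definition h_vec ::
  "(nat \<Rightarrow> nat \<Rightarrow> complex mat) \<Rightarrow> (nat \<Rightarrow> nat \<Rightarrow> nat \<Rightarrow> 'a \<Rightarrow> complex) \<Rightarrow> nat \<Rightarrow> nat \<Rightarrow> 'a \<Rightarrow> complex vec"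
where
  "h_vec R hW M l \<omega> = channel M (R M l) (\<lambda>i. hW M l i \<omega>)"

definition Y_mat ::
  "nat \<Rightarrow> nat \<Rightarrow> complex vec \<Rightarrow> (nat \<Rightarrow> nat \<Rightarrow> complex mat) \<Rightarrow> (nat \<Rightarrow> nat \<Rightarrow> nat \<Rightarrow> 'a \<Rightarrow> complex) \<Rightarrow>
   (nat \<Rightarrow> nat \<Rightarrow> nat \<Rightarrow> 'a \<Rightarrow> complex) \<Rightarrow> nat \<Rightarrow> 'a \<Rightarrow> complex mat"
where
  "Y_mat L \<tau> s R hW N M \<omega> = received L M \<tau> (\<lambda>l. h_vec R hW M l \<omega>) (\<lambda>l. s) (\<lambda>i t. N M i t \<omega>)"

definition W_mat ::
  "nat \<Rightarrow> (nat \<Rightarrow> nat \<Rightarrow> complex mat) \<Rightarrow> (nat \<Rightarrow> nat \<Rightarrow> nat \<Rightarrow> 'a \<Rightarrow> complex) \<Rightarrow>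
   (nat \<Rightarrow> nat \<Rightarrow> 'a \<Rightarrow> complex) \<Rightarrow> (nat \<Rightarrow> nat \<Rightarrow> nat \<Rightarrow> nat \<Rightarrow> 'a \<Rightarrow> complex) \<Rightarrow>
   nat \<Rightarrow> nat \<Rightarrow> 'a \<Rightarrow> complex mat"
where
  "W_mat L R hW x Z M C \<omega> =
     received L M C (\<lambda>l. h_vec R hW M l \<omega>) (\<lambda>l. vec C (\<lambda>c. x l c \<omega>)) (\<lambda>i c. Z M C i c \<omega>)"

end

theory Submission
  imports Defs "Jordan_Normal_Form.Char_Poly" "HOL-Real_Asymp.Real_Asymp"
begin

text \<open>
  Write \<open>G = \<Sum>\<^sub>l g\<^sub>l x\<^sub>l\<^sup>T + V\<close> for the filtered data, with \<open>g\<^sub>l = \<Xi>\<^sub>j h\<^sub>l\<close>. Almost surely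
  \<open>g\<^sub>k\<^sup>H g\<^sub>l / M\<close> tends to \<open>\<alpha>\<^sub>l\<close> for \<open>k = l\<close> and to 0 otherwise (fourth moments of quadratic forms
  and Borel--Cantelli, which needs no relation between the models for different \<open>M\<close>),
  \<open>x\<^sub>l\<^sup>T x\<^sub>k\<^sup>* / C\<close> tends to the Kronecker delta (strong law of large numbers), and
  the noise matrix is \<open>o(\<surd>(M C))\<close> in operator norm, by exponential moment bounds for the entries of the
  Gram matrix of its shorter side. Hence \<open>G G\<^sup>H / (M C)\<close> is asymptotically an orthogonal sum of
  rank-one matrices with eigenvalues \<open>\<alpha>\<^sub>l\<close>, and its principal eigenvector \<open>u\<close> aligns with \<open>g\<^sub>j\<close>.

  To undo the filter, whose inverse has no bounded norm, expand \<open>u\<close> by its eigenvalue equation into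
  the \<open>g\<^sub>l\<close> and the filtered noise: \<open>\<Xi>\<^sub>j' \<Xi>\<^sub>j\<close> is the orthogonal projection onto the range of \<open>R\<^sub>j\<close>, so it
  fixes \<open>h\<^sub>j\<close> and does not enlarge the other terms. So \<open>\<Xi>\<^sub>j' u\<close> aligns with \<open>h\<^sub>j\<close>, and the remaining
  channels and the pilot noise are asymptotically orthogonal to \<open>h\<^sub>j\<close>.
\<close>

section \<open>Hermitian matrices and the filters\<close>

text \<open>The limit runs over \<open>M\<close> and \<open>C\<close> jointly, with no coupling of
  their rates, so each random statement has to hold eventually almost surely by summability alone.
  For the channels a second moment would only give the non-summable rate \<open>1 / M\<close>; the
  fourth moment gives \<open>1 / M^2\<close>. For the data noise, all pairs with
  \<open>max M C = N\<close> form one event, so its tail must beat a polynomial number of pairs and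
  of Gram entries. The symbols have no more than a second moment; their products are merely
  integrable and need the strong law in its sharp form, which applies because each stream is shared
  by all \<open>C\<close>. Once these almost sure events hold, \<omega> is fixed and the remainder
  is deterministic analysis along a filter, so the eigenvector may be chosen without measurability.
  Positivity of \<open>\<alpha> j\<close> separates the signal eigenvalue from the noise and keeps
  \<open>norm2 (h j)\<close> of order \<open>sqrt M\<close>. It follows from nonnegativity of the
  other limits; with a single cell there are none, and it is a hypothesis.\<close>

lemma adj_dim [simp]: "dim_row (mat_adjoint A) = dim_col A" "dim_col (mat_adjoint A) = dim_row A"
  by (simp_all add: mat_adjoint_def)

lemma adj_carrier [simp]: "A \<in> carrier_mat n m \<Longrightarrow> mat_adjoint A \<in> carrier_mat m n"
  by (intro carrier_matI) auto

lemma adj_index [simp]: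
  "i < dim_col A \<Longrightarrow> k < dim_row A \<Longrightarrow> mat_adjoint A $$ (i, k) = conjugate (A $$ (k, i))"
  by (simp add: mat_adjoint_def mat_of_rows_def)

lemma adj_adj [simp]: "mat_adjoint (mat_adjoint A) = A"
  by (rule eq_matI) auto

lemma adj_mult:
  fixes A B :: "complex mat"
  assumes "dim_col A = dim_row B"
  shows "mat_adjoint (A * B) = mat_adjoint B * mat_adjoint A"
  using assms
  by (intro eq_matI) (auto simp: scalar_prod_def mult.commute intro!: sum.cong)

lemma mult_assoc:
  fixes A :: "'a :: semiring_0 mat"
  assumes "dim_col A = dim_row B" "dim_col B = dim_row D"
  shows "A * B * D = A * (B * D)"
  using assms by (intro assoc_mult_mat) auto

lemma mult_vec_assoc:
  fixes A :: "'a :: semiring_0 mat"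
  assumes "dim_col A = dim_row B" "dim_col B = dim_vec v"
  shows "(A * B) *\<^sub>v v = A *\<^sub>v (B *\<^sub>v v)"
  using assms by (intro assoc_mult_mat_vec) auto

lemma cscalar_prod_adj:
  fixes A :: "complex mat"
  assumes "A \<in> carrier_mat n m" "v \<in> carrier_vec m" "w \<in> carrier_vec n"
  shows "(A *\<^sub>v v) \<bullet>c w = v \<bullet>c (mat_adjoint A *\<^sub>v w)"
proof -
  have "(A *\<^sub>v v) \<bullet>c w = (\<Sum>i<n. \<Sum>k<m. A $$ (i,k) * v $ k * cnj (w $ i))"
    using assms by (auto simp: scalar_prod_def sum_distrib_right lessThan_atLeast0 intro!: sum.cong)
  also have "\<dots> = (\<Sum>k<m. \<Sum>i<n. A $$ (i,k) * v $ k * cnj (w $ i))"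
    by (rule sum.swap)
  also have "\<dots> = v \<bullet>c (mat_adjoint A *\<^sub>v w)"
    using assms by (auto simp: scalar_prod_def sum_distrib_left lessThan_atLeast0 intro!: sum.cong)
  finally show ?thesis .
qed

lemma cscalar_prod_self: "v \<bullet>c v = complex_of_real ((norm2 v)\<^sup>2)"
  by (auto simp: scalar_prod_def norm2_def lessThan_atLeast0 complex_mult_cnj cmod_power2 sum_nonneg)

lemma norm2_nonneg [simp]: "0 \<le> norm2 v"
  by (simp add: norm2_def sum_nonneg)

lemma norm2_eq_0: "v \<in> carrier_vec n \<Longrightarrow> norm2 v = 0 \<longleftrightarrow> v = 0\<^sub>v n"
  by (auto simp: norm2_def sum_nonneg_eq_0_iff sum_nonneg intro!: eq_vecI)

lemma norm2_smult [simp]: "norm2 (a \<cdot>\<^sub>v v) = cmod a * norm2 v"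
  by (simp add: norm2_def norm_mult power_mult_distrib real_sqrt_mult flip: sum_distrib_left)

lemma norm2_Cauchy_Schwarz:
  assumes "v \<in> carrier_vec n" "w \<in> carrier_vec n"
  shows "cmod (v \<bullet>c w) \<le> norm2 v * norm2 w"
proof -
  have "cmod (v \<bullet>c w) \<le> (\<Sum>i<n. cmod (v $ i) * cmod (w $ i))"
    using assms by (auto simp: scalar_prod_def lessThan_atLeast0 norm_mult
        intro!: order.trans[OF norm_sum] sum_mono)
  also have "\<dots> \<le> L2_set (\<lambda>i. cmod (v $ i)) {..<n} * L2_set (\<lambda>i. cmod (w $ i)) {..<n}"
    using L2_set_mult_ineq[of "\<lambda>i. cmod (v $ i)" "\<lambda>i. cmod (w $ i)" "{..<n}"] by simp
  finally show ?thesis using assms by (simp add: norm2_def L2_set_def)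
qed

section \<open>Unitary diagonalization of Hermitian matrices\<close>

definition unitary :: "nat \<Rightarrow> complex mat \<Rightarrow> bool" where
  "unitary n U \<longleftrightarrow> U \<in> carrier_mat n n \<and> mat_adjoint U * U = 1\<^sub>m n"

lemma unitaryD:
  assumes "unitary n U"
  shows "U \<in> carrier_mat n n" "mat_adjoint U * U = 1\<^sub>m n" "U * mat_adjoint U = 1\<^sub>m n"
  using assms mat_mult_left_right_inverse[of "mat_adjoint U" n U] by (auto simp: unitary_def)

lemma unitary_cancel:
  assumes "unitary n U" "dim_row A = n"
  shows "mat_adjoint U * (U * A) = A" "U * (mat_adjoint U * A) = A"
  using unitaryD[OF assms(1)] assms(2) by (simp_all flip: mult_assoc)

lemma unitary_mult:
  assumes "unitary n U" "unitary n V"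
  shows "unitary n (U * V)"
proof -
  have "mat_adjoint (U * V) * (U * V) = 1\<^sub>m n"
    using unitaryD[OF assms(1)] unitaryD[OF assms(2)]
    by (simp add: adj_mult mult_assoc unitary_cancel[OF assms(1)])
  then show ?thesis using unitaryD(1)[OF assms(1)] unitaryD(1)[OF assms(2)] by (simp add: unitary_def)
qed

text \<open>The diagonal is a function of the index, so that products, adjoints, square roots and
  reciprocals of diagonal matrices become pointwise operations on it.\<close>

definition diag :: "nat \<Rightarrow> (nat \<Rightarrow> complex) \<Rightarrow> complex mat" where
  "diag n d = mat n n (\<lambda>(i, k). if i = k then d i else 0)"

lemma diag_carrier [simp]: "diag n d \<in> carrier_mat n n" "dim_row (diag n d) = n" "dim_col (diag n d) = n"
  by (simp_all add: diag_def)

lemma diag_mult: "diag n d * diag n e = diag n (\<lambda>i. d i * e i)"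
  by (rule eq_matI) (auto simp: diag_def scalar_prod_def sum.delta' if_distrib[of "\<lambda>x. x * _"] cong: if_cong)

lemma diag_adj: "mat_adjoint (diag n d) = diag n (\<lambda>i. cnj (d i))"
  by (rule eq_matI) (auto simp: diag_def)

text \<open>Gram-Schmidt keeps the head of its list, so applied to a basis completed from
  \<open>v\<close> it yields orthogonal vectors that start with \<open>v\<close>. They are not
  normalized; the factors \<open>f i\<close> do this, which is why the first column is a multiple of
  \<open>v\<close>.\<close>

lemma exists_unitary_first_col:
  assumes v: "v \<in> carrier_vec n" "v \<noteq> 0\<^sub>v n" and n: "n > 0"
  shows "\<exists>U c. unitary n U \<and> c \<noteq> 0 \<and> col U 0 = c \<cdot>\<^sub>v v"
proof -
  interpret cof_vec_space n "TYPE(complex)" .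
  define b where "b = basis_completion v"
  define ws where "ws = gram_schmidt n b"
  from basis_completion[OF v, folded b_def]
  have dist_b: "distinct b" and indep: "\<not> lin_dep (set b)" and b: "set b \<subseteq> carrier_vec n"
    and hdb: "hd b = v" and len_b: "length b = n" by auto
  from hdb len_b n obtain vs where bv: "b = v # vs" by (cases b) auto
  from gram_schmidt_result[OF b dist_b indep refl, folded ws_def]
  have ws: "set ws \<subseteq> carrier_vec n" "corthogonal ws" "length ws = n" by (auto simp: len_b)
  from gram_schmidt_hd[OF v(1), of vs, folded bv] have hdws: "ws ! 0 = v"
    using ws n unfolding ws_def by (cases "gram_schmidt n b") auto
  have wsc: "ws ! i \<in> carrier_vec n" if "i < n" for i using ws that by auto
  define f where "f i = complex_of_real (1 / norm2 (ws ! i))" for i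
  define U where "U = mat_of_cols n (map (\<lambda>i. f i \<cdot>\<^sub>v ws ! i) [0..<n])"
  have Uc: "U \<in> carrier_mat n n" by (simp add: U_def mat_of_cols_def)
  have colU: "col U i = f i \<cdot>\<^sub>v ws ! i" if "i < n" for i
    using that wsc unfolding U_def by (subst col_mat_of_cols) auto
  have nz: "norm2 (ws ! i) \<noteq> 0" if "i < n" for i
    using corthogonalD[OF ws(2), of i i] that ws(3) cscalar_prod_self[of "ws ! i"] by auto
  have "mat_adjoint U * U = 1\<^sub>m n"
  proof (rule eq_matI)
    fix i k assume "i < dim_row (1\<^sub>m n :: complex mat)" "k < dim_col (1\<^sub>m n :: complex mat)"
    then have ik: "i < n" "k < n" by auto
    have r: "row (mat_adjoint U) i = conjugate (col U i)"
      using ik Uc by (intro eq_vecI) auto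
    have "(mat_adjoint U * U) $$ (i, k) = col U k \<bullet>c col U i"
    proof -
      have c: "col U i \<in> carrier_vec n" "col U k \<in> carrier_vec n"
        using Uc by (auto intro!: carrier_vecI)
      have "(mat_adjoint U * U) $$ (i, k) = conjugate (col U i) \<bullet> col U k"
        using ik Uc r by simp
      also have "\<dots> = col U k \<bullet>c col U i"
        using c by (intro comm_scalar_prod[of _ n]) auto
      finally show ?thesis .
    qed
    also have "\<dots> = f k * cnj (f i) * (ws ! k \<bullet>c ws ! i)"
      using ik wsc[of i] wsc[of k] by (simp add: colU scalar_prod_def sum_distrib_left mult_ac)
    also have "\<dots> = 1\<^sub>m n $$ (i, k)"
    proof (cases "i = k")
      case True
      then show ?thesis using ik nz[of i] by (simp add: cscalar_prod_self f_def power2_eq_square)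
    next
      case False
      then show ?thesis using ik corthogonalD[OF ws(2), of k i] ws(3) by simp
    qed
    finally show "(mat_adjoint U * U) $$ (i, k) = 1\<^sub>m n $$ (i, k)" .
  qed (use Uc in auto)
  then show ?thesis using Uc colU[OF n] hdws nz[OF n] n
    by (intro exI[of _ U] exI[of _ "f 0"]) (auto simp: unitary_def f_def)
qed

text \<open>Deflation: conjugation by a unitary matrix whose first column is an eigenvector clears
  the first column below the corner. Symmetry then clears the first row, and the remaining Hermitian
  block falls under the induction hypothesis. Taking \<open>d\<close> real-valued records that the
  eigenvalues are real.\<close>

theorem hermitian_diagonalization:
  assumes "A \<in> carrier_mat n n" "mat_adjoint A = A"
  shows "\<exists>U d. unitary n U \<and> A = U * diag n (\<lambda>i. complex_of_real (d i)) * mat_adjoint U"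
  using assms
proof (induction n arbitrary: A)
  case 0
  then show ?case
    by (intro exI[of _ "1\<^sub>m 0"]) (auto simp: unitary_def intro!: eq_matI)
next
  case (Suc n)
  let ?n = "Suc n"
  note A = Suc.prems(1)
  obtain as where "char_poly A = (\<Prod>a\<leftarrow>as. [:- a, 1:])" "length as = ?n"
    using char_poly_factorized[OF A] by auto
  then obtain e where "poly (char_poly A) e = 0" by (cases as) auto
  then obtain v where "eigenvector A v e"
    using eigenvalue_root_char_poly[OF A] unfolding eigenvalue_def by auto
  then have v: "v \<in> carrier_vec ?n" "v \<noteq> 0\<^sub>v ?n" "A *\<^sub>v v = e \<cdot>\<^sub>v v"
    using A by (auto simp: eigenvector_def)
  obtain U c where U: "unitary ?n U" and c: "c \<noteq> 0" and col: "col U 0 = c \<cdot>\<^sub>v v"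
    using exists_unitary_first_col[OF v(1,2)] by blast
  note Uc = unitaryD(1)[OF U] and U1 = unitaryD(2)[OF U] and U2 = unitaryD(3)[OF U]
  define B where "B = mat_adjoint U * A * U"
  have B: "B \<in> carrier_mat ?n ?n" using Uc A by (auto simp: B_def)
  have Badj: "mat_adjoint B = B"
    using Uc A Suc.prems(2)
    by (simp add: B_def adj_mult mult_assoc)
  have colc: "col U 0 \<in> carrier_vec ?n" using Uc by (intro carrier_vecI) simp
  have col0: "B $$ (i, 0) = (if i = 0 then e else 0)" if "i < ?n" for i
  proof -
    have "col B 0 = (mat_adjoint U * A) *\<^sub>v col U 0"
      unfolding B_def using Uc A by (intro col_mult2[of _ ?n ?n _ ?n]) auto
    also have "\<dots> = mat_adjoint U *\<^sub>v (A *\<^sub>v col U 0)"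
      using Uc A by (simp add: mult_vec_assoc)
    also have "A *\<^sub>v col U 0 = e \<cdot>\<^sub>v col U 0"
      using v A by (simp add: col mult_mat_vec[of _ ?n ?n] smult_smult_assoc mult.commute)
    also have "mat_adjoint U *\<^sub>v (e \<cdot>\<^sub>v col U 0) = e \<cdot>\<^sub>v (mat_adjoint U *\<^sub>v col U 0)"
      by (rule mult_mat_vec[OF adj_carrier[OF Uc] colc])
    also have "mat_adjoint U *\<^sub>v col U 0 = col (mat_adjoint U * U) 0"
      by (rule col_mult2[OF adj_carrier[OF Uc] Uc, symmetric]) simp
    finally have "col B 0 = e \<cdot>\<^sub>v col (1\<^sub>m ?n) 0" by (simp add: U1)
    then have "col B 0 $ i = (e \<cdot>\<^sub>v col (1\<^sub>m ?n) 0) $ i" by (rule arg_cong)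
    then show ?thesis using that B by auto
  qed
  have row0: "B $$ (0, k) = (if k = 0 then cnj e else 0)" if "k < ?n" for k
  proof -
    have "B $$ (0, k) = mat_adjoint B $$ (0, k)" by (simp add: Badj)
    then show ?thesis using col0[OF that] that B by auto
  qed
  \<comment> \<open>The corner entry is read once from the column and once from the row, which gives
    \<open>e = cnj e\<close>.\<close>
  have e: "e \<in> \<real>" using row0[of 0] col0[of 0] by (simp add: Reals_cnj_iff)
  define B3 where "B3 = mat n n (\<lambda>(i, k). B $$ (Suc i, Suc k))"
  have B3: "B3 \<in> carrier_mat n n" by (simp add: B3_def)
  have "mat_adjoint B3 = B3"
  proof (rule eq_matI)
    fix i k assume "i < dim_row B3" "k < dim_col B3"
    then have ik: "i < n" "k < n" by (auto simp: B3_def)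
    have "B $$ (Suc i, Suc k) = mat_adjoint B $$ (Suc i, Suc k)" by (simp add: Badj)
    then show "mat_adjoint B3 $$ (i, k) = B3 $$ (i, k)" using ik B by (auto simp: B3_def)
  qed (auto simp: B3_def)
  from Suc.IH[OF B3 this] obtain V d where V: "unitary n V"
    and B3eq: "B3 = V * diag n (\<lambda>i. complex_of_real (d i)) * mat_adjoint V" by blast
  note Vc = unitaryD(1)[OF V] and V1 = unitaryD(2)[OF V]
  define V' where "V' = four_block_mat (1\<^sub>m 1) (0\<^sub>m 1 n) (0\<^sub>m n 1) V"
  define d' where "d' i = (case i of 0 \<Rightarrow> Re e | Suc i \<Rightarrow> d i)" for i
  have V'c: "V' \<in> carrier_mat ?n ?n" using Vc by (auto simp: V'_def)
  have V'adj: "mat_adjoint V' = four_block_mat (1\<^sub>m 1) (0\<^sub>m 1 n) (0\<^sub>m n 1) (mat_adjoint V)"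
    using Vc by (intro eq_matI) (auto simp: V'_def)
  have dd: "diag ?n (\<lambda>i. complex_of_real (d' i)) =
      four_block_mat (diag 1 (\<lambda>_. e)) (0\<^sub>m 1 n) (0\<^sub>m n 1) (diag n (\<lambda>i. complex_of_real (d i)))"
    using e by (intro eq_matI) (auto simp: diag_def d'_def split: nat.splits)
  have "mat_adjoint V' * V' = four_block_mat (1\<^sub>m 1) (0\<^sub>m 1 n) (0\<^sub>m n 1) (1\<^sub>m n)"
    unfolding V'adj unfolding V'_def using Vc V1
    by (subst mult_four_block_mat[of _ 1 1 _ n _ n _ _ 1 _ n]) auto
  also have "\<dots> = 1\<^sub>m ?n" by (intro eq_matI) auto
  finally have V': "unitary ?n V'" using V'c by (simp add: unitary_def)
  have "V' * diag ?n (\<lambda>i. complex_of_real (d' i)) * mat_adjoint V' =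
      four_block_mat (diag 1 (\<lambda>_. e)) (0\<^sub>m 1 n) (0\<^sub>m n 1) B3"
    unfolding V'adj dd unfolding V'_def using Vc
    apply (subst mult_four_block_mat[of _ 1 1 _ n _ n _ _ 1 _ n], auto)
    apply (subst mult_four_block_mat[of _ 1 1 _ n _ n _ _ 1 _ n], auto simp: B3eq)
    done
  also have "\<dots> = B"
    using col0 row0 B e by (intro eq_matI) (auto simp: diag_def B3_def Reals_cnj_iff split: if_splits)
  finally have Beq: "B = V' * diag ?n (\<lambda>i. complex_of_real (d' i)) * mat_adjoint V'" by simp
  have "A = U * B * mat_adjoint U"
    using Uc A by (simp add: B_def mult_assoc unitary_cancel[OF U] U2)
  also have "\<dots> = (U * V') * diag ?n (\<lambda>i. complex_of_real (d' i)) * mat_adjoint (U * V')"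
    using Uc V'c by (simp add: Beq adj_mult mult_assoc)
  finally show ?case using unitary_mult[OF U V'] by (intro exI conjI)
qed

lemma unitary_norm2:
  assumes "unitary n U" "v \<in> carrier_vec n"
  shows "norm2 (mat_adjoint U *\<^sub>v v) = norm2 v"
proof -
  note U = unitaryD[OF assms(1)]
  have w: "mat_adjoint U *\<^sub>v v \<in> carrier_vec n" using U(1) by (intro carrier_vecI) simp
  have "(mat_adjoint U *\<^sub>v v) \<bullet>c (mat_adjoint U *\<^sub>v v) = v \<bullet>c (U *\<^sub>v (mat_adjoint U *\<^sub>v v))"
    using cscalar_prod_adj[OF adj_carrier[OF U(1)] assms(2) w] by simp
  also have "U *\<^sub>v (mat_adjoint U *\<^sub>v v) = v"
    using U assms(2) by (simp flip: mult_vec_assoc)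
  finally have "(mat_adjoint U *\<^sub>v v) \<bullet>c (mat_adjoint U *\<^sub>v v) = v \<bullet>c v" .
  then have "(norm2 (mat_adjoint U *\<^sub>v v))\<^sup>2 = (norm2 v)\<^sup>2"
    unfolding cscalar_prod_self of_real_eq_iff .
  then show ?thesis by (simp add: power2_eq_iff_nonneg)
qed

lemma diag_mult_vec:
  "w \<in> carrier_vec n \<Longrightarrow> diag n d *\<^sub>v w = vec n (\<lambda>i. d i * w $ i)"
  by (intro eq_vecI) (auto simp: diag_def scalar_prod_def if_distrib[of "\<lambda>x. x * _"] sum.delta' cong: if_cong)

lemma quadratic_form_diag:
  assumes U: "unitary n U" and v: "v \<in> carrier_vec n"
  shows "((U * diag n (\<lambda>i. complex_of_real (d i)) * mat_adjoint U) *\<^sub>v v) \<bullet>c v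
    = complex_of_real (\<Sum>i<n. d i * (cmod ((mat_adjoint U *\<^sub>v v) $ i))\<^sup>2)"
proof -
  note Uc = unitaryD(1)[OF U]
  let ?w = "mat_adjoint U *\<^sub>v v"
  have w: "?w \<in> carrier_vec n" using Uc by (auto intro!: carrier_vecI)
  have dw: "diag n (\<lambda>i. complex_of_real (d i)) *\<^sub>v ?w = vec n (\<lambda>i. complex_of_real (d i) * ?w $ i)"
    by (rule diag_mult_vec[OF w])
  have "((U * diag n (\<lambda>i. complex_of_real (d i)) * mat_adjoint U) *\<^sub>v v) \<bullet>c v
      = (U *\<^sub>v (diag n (\<lambda>i. complex_of_real (d i)) *\<^sub>v ?w)) \<bullet>c v"
    using Uc v by (simp add: mult_vec_assoc)
  also have "\<dots> = (diag n (\<lambda>i. complex_of_real (d i)) *\<^sub>v ?w) \<bullet>c ?w"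
    using v by (intro cscalar_prod_adj[OF Uc]) (auto intro!: carrier_vecI)
  also have "\<dots> = (\<Sum>i<n. complex_of_real (d i) * (?w $ i * cnj (?w $ i)))"
  proof -
    have "vec n (\<lambda>i. complex_of_real (d i) * w $ i) \<bullet>c w = (\<Sum>i<n. complex_of_real (d i) * (w $ i * cnj (w $ i)))"
      if "w \<in> carrier_vec n" for w :: "complex vec"
      using that by (auto simp: scalar_prod_def lessThan_atLeast0 mult_ac intro!: sum.cong)
    then show ?thesis unfolding dw using w by blast
  qed
  also have "\<dots> = complex_of_real (\<Sum>i<n. d i * (cmod (?w $ i))\<^sup>2)"
    by (simp only: complex_norm_square[symmetric] of_real_mult[symmetric] of_real_sum[symmetric])
  finally show ?thesis .
qed

lemma diag_eigenvalue:
  assumes U: "unitary n U" and i: "i < n"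
    and A: "A = U * diag n (\<lambda>i. complex_of_real (d i)) * mat_adjoint U"
  shows "eigenvector A (col U i) (complex_of_real (d i))"
proof -
  note Uc = unitaryD(1)[OF U]
  have c: "col U i \<in> carrier_vec n" using Uc by (auto intro!: carrier_vecI)
  have 1: "mat_adjoint U *\<^sub>v col U i = unit_vec n i"
    using col_mult2[OF adj_carrier[OF Uc] Uc i] i unitaryD(2)[OF U] by simp
  have 2: "diag n (\<lambda>i. complex_of_real (d i)) *\<^sub>v unit_vec n i = complex_of_real (d i) \<cdot>\<^sub>v unit_vec n i"
    using i by (intro eq_vecI) (auto simp: diag_def)
  have 3: "U *\<^sub>v unit_vec n i = col U i"
    using col_mult2[OF Uc one_carrier_mat i] Uc i by simp
  have "A *\<^sub>v col U i = U *\<^sub>v (diag n (\<lambda>i. complex_of_real (d i)) *\<^sub>v (mat_adjoint U *\<^sub>v col U i))"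
    using Uc c by (simp add: A mult_vec_assoc)
  also have "\<dots> = complex_of_real (d i) \<cdot>\<^sub>v col U i"
    unfolding 1 2 using mult_mat_vec[OF Uc, of "unit_vec n i"] by (simp add: 3)
  finally have *: "A *\<^sub>v col U i = complex_of_real (d i) \<cdot>\<^sub>v col U i" .
  have "norm2 (col U i) = 1"
    using unitary_norm2[OF U c] i unfolding 1
    by (simp add: norm2_def if_distrib[of cmod] if_distrib[of "\<lambda>x. x ^ 2"] sum.delta cong: if_cong)
  then have "col U i \<noteq> 0\<^sub>v n" using norm2_eq_0[OF c] by auto
  then show ?thesis using * c Uc A by (simp add: eigenvector_def)
qed

text \<open>In the eigenbasis the quadratic form is a weighted sum of the \<open>d i\<close>, each
  of which is an eigenvalue. Since these are real, it suffices that \<open>k\<close> dominates the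
  real eigenvalues, as \<open>principal_eigenvector\<close> provides.\<close>

theorem rayleigh_le:
  assumes A: "A \<in> carrier_mat n n" "mat_adjoint A = A" and v: "v \<in> carrier_vec n"
    and k: "\<And>k'. eigenvalue A (complex_of_real k') \<Longrightarrow> k' \<le> k"
  shows "Re ((A *\<^sub>v v) \<bullet>c v) \<le> k * (norm2 v)\<^sup>2"
proof -
  obtain U d where U: "unitary n U"
    and Aeq: "A = U * diag n (\<lambda>i. complex_of_real (d i)) * mat_adjoint U"
    using hermitian_diagonalization[OF A] by blast
  let ?w = "mat_adjoint U *\<^sub>v v"
  have "d i \<le> k" if "i < n" for i
    using diag_eigenvalue[OF U that Aeq] k unfolding eigenvalue_def by blast
  then have "(\<Sum>i<n. d i * (cmod (?w $ i))\<^sup>2) \<le> (\<Sum>i<n. k * (cmod (?w $ i))\<^sup>2)"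
    by (intro sum_mono mult_right_mono) auto
  also have "\<dots> = k * (norm2 ?w)\<^sup>2"
    using unitaryD(1)[OF U] by (simp add: norm2_def sum_nonneg sum_distrib_left)
  finally show ?thesis
    using quadratic_form_diag[OF U v, of d] unitary_norm2[OF U v] by (simp add: Aeq)
qed

section \<open>Positive semidefinite matrices and their square roots\<close>

lemma psdD:
  assumes "psd A" "A \<in> carrier_mat n n"
  shows "mat_adjoint A = A" "v \<in> carrier_vec n \<Longrightarrow> 0 \<le> Re ((A *\<^sub>v v) \<bullet>c v)"
    "v \<in> carrier_vec n \<Longrightarrow> (A *\<^sub>v v) \<bullet>c v = complex_of_real (Re ((A *\<^sub>v v) \<bullet>c v))"
  using assms by (auto simp: psd_def less_eq_complex_def complex_eq_iff)

lemma psd_diagonalization: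
  assumes "psd A" "A \<in> carrier_mat n n"
  obtains U d where "unitary n U" "\<And>i. i < n \<Longrightarrow> 0 \<le> d i"
    "A = U * diag n (\<lambda>i. complex_of_real (d i)) * mat_adjoint U"
proof -
  obtain U d where U: "unitary n U"
    and A: "A = U * diag n (\<lambda>i. complex_of_real (d i)) * mat_adjoint U"
    using hermitian_diagonalization[OF assms(2) psdD(1)[OF assms]] by blast
  have "0 \<le> d i" if i: "i < n" for i
  proof -
    have c: "col U i \<in> carrier_vec n" using unitaryD(1)[OF U] by (auto intro!: carrier_vecI)
    have e: "eigenvector A (col U i) (complex_of_real (d i))" by (rule diag_eigenvalue[OF U i A])
    then have "(A *\<^sub>v col U i) \<bullet>c col U i = complex_of_real (d i * (norm2 (col U i))\<^sup>2)"
      using c by (simp add: eigenvector_def cscalar_prod_self)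
    then have "0 \<le> d i * (norm2 (col U i))\<^sup>2"
      using psdD(2)[OF assms c] by (simp flip: of_real_power)
    moreover have "norm2 (col U i) > 0"
      using e norm2_eq_0[OF c] assms(2) norm2_nonneg[of "col U i"] by (auto simp: eigenvector_def order_less_le)
    ultimately show ?thesis by (simp add: zero_le_mult_iff)
  qed
  then show thesis using that U A by blast
qed

lemma psd_diag:
  assumes U: "unitary n U" and d: "\<And>i. i < n \<Longrightarrow> 0 \<le> d i"
  shows "psd (U * diag n (\<lambda>i. complex_of_real (d i)) * mat_adjoint U)" (is "psd ?A")
proof -
  note Uc = unitaryD(1)[OF U]
  have "mat_adjoint ?A = ?A" using Uc by (simp add: adj_mult mult_assoc diag_adj)
  moreover have "0 \<le> (?A *\<^sub>v v) \<bullet>c v" if "v \<in> carrier_vec n" for v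
    using d unfolding quadratic_form_diag[OF U that]
    by (auto simp: less_eq_complex_def intro!: sum_nonneg)
  ultimately show ?thesis using Uc by (simp add: psd_def)
qed

lemma smult_vec_scalar: "dim_vec v = dim_vec w \<Longrightarrow> (a \<cdot>\<^sub>v v) \<bullet>c (w :: complex vec) = a * (v \<bullet>c w)"
  by (auto simp: scalar_prod_def sum_distrib_left mult_ac intro!: sum.cong)

lemma cscalar_prod_smult:
  "dim_vec v = dim_vec w \<Longrightarrow> v \<bullet>c (a \<cdot>\<^sub>v (w :: complex vec)) = cnj a * (v \<bullet>c w)"
  by (auto simp: scalar_prod_def sum_distrib_left mult_ac intro!: sum.cong)

lemma cscalar_prod_add:
  fixes p q v :: "complex vec"
  assumes "p \<in> carrier_vec n" "q \<in> carrier_vec n" "v \<in> carrier_vec n"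
  shows "(p + q) \<bullet>c v = p \<bullet>c v + q \<bullet>c v" "v \<bullet>c (p + q) = v \<bullet>c p + v \<bullet>c q"
  using assms by (simp_all add: scalar_prod_def algebra_simps sum.distrib)

text \<open>With \<open>D = S - T\<close>, the identity \<open>S S - T T = D S + T D\<close> holds
  without any commutation. At an eigenvector of \<open>D\<close> with eigenvalue
  \<open>d \<noteq> 0\<close> it says that the quadratic forms of \<open>S\<close> and
  \<open>T\<close> add up to 0. Both are nonnegative, so both vanish, and so does their difference
  \<open>d * norm2 v ^ 2\<close>. Hence the Hermitian matrix \<open>D\<close> has only the
  eigenvalue 0.\<close>

lemma psd_sqrt_unique:
  assumes S: "S \<in> carrier_mat n n" "psd S" and T: "T \<in> carrier_mat n n" "psd T"
    and eq: "S * S = T * T"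
  shows "S = T"
proof -
  define D where "D = S - T"
  have D: "D \<in> carrier_mat n n" using T by (auto simp: D_def intro: minus_carrier_mat)
  note Sa = psdD[OF S(2,1)] and Ta = psdD[OF T(2,1)]
  have Dadj: "mat_adjoint D = D"
  proof (rule eq_matI)
    fix i k assume "i < dim_row D" "k < dim_col D"
    then have ik: "i < n" "k < n" using D by auto
    have "S $$ (i,k) = mat_adjoint S $$ (i,k)" "T $$ (i,k) = mat_adjoint T $$ (i,k)"
      by (simp_all only: Sa(1) Ta(1))
    then show "mat_adjoint D $$ (i, k) = D $$ (i, k)" using ik S T by (auto simp: D_def)
  qed (use D in auto)
  obtain U d where U: "unitary n U" and Deq: "D = U * diag n (\<lambda>i. complex_of_real (d i)) * mat_adjoint U"
    using hermitian_diagonalization[OF D Dadj] by blast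
  have d0: "d i = 0" if i: "i < n" for i
  proof (rule ccontr)
    assume nz: "d i \<noteq> 0"
    define v where "v = col U i"
    have v: "v \<in> carrier_vec n" using unitaryD(1)[OF U] by (auto simp: v_def intro!: carrier_vecI)
    have ev: "eigenvector D v (complex_of_real (d i))"
      unfolding v_def by (rule diag_eigenvalue[OF U i Deq])
    then have Dv: "D *\<^sub>v v = complex_of_real (d i) \<cdot>\<^sub>v v" and v0: "v \<noteq> 0\<^sub>v n"
      using D by (auto simp: eigenvector_def)
    have Sv: "S *\<^sub>v v \<in> carrier_vec n" and Tv: "T *\<^sub>v v \<in> carrier_vec n"
      using S T v by auto
    have Dv': "D *\<^sub>v v \<in> carrier_vec n" using D v by auto
    have DSv: "S *\<^sub>v v = D *\<^sub>v v + T *\<^sub>v v"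
      using S T v by (simp add: D_def minus_mult_distrib_mat_vec[of _ n n] minus_add_uminus_vec[of _ n])
         (auto intro!: eq_vecI)
    have "(S *\<^sub>v v) \<bullet>c (S *\<^sub>v v) = ((S * S) *\<^sub>v v) \<bullet>c v"
      using cscalar_prod_adj[OF S(1) Sv v] S v by (simp add: Sa(1) mult_vec_assoc)
    also have "\<dots> = (T *\<^sub>v v) \<bullet>c (T *\<^sub>v v)"
      using cscalar_prod_adj[OF T(1) Tv v] T v by (simp add: Ta(1) mult_vec_assoc eq)
    finally have "(norm2 (S *\<^sub>v v))\<^sup>2 = (norm2 (T *\<^sub>v v))\<^sup>2"
      by (simp add: cscalar_prod_self flip: of_real_power)
    have expand: "(S *\<^sub>v v) \<bullet>c (S *\<^sub>v v) - (T *\<^sub>v v) \<bullet>c (T *\<^sub>v v)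
        = (D *\<^sub>v v) \<bullet>c (S *\<^sub>v v) + (T *\<^sub>v v) \<bullet>c (D *\<^sub>v v)"
      unfolding DSv using Dv' Tv by (simp add: cscalar_prod_add[of _ n])
    have *: "(D *\<^sub>v v) \<bullet>c (S *\<^sub>v v) = complex_of_real (d i) * ((S *\<^sub>v v) \<bullet>c v)"
      using cscalar_prod_adj[OF S(1) v v] v S by (simp add: Dv Sa(1) smult_vec_scalar)
    have **: "(T *\<^sub>v v) \<bullet>c (D *\<^sub>v v) = complex_of_real (d i) * ((T *\<^sub>v v) \<bullet>c v)"
      using v T unfolding Dv by (simp add: cscalar_prod_smult)
    have "complex_of_real (d i) * ((S *\<^sub>v v) \<bullet>c v + (T *\<^sub>v v) \<bullet>c v) = 0"
      using expand \<open>(norm2 (S *\<^sub>v v))\<^sup>2 = (norm2 (T *\<^sub>v v))\<^sup>2\<close> unfolding * **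
      by (simp add: cscalar_prod_self distrib_left)
    then have "Re ((S *\<^sub>v v) \<bullet>c v) + Re ((T *\<^sub>v v) \<bullet>c v) = 0"
      using nz by (metis mult_eq_0_iff of_real_eq_0_iff plus_complex.sel(1) zero_complex.sel(1))
    then have z: "Re ((S *\<^sub>v v) \<bullet>c v) = 0" "Re ((T *\<^sub>v v) \<bullet>c v) = 0"
      using Sa(2)[OF v] Ta(2)[OF v] by auto
    have "(D *\<^sub>v v) \<bullet>c v = (S *\<^sub>v v) \<bullet>c v - (T *\<^sub>v v) \<bullet>c v"
      unfolding DSv using Dv' Tv v by (simp add: cscalar_prod_add[of _ n])
    then have "complex_of_real (d i * (norm2 v)\<^sup>2) = 0"
      using Sa(3)[OF v] Ta(3)[OF v] z unfolding Dv by (simp add: smult_vec_scalar cscalar_prod_self)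
    then show False using nz norm2_eq_0[OF v] v0 by (simp only: of_real_eq_0_iff) auto
  qed
  have "diag n (\<lambda>i. complex_of_real (d i)) = 0\<^sub>m n n" using d0 by (intro eq_matI) (auto simp: diag_def)
  then have "D = 0\<^sub>m n n" using unitaryD(1)[OF U] unfolding Deq by simp
  then have "D $$ (i,k) = 0" if "i < n" "k < n" for i k using that by simp
  then show ?thesis using S T by (intro eq_matI) (auto simp: D_def)
qed

theorem psd_sqrt:
  assumes "psd A" "A \<in> carrier_mat n n"
  shows "psd_sqrt A \<in> carrier_mat n n" "psd (psd_sqrt A)" "psd_sqrt A * psd_sqrt A = A"
proof -
  obtain U d where U: "unitary n U" and d: "\<And>i. i < n \<Longrightarrow> 0 \<le> d i"
    and A: "A = U * diag n (\<lambda>i. complex_of_real (d i)) * mat_adjoint U"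
    using psd_diagonalization[OF assms] by blast
  note Uc = unitaryD(1)[OF U]
  define S where "S = U * diag n (\<lambda>i. complex_of_real (sqrt (d i))) * mat_adjoint U"
  have S: "S \<in> carrier_mat n n" "psd S"
    using Uc d unfolding S_def by (auto intro!: psd_diag[OF U])
  have "S * S = U * (diag n (\<lambda>i. complex_of_real (sqrt (d i))) * diag n (\<lambda>i. complex_of_real (sqrt (d i)))) * mat_adjoint U"
    using Uc by (simp add: S_def mult_assoc unitary_cancel[OF U])
  also have "diag n (\<lambda>i. complex_of_real (sqrt (d i))) * diag n (\<lambda>i. complex_of_real (sqrt (d i)))
      = diag n (\<lambda>i. complex_of_real (d i))"
    using d unfolding diag_mult by (intro eq_matI) (auto simp: diag_def simp flip: of_real_mult)
  finally have SS: "S * S = A" using A by simp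
  \<comment> \<open>The description in \<open>psd_sqrt\<close> fixes no dimension. It is recovered
    from the product \<open>S' * S'\<close> and from \<open>psd\<close>, which forces a square
    matrix.\<close>
  have uniq: "S' = S" if "psd S' \<and> S' * S' = A" for S'
  proof (rule psd_sqrt_unique)
    have "dim_row (S' * S') = n" using that assms(2) by auto
    moreover have "dim_col S' = dim_row S'" using that unfolding psd_def by simp
    ultimately show "S' \<in> carrier_mat n n" by (intro carrier_matI) auto
    show "psd S'" "S' * S' = S * S" using that SS by simp_all
  qed (rule S)+
  have "psd S \<and> S * S = A" using S(2) SS by (rule conjI)
  then have "psd_sqrt A = S" unfolding psd_sqrt_def by (rule the_equality) (rule uniq)
  then show "psd_sqrt A \<in> carrier_mat n n" "psd (psd_sqrt A)" "psd_sqrt A * psd_sqrt A = A"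
    by (simp_all only: S SS)
qed

section \<open>The Moore-Penrose pseudoinverse: existence and uniqueness\<close>

definition penrose :: "complex mat \<Rightarrow> complex mat \<Rightarrow> bool" where
  "penrose A X \<longleftrightarrow> X \<in> carrier_mat (dim_col A) (dim_row A) \<and>
     A * X * A = A \<and> X * A * X = X \<and>
     mat_adjoint (A * X) = A * X \<and> mat_adjoint (X * A) = X * A"

text \<open>Inserting \<open>A = A Y A\<close> into the Hermitian product \<open>A X\<close> gives
  \<open>A X = (A X) (A Y) = A Y\<close>, and symmetrically \<open>X A = Y A\<close>. Then
  \<open>X = X A X = Y A X = Y A Y = Y\<close>.\<close>

lemma penrose_unique:
  assumes "penrose A X" "penrose A Y"
  shows "X = Y"
proof -
  have c: "dim_row X = dim_col A" "dim_col X = dim_row A" "dim_row Y = dim_col A" "dim_col Y = dim_row A"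
    using assms by (auto simp: penrose_def)
  have X: "A * (X * A) = A" "X * (A * X) = X" "mat_adjoint X * mat_adjoint A = A * X"
      "mat_adjoint A * mat_adjoint X = X * A"
    and Y: "A * (Y * A) = A" "Y * (A * Y) = Y" "mat_adjoint Y * mat_adjoint A = A * Y"
      "mat_adjoint A * mat_adjoint Y = Y * A"
    using assms c by (auto simp: penrose_def adj_mult mult_assoc)
  have adjX: "mat_adjoint A * (mat_adjoint X * mat_adjoint A) = mat_adjoint A"
    using arg_cong[OF X(1), of mat_adjoint] c by (simp add: adj_mult mult_assoc)
  have adjY: "mat_adjoint A * (mat_adjoint Y * mat_adjoint A) = mat_adjoint A"
    using arg_cong[OF Y(1), of mat_adjoint] c by (simp add: adj_mult mult_assoc)
  have "A * X = mat_adjoint X * (mat_adjoint A * (mat_adjoint Y * mat_adjoint A))"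
    using adjY X(3) by simp
  also have "\<dots> = (mat_adjoint X * mat_adjoint A) * (mat_adjoint Y * mat_adjoint A)"
    using c by (simp add: mult_assoc)
  also have "\<dots> = (A * X * A) * Y" using c by (simp add: X(3) Y(3) mult_assoc)
  finally have 1: "A * X = A * Y" using c by (simp add: X(1) mult_assoc)
  have "X * A = (mat_adjoint A * (mat_adjoint Y * mat_adjoint A)) * mat_adjoint X"
    using adjY X(4) by simp
  also have "\<dots> = (mat_adjoint A * mat_adjoint Y) * (mat_adjoint A * mat_adjoint X)"
    using c by (simp add: mult_assoc)
  also have "\<dots> = Y * (A * X * A)" using c by (simp add: X(4) Y(4) mult_assoc)
  finally have 2: "X * A = Y * A" using c by (simp add: X(1) mult_assoc)
  have "X = X * A * X" using c X(2) by (simp add: mult_assoc)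
  also have "\<dots> = Y * (A * X)" using c by (simp add: 2 mult_assoc)
  also have "\<dots> = Y" by (simp add: 1 Y(2))
  finally show ?thesis .
qed

theorem pinv_penrose:
  assumes "A \<in> carrier_mat n n" "mat_adjoint A = A"
  shows "penrose A (pinv A)"
proof -
  obtain U d where U: "unitary n U" and A: "A = U * diag n (\<lambda>i. complex_of_real (d i)) * mat_adjoint U"
    using hermitian_diagonalization[OF assms] by blast
  note Uc = unitaryD(1)[OF U]
  \<comment> \<open>Here \<open>1 / 0 = 0\<close> is exactly what the pseudoinverse asks for:
    nonzero eigenvalues are inverted and zero ones are kept.\<close>
  let ?D = "diag n (\<lambda>i. complex_of_real (d i))" and ?E = "diag n (\<lambda>i. complex_of_real (1 / d i))"
  define X where "X = U * ?E * mat_adjoint U"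
  have X: "X \<in> carrier_mat n n" using Uc by (auto simp: X_def)
  have AX: "A * X = U * (?D * ?E) * mat_adjoint U" and XA: "X * A = U * (?E * ?D) * mat_adjoint U"
    using Uc by (simp_all add: A X_def mult_assoc unitary_cancel[OF U])
  have DED: "?D * ?E * ?D = ?D" "?E * ?D * ?E = ?E"
    unfolding diag_mult by (auto simp: diag_def intro!: eq_matI)
  have e1: "A * X * A = U * (?D * ?E * ?D) * mat_adjoint U"
    unfolding AX using Uc by (simp add: A mult_assoc unitary_cancel[OF U])
  have e2: "X * A * X = U * (?E * ?D * ?E) * mat_adjoint U"
    unfolding XA using Uc by (simp add: X_def mult_assoc unitary_cancel[OF U])
  have e3: "mat_adjoint (A * X) = A * X" "mat_adjoint (X * A) = X * A"
    unfolding AX XA diag_mult using Uc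
    by (simp_all add: adj_mult mult_assoc diag_adj if_distrib[of cnj] cong: if_cong)
  have "penrose A X"
    unfolding penrose_def using X assms(1) e3 e1[unfolded DED, folded A] e2[unfolded DED, folded X_def] by simp
  then show ?thesis
    unfolding pinv_def penrose_def[symmetric] using penrose_unique by (metis theI)
qed

section \<open>Operator norm bounds\<close>

lemma norm2_mult_le_frobenius:
  assumes A: "A \<in> carrier_mat n m" and v: "v \<in> carrier_vec m"
  shows "norm2 (A *\<^sub>v v) \<le> sqrt (\<Sum>i<n. (norm2 (row A i))\<^sup>2) * norm2 v"
proof -
  have "(norm2 (A *\<^sub>v v))\<^sup>2 = (\<Sum>i<n. (cmod (row A i \<bullet> v))\<^sup>2)"
    using A by (simp add: norm2_def sum_nonneg)
  also have "\<dots> \<le> (\<Sum>i<n. (norm2 (row A i) * norm2 v)\<^sup>2)"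
  proof (intro sum_mono power_mono)
    fix i assume "i \<in> {..<n}"
    have r: "row A i \<in> carrier_vec m" using A by (intro carrier_vecI) auto
    have "cmod (row A i \<bullet>c conjugate v) \<le> norm2 (row A i) * norm2 (conjugate v)"
      using r v by (intro norm2_Cauchy_Schwarz) auto
    then show "cmod (row A i \<bullet> v) \<le> norm2 (row A i) * norm2 v" by (simp add: norm2_def)
  qed simp
  also have "\<dots> = (sqrt (\<Sum>i<n. (norm2 (row A i))\<^sup>2) * norm2 v)\<^sup>2"
    by (simp add: power_mult_distrib sum_nonneg sum_distrib_right)
  finally show ?thesis by (rule power2_le_imp_le) (simp add: sum_nonneg)
qed

text \<open>The Frobenius estimate makes the set under the supremum in \<open>spectral_norm\<close>
  bounded above, without which a real supremum says nothing. What remains is the definition at the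
  normalized vector.\<close>

lemma norm2_mult_le_spectral_norm:
  assumes A: "A \<in> carrier_mat n m" and v: "v \<in> carrier_vec m"
  shows "norm2 (A *\<^sub>v v) \<le> spectral_norm A * norm2 v"
proof (cases "norm2 v = 0")
  case True
  then show ?thesis using norm2_mult_le_frobenius[OF A v] by simp
next
  case False
  let ?B = "{v \<in> carrier_vec (dim_col A). norm2 v \<le> 1}"
  have bdd: "bdd_above ((\<lambda>v. norm2 (A *\<^sub>v v)) ` ?B)"
  proof (rule bdd_aboveI2)
    fix w assume w: "w \<in> ?B"
    have "norm2 (A *\<^sub>v w) \<le> sqrt (\<Sum>i<n. (norm2 (row A i))\<^sup>2) * norm2 w"
      using w A by (intro norm2_mult_le_frobenius) auto
    also have "\<dots> \<le> sqrt (\<Sum>i<n. (norm2 (row A i))\<^sup>2) * 1"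
      using w by (intro mult_left_mono) (auto simp: sum_nonneg)
    finally show "norm2 (A *\<^sub>v w) \<le> sqrt (\<Sum>i<n. (norm2 (row A i))\<^sup>2) * 1" .
  qed
  have "norm2 (A *\<^sub>v (complex_of_real (1 / norm2 v) \<cdot>\<^sub>v v)) \<le> spectral_norm A"
    unfolding spectral_norm_def using v False A by (intro cSUP_upper[OF _ bdd]) (auto simp: norm_divide)
  also have "A *\<^sub>v (complex_of_real (1 / norm2 v) \<cdot>\<^sub>v v) = complex_of_real (1 / norm2 v) \<cdot>\<^sub>v (A *\<^sub>v v)"
    by (rule mult_mat_vec[OF A v])
  finally show ?thesis using False norm2_nonneg[of v] by (auto simp: norm_divide field_simps order_less_le)
qed

text \<open>Moving the adjoint across the scalar product bounds \<open>norm2 (A^H w) ^ 2\<close> by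
  \<open>k * norm2 (A^H w) * norm2 w\<close>, and one factor cancels. The bound is an arbitrary
  constant \<open>k\<close> instead of \<open>spectral_norm A\<close>, because later constants are
  products such as \<open>\<kappa> * sqrt \<zeta>\<close>.\<close>

lemma adjoint_bound:
  assumes A: "A \<in> carrier_mat n m" and w: "w \<in> carrier_vec n" and k: "0 \<le> k"
    and le: "\<And>v. v \<in> carrier_vec m \<Longrightarrow> norm2 (A *\<^sub>v v) \<le> k * norm2 v"
  shows "norm2 (mat_adjoint A *\<^sub>v w) \<le> k * norm2 w"
proof -
  let ?v = "mat_adjoint A *\<^sub>v w"
  have v: "?v \<in> carrier_vec m" using A by (intro carrier_vecI) simp
  have "(norm2 ?v)\<^sup>2 = cmod (?v \<bullet>c ?v)" by (simp only: cscalar_prod_self norm_of_real) simp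
  also have "?v \<bullet>c ?v = (A *\<^sub>v ?v) \<bullet>c w" by (rule cscalar_prod_adj[OF A v w, symmetric])
  also have "cmod \<dots> \<le> norm2 (A *\<^sub>v ?v) * norm2 w"
    using A w by (intro norm2_Cauchy_Schwarz[of _ n]) (auto intro!: carrier_vecI)
  also have "\<dots> \<le> (k * norm2 ?v) * norm2 w" using le[OF v] by (intro mult_right_mono) auto
  finally have *: "norm2 ?v * norm2 ?v \<le> norm2 ?v * (k * norm2 w)" by (simp add: power2_eq_square mult_ac)
  show ?thesis
  proof (cases "norm2 ?v = 0")
    case True
    then show ?thesis using k by simp
  next
    case False
    then show ?thesis using * norm2_nonneg[of ?v] by (simp add: mult_le_cancel_left order_less_le)
  qed
qed

section \<open>The total covariance and the filters \<open>Xi\<close> and \<open>Xi'\<close>\<close>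

lemma total_cov_carrier [simp]: "total_cov L M \<sigma> R \<in> carrier_mat M M"
  by (auto simp: total_cov_def mat_sum_def)

lemma total_cov_quadratic:
  assumes R: "\<And>l. l \<in> {1..L} \<Longrightarrow> R l \<in> carrier_mat M M" and v: "v \<in> carrier_vec M"
  shows "(total_cov L M \<sigma> R *\<^sub>v v) \<bullet>c v
    = (\<Sum>l=1..L. (R l *\<^sub>v v) \<bullet>c v) + complex_of_real (\<sigma>\<^sup>2 * (norm2 v)\<^sup>2)"
proof -
  have s: "(mat_sum M M R {1..L} *\<^sub>v v) \<bullet>c v = (\<Sum>l=1..L. (R l *\<^sub>v v) \<bullet>c v)"
  proof -
    have "(mat_sum M M R {1..L} *\<^sub>v v) \<bullet>c v
        = (\<Sum>i<M. \<Sum>k<M. \<Sum>l=1..L. R l $$ (i,k) * v $ k * cnj (v $ i))"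
      using v by (auto simp: mat_sum_def scalar_prod_def lessThan_atLeast0 sum_distrib_right intro!: sum.cong)
    also have "\<dots> = (\<Sum>i<M. \<Sum>l=1..L. \<Sum>k<M. R l $$ (i,k) * v $ k * cnj (v $ i))"
      by (intro sum.cong sum.swap refl)
    also have "\<dots> = (\<Sum>l=1..L. \<Sum>i<M. \<Sum>k<M. R l $$ (i,k) * v $ k * cnj (v $ i))"
      by (rule sum.swap)
    also have "\<dots> = (\<Sum>l=1..L. (R l *\<^sub>v v) \<bullet>c v)"
    proof (intro sum.cong refl)
      fix l assume "l \<in> {1..L}"
      then have "R l \<in> carrier_mat M M" by (rule R)
      then show "(\<Sum>i<M. \<Sum>k<M. R l $$ (i,k) * v $ k * cnj (v $ i)) = (R l *\<^sub>v v) \<bullet>c v"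
        using v by (auto simp: scalar_prod_def lessThan_atLeast0 sum_distrib_right intro!: sum.cong)
    qed
    finally show ?thesis .
  qed
  have c: "mat_sum M M R {1..L} \<in> carrier_mat M M" by (simp add: mat_sum_def)
  have one: "(complex_of_real (\<sigma>\<^sup>2) \<cdot>\<^sub>m 1\<^sub>m M) *\<^sub>v v = complex_of_real (\<sigma>\<^sup>2) \<cdot>\<^sub>v v"
    using v by (intro eq_vecI) (auto simp: scalar_prod_def if_distrib[of "\<lambda>x. _ * x"] if_distrib[of "\<lambda>x. x * _"] sum.delta sum.delta' cong: if_cong)
  have "total_cov L M \<sigma> R *\<^sub>v v = mat_sum M M R {1..L} *\<^sub>v v + complex_of_real (\<sigma>\<^sup>2) \<cdot>\<^sub>v v"
    unfolding total_cov_def using v c one by (subst add_mult_distrib_mat_vec[of _ M M]) auto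
  then show ?thesis
    using v c by (simp add: cscalar_prod_add[of _ M] s[unfolded One_nat_def] smult_vec_scalar cscalar_prod_self)
qed

text \<open>The covariances are positive semidefinite, so the quadratic form of \<open>T\<close> is
  at least \<open>\<sigma>^2 * norm2 w ^ 2\<close>, and Cauchy-Schwarz gives
  \<open>norm2 (T w) \<ge> \<sigma>^2 * norm2 w\<close>. Injectivity makes
  \<open>mat_inverse\<close> return a value, and the same inequality bounds the inverse by
  \<open>1 / \<sigma>^2\<close>.\<close>

lemma total_cov_inverse:
  assumes \<sigma>: "\<sigma>\<^sup>2 > 0" and R: "\<And>l. l \<in> {1..L} \<Longrightarrow> R l \<in> carrier_mat M M \<and> psd (R l)"
  defines "T \<equiv> total_cov L M \<sigma> R" and "T' \<equiv> the (mat_inverse (total_cov L M \<sigma> R))"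
  shows "T' \<in> carrier_mat M M" "T * T' = 1\<^sub>m M" "T' * T = 1\<^sub>m M"
    "v \<in> carrier_vec M \<Longrightarrow> norm2 (T' *\<^sub>v v) \<le> norm2 v / \<sigma>\<^sup>2"
proof -
  have T: "T \<in> carrier_mat M M" by (simp add: T_def)
  have low: "\<sigma>\<^sup>2 * norm2 w \<le> norm2 (T *\<^sub>v w)" if w: "w \<in> carrier_vec M" for w
  proof -
    have "0 \<le> (\<Sum>l=1..L. Re ((R l *\<^sub>v w) \<bullet>c w))"
      using R w by (intro sum_nonneg psdD(2)) auto
    then have "\<sigma>\<^sup>2 * (norm2 w)\<^sup>2 \<le> Re ((T *\<^sub>v w) \<bullet>c w)"
      using R unfolding T_def by (subst total_cov_quadratic[OF _ w]) auto
    also have "\<dots> \<le> cmod ((T *\<^sub>v w) \<bullet>c w)" by (rule complex_Re_le_cmod)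
    also have "\<dots> \<le> norm2 (T *\<^sub>v w) * norm2 w"
      using T w by (intro norm2_Cauchy_Schwarz[of _ M]) auto
    finally have "(\<sigma>\<^sup>2 * norm2 w) * norm2 w \<le> norm2 (T *\<^sub>v w) * norm2 w"
      by (simp add: power2_eq_square mult_ac)
    then show ?thesis using norm2_nonneg[of w] by (cases "norm2 w = 0") (auto simp: mult_le_cancel_right)
  qed
  have "det T \<noteq> 0"
  proof
    assume "det T = 0"
    then obtain w where w: "w \<in> carrier_vec M" "w \<noteq> 0\<^sub>v M" "T *\<^sub>v w = 0\<^sub>v M"
      using det_0_iff_vec_prod_zero_field[OF T] by blast
    then have "\<sigma>\<^sup>2 * norm2 w \<le> 0" using low[OF w(1)] norm2_eq_0[of "0\<^sub>v M" M] by auto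
    then have "norm2 w = 0" using \<sigma> norm2_nonneg[of w] by (simp add: mult_le_0_iff)
    then show False using w norm2_eq_0 by auto
  qed
  then have "T \<in> Units (ring_mat TYPE(complex) M b)" for b :: unit
    by (rule det_non_zero_imp_unit[OF T])
  then obtain B where B: "mat_inverse T = Some B"
    using mat_inverse(1)[OF T, of "()"] by (cases "mat_inverse T") auto
  have T': "T' = B" using B by (simp add: T'_def T_def)
  note inv = mat_inverse(2)[OF T B]
  show "T' \<in> carrier_mat M M" "T * T' = 1\<^sub>m M" "T' * T = 1\<^sub>m M" using inv by (simp_all add: T')
  show "norm2 (T' *\<^sub>v v) \<le> norm2 v / \<sigma>\<^sup>2" if v: "v \<in> carrier_vec M"
  proof -
    have c: "T' *\<^sub>v v \<in> carrier_vec M" using inv v by (auto simp: T')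
    have "T *\<^sub>v (T' *\<^sub>v v) = v"
      using mult_vec_assoc[of T B v] inv T v by (auto simp: T')
    then show ?thesis using low[OF c] \<sigma> by (simp add: field_simps)
  qed
qed

text \<open>The square of the left norm is the quadratic form of \<open>A\<close> at
  \<open>v\<close>.\<close>

lemma psd_sqrt_bound:
  assumes "A \<in> carrier_mat n n" "psd A" "spectral_norm A < z" and v: "v \<in> carrier_vec n"
  shows "norm2 (psd_sqrt A *\<^sub>v v) \<le> sqrt z * norm2 v"
proof -
  note S = psd_sqrt[OF assms(2,1)]
  have Sv: "psd_sqrt A *\<^sub>v v \<in> carrier_vec n" using S(1) v by auto
  have "(norm2 (psd_sqrt A *\<^sub>v v))\<^sup>2 = cmod ((psd_sqrt A *\<^sub>v v) \<bullet>c (psd_sqrt A *\<^sub>v v))"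
    by (simp only: cscalar_prod_self norm_of_real) simp
  also have "(psd_sqrt A *\<^sub>v v) \<bullet>c (psd_sqrt A *\<^sub>v v) = (psd_sqrt A *\<^sub>v (psd_sqrt A *\<^sub>v v)) \<bullet>c v"
    using cscalar_prod_adj[OF S(1) Sv v] psdD(1)[OF S(2,1)] by simp
  also have "psd_sqrt A *\<^sub>v (psd_sqrt A *\<^sub>v v) = A *\<^sub>v v"
    using S v by (simp flip: mult_vec_assoc)
  also have "cmod ((A *\<^sub>v v) \<bullet>c v) \<le> norm2 (A *\<^sub>v v) * norm2 v"
    using assms(1) v by (intro norm2_Cauchy_Schwarz[of _ n]) auto
  also have "\<dots> \<le> (spectral_norm A * norm2 v) * norm2 v"
    using norm2_mult_le_spectral_norm[OF assms(1) v] by (intro mult_right_mono) auto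
  also have "\<dots> \<le> (z * norm2 v) * norm2 v"
    using assms(3) by (intro mult_right_mono) auto
  finally have "(norm2 (psd_sqrt A *\<^sub>v v))\<^sup>2 \<le> z * (norm2 v)\<^sup>2" by (simp add: power2_eq_square)
  from real_sqrt_le_mono[OF this] show ?thesis by (simp add: real_sqrt_mult)
qed

lemma spectral_norm_nonneg: "0 \<le> spectral_norm A" if "A \<in> carrier_mat n m" "m > 0"
proof -
  have "norm2 (unit_vec m 0) = 1"
    using that by (simp add: norm2_def if_distrib[of cmod] if_distrib[of "\<lambda>x. x ^ 2"] sum.delta cong: if_cong)
  then show ?thesis
    using order_trans[OF norm2_nonneg norm2_mult_le_spectral_norm[OF that(1) unit_vec_carrier, of 0]]
    by simp
qed

text \<open>The constant is a product: \<open>1 / \<sigma>^2\<close> for the inverse of the total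
  covariance and \<open>z\<close> for \<open>R j\<close>.\<close>

lemma Xi_bound:
  assumes \<sigma>: "\<sigma>\<^sup>2 > 0" and R: "\<And>l. l \<in> {1..L} \<Longrightarrow> R l \<in> carrier_mat M M \<and> psd (R l)"
    and j: "j \<in> {1..L}" and z: "spectral_norm (R j) < z"
  shows "Xi L M \<sigma> R j \<in> carrier_mat M M"
    "v \<in> carrier_vec M \<Longrightarrow> norm2 (Xi L M \<sigma> R j *\<^sub>v v) \<le> z / \<sigma>\<^sup>2 * norm2 v"
proof -
  note T = total_cov_inverse[OF \<sigma> R]
  have Rj: "R j \<in> carrier_mat M M" using R j by auto
  show "Xi L M \<sigma> R j \<in> carrier_mat M M" unfolding Xi_def by (rule mult_carrier_mat[OF T(1) Rj])
  assume v: "v \<in> carrier_vec M"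
  have Rv: "R j *\<^sub>v v \<in> carrier_vec M" using Rj v by auto
  have "Xi L M \<sigma> R j *\<^sub>v v = the (mat_inverse (total_cov L M \<sigma> R)) *\<^sub>v (R j *\<^sub>v v)"
    unfolding Xi_def by (rule assoc_mult_mat_vec[OF T(1) Rj v])
  then have "norm2 (Xi L M \<sigma> R j *\<^sub>v v) \<le> norm2 (R j *\<^sub>v v) / \<sigma>\<^sup>2"
    using T(4)[OF _ Rv] by simp
  also have "\<dots> \<le> (spectral_norm (R j) * norm2 v) / \<sigma>\<^sup>2"
    using \<sigma> norm2_mult_le_spectral_norm[OF Rj v] by (intro divide_right_mono) auto
  also have "\<dots> \<le> (z * norm2 v) / \<sigma>\<^sup>2"
    using z \<sigma> by (intro divide_right_mono mult_right_mono) auto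
  finally show "norm2 (Xi L M \<sigma> R j *\<^sub>v v) \<le> z / \<sigma>\<^sup>2 * norm2 v" by simp
qed

lemma mult_mat_zero_vec: "A \<in> carrier_mat n m \<Longrightarrow> A *\<^sub>v 0\<^sub>v m = (0\<^sub>v n :: complex vec)"
  by (intro eq_vecI) (auto simp: scalar_prod_def)

lemma cscalar_prod_minus:
  fixes p q v :: "complex vec"
  assumes "p \<in> carrier_vec n" "q \<in> carrier_vec n" "v \<in> carrier_vec n"
  shows "v \<bullet>c (p - q) = v \<bullet>c p - v \<bullet>c q"
  using assms by (simp add: scalar_prod_def algebra_simps sum_subtractf)

text \<open>The total covariance cancels in the product, which leaves
  \<open>Q = pinv (R j) * R j\<close>, Hermitian and idempotent by the Penrose equations; hence the
  contraction. The last claim says that the range of the square root of \<open>R j\<close> lies in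
  the range of \<open>Q\<close>, which is where every channel vector of user \<open>j\<close>
  lives.\<close>

lemma Xi'_Xi:
  assumes \<sigma>: "\<sigma>\<^sup>2 > 0" and R: "\<And>l. l \<in> {1..L} \<Longrightarrow> R l \<in> carrier_mat M M \<and> psd (R l)"
    and j: "j \<in> {1..L}"
  shows "Xi' L M \<sigma> R j \<in> carrier_mat M M"
    "v \<in> carrier_vec M \<Longrightarrow> norm2 (Xi' L M \<sigma> R j *\<^sub>v (Xi L M \<sigma> R j *\<^sub>v v)) \<le> norm2 v"
    "v \<in> carrier_vec M \<Longrightarrow>
      Xi' L M \<sigma> R j *\<^sub>v (Xi L M \<sigma> R j *\<^sub>v (psd_sqrt (R j) *\<^sub>v v)) = psd_sqrt (R j) *\<^sub>v v"
proof -
  note T = total_cov_inverse[OF \<sigma> R]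
  let ?A = "R j" and ?X = "pinv (R j)" and ?S = "psd_sqrt (R j)"
  have A: "?A \<in> carrier_mat M M" "psd ?A" using R j by auto
  have T1: "the (mat_inverse (total_cov L M \<sigma> R)) \<in> carrier_mat M M" by (rule T(1))
  have T2: "total_cov L M \<sigma> R * the (mat_inverse (total_cov L M \<sigma> R)) = 1\<^sub>m M" by (rule T(2))
  note Aadj = psdD(1)[OF A(2,1)]
  have pen: "penrose ?A ?X" by (rule pinv_penrose[OF A(1) Aadj])
  then have X: "?X \<in> carrier_mat M M" using A(1) by (auto simp: penrose_def)
  show "Xi' L M \<sigma> R j \<in> carrier_mat M M" unfolding Xi'_def using X by auto
  define Q where "Q = ?X * ?A"
  have Q: "Q \<in> carrier_mat M M" using X A by (auto simp: Q_def)
  have Xi: "Xi L M \<sigma> R j \<in> carrier_mat M M" unfolding Xi_def by (rule mult_carrier_mat[OF T1 A(1)])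
  have "Xi' L M \<sigma> R j * Xi L M \<sigma> R j
      = ?X * ((total_cov L M \<sigma> R * the (mat_inverse (total_cov L M \<sigma> R))) * ?A)"
    using X A T1 total_cov_carrier[of L M \<sigma> R]
    by (simp only: Xi_def Xi'_def mult_assoc carrier_matD mult_carrier_mat index_mult_mat)
  also have "\<dots> = Q" using A(1) by (simp add: T2 Q_def)
  finally have QQ: "Xi' L M \<sigma> R j *\<^sub>v (Xi L M \<sigma> R j *\<^sub>v v) = Q *\<^sub>v v" if "v \<in> carrier_vec M" for v
    using that Xi \<open>Xi' L M \<sigma> R j \<in> carrier_mat M M\<close> by (simp flip: mult_vec_assoc)
  have Qadj: "mat_adjoint Q = Q" and Qidem: "Q * Q = Q" and AQ: "?A * Q = ?A"
    using pen X A(1) by (auto simp: penrose_def Q_def mult_assoc)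
  have QA: "Q * ?A = ?A"
    using arg_cong[OF AQ, of mat_adjoint] Q A(1) by (simp add: adj_mult Qadj Aadj)
  show "norm2 (Xi' L M \<sigma> R j *\<^sub>v (Xi L M \<sigma> R j *\<^sub>v v)) \<le> norm2 v" if v: "v \<in> carrier_vec M"
  proof -
    have Qv: "Q *\<^sub>v v \<in> carrier_vec M" using Q v by auto
    have "(norm2 (Q *\<^sub>v v))\<^sup>2 = cmod ((Q *\<^sub>v v) \<bullet>c (Q *\<^sub>v v))"
      by (simp only: cscalar_prod_self norm_of_real) simp
    also have "(Q *\<^sub>v v) \<bullet>c (Q *\<^sub>v v) = (Q *\<^sub>v (Q *\<^sub>v v)) \<bullet>c v"
      using cscalar_prod_adj[OF Q Qv v] Qadj by simp
    also have "Q *\<^sub>v (Q *\<^sub>v v) = Q *\<^sub>v v" using Q v by (simp add: Qidem flip: mult_vec_assoc)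
    also have "cmod ((Q *\<^sub>v v) \<bullet>c v) \<le> norm2 (Q *\<^sub>v v) * norm2 v"
      by (rule norm2_Cauchy_Schwarz[OF Qv v])
    finally have "norm2 (Q *\<^sub>v v) * norm2 (Q *\<^sub>v v) \<le> norm2 (Q *\<^sub>v v) * norm2 v"
      by (simp add: power2_eq_square)
    then show ?thesis using norm2_nonneg[of "Q *\<^sub>v v"] norm2_nonneg[of v]
      by (cases "norm2 (Q *\<^sub>v v) = 0") (auto simp: QQ[OF v] mult_le_cancel_left)
  qed
  show "Xi' L M \<sigma> R j *\<^sub>v (Xi L M \<sigma> R j *\<^sub>v (?S *\<^sub>v v)) = ?S *\<^sub>v v" if v: "v \<in> carrier_vec M"
  proof -
    note S = psd_sqrt[OF A(2,1)]
    note Sadj = psdD(1)[OF S(2,1)]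
    \<comment> \<open>The component of \<open>S v\<close> outside the range of \<open>Q\<close>.
      From \<open>Q w = 0\<close> follows \<open>R j w = R j Q w = 0\<close>, hence
      \<open>S w = 0\<close> because \<open>norm2 (S w) ^ 2\<close> is the form of
      \<open>R j\<close> at \<open>w\<close>. So \<open>w\<close> is orthogonal to
      \<open>S v\<close> and to \<open>Q S v\<close>, and therefore to itself.\<close>
    define w where "w = ?S *\<^sub>v v - Q *\<^sub>v (?S *\<^sub>v v)"
    have Sv: "?S *\<^sub>v v \<in> carrier_vec M" and QSv: "Q *\<^sub>v (?S *\<^sub>v v) \<in> carrier_vec M"
      using S Q v by auto
    have w: "w \<in> carrier_vec M" using Q by (intro carrier_vecI) (simp add: w_def)
    have Qw: "Q *\<^sub>v w = 0\<^sub>v M"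
    proof -
      have "Q *\<^sub>v (Q *\<^sub>v (?S *\<^sub>v v)) = Q *\<^sub>v (?S *\<^sub>v v)"
        using assoc_mult_mat_vec[OF Q Q Sv] by (simp add: Qidem)
      then show ?thesis
        unfolding w_def using QSv by (simp add: mult_minus_distrib_mat_vec[OF Q Sv QSv])
    qed
    have Sw: "?S *\<^sub>v w = 0\<^sub>v M"
    proof -
      have "(?S *\<^sub>v w) \<bullet>c (?S *\<^sub>v w) = w \<bullet>c (?S *\<^sub>v (?S *\<^sub>v w))"
        using cscalar_prod_adj[OF S(1) w, of "?S *\<^sub>v w"] S(1) w Sadj by simp
      also have "?S *\<^sub>v (?S *\<^sub>v w) = ?A *\<^sub>v w"
        using S w by (simp flip: mult_vec_assoc)
      also have "?A *\<^sub>v w = ?A *\<^sub>v (Q *\<^sub>v w)"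
        using A(1) Q w by (simp add: AQ flip: mult_vec_assoc)
      finally have "complex_of_real ((norm2 (?S *\<^sub>v w))\<^sup>2) = 0"
        using w by (simp add: Qw mult_mat_zero_vec[OF A(1)] cscalar_prod_self)
      then have "norm2 (?S *\<^sub>v w) = 0" by simp
      then show ?thesis using S(1) w by (subst norm2_eq_0[symmetric]) auto
    qed
    have wQ: "w \<bullet>c (Q *\<^sub>v (?S *\<^sub>v v)) = 0"
      using cscalar_prod_adj[OF Q w Sv] Qadj Qw Sv by simp
    have "w \<bullet>c (?S *\<^sub>v v) = 0"
      using cscalar_prod_adj[OF S(1) w v] Sadj Sw v by simp
    then have "w \<bullet>c (?S *\<^sub>v v - Q *\<^sub>v (?S *\<^sub>v v)) = 0"
      unfolding cscalar_prod_minus[OF Sv QSv w] using wQ by simp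
    then have "w \<bullet>c w = 0" by (simp only: w_def)
    then have "w = 0\<^sub>v M" using norm2_eq_0[OF w] by (simp add: cscalar_prod_self)
    then have eq: "(?S *\<^sub>v v) $ i - (Q *\<^sub>v (?S *\<^sub>v v)) $ i = 0" if "i < M" for i
      using that Q QSv unfolding w_def by (metis carrier_vecD index_minus_vec(1) index_zero_vec(1))
    have "Q *\<^sub>v (?S *\<^sub>v v) = ?S *\<^sub>v v"
      using eq carrier_vecD[OF Sv] carrier_vecD[OF QSv] by (intro eq_vecI) (simp_all only: right_minus_eq)
    then show ?thesis by (simp only: QQ[OF Sv])
  qed
qed

section \<open>Moments of linear and quadratic forms\<close>

text \<open>A class closed under sums, products, conjugation and real or imaginary parts. With it
  the integrability of every polynomial in the Gaussian sources follows from the shape of the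
  expression, through \<open>all_moments_intros\<close>.\<close>

definition all_moments :: "'a measure \<Rightarrow> ('a \<Rightarrow> 'b :: {real_normed_field, banach, second_countable_topology}) \<Rightarrow> bool" where
  "all_moments P f \<longleftrightarrow> f \<in> borel_measurable P \<and> (\<forall>p::nat. integrable P (\<lambda>\<omega>. norm (f \<omega>) ^ p))"

lemma all_momentsD:
  assumes "all_moments P f"
  shows "f \<in> borel_measurable P" "integrable P (\<lambda>\<omega>. norm (f \<omega>) ^ p)" "integrable P f"
    "integrable P (\<lambda>\<omega>. f \<omega> ^ p)"
proof -
  show 1: "f \<in> borel_measurable P" "integrable P (\<lambda>\<omega>. norm (f \<omega>) ^ p)" for p
    using assms by (auto simp: all_moments_def)
  show "integrable P f" using 1(2)[of 1] 1(1) by (simp add: integrable_norm_iff)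
  show "integrable P (\<lambda>\<omega>. f \<omega> ^ p)"
    using 1 by (intro Bochner_Integration.integrable_bound[OF 1(2)[of p]]) (auto simp: norm_power)
qed

lemma all_moments_bound:
  assumes g: "g \<in> borel_measurable P" and f: "all_moments P f" and le: "\<And>\<omega>. norm (g \<omega>) \<le> norm (f \<omega>)"
  shows "all_moments P g"
  unfolding all_moments_def
proof (intro conjI allI g)
  show "integrable P (\<lambda>\<omega>. norm (g \<omega>) ^ p)" for p
    using g le by (intro Bochner_Integration.integrable_bound[OF all_momentsD(2)[OF f, of p]])
      (auto intro!: power_mono)
qed

lemma all_moments_add:
  assumes f: "all_moments P f" and g: "all_moments P g"
  shows "all_moments P (\<lambda>\<omega>. f \<omega> + g \<omega>)"
  unfolding all_moments_def
proof (intro conjI allI)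
  note [measurable] = all_momentsD(1)[OF f] all_momentsD(1)[OF g]
  show "(\<lambda>\<omega>. f \<omega> + g \<omega>) \<in> borel_measurable P" by measurable
  fix p :: nat
  have le: "norm (x + y) ^ p \<le> 2 ^ p * (norm x ^ p + norm y ^ p)" for x y :: 'b
  proof -
    have "norm (x + y) ^ p \<le> (2 * max (norm x) (norm y)) ^ p"
      by (intro power_mono order_trans[OF norm_triangle_ineq]) auto
    also have "\<dots> \<le> 2 ^ p * (norm x ^ p + norm y ^ p)"
      by (auto simp: power_mult_distrib max_def)
    finally show ?thesis .
  qed
  have "integrable P (\<lambda>\<omega>. 2 ^ p * (norm (f \<omega>) ^ p + norm (g \<omega>) ^ p))"
    by (intro integrable_mult_right Bochner_Integration.integrable_add all_momentsD(2)[OF f] all_momentsD(2)[OF g])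
  then show "integrable P (\<lambda>\<omega>. norm (f \<omega> + g \<omega>) ^ p)"
    by (rule Bochner_Integration.integrable_bound) (auto intro!: AE_I2 order_trans[OF le])
qed

text \<open>The arithmetic-geometric mean inequality bounds the \<open>p\<close>-th moment of a
  product by moments of order \<open>2 p\<close> of the factors. This doubling is why the class asks
  for all orders at once.\<close>

lemma all_moments_mult:
  assumes f: "all_moments P f" and g: "all_moments P g"
  shows "all_moments P (\<lambda>\<omega>. f \<omega> * g \<omega>)"
  unfolding all_moments_def
proof (intro conjI allI)
  note [measurable] = all_momentsD(1)[OF f] all_momentsD(1)[OF g]
  show "(\<lambda>\<omega>. f \<omega> * g \<omega>) \<in> borel_measurable P" by measurable
  fix p :: nat
  have le: "norm (x * y) ^ p \<le> norm x ^ (2 * p) + norm y ^ (2 * p)" for x y :: 'b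
  proof -
    have "2 * (norm x ^ p * norm y ^ p) \<le> (norm x ^ p)\<^sup>2 + (norm y ^ p)\<^sup>2"
      using sum_squares_bound[of "norm x ^ p" "norm y ^ p"] by simp
    then have "norm x ^ p * norm y ^ p \<le> (norm x ^ p)\<^sup>2 + (norm y ^ p)\<^sup>2"
      by (smt (verit) mult_nonneg_nonneg norm_ge_zero zero_le_power)
    then show ?thesis by (simp add: norm_mult power_mult_distrib power_mult[symmetric] mult.commute)
  qed
  have "integrable P (\<lambda>\<omega>. norm (f \<omega>) ^ (2 * p) + norm (g \<omega>) ^ (2 * p))"
    by (intro Bochner_Integration.integrable_add all_momentsD(2)[OF f] all_momentsD(2)[OF g])
  then show "integrable P (\<lambda>\<omega>. norm (f \<omega> * g \<omega>) ^ p)"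
    by (rule Bochner_Integration.integrable_bound) (auto intro!: AE_I2 order_trans[OF le])
qed

context prob_space begin

lemma all_moments_const [simp]: "all_moments M (\<lambda>_. c)"
  by (simp add: all_moments_def)

lemma all_moments_sum:
  assumes "\<And>i. i \<in> I \<Longrightarrow> all_moments M (f i)"
  shows "all_moments M (\<lambda>\<omega>. \<Sum>i\<in>I. f i \<omega>)"
  using assms by (induction I rule: infinite_finite_induct) (auto intro!: all_moments_add)

lemma all_moments_power: "all_moments M f \<Longrightarrow> all_moments M (\<lambda>\<omega>. f \<omega> ^ p)"
  by (induction p) (auto intro!: all_moments_mult)

lemma all_moments_uminus: "all_moments M f \<Longrightarrow> all_moments M (\<lambda>\<omega>. - f \<omega>)"
  using all_moments_mult[OF all_moments_const[of "-1"]] by simp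

lemma all_moments_diff:
  "all_moments M f \<Longrightarrow> all_moments M g \<Longrightarrow> all_moments M (\<lambda>\<omega>. f \<omega> - g \<omega>)"
  using all_moments_add[OF _ all_moments_uminus] by simp

lemma all_moments_complex:
  assumes f: "all_moments M f"
  shows "all_moments M (\<lambda>\<omega>. Re (f \<omega>))" "all_moments M (\<lambda>\<omega>. Im (f \<omega>))"
    "all_moments M (\<lambda>\<omega>. cnj (f \<omega>))" "all_moments M (\<lambda>\<omega>. cmod (f \<omega>))"
proof -
  note [measurable] = all_momentsD(1)[OF f]
  have Re: "(\<lambda>\<omega>. Re (f \<omega>)) \<in> borel_measurable M" and Im: "(\<lambda>\<omega>. Im (f \<omega>)) \<in> borel_measurable M" by measurable
  show "all_moments M (\<lambda>\<omega>. Re (f \<omega>))"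
    by (rule all_moments_bound[OF Re f]) (simp add: abs_Re_le_cmod)
  show "all_moments M (\<lambda>\<omega>. Im (f \<omega>))"
    by (rule all_moments_bound[OF Im f]) (simp add: abs_Im_le_cmod)
  have "(\<lambda>\<omega>. cnj (f \<omega>)) \<in> borel_measurable M"
    by (rule measurable_compose[OF all_momentsD(1)[OF f] borel_measurable_continuous_onI])
       (intro continuous_intros)
  then show "all_moments M (\<lambda>\<omega>. cnj (f \<omega>))" by (rule all_moments_bound[OF _ f]) simp
  show "all_moments M (\<lambda>\<omega>. cmod (f \<omega>))"
    using all_momentsD(2)[OF f] by (simp add: all_moments_def)
qed

lemmas all_moments_intros = all_moments_add all_moments_mult all_moments_const all_moments_sum
  all_moments_power all_moments_uminus all_moments_diff all_moments_complex

lemma indep_var_split: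
  assumes "indep_vars (\<lambda>_. borel) \<xi> I" "i \<in> I" "J \<subseteq> I" "i \<notin> J"
    and f: "f \<in> borel_measurable borel" and \<phi>: "\<phi> \<in> borel_measurable (PiM J (\<lambda>_. borel))"
  shows "indep_var borel (\<lambda>\<omega>. f (\<xi> i \<omega>)) borel (\<lambda>\<omega>. \<phi> (\<lambda>k\<in>J. \<xi> k \<omega>))"
proof -
  have "indep_var borel ((\<lambda>x. f (x i)) \<circ> (\<lambda>\<omega>. \<lambda>k\<in>{i}. \<xi> k \<omega>)) borel (\<phi> \<circ> (\<lambda>\<omega>. \<lambda>k\<in>J. \<xi> k \<omega>))"
    using assms by (intro indep_var_compose[OF indep_var_restrict[OF assms(1)]] measurable_compose[OF _ f]) auto
  then show ?thesis by (simp add: comp_def)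
qed

text \<open>The form of independence used when a sum grows by one index: whatever depends on the new
  variable factors from whatever is built from the earlier ones. \<open>g\<close> restates the
  second factor as a function of \<omega>, so that applications need not mention restricted
  families.\<close>

lemma expectation_split:
  fixes f :: "complex \<Rightarrow> real" and \<phi> :: "('i \<Rightarrow> complex) \<Rightarrow> real"
  assumes "indep_vars (\<lambda>_. borel) \<xi> I" "i \<in> I" "J \<subseteq> I" "i \<notin> J"
    and f: "f \<in> borel_measurable borel" and \<phi>: "\<phi> \<in> borel_measurable (PiM J (\<lambda>_. borel))"
    and eq: "\<And>\<omega>. \<phi> (\<lambda>k\<in>J. \<xi> k \<omega>) = g \<omega>"
    and int: "integrable M (\<lambda>\<omega>. f (\<xi> i \<omega>))" "integrable M g"
  shows "expectation (\<lambda>\<omega>. f (\<xi> i \<omega>) * g \<omega>) = expectation (\<lambda>\<omega>. f (\<xi> i \<omega>)) * expectation g"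
  using indep_var_lebesgue_integral[OF indep_var_split[OF assms(1-6)]] int unfolding eq by simp

end

section \<open>Fourth moments of linear and quadratic forms\<close>

lemma fourth_power_identity: "((t::real) + d) ^ 4 = t ^ 4 + d * (4 * t ^ 3) + d\<^sup>2 * (6 * t\<^sup>2) + d ^ 3 * (4 * t) + d ^ 4"
  by (simp add: power4_eq_xxxx power3_eq_cube power2_eq_square algebra_simps)

text \<open>Made for an increment \<open>d\<close> with \<open>s^3 d\<close> of mean zero. That
  cross term is kept exactly, and the other mixed terms are absorbed by Young's inequality, with a
  free weight \<open>e\<close> that keeps the factor in front of \<open>s^4\<close> as close to 1 as
  the induction requires.\<close>

lemma fourth_power_le:
  fixes s d :: real
  assumes "e > 0"
  shows "(s + d) ^ 4 \<le> s ^ 4 + 4 * (s ^ 3 * d) + 4 * (e * s ^ 4 + d ^ 4 / e) + 3 * d ^ 4"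
proof -
  have "0 \<le> (s * d - d\<^sup>2)\<^sup>2" by simp
  then have 1: "4 * (s * d ^ 3) \<le> 2 * (s\<^sup>2 * d\<^sup>2) + 2 * d ^ 4"
    by (simp add: power4_eq_xxxx power3_eq_cube power2_eq_square algebra_simps)
  have "0 \<le> (e * s\<^sup>2 - d\<^sup>2)\<^sup>2 / e" using assms by simp
  also have "\<dots> = e * s ^ 4 + d ^ 4 / e - 2 * (s\<^sup>2 * d\<^sup>2)"
    using assms by (simp add: power4_eq_xxxx power2_eq_square field_simps)
  finally have "2 * (s\<^sup>2 * d\<^sup>2) \<le> e * s ^ 4 + d ^ 4 / e" by simp
  then have 2: "8 * (s\<^sup>2 * d\<^sup>2) \<le> 4 * (e * s ^ 4 + d ^ 4 / e)" by simp
  have "(s + d) ^ 4 = s ^ 4 + 4 * (s ^ 3 * d) + 6 * (s\<^sup>2 * d\<^sup>2) + 4 * (s * d ^ 3) + d ^ 4"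
    unfolding fourth_power_identity by simp
  then have "(s + d) ^ 4 \<le> s ^ 4 + 4 * (s ^ 3 * d) + 8 * (s\<^sup>2 * d\<^sup>2) + 3 * d ^ 4" using 1 by linarith
  also have "\<dots> \<le> s ^ 4 + 4 * (s ^ 3 * d) + 4 * (e * s ^ 4 + d ^ 4 / e) + 3 * d ^ 4"
    by (intro add_mono order_refl 2)
  finally show ?thesis .
qed

text \<open>Two applications of Cauchy-Schwarz for three terms; \<open>27 = 3^2 * 3\<close>.\<close>

lemma fourth_power_sum3_le: "((x::real) + y + z) ^ 4 \<le> 27 * (x ^ 4 + y ^ 4 + z ^ 4)"
proof -
  have sq: "(x + y + z)\<^sup>2 \<le> 3 * (x\<^sup>2 + y\<^sup>2 + z\<^sup>2)" for x y z :: real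
    using sum_squares_bound[of x y] sum_squares_bound[of y z] sum_squares_bound[of x z]
    by (simp add: power2_eq_square algebra_simps)
  have "(x + y + z) ^ 4 = ((x + y + z)\<^sup>2)\<^sup>2" by simp
  also have "\<dots> \<le> (3 * (x\<^sup>2 + y\<^sup>2 + z\<^sup>2))\<^sup>2" by (intro power_mono sq) simp
  also have "\<dots> = 9 * (x\<^sup>2 + y\<^sup>2 + z\<^sup>2)\<^sup>2" by (simp only: power_mult_distrib) simp
  also have "\<dots> \<le> 9 * (3 * ((x\<^sup>2)\<^sup>2 + (y\<^sup>2)\<^sup>2 + (z\<^sup>2)\<^sup>2))"
    by (intro mult_left_mono sq) simp
  finally show ?thesis by simp
qed

context prob_space begin

text \<open>One induction carries all three claims, since in the expansion of
  \<open>(T + d)^4\<close> the term \<open>6 d^2 T^2\<close> needs the second moment and the odd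
  terms vanish by the zero means of \<open>d\<close> and \<open>T\<close>. The constant 3 closes the
  step: \<open>3 K^2 (s + q)^2\<close> contains the mixed term \<open>6 K^2 s q\<close>, and
  \<open>K q^2 \<le> 3 K^2 q^2\<close> since \<open>K \<ge> 1\<close>.\<close>

lemma linear_form_moments:
  fixes \<xi> :: "'i \<Rightarrow> 'a \<Rightarrow> complex" and c :: "'i \<Rightarrow> complex"
  assumes ind: "indep_vars (\<lambda>_. borel) \<xi> I" and fin: "finite J" and sub: "J \<subseteq> I"
    and mom: "\<And>i. i \<in> I \<Longrightarrow> all_moments M (\<xi> i)"
    and mean: "\<And>i. i \<in> I \<Longrightarrow> expectation (\<xi> i) = 0"
    and K: "K \<ge> 1" "\<And>i. i \<in> I \<Longrightarrow> expectation (\<lambda>\<omega>. (cmod (\<xi> i \<omega>))\<^sup>2) \<le> K"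
      "\<And>i. i \<in> I \<Longrightarrow> expectation (\<lambda>\<omega>. cmod (\<xi> i \<omega>) ^ 4) \<le> K"
  defines "T \<equiv> \<lambda>J \<omega>. Re (\<Sum>k\<in>J. c k * \<xi> k \<omega>)"
  shows "expectation (T J) = 0" "expectation (\<lambda>\<omega>. (T J \<omega>)\<^sup>2) \<le> K * (\<Sum>k\<in>J. (cmod (c k))\<^sup>2)"
    "expectation (\<lambda>\<omega>. T J \<omega> ^ 4) \<le> 3 * K\<^sup>2 * (\<Sum>k\<in>J. (cmod (c k))\<^sup>2)\<^sup>2"
proof -
  have Tmom: "all_moments M (T J)" if "J \<subseteq> I" for J
    unfolding T_def using that by (intro all_moments_intros mom) auto
  have "expectation (T J) = 0 \<and> expectation (\<lambda>\<omega>. (T J \<omega>)\<^sup>2) \<le> K * (\<Sum>k\<in>J. (cmod (c k))\<^sup>2) \<and>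
    expectation (\<lambda>\<omega>. T J \<omega> ^ 4) \<le> 3 * K\<^sup>2 * (\<Sum>k\<in>J. (cmod (c k))\<^sup>2)\<^sup>2"
    using fin sub
  proof (induction J)
    case empty
    then show ?case by (simp add: T_def)
  next
    case (insert i J)
    then have i: "i \<in> I" "i \<notin> J" and J: "finite J" "J \<subseteq> I" by auto
    note IH = insert.IH[OF J(2)]
    define d where "d z = Re (c i * z)" for z
    define s where "s = (\<Sum>k\<in>J. (cmod (c k))\<^sup>2)"
    define q where "q = (cmod (c i))\<^sup>2"
    have s0: "0 \<le> s" "0 \<le> q" by (simp_all add: s_def q_def sum_nonneg)
    have T: "T (insert i J) = (\<lambda>\<omega>. T J \<omega> + d (\<xi> i \<omega>))"
      using i J by (auto simp: T_def d_def fun_eq_iff)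
    have dmeas: "(\<lambda>z. d z ^ p) \<in> borel_measurable borel" for p
      unfolding d_def by (intro borel_measurable_continuous_onI continuous_intros)
    have dmom: "all_moments M (\<lambda>\<omega>. d (\<xi> i \<omega>))"
      unfolding d_def by (intro all_moments_intros mom i)
    define \<phi> where "\<phi> x = Re (\<Sum>k\<in>J. c k * x k)" for x :: "'i \<Rightarrow> complex"
    have \<phi>: "\<phi> \<in> borel_measurable (PiM J (\<lambda>_. borel))" unfolding \<phi>_def by measurable
    have \<phi>eq: "\<phi> (\<lambda>k\<in>J. \<xi> k \<omega>) = T J \<omega>" for \<omega> by (simp add: \<phi>_def T_def cong: sum.cong)
    have split: "expectation (\<lambda>\<omega>. d (\<xi> i \<omega>) ^ p * (a * T J \<omega> ^ r))
        = expectation (\<lambda>\<omega>. d (\<xi> i \<omega>) ^ p) * (a * expectation (\<lambda>\<omega>. T J \<omega> ^ r))" for p r a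
    proof -
      have "expectation (\<lambda>\<omega>. d (\<xi> i \<omega>) ^ p * (a * T J \<omega> ^ r))
        = expectation (\<lambda>\<omega>. d (\<xi> i \<omega>) ^ p) * expectation (\<lambda>\<omega>. a * T J \<omega> ^ r)"
        using \<phi> all_momentsD(4)[OF dmom] all_momentsD(4)[OF Tmom[OF J(2)]]
        by (intro expectation_split[OF ind i(1) J(2) i(2) dmeas, of "\<lambda>x. a * \<phi> x ^ r"]) (auto simp: \<phi>eq)
      then show ?thesis by simp
    qed
    have int: "integrable M (\<lambda>\<omega>. d (\<xi> i \<omega>) ^ p * (a * T J \<omega> ^ r))" for p r a
      by (intro all_momentsD(3) all_moments_intros dmom Tmom J)
    have dle: "\<bar>d z\<bar> \<le> cmod (c i) * cmod z" for z
      unfolding d_def by (metis abs_Re_le_cmod norm_mult)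
    have Ed: "expectation (\<lambda>\<omega>. d (\<xi> i \<omega>)) = 0"
      using mean[OF i(1)] all_momentsD(3)[OF mom[OF i(1)]] unfolding d_def by simp
    have dp: "expectation (\<lambda>\<omega>. d (\<xi> i \<omega>) ^ p) \<le> cmod (c i) ^ p * expectation (\<lambda>\<omega>. cmod (\<xi> i \<omega>) ^ p)" if "even p" for p
    proof -
      have "expectation (\<lambda>\<omega>. d (\<xi> i \<omega>) ^ p) \<le> expectation (\<lambda>\<omega>. cmod (c i) ^ p * cmod (\<xi> i \<omega>) ^ p)"
      proof (intro integral_mono)
        fix \<omega>
        have "d (\<xi> i \<omega>) ^ p = \<bar>d (\<xi> i \<omega>)\<bar> ^ p" by (simp only: power_even_abs[OF that])
        also have "\<dots> \<le> (cmod (c i) * cmod (\<xi> i \<omega>)) ^ p" by (intro power_mono dle) simp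
        finally show "d (\<xi> i \<omega>) ^ p \<le> cmod (c i) ^ p * cmod (\<xi> i \<omega>) ^ p" by (simp add: power_mult_distrib)
      qed (intro all_momentsD(3) all_moments_intros dmom mom i)+
      then show ?thesis by simp
    qed
    have "cmod (c i) ^ 2 * expectation (\<lambda>\<omega>. cmod (\<xi> i \<omega>) ^ 2) \<le> q * K"
      using K(2)[OF i(1)] unfolding q_def by (intro mult_left_mono) auto
    then have d2: "expectation (\<lambda>\<omega>. (d (\<xi> i \<omega>))\<^sup>2) \<le> K * q" using dp[of 2] by (simp add: mult.commute)
    have "cmod (c i) ^ 4 * expectation (\<lambda>\<omega>. cmod (\<xi> i \<omega>) ^ 4) \<le> q\<^sup>2 * K"
      using K(3)[OF i(1)] unfolding q_def by (auto intro!: mult_left_mono)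
    then have d4: "expectation (\<lambda>\<omega>. d (\<xi> i \<omega>) ^ 4) \<le> K * q\<^sup>2" using dp[of 4] by (simp add: mult.commute)
    have T1: "expectation (T (insert i J)) = 0"
      unfolding T using IH Ed by (subst Bochner_Integration.integral_add) (auto intro!: all_momentsD(3) dmom Tmom J)
    have "(\<lambda>\<omega>. (T (insert i J) \<omega>)\<^sup>2) = (\<lambda>\<omega>. T J \<omega> ^ 2 + d (\<xi> i \<omega>) ^ 1 * (2 * T J \<omega> ^ 1) + d (\<xi> i \<omega>) ^ 2)"
      unfolding T by (simp add: fun_eq_iff power2_eq_square algebra_simps)
    then have "expectation (\<lambda>\<omega>. (T (insert i J) \<omega>)\<^sup>2)
        = expectation (\<lambda>\<omega>. T J \<omega> ^ 2) + expectation (\<lambda>\<omega>. d (\<xi> i \<omega>) ^ 1 * (2 * T J \<omega> ^ 1)) + expectation (\<lambda>\<omega>. d (\<xi> i \<omega>) ^ 2)"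
      using int[of 1 2 1] all_momentsD(4)[OF dmom] all_momentsD(4)[OF Tmom[OF J(2)]] by simp
    also have "expectation (\<lambda>\<omega>. d (\<xi> i \<omega>) ^ 1 * (2 * T J \<omega> ^ 1)) = 0" unfolding split using Ed by simp
    finally have T2: "expectation (\<lambda>\<omega>. (T (insert i J) \<omega>)\<^sup>2) \<le> K * (s + q)"
      using IH d2 by (simp add: s_def distrib_left)
    have "(\<lambda>\<omega>. T (insert i J) \<omega> ^ 4) = (\<lambda>\<omega>. T J \<omega> ^ 4 + d (\<xi> i \<omega>) ^ 1 * (4 * T J \<omega> ^ 3)
        + d (\<xi> i \<omega>) ^ 2 * (6 * T J \<omega> ^ 2) + d (\<xi> i \<omega>) ^ 3 * (4 * T J \<omega> ^ 1) + d (\<xi> i \<omega>) ^ 4)"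
      unfolding T fourth_power_identity by simp
    then have "expectation (\<lambda>\<omega>. T (insert i J) \<omega> ^ 4) = expectation (\<lambda>\<omega>. T J \<omega> ^ 4)
        + expectation (\<lambda>\<omega>. d (\<xi> i \<omega>) ^ 1 * (4 * T J \<omega> ^ 3)) + expectation (\<lambda>\<omega>. d (\<xi> i \<omega>) ^ 2 * (6 * T J \<omega> ^ 2))
        + expectation (\<lambda>\<omega>. d (\<xi> i \<omega>) ^ 3 * (4 * T J \<omega> ^ 1)) + expectation (\<lambda>\<omega>. d (\<xi> i \<omega>) ^ 4)"
      using int int[of 1 4 3] int[of 3 4 1] all_momentsD(4)[OF dmom] all_momentsD(4)[OF Tmom[OF J(2)]] by simp
    also have "\<dots> = expectation (\<lambda>\<omega>. T J \<omega> ^ 4)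
        + 6 * (expectation (\<lambda>\<omega>. (d (\<xi> i \<omega>))\<^sup>2) * expectation (\<lambda>\<omega>. (T J \<omega>)\<^sup>2)) + expectation (\<lambda>\<omega>. d (\<xi> i \<omega>) ^ 4)"
      unfolding split using Ed IH by simp
    also have "\<dots> \<le> 3 * K\<^sup>2 * s\<^sup>2 + 6 * ((K * q) * (K * s)) + K * q\<^sup>2"
      using IH d2 d4 K s0 by (intro add_mono mult_left_mono mult_mono) (auto simp: s_def)
    also have "K * q\<^sup>2 \<le> 3 * (K\<^sup>2 * q\<^sup>2)"
    proof -
      have "K * q\<^sup>2 \<le> K\<^sup>2 * q\<^sup>2" using K(1) by (intro mult_right_mono) (auto intro: self_le_power)
      moreover have "0 \<le> K\<^sup>2 * q\<^sup>2" by simp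
      ultimately show ?thesis by linarith
    qed
    finally have T4: "expectation (\<lambda>\<omega>. T (insert i J) \<omega> ^ 4) \<le> 3 * K\<^sup>2 * (s + q)\<^sup>2"
      by (simp add: power2_eq_square algebra_simps)
    show ?case using T1 T2 T4 i J by (simp add: s_def q_def add.commute)
  qed
  then show "expectation (T J) = 0" "expectation (\<lambda>\<omega>. (T J \<omega>)\<^sup>2) \<le> K * (\<Sum>k\<in>J. (cmod (c k))\<^sup>2)"
    "expectation (\<lambda>\<omega>. T J \<omega> ^ 4) \<le> 3 * K\<^sup>2 * (\<Sum>k\<in>J. (cmod (c k))\<^sup>2)\<^sup>2" by auto
qed


text \<open>A martingale argument. Adding index \<open>i\<close> to \<open>J\<close> changes the
  centred form by an increment \<open>D\<close>, each of whose terms has a mean-zero factor in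
  \<open>\<xi> i\<close> multiplied by a function of the earlier variables. So \<open>S^3 D\<close>
  has mean zero, and the row and column bounds keep the fourth moment of \<open>D\<close> below one
  constant for all \<open>i\<close>. Such increments make the fourth moment grow only quadratically
  in the number of indices.\<close>

lemma quadratic_form_Re_fourth_moment:
  fixes \<xi> :: "'i \<Rightarrow> 'a \<Rightarrow> complex" and a :: "'i \<Rightarrow> 'i \<Rightarrow> complex"
  assumes ind: "indep_vars (\<lambda>_. borel) \<xi> I" and fin: "finite I"
    and mom: "\<And>i. i \<in> I \<Longrightarrow> all_moments M (\<xi> i)"
    and mean: "\<And>i. i \<in> I \<Longrightarrow> expectation (\<xi> i) = 0"
    and m: "\<And>i. i \<in> I \<Longrightarrow> expectation (\<lambda>\<omega>. (cmod (\<xi> i \<omega>))\<^sup>2) = m i"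
    and K: "K \<ge> 1" "\<And>i. i \<in> I \<Longrightarrow> m i \<le> K"
      "\<And>i. i \<in> I \<Longrightarrow> expectation (\<lambda>\<omega>. cmod (\<xi> i \<omega>) ^ 4) \<le> K"
      "\<And>i. i \<in> I \<Longrightarrow> expectation (\<lambda>\<omega>. ((cmod (\<xi> i \<omega>))\<^sup>2 - m i) ^ 4) \<le> K"
    and row: "\<And>i. i \<in> I \<Longrightarrow> (\<Sum>k\<in>I. (cmod (a i k))\<^sup>2) \<le> \<kappa>"
    and col: "\<And>i. i \<in> I \<Longrightarrow> (\<Sum>k\<in>I. (cmod (a k i))\<^sup>2) \<le> \<kappa>"
  defines "S \<equiv> \<lambda>J \<omega>. Re ((\<Sum>i\<in>J. \<Sum>k\<in>J. a i k * cnj (\<xi> i \<omega>) * \<xi> k \<omega>) - (\<Sum>i\<in>J. a i i * complex_of_real (m i)))"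
  shows "expectation (\<lambda>\<omega>. S I \<omega> ^ 4) \<le> 41904 * K ^ 3 * \<kappa>\<^sup>2 * (real (card I))\<^sup>2"
proof -
  \<comment> \<open>The bound for one increment: \<open>2619 = 27 * (1 + 48 + 48)\<close>, where 27
    comes from splitting \<open>D\<close> into three terms, 1 from the diagonal term, and 48 from
    each of the two real linear forms.\<close>
  define K' where "K' = 2619 * K ^ 3 * \<kappa>\<^sup>2"
  have Smom: "all_moments M (S J)" if "J \<subseteq> I" for J
    unfolding S_def using that by (intro all_moments_intros mom) auto
  have "expectation (\<lambda>\<omega>. S J \<omega> ^ 4) \<le> 16 * K' * (real (card J))\<^sup>2" if "finite J" "J \<subseteq> I" for J
    using that
  proof (induction J)
    case empty
    then show ?case by (simp add: S_def)
  next
    case (insert i J)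
    then have i: "i \<in> I" "i \<notin> J" and J: "finite J" "J \<subseteq> I" by auto
    note IH = insert.IH[OF J(2)]
    \<comment> \<open>Under the real part the column terms through \<open>i\<close> may be
      conjugated, after which they merge with the row terms into one linear form in the earlier
      variables.\<close>
    define c where "c k = a i k + cnj (a k i)" for k
    define BR where "BR \<omega> = Re (\<Sum>k\<in>J. c k * \<xi> k \<omega>)" for \<omega>
    \<comment> \<open>The imaginary part of a linear form is the real part of the form with
      coefficients multiplied by \<open>- \<i>\<close>, so the bound for real parts serves
      both.\<close>
    define BI where "BI \<omega> = Re (\<Sum>k\<in>J. (- \<i> * c k) * \<xi> k \<omega>)" for \<omega>
    have BI: "BI \<omega> = Im (\<Sum>k\<in>J. c k * \<xi> k \<omega>)" for \<omega>
      by (simp add: BI_def algebra_simps)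
    have csum: "(\<Sum>k\<in>J. (cmod (c k))\<^sup>2) \<le> 4 * \<kappa>"
    proof -
      have sq: "(cmod (c k))\<^sup>2 \<le> 2 * (cmod (a i k))\<^sup>2 + 2 * (cmod (a k i))\<^sup>2" for k
      proof -
        have "(cmod (c k))\<^sup>2 \<le> (cmod (a i k) + cmod (a k i))\<^sup>2"
          unfolding c_def by (intro power_mono order_trans[OF norm_triangle_ineq]) auto
        also have "\<dots> \<le> 2 * (cmod (a i k))\<^sup>2 + 2 * (cmod (a k i))\<^sup>2"
          using sum_squares_bound[of "cmod (a i k)" "cmod (a k i)"] by (simp add: power2_sum)
        finally show ?thesis .
      qed
      have "(\<Sum>k\<in>J. (cmod (c k))\<^sup>2) \<le> (\<Sum>k\<in>I. 2 * (cmod (a i k))\<^sup>2 + 2 * (cmod (a k i))\<^sup>2)"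
        using sq fin J by (intro order_trans[OF sum_mono[OF sq] sum_mono2]) auto
      also have "\<dots> = 2 * (\<Sum>k\<in>I. (cmod (a i k))\<^sup>2) + 2 * (\<Sum>k\<in>I. (cmod (a k i))\<^sup>2)"
        by (simp add: sum.distrib sum_distrib_left)
      finally show ?thesis using row[OF i(1)] col[OF i(1)] by linarith
    qed
    have \<kappa>: "0 \<le> \<kappa>" using row[OF i(1)] by (meson order_trans sum_nonneg zero_le_power2)
    have aii: "(cmod (a i i))\<^sup>2 \<le> \<kappa>"
      using member_le_sum[OF i(1), of "\<lambda>k. (cmod (a i k))\<^sup>2"] fin row[OF i(1)] by auto
    have B4: "expectation (\<lambda>\<omega>. BR \<omega> ^ 4) \<le> 48 * K\<^sup>2 * \<kappa>\<^sup>2" "expectation (\<lambda>\<omega>. BI \<omega> ^ 4) \<le> 48 * K\<^sup>2 * \<kappa>\<^sup>2"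
    proof -
      have "3 * K\<^sup>2 * (\<Sum>k\<in>J. (cmod (c k))\<^sup>2)\<^sup>2 \<le> 3 * K\<^sup>2 * (4 * \<kappa>)\<^sup>2"
        using csum by (intro mult_left_mono power_mono) (auto simp: sum_nonneg)
      also have "\<dots> = 48 * K\<^sup>2 * \<kappa>\<^sup>2" by (simp add: power2_eq_square)
      finally have *: "3 * K\<^sup>2 * (\<Sum>k\<in>J. (cmod (c k))\<^sup>2)\<^sup>2 \<le> 48 * K\<^sup>2 * \<kappa>\<^sup>2" .
      have "expectation (\<lambda>\<omega>. BR \<omega> ^ 4) \<le> 3 * K\<^sup>2 * (\<Sum>k\<in>J. (cmod (c k))\<^sup>2)\<^sup>2"
        unfolding BR_def using K m by (intro linear_form_moments(3)[OF ind J mom mean]) auto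
      then show "expectation (\<lambda>\<omega>. BR \<omega> ^ 4) \<le> 48 * K\<^sup>2 * \<kappa>\<^sup>2" using * by (rule order_trans)
      have "expectation (\<lambda>\<omega>. BI \<omega> ^ 4) \<le> 3 * K\<^sup>2 * (\<Sum>k\<in>J. (cmod (- \<i> * c k))\<^sup>2)\<^sup>2"
        unfolding BI_def using K m by (intro linear_form_moments(3)[OF ind J mom mean]) auto
      then show "expectation (\<lambda>\<omega>. BI \<omega> ^ 4) \<le> 48 * K\<^sup>2 * \<kappa>\<^sup>2" using * by (simp add: norm_mult)
    qed
    define p where "p z = (cmod z)\<^sup>2 - m i" for z
    define D where "D \<omega> = p (\<xi> i \<omega>) * Re (a i i) + Re (\<xi> i \<omega>) * BR \<omega> + Im (\<xi> i \<omega>) * BI \<omega>" for \<omega>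
    have Sins: "S (insert i J) \<omega> = S J \<omega> + D \<omega>" for \<omega>
    proof -
      have e1: "(\<Sum>i'\<in>insert i J. \<Sum>k\<in>insert i J. a i' k * cnj (\<xi> i' \<omega>) * \<xi> k \<omega>)
          = (\<Sum>i'\<in>J. \<Sum>k\<in>J. a i' k * cnj (\<xi> i' \<omega>) * \<xi> k \<omega>) + a i i * (cnj (\<xi> i \<omega>) * \<xi> i \<omega>)
            + (\<Sum>k\<in>J. a i k * cnj (\<xi> i \<omega>) * \<xi> k \<omega>) + (\<Sum>k\<in>J. a k i * cnj (\<xi> k \<omega>) * \<xi> i \<omega>)"
        using i J by (simp add: sum.distrib algebra_simps)
      have e2: "cnj (\<xi> i \<omega>) * \<xi> i \<omega> = complex_of_real ((cmod (\<xi> i \<omega>))\<^sup>2)"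
        by (simp only: complex_norm_square mult.commute)
      have e3: "Re (\<Sum>k\<in>J. a k i * cnj (\<xi> k \<omega>) * \<xi> i \<omega>) = Re (\<Sum>k\<in>J. cnj (\<xi> i \<omega>) * (cnj (a k i) * \<xi> k \<omega>))"
        unfolding Re_sum by (intro sum.cong refl) (simp add: algebra_simps)
      have e4: "Re (\<Sum>k\<in>J. a i k * cnj (\<xi> i \<omega>) * \<xi> k \<omega>) + Re (\<Sum>k\<in>J. cnj (\<xi> i \<omega>) * (cnj (a k i) * \<xi> k \<omega>))
          = Re (cnj (\<xi> i \<omega>) * (\<Sum>k\<in>J. c k * \<xi> k \<omega>))"
        unfolding sum_distrib_left plus_complex.sel(1)[symmetric] sum.distrib[symmetric] c_def
        by (simp add: algebra_simps)
      have e5: "Re (cnj (\<xi> i \<omega>) * (\<Sum>k\<in>J. c k * \<xi> k \<omega>)) = Re (\<xi> i \<omega>) * BR \<omega> + Im (\<xi> i \<omega>) * BI \<omega>"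
        unfolding BR_def BI by simp
      have gen: "Re ((Q + z * complex_of_real r + A1 + A2) - (z * complex_of_real r' + s))
          = Re (Q - s) + ((r - r') * Re z + (Re A1 + Re A2))" for Q z A1 A2 s r r'
        by (simp add: algebra_simps)
      show ?thesis
        unfolding S_def e1 e2 sum.insert[OF J(1) i(2), of "\<lambda>i. a i i * complex_of_real (m i)"] gen e3 e4 e5
        by (simp add: D_def p_def)
    qed
    have \<xi>mom: "all_moments M (\<xi> i)" by (rule mom[OF i(1)])
    have BRmom: "all_moments M BR" and BImom: "all_moments M BI"
      unfolding BR_def BI_def using J by (intro all_moments_intros mom; auto)+
    have pmom: "all_moments M (\<lambda>\<omega>. p (\<xi> i \<omega>))" unfolding p_def by (intro all_moments_intros \<xi>mom)
    have Dmom: "all_moments M D" unfolding D_def by (intro all_moments_intros \<xi>mom BRmom BImom pmom)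
    have Smom': "all_moments M (S J)" by (rule Smom[OF J(2)])
    define sJ where "sJ x = Re ((\<Sum>i\<in>J. \<Sum>k\<in>J. a i k * cnj (x i) * x k) - (\<Sum>i\<in>J. a i i * complex_of_real (m i)))" for x
    define bR where "bR x = Re (\<Sum>k\<in>J. c k * x k)" for x
    define bI where "bI x = Re (\<Sum>k\<in>J. (- \<i> * c k) * x k)" for x
    have cnj_meas [measurable]: "cnj \<in> borel_measurable borel"
      by (intro borel_measurable_continuous_onI continuous_intros)
    have [measurable]: "sJ \<in> borel_measurable (PiM J (\<lambda>_. borel))" "bR \<in> borel_measurable (PiM J (\<lambda>_. borel))"
      "bI \<in> borel_measurable (PiM J (\<lambda>_. borel))"
      unfolding sJ_def bR_def bI_def by measurable
    have pmeas: "p \<in> borel_measurable borel" unfolding p_def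
      by (intro borel_measurable_continuous_onI continuous_intros)
    have req: "sJ (\<lambda>k\<in>J. \<xi> k \<omega>) = S J \<omega>" "bR (\<lambda>k\<in>J. \<xi> k \<omega>) = BR \<omega>" "bI (\<lambda>k\<in>J. \<xi> k \<omega>) = BI \<omega>" for \<omega>
      by (simp_all add: sJ_def S_def bR_def BR_def bI_def BI_def cong: sum.cong)
    note split = expectation_split[OF ind i(1) J(2) i(2)]
    have ReIm0: "expectation (\<lambda>\<omega>. Re (\<xi> i \<omega>)) = 0" "expectation (\<lambda>\<omega>. Im (\<xi> i \<omega>)) = 0"
      using mean[OF i(1)] all_momentsD(3)[OF \<xi>mom] by simp_all
    have p0: "expectation (\<lambda>\<omega>. p (\<xi> i \<omega>)) = 0"
    proof -
      have "integrable M (\<lambda>\<omega>. (cmod (\<xi> i \<omega>))\<^sup>2)" by (rule all_momentsD(2)[OF \<xi>mom])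
      then show ?thesis using m[OF i(1)] by (simp add: p_def prob_space)
    qed
    have "expectation (\<lambda>\<omega>. p (\<xi> i \<omega>) * (Re (a i i) * S J \<omega> ^ 3)) = 0"
      using p0 by (subst split[OF pmeas, of "\<lambda>x. Re (a i i) * sJ x ^ 3"])
        (auto simp: req intro!: all_momentsD(3) all_moments_intros pmom Smom')
    moreover have "expectation (\<lambda>\<omega>. Re (\<xi> i \<omega>) * (BR \<omega> * S J \<omega> ^ 3)) = 0"
      using ReIm0 by (subst split[of Re "\<lambda>x. bR x * sJ x ^ 3"])
        (auto simp: req intro!: all_momentsD(3) all_moments_intros \<xi>mom BRmom Smom')
    moreover have "expectation (\<lambda>\<omega>. Im (\<xi> i \<omega>) * (BI \<omega> * S J \<omega> ^ 3)) = 0"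
      using ReIm0 by (subst split[of Im "\<lambda>x. bI x * sJ x ^ 3"])
        (auto simp: req intro!: all_momentsD(3) all_moments_intros \<xi>mom BImom Smom')
    moreover have "(\<lambda>\<omega>. S J \<omega> ^ 3 * D \<omega>) = (\<lambda>\<omega>. p (\<xi> i \<omega>) * (Re (a i i) * S J \<omega> ^ 3)
        + Re (\<xi> i \<omega>) * (BR \<omega> * S J \<omega> ^ 3) + Im (\<xi> i \<omega>) * (BI \<omega> * S J \<omega> ^ 3))"
      by (simp add: D_def algebra_simps)
    moreover have "integrable M (\<lambda>\<omega>. p (\<xi> i \<omega>) * (Re (a i i) * S J \<omega> ^ 3))"
      "integrable M (\<lambda>\<omega>. Re (\<xi> i \<omega>) * (BR \<omega> * S J \<omega> ^ 3))" "integrable M (\<lambda>\<omega>. Im (\<xi> i \<omega>) * (BI \<omega> * S J \<omega> ^ 3))"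
      by (intro all_momentsD(3) all_moments_intros pmom \<xi>mom BRmom BImom Smom')+
    ultimately have cross: "expectation (\<lambda>\<omega>. S J \<omega> ^ 3 * D \<omega>) = 0" by simp
    have ReIm4: "expectation (\<lambda>\<omega>. Re (\<xi> i \<omega>) ^ 4) \<le> K" "expectation (\<lambda>\<omega>. Im (\<xi> i \<omega>) ^ 4) \<le> K"
    proof -
      have le: "Re z ^ 4 \<le> cmod z ^ 4" "Im z ^ 4 \<le> cmod z ^ 4" for z
        using power_mono[OF abs_Re_le_cmod[of z] abs_ge_zero, of 4] power_mono[OF abs_Im_le_cmod[of z] abs_ge_zero, of 4] by auto
      have "expectation (\<lambda>\<omega>. Re (\<xi> i \<omega>) ^ 4) \<le> expectation (\<lambda>\<omega>. cmod (\<xi> i \<omega>) ^ 4)"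
        by (intro integral_mono le all_momentsD(3) all_moments_intros \<xi>mom)
      then show "expectation (\<lambda>\<omega>. Re (\<xi> i \<omega>) ^ 4) \<le> K" using K(3)[OF i(1)] by simp
      have "expectation (\<lambda>\<omega>. Im (\<xi> i \<omega>) ^ 4) \<le> expectation (\<lambda>\<omega>. cmod (\<xi> i \<omega>) ^ 4)"
        by (intro integral_mono le all_momentsD(3) all_moments_intros \<xi>mom)
      then show "expectation (\<lambda>\<omega>. Im (\<xi> i \<omega>) ^ 4) \<le> K" using K(3)[OF i(1)] by simp
    qed
    have D4: "expectation (\<lambda>\<omega>. D \<omega> ^ 4) \<le> K'"
    proof -
      have "expectation (\<lambda>\<omega>. D \<omega> ^ 4) \<le> expectation (\<lambda>\<omega>. 27 * (Re (a i i) ^ 4 * p (\<xi> i \<omega>) ^ 4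
          + Re (\<xi> i \<omega>) ^ 4 * BR \<omega> ^ 4 + Im (\<xi> i \<omega>) ^ 4 * BI \<omega> ^ 4))"
      proof (intro integral_mono)
        show "D \<omega> ^ 4 \<le> 27 * (Re (a i i) ^ 4 * p (\<xi> i \<omega>) ^ 4 + Re (\<xi> i \<omega>) ^ 4 * BR \<omega> ^ 4 + Im (\<xi> i \<omega>) ^ 4 * BI \<omega> ^ 4)" for \<omega>
          using fourth_power_sum3_le[of "p (\<xi> i \<omega>) * Re (a i i)" "Re (\<xi> i \<omega>) * BR \<omega>" "Im (\<xi> i \<omega>) * BI \<omega>"]
          unfolding D_def power_mult_distrib by (simp add: mult.commute)
      qed (intro all_momentsD(3) all_moments_intros Dmom pmom \<xi>mom BRmom BImom)+
      also have "\<dots> = 27 * (Re (a i i) ^ 4 * expectation (\<lambda>\<omega>. p (\<xi> i \<omega>) ^ 4)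
          + expectation (\<lambda>\<omega>. Re (\<xi> i \<omega>) ^ 4 * BR \<omega> ^ 4) + expectation (\<lambda>\<omega>. Im (\<xi> i \<omega>) ^ 4 * BI \<omega> ^ 4))"
      proof -
        have "integrable M (\<lambda>\<omega>. p (\<xi> i \<omega>) ^ 4)" "integrable M (\<lambda>\<omega>. Re (\<xi> i \<omega>) ^ 4 * BR \<omega> ^ 4)"
          "integrable M (\<lambda>\<omega>. Im (\<xi> i \<omega>) ^ 4 * BI \<omega> ^ 4)"
          by (intro all_momentsD(3) all_moments_intros pmom \<xi>mom BRmom BImom)+
        then show ?thesis by simp
      qed
      also have "expectation (\<lambda>\<omega>. Re (\<xi> i \<omega>) ^ 4 * BR \<omega> ^ 4)
          = expectation (\<lambda>\<omega>. Re (\<xi> i \<omega>) ^ 4) * expectation (\<lambda>\<omega>. BR \<omega> ^ 4)"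
        by (rule split[of "\<lambda>z. Re z ^ 4" "\<lambda>x. bR x ^ 4"])
          (auto simp: req intro!: all_momentsD(3) all_moments_intros \<xi>mom BRmom)
      also have "expectation (\<lambda>\<omega>. Im (\<xi> i \<omega>) ^ 4 * BI \<omega> ^ 4)
          = expectation (\<lambda>\<omega>. Im (\<xi> i \<omega>) ^ 4) * expectation (\<lambda>\<omega>. BI \<omega> ^ 4)"
        by (rule split[of "\<lambda>z. Im z ^ 4" "\<lambda>x. bI x ^ 4"])
          (auto simp: req intro!: all_momentsD(3) all_moments_intros \<xi>mom BImom)
      also have "27 * (Re (a i i) ^ 4 * expectation (\<lambda>\<omega>. p (\<xi> i \<omega>) ^ 4)
          + expectation (\<lambda>\<omega>. Re (\<xi> i \<omega>) ^ 4) * expectation (\<lambda>\<omega>. BR \<omega> ^ 4)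
          + expectation (\<lambda>\<omega>. Im (\<xi> i \<omega>) ^ 4) * expectation (\<lambda>\<omega>. BI \<omega> ^ 4))
          \<le> 27 * (\<kappa>\<^sup>2 * K + K * (48 * K\<^sup>2 * \<kappa>\<^sup>2) + K * (48 * K\<^sup>2 * \<kappa>\<^sup>2))"
      proof (intro mult_left_mono[of _ _ 27] add_mono mult_mono B4 ReIm4)
        have "Re (a i i) ^ 4 = (\<bar>Re (a i i)\<bar>\<^sup>2)\<^sup>2" by simp
        also have "\<dots> \<le> \<kappa>\<^sup>2"
          by (intro power_mono order_trans[OF power_mono[OF abs_Re_le_cmod] aii]) auto
        finally show "Re (a i i) ^ 4 \<le> \<kappa>\<^sup>2" .
        show "expectation (\<lambda>\<omega>. p (\<xi> i \<omega>) ^ 4) \<le> K" unfolding p_def by (rule K(4)[OF i(1)])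
      qed (use K(1) in auto)
      also have "\<dots> \<le> 27 * (\<kappa>\<^sup>2 * K ^ 3 + K * (48 * K\<^sup>2 * \<kappa>\<^sup>2) + K * (48 * K\<^sup>2 * \<kappa>\<^sup>2))"
        using K(1) by (intro mult_left_mono add_mono order_refl) (auto intro: self_le_power)
      also have "\<dots> = K'" by (simp add: K'_def power3_eq_cube power2_eq_square)
      finally show ?thesis .
    qed
    have K'0: "0 \<le> K'" using K(1) by (simp add: K'_def)
    show ?case
    \<comment> \<open>With no earlier index the weight \<open>e\<close> would be
      \<open>1 / 0\<close>; there the form consists of the single increment
      \<open>D\<close>.\<close>
    proof (cases "J = {}")
      case True
      then have "S (insert i J) = D" using Sins by (auto simp: fun_eq_iff S_def)
      then show ?thesis using D4 K'0 True by simp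
    next
      case False
      define n where "n = real (card J)"
      have n: "n > 0" using False J by (auto simp: n_def card_gt_0_iff)
      \<comment> \<open>This weight balances the two error terms: \<open>4 e (16 K' n^2)\<close> and
        \<open>4 K' / e\<close> are both \<open>16 K' n\<close>, and the total
        \<open>16 K' n^2 + 32 K' n + 3 K'\<close> stays below
        \<open>16 K' (n + 1)^2\<close>.\<close>
      define e where "e = 1 / (4 * n)"
      have e: "e > 0" using n by (simp add: e_def)
      have "expectation (\<lambda>\<omega>. S (insert i J) \<omega> ^ 4) \<le> expectation (\<lambda>\<omega>. S J \<omega> ^ 4 + 4 * (S J \<omega> ^ 3 * D \<omega>)
          + 4 * (e * S J \<omega> ^ 4 + D \<omega> ^ 4 * (1 / e)) + 3 * D \<omega> ^ 4)"
      proof (intro integral_mono)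
        show "S (insert i J) \<omega> ^ 4 \<le> S J \<omega> ^ 4 + 4 * (S J \<omega> ^ 3 * D \<omega>)
          + 4 * (e * S J \<omega> ^ 4 + D \<omega> ^ 4 * (1 / e)) + 3 * D \<omega> ^ 4" for \<omega>
          using fourth_power_le[OF e, of "S J \<omega>" "D \<omega>"] unfolding Sins by simp
      qed (intro all_momentsD(3) all_moments_intros Smom Smom' Dmom insert.prems)+
      also have "\<dots> = expectation (\<lambda>\<omega>. S J \<omega> ^ 4) + 4 * 0
          + 4 * (e * expectation (\<lambda>\<omega>. S J \<omega> ^ 4) + expectation (\<lambda>\<omega>. D \<omega> ^ 4) * (1 / e)) + 3 * expectation (\<lambda>\<omega>. D \<omega> ^ 4)"
      proof -
        have "integrable M (\<lambda>\<omega>. S J \<omega> ^ 4)" "integrable M (\<lambda>\<omega>. D \<omega> ^ 4)" "integrable M (\<lambda>\<omega>. S J \<omega> ^ 3 * D \<omega>)"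
          by (intro all_momentsD(3) all_moments_intros Smom' Dmom)+
        then show ?thesis unfolding cross[symmetric] by simp
      qed
      also have "\<dots> \<le> 16 * K' * n\<^sup>2 + 4 * 0 + 4 * (e * (16 * K' * n\<^sup>2) + K' * (1 / e)) + 3 * K'"
        using IH D4 e by (intro add_mono mult_left_mono mult_right_mono) (auto simp: n_def)
      also have "\<dots> = 16 * K' * n\<^sup>2 + 32 * K' * n + 3 * K'"
        using n by (simp add: e_def power2_eq_square field_simps)
      also have "\<dots> \<le> 16 * K' * (n + 1)\<^sup>2" using K'0 by (simp add: power2_eq_square algebra_simps)
      also have "n + 1 = real (card (insert i J))" using i J by (simp add: n_def)
      finally show ?thesis .
    qed
  qed
  from this[OF fin order_refl] show ?thesis by (simp add: K'_def mult_ac)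
qed

text \<open>The imaginary part is the real part of the form with matrix \<open>- \<i> a\<close>,
  which has the same row and column sums. The factor 4 over the real case is 2 from
  \<open>|S|^4 \<le> 2 (Re^4 + Im^4)\<close> times two parts.\<close>

lemma quadratic_form_fourth_moment:
  fixes \<xi> :: "'i \<Rightarrow> 'a \<Rightarrow> complex" and a :: "'i \<Rightarrow> 'i \<Rightarrow> complex"
  assumes ind: "indep_vars (\<lambda>_. borel) \<xi> I" and fin: "finite I"
    and mom: "\<And>i. i \<in> I \<Longrightarrow> all_moments M (\<xi> i)"
    and mean: "\<And>i. i \<in> I \<Longrightarrow> expectation (\<xi> i) = 0"
    and m: "\<And>i. i \<in> I \<Longrightarrow> expectation (\<lambda>\<omega>. (cmod (\<xi> i \<omega>))\<^sup>2) = m i"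
    and K: "K \<ge> 1" "\<And>i. i \<in> I \<Longrightarrow> m i \<le> K"
      "\<And>i. i \<in> I \<Longrightarrow> expectation (\<lambda>\<omega>. cmod (\<xi> i \<omega>) ^ 4) \<le> K"
      "\<And>i. i \<in> I \<Longrightarrow> expectation (\<lambda>\<omega>. ((cmod (\<xi> i \<omega>))\<^sup>2 - m i) ^ 4) \<le> K"
    and row: "\<And>i. i \<in> I \<Longrightarrow> (\<Sum>k\<in>I. (cmod (a i k))\<^sup>2) \<le> \<kappa>"
    and col: "\<And>i. i \<in> I \<Longrightarrow> (\<Sum>k\<in>I. (cmod (a k i))\<^sup>2) \<le> \<kappa>"
  defines "S \<equiv> \<lambda>\<omega>. (\<Sum>i\<in>I. \<Sum>k\<in>I. a i k * cnj (\<xi> i \<omega>) * \<xi> k \<omega>) - (\<Sum>i\<in>I. a i i * complex_of_real (m i))"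
  shows "all_moments M S" "expectation (\<lambda>\<omega>. cmod (S \<omega>) ^ 4) \<le> 167616 * K ^ 3 * \<kappa>\<^sup>2 * (real (card I))\<^sup>2"
proof -
  show S: "all_moments M S" unfolding S_def by (intro all_moments_intros mom)
  define B where "B = 41904 * K ^ 3 * \<kappa>\<^sup>2 * (real (card I))\<^sup>2"
  have R: "expectation (\<lambda>\<omega>. Re (S \<omega>) ^ 4) \<le> B"
    unfolding B_def S_def by (rule quadratic_form_Re_fourth_moment[OF ind fin mom mean m K row col])
  have "Re ((\<Sum>i\<in>I. \<Sum>k\<in>I. (- \<i> * a i k) * cnj (\<xi> i \<omega>) * \<xi> k \<omega>) - (\<Sum>i\<in>I. (- \<i> * a i i) * complex_of_real (m i)))
      = Im (S \<omega>)" for \<omega>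
  proof -
    have "(\<Sum>i\<in>I. \<Sum>k\<in>I. (- \<i> * a i k) * cnj (\<xi> i \<omega>) * \<xi> k \<omega>) - (\<Sum>i\<in>I. (- \<i> * a i i) * complex_of_real (m i)) = - \<i> * S \<omega>"
      by (simp only: S_def right_diff_distrib sum_distrib_left mult.assoc)
    then show ?thesis by simp
  qed
  moreover have "expectation (\<lambda>\<omega>. Re ((\<Sum>i\<in>I. \<Sum>k\<in>I. (- \<i> * a i k) * cnj (\<xi> i \<omega>) * \<xi> k \<omega>) - (\<Sum>i\<in>I. (- \<i> * a i i) * complex_of_real (m i))) ^ 4) \<le> B"
    unfolding B_def by (rule quadratic_form_Re_fourth_moment[OF ind fin mom mean m K]) (simp_all add: norm_mult row col)
  ultimately have I: "expectation (\<lambda>\<omega>. Im (S \<omega>) ^ 4) \<le> B" by simp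
  have "expectation (\<lambda>\<omega>. cmod (S \<omega>) ^ 4) \<le> expectation (\<lambda>\<omega>. 2 * (Re (S \<omega>) ^ 4 + Im (S \<omega>) ^ 4))"
  proof (intro integral_mono)
    show "cmod (S \<omega>) ^ 4 \<le> 2 * (Re (S \<omega>) ^ 4 + Im (S \<omega>) ^ 4)" for \<omega>
    proof -
      have "cmod (S \<omega>) ^ 4 = ((cmod (S \<omega>))\<^sup>2)\<^sup>2" by simp
      also have "\<dots> = ((Re (S \<omega>))\<^sup>2 + (Im (S \<omega>))\<^sup>2)\<^sup>2" by (simp only: cmod_power2)
      also have "\<dots> \<le> 2 * (Re (S \<omega>) ^ 4 + Im (S \<omega>) ^ 4)"
        using sum_squares_bound[of "(Re (S \<omega>))\<^sup>2" "(Im (S \<omega>))\<^sup>2"] by (simp add: power2_sum)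
      finally show ?thesis .
    qed
  qed (intro all_momentsD(3) all_moments_intros S)+
  also have "\<dots> = 2 * (expectation (\<lambda>\<omega>. Re (S \<omega>) ^ 4) + expectation (\<lambda>\<omega>. Im (S \<omega>) ^ 4))"
  proof -
    have "integrable M (\<lambda>\<omega>. Re (S \<omega>) ^ 4)" "integrable M (\<lambda>\<omega>. Im (S \<omega>) ^ 4)"
      by (intro all_momentsD(3) all_moments_intros S)+
    then show ?thesis by simp
  qed
  also have "\<dots> \<le> 4 * B" using R I by simp
  finally show "expectation (\<lambda>\<omega>. cmod (S \<omega>) ^ 4) \<le> 167616 * K ^ 3 * \<kappa>\<^sup>2 * (real (card I))\<^sup>2"
    by (simp add: B_def)
qed

end

section \<open>Complex Gaussian variables\<close>

text \<open>The substitution \<open>z = c w\<close> in the plane; the Jacobian is \<open>c^2\<close>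
  because the real dimension is 2.\<close>

lemma nn_integral_gauss_scale:
  assumes "c > 0"
  shows "(\<integral>\<^sup>+ z. ennreal (exp (- (cmod z)\<^sup>2 * a)) \<partial>lborel)
    = ennreal (c\<^sup>2) * (\<integral>\<^sup>+ z. ennreal (exp (- (cmod z)\<^sup>2 * (c\<^sup>2 * a))) \<partial>lborel)"
proof -
  have [measurable]: "(\<lambda>z. ennreal (exp (- (cmod z)\<^sup>2 * a))) \<in> borel_measurable borel" by measurable
  have "(\<integral>\<^sup>+ z. ennreal (exp (- (cmod z)\<^sup>2 * a)) \<partial>lborel)
    = (\<integral>\<^sup>+ z. ennreal (exp (- (cmod z)\<^sup>2 * a)) \<partial>(density (distr lborel borel (\<lambda>x::complex. 0 + c *\<^sub>R x)) (\<lambda>_. ennreal (\<bar>c\<bar> ^ DIM(complex)))))"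
    using lborel_affine[of c "0 :: complex"] assms by simp
  also have "\<dots> = (\<integral>\<^sup>+ z. ennreal (c\<^sup>2) * ennreal (exp (- (cmod (c *\<^sub>R z))\<^sup>2 * a)) \<partial>lborel)"
    using assms by (subst nn_integral_density; (subst nn_integral_distr)?) (auto simp: nn_integral_distr)
  also have "\<dots> = ennreal (c\<^sup>2) * (\<integral>\<^sup>+ z. ennreal (exp (- (cmod z)\<^sup>2 * (c\<^sup>2 * a))) \<partial>lborel)"
    by (subst nn_integral_cmult) (auto simp: power_mult_distrib mult_ac)
  finally show ?thesis .
qed

context prob_space begin

text \<open>The Gaussian integral is never evaluated. The density has total mass 1, being that of a
  random variable; the factor \<open>exp (s |z|^2)\<close> turns it into a Gaussian of another
  width, and scaling by \<open>c = sqrt (1 - s v)\<close> relates the two integrals. Negative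
  \<open>s\<close> are included, as the computation of the variance requires.\<close>

lemma CN_exp_moment:
  assumes d: "distributed M lborel X (CN_density v)" and v: "v > 0" and s: "s < 1 / v"
  shows "(\<integral>\<^sup>+ \<omega>. ennreal (exp (s * (cmod (X \<omega>))\<^sup>2)) \<partial>M) = ennreal (1 / (1 - s * v))"
proof -
  have sv: "0 < 1 - s * v" using s v by (simp add: field_simps)
  have key: "(\<integral>\<^sup>+ \<omega>. ennreal (exp (s * (cmod (X \<omega>))\<^sup>2)) \<partial>M)
     = ennreal (1 / (pi * v)) * (\<integral>\<^sup>+ z. ennreal (exp (- (cmod z)\<^sup>2 * (1 / v - s))) \<partial>lborel)" for s
  proof -
    have "(\<integral>\<^sup>+ \<omega>. ennreal (exp (s * (cmod (X \<omega>))\<^sup>2)) \<partial>M)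
      = (\<integral>\<^sup>+ z. CN_density v z * ennreal (exp (s * (cmod z)\<^sup>2)) \<partial>lborel)"
      using distributed_nn_integral[OF d, of "\<lambda>z. ennreal (exp (s * (cmod z)\<^sup>2))"] by simp
    also have "\<dots> = (\<integral>\<^sup>+ z. ennreal (1 / (pi * v)) * ennreal (exp (- (cmod z)\<^sup>2 * (1 / v - s))) \<partial>lborel)"
    proof (intro nn_integral_cong)
      fix z :: complex
      have "exp (- (cmod z)\<^sup>2 / v) / (pi * v) * exp (s * (cmod z)\<^sup>2)
          = 1 / (pi * v) * exp (- (cmod z)\<^sup>2 * (1 / v - s))"
        using exp_add[of "- (cmod z)\<^sup>2 / v" "s * (cmod z)\<^sup>2"] by (simp add: algebra_simps)
      then show "CN_density v z * ennreal (exp (s * (cmod z)\<^sup>2))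
          = ennreal (1 / (pi * v)) * ennreal (exp (- (cmod z)\<^sup>2 * (1 / v - s)))"
        using v unfolding CN_density_def by (simp flip: ennreal_mult)
    qed
    also have "\<dots> = ennreal (1 / (pi * v)) * (\<integral>\<^sup>+ z. ennreal (exp (- (cmod z)\<^sup>2 * (1 / v - s))) \<partial>lborel)"
      by (rule nn_integral_cmult) simp
    finally show ?thesis .
  qed
  define c where "c = sqrt (1 - s * v)"
  have c: "c > 0" "c\<^sup>2 = 1 - s * v" using sv by (simp_all add: c_def)
  have "1 = (\<integral>\<^sup>+ \<omega>. ennreal (exp (0 * (cmod (X \<omega>))\<^sup>2)) \<partial>M)"
    using emeasure_space_1 by simp
  also have "\<dots> = ennreal (1 / (pi * v)) * (\<integral>\<^sup>+ z. ennreal (exp (- (cmod z)\<^sup>2 * (1 / v))) \<partial>lborel)"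
    unfolding key by simp
  also have "\<dots> = ennreal (1 / (pi * v)) * (ennreal (c\<^sup>2) * (\<integral>\<^sup>+ z. ennreal (exp (- (cmod z)\<^sup>2 * (c\<^sup>2 * (1 / v)))) \<partial>lborel))"
    by (subst nn_integral_gauss_scale[OF c(1)]) (rule refl)
  also have "c\<^sup>2 * (1 / v) = 1 / v - s" using v by (simp add: c(2) field_simps)
  also have "ennreal (1 / (pi * v)) * (ennreal (c\<^sup>2) * (\<integral>\<^sup>+ z. ennreal (exp (- (cmod z)\<^sup>2 * (1 / v - s))) \<partial>lborel))
      = ennreal (c\<^sup>2) * (\<integral>\<^sup>+ \<omega>. ennreal (exp (s * (cmod (X \<omega>))\<^sup>2)) \<partial>M)"
    unfolding key by (simp add: mult_ac)
  finally have eq: "ennreal (c\<^sup>2) * (\<integral>\<^sup>+ \<omega>. ennreal (exp (s * (cmod (X \<omega>))\<^sup>2)) \<partial>M) = 1" by simp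
  have "ennreal (1 / c\<^sup>2) * ennreal (c\<^sup>2) = 1"
    using c(1) by (subst ennreal_mult[symmetric]) auto
  then have "(\<integral>\<^sup>+ \<omega>. ennreal (exp (s * (cmod (X \<omega>))\<^sup>2)) \<partial>M)
     = ennreal (1 / c\<^sup>2) * (ennreal (c\<^sup>2) * (\<integral>\<^sup>+ \<omega>. ennreal (exp (s * (cmod (X \<omega>))\<^sup>2)) \<partial>M))"
    by (simp flip: mult.assoc)
  then show ?thesis unfolding eq by (simp add: c(2))
qed

lemma CN_exp_expectation:
  assumes d: "distributed M lborel X (CN_density v)" and v: "v > 0" and s: "s < 1 / v"
  shows "integrable M (\<lambda>\<omega>. exp (s * (cmod (X \<omega>))\<^sup>2))"
    "expectation (\<lambda>\<omega>. exp (s * (cmod (X \<omega>))\<^sup>2)) = 1 / (1 - s * v)"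
proof -
  have [measurable]: "X \<in> borel_measurable M" using distributed_measurable[OF d] by simp
  have sv: "0 < 1 - s * v" using s v by (simp add: field_simps)
  show int: "integrable M (\<lambda>\<omega>. exp (s * (cmod (X \<omega>))\<^sup>2))"
    using CN_exp_moment[OF assms] by (intro integrableI_nonneg) auto
  show "expectation (\<lambda>\<omega>. exp (s * (cmod (X \<omega>))\<^sup>2)) = 1 / (1 - s * v)"
    using sv by (intro integral_eq_nn_integral[THEN trans]) (auto simp: CN_exp_moment[OF assms])
qed

text \<open>The exponential moment at \<open>s = 1 / (2 v)\<close> is finite and dominates every
  power: one term of the exponential series bounds \<open>r^(2 p)\<close>, which exceeds
  \<open>r^p\<close> once \<open>r > 1\<close>, and for \<open>r \<le> 1\<close> the power is at
  most 1.\<close>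

lemma CN_all_moments:
  assumes d: "distributed M lborel X (CN_density v)" and v: "v > 0"
  shows "all_moments M X"
  unfolding all_moments_def
proof (intro conjI allI)
  show [measurable]: "X \<in> borel_measurable M" using distributed_measurable[OF d] by simp
  fix p
  define s where "s = 1 / (2 * v)"
  have s: "s > 0" "s < 1 / v" using v by (simp_all add: s_def field_simps)
  have le: "r ^ p \<le> (1 + fact p / s ^ p) * exp (s * r\<^sup>2)" if r: "r \<ge> 0" for r :: real
  proof (cases "r \<le> 1")
    case True
    then have "r ^ p \<le> 1 * 1" using r by (simp add: power_le_one)
    also have "\<dots> \<le> (1 + fact p / s ^ p) * exp (s * r\<^sup>2)"
      using s by (intro mult_mono) auto
    finally show ?thesis .
  next
    case False
    then have "r ^ p \<le> (r ^ p)\<^sup>2" by (intro self_le_power) auto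
    then have "r ^ p \<le> (r\<^sup>2) ^ p" by (simp flip: power_mult add: mult.commute)
    also have "\<dots> = fact p / s ^ p * ((s * r\<^sup>2) ^ p / fact p)"
      using s by (simp add: power_mult_distrib)
    also have "\<dots> \<le> fact p / s ^ p * exp (s * r\<^sup>2)"
    proof (intro mult_left_mono)
      have "(\<Sum>n\<in>{p}. (s * r\<^sup>2) ^ n /\<^sub>R fact n) \<le> exp (s * r\<^sup>2)"
        unfolding exp_def using s by (intro sum_le_suminf summable_exp_generic) auto
      then show "(s * r\<^sup>2) ^ p / fact p \<le> exp (s * r\<^sup>2)" by (simp add: divide_inverse mult.commute)
    qed (use s in auto)
    also have "\<dots> \<le> (1 + fact p / s ^ p) * exp (s * r\<^sup>2)"
      by (intro mult_right_mono) auto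
    finally show ?thesis .
  qed
  have "integrable M (\<lambda>\<omega>. (1 + fact p / s ^ p) * exp (s * (cmod (X \<omega>))\<^sup>2))"
    using CN_exp_expectation(1)[OF d v s(2)] by simp
  then show "integrable M (\<lambda>\<omega>. norm (X \<omega>) ^ p)"
  proof (rule Bochner_Integration.integrable_bound)
    show "AE \<omega> in M. norm (norm (X \<omega>) ^ p) \<le> norm ((1 + fact p / s ^ p) * exp (s * (cmod (X \<omega>))\<^sup>2))"
    proof (rule AE_I2)
      fix \<omega>
      have "norm (norm (X \<omega>) ^ p) = norm (X \<omega>) ^ p" by simp
      also have "\<dots> \<le> (1 + fact p / s ^ p) * exp (s * (cmod (X \<omega>))\<^sup>2)" by (rule le) simp
      also have "\<dots> \<le> norm ((1 + fact p / s ^ p) * exp (s * (cmod (X \<omega>))\<^sup>2))"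
        unfolding real_norm_def by (rule abs_ge_self)
      finally show "norm (norm (X \<omega>) ^ p) \<le> norm ((1 + fact p / s ^ p) * exp (s * (cmod (X \<omega>))\<^sup>2))" .
    qed
  qed measurable
qed

lemma CN_variance:
  assumes d: "distributed M lborel X (CN_density v)" and v: "v > 0"
  shows "expectation (\<lambda>\<omega>. (cmod (X \<omega>))\<^sup>2) = v"
proof -
  have int: "integrable M (\<lambda>\<omega>. (cmod (X \<omega>))\<^sup>2)" by (rule all_momentsD(2)[OF CN_all_moments[OF d v]])
  let ?m = "expectation (\<lambda>\<omega>. (cmod (X \<omega>))\<^sup>2)"
  have le: "1 + s * ?m \<le> 1 / (1 - s * v)" if s: "s < 1 / v" for s
  proof -
    have "1 + s * ?m = expectation (\<lambda>\<omega>. 1 + s * (cmod (X \<omega>))\<^sup>2)"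
      using int by (simp add: prob_space)
    also have "\<dots> \<le> expectation (\<lambda>\<omega>. exp (s * (cmod (X \<omega>))\<^sup>2))"
      using int by (intro integral_mono CN_exp_expectation(1)[OF d v s]) auto
    finally show ?thesis using CN_exp_expectation(2)[OF d v s] by simp
  qed
  text \<open>Difference quotients at 0 of the exponential moment, from both sides.\<close>
  have up: "?m \<le> v / (1 - s * v)" if s: "0 < s" "s < 1 / v" for s
  proof -
    have sv: "0 < 1 - s * v" using s v by (simp add: field_simps)
    have "s * ?m \<le> 1 / (1 - s * v) - 1" using le[OF s(2)] by simp
    also have "\<dots> = s * (v / (1 - s * v))" using sv by (simp add: field_simps)
    finally show ?thesis by (rule mult_left_le_imp_le[OF _ s(1)])
  qed
  have low: "v / (1 + s * v) \<le> ?m" if s: "0 < s" for s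
  proof -
    have sv: "0 < 1 + s * v" using s v by (simp add: add_pos_pos)
    have "0 < 1 / v" using v by simp
    then have "- s < 1 / v" using s by linarith
    from le[OF this] have "1 - 1 / (1 + s * v) \<le> s * ?m" by simp
    moreover have "1 - 1 / (1 + s * v) = s * (v / (1 + s * v))" using sv by (simp add: field_simps)
    ultimately have "s * (v / (1 + s * v)) \<le> s * ?m" by simp
    then show ?thesis by (rule mult_left_le_imp_le[OF _ s])
  qed
  have "?m \<le> v"
  proof (rule tendsto_lowerbound)
    show "((\<lambda>s. v / (1 - s * v)) \<longlongrightarrow> v) (at_right 0)"
      by (auto intro!: tendsto_eq_intros)
    show "\<forall>\<^sub>F s in at_right 0. ?m \<le> v / (1 - s * v)"
      using v by (intro eventually_at_rightI[of 0 "1 / v"]) (auto intro: up)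
  qed simp
  moreover have "v \<le> ?m"
  proof (rule tendsto_upperbound)
    show "((\<lambda>s. v / (1 + s * v)) \<longlongrightarrow> v) (at_right 0)"
      by (auto intro!: tendsto_eq_intros)
    show "\<forall>\<^sub>F s in at_right 0. v / (1 + s * v) \<le> ?m"
      using v by (intro eventually_at_rightI[of 0 1]) (auto intro: low)
  qed simp
  ultimately show ?thesis by simp
qed

text \<open>The density is even and Lebesgue measure is invariant under
  \<open>z \<mapsto> - z\<close>, so odd real functions of \<open>X\<close> have mean zero; this is
  applied to \<open>Re\<close> and \<open>Im\<close>.\<close>

lemma CN_mean:
  assumes d: "distributed M lborel X (CN_density v)" and v: "v > 0"
  shows "expectation X = 0"
proof -
  let ?f = "\<lambda>z. exp (- (cmod z)\<^sup>2 / v) / (pi * v)"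
  have d': "distributed M lborel X (\<lambda>z. ennreal (?f z))"
    using d by (simp add: CN_density_def[abs_def])
  have f: "0 \<le> ?f z" for z using v by simp
  have lborel_neg: "lborel = distr lborel borel (\<lambda>z::complex. - z)"
    using lborel_affine[of "-1" "0 :: complex"] by (simp add: density_1)
  have zero: "expectation (\<lambda>\<omega>. g (X \<omega>)) = 0"
    if g [measurable]: "g \<in> borel_measurable borel" and odd: "\<And>z. g (- z) = - g z" for g :: "complex \<Rightarrow> real"
  proof -
    have "expectation (\<lambda>\<omega>. g (X \<omega>)) = (\<integral>z. ?f z * g z \<partial>lborel)"
      using distributed_integral[OF d', of g] f by simp
    also have "\<dots> = (\<integral>z. ?f z * g z \<partial>distr lborel borel (\<lambda>z::complex. - z))"
      by (subst lborel_neg) (rule refl)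
    also have "\<dots> = (\<integral>z. ?f (- z) * g (- z) \<partial>lborel)"
      by (intro integral_distr) measurable
    also have "\<dots> = - (\<integral>z. ?f z * g z \<partial>lborel)"
      by (simp add: odd)
    also have "(\<integral>z. ?f z * g z \<partial>lborel) = expectation (\<lambda>\<omega>. g (X \<omega>))"
      using distributed_integral[OF d', of g] f by simp
    finally show ?thesis by simp
  qed
  have int: "integrable M X" by (rule all_momentsD(3)[OF CN_all_moments[OF d v]])
  have "Re (expectation X) = 0" "Im (expectation X) = 0"
    using zero[of Re] zero[of Im] integral_Re[OF int] integral_Im[OF int] by simp_all
  then show ?thesis by (simp add: complex_eq_iff)
qed

end

section \<open>The strong law of large numbers\<close>

lemma cesaro_mean:
  fixes a :: "nat \<Rightarrow> real"
  assumes "a \<longlonglongrightarrow> l"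
  shows "(\<lambda>n. (\<Sum>k<n. a k) / real n) \<longlonglongrightarrow> l"
proof (rule LIMSEQ_I)
  fix e :: real assume e: "e > 0"
  obtain N where N: "\<And>k. k \<ge> N \<Longrightarrow> \<bar>a k - l\<bar> < e / 2"
    using LIMSEQ_D[OF assms, of "e / 2"] e by auto
  define B where "B = (\<Sum>k<N. \<bar>a k - l\<bar>)"
  obtain n0 where n0: "real n0 > 2 * B / e" using reals_Archimedean2 by blast
  show "\<exists>no. \<forall>n\<ge>no. norm ((\<Sum>k<n. a k) / real n - l) < e"
  proof (intro exI allI impI)
    fix n assume n: "n \<ge> Suc (max N n0)"
    then have n': "real n > 0" "N \<le> n" "real n > 2 * B / e" using n0 by auto
    have "(\<Sum>k<n. a k) / real n - l = (\<Sum>k<n. a k - l) / real n"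
      using n' by (simp add: sum_subtractf field_simps)
    also have "norm \<dots> \<le> (\<Sum>k<n. \<bar>a k - l\<bar>) / real n"
      using n' by (simp add: divide_right_mono sum_abs)
    also have "(\<Sum>k<n. \<bar>a k - l\<bar>) = B + (\<Sum>k=N..<n. \<bar>a k - l\<bar>)"
      using n' by (simp add: B_def lessThan_atLeast0 sum.atLeastLessThan_concat)
    also have "(\<Sum>k=N..<n. \<bar>a k - l\<bar>) \<le> (\<Sum>k=N..<n. e / 2)"
      using N by (intro sum_mono less_imp_le) auto
    also have "\<dots> \<le> real n * (e / 2)" using e by (simp add: of_nat_diff n')
    also have "(B + real n * (e / 2)) / real n = B / real n + e / 2" using n' by (simp add: field_simps)
    also have "B / real n < e / 2" using n' e by (simp add: field_simps)
    finally show "norm ((\<Sum>k<n. a k) / real n - l) < e"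
      using n' by (simp add: divide_right_mono)
  qed
qed

text \<open>The series of the \<open>f n\<close> has finite expectation, hence converges almost
  surely. Nothing is asked about the joint law of the \<open>f n\<close>, which suits models for
  different numbers of antennas.\<close>

lemma AE_tendsto_zero_of_summable:
  fixes f :: "nat \<Rightarrow> 'a \<Rightarrow> real"
  assumes int: "\<And>n. integrable M (f n)" and nonneg: "\<And>n \<omega>. 0 \<le> f n \<omega>"
    and sum: "summable (\<lambda>n. integral\<^sup>L M (f n))"
  shows "AE \<omega> in M. (\<lambda>n. f n \<omega>) \<longlonglongrightarrow> 0"
proof -
  have [measurable]: "f n \<in> borel_measurable M" for n using int by (rule borel_measurable_integrable)
  have "(\<integral>\<^sup>+ \<omega>. (\<Sum>n. ennreal (f n \<omega>)) \<partial>M) = (\<Sum>n. \<integral>\<^sup>+ \<omega>. ennreal (f n \<omega>) \<partial>M)"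
    by (rule nn_integral_suminf) measurable
  also have "\<dots> = (\<Sum>n. ennreal (integral\<^sup>L M (f n)))"
    using int nonneg by (simp add: nn_integral_eq_integral)
  also have "\<dots> = ennreal (\<Sum>n. integral\<^sup>L M (f n))"
    using nonneg by (intro suminf_ennreal2 sum) (simp add: integral_nonneg_AE)
  also have "\<dots> \<noteq> \<infinity>" by simp
  finally have "AE \<omega> in M. (\<Sum>n. ennreal (f n \<omega>)) \<noteq> \<infinity>"
    by (intro nn_integral_PInf_AE) auto
  then show ?thesis
  proof (rule AE_mp, intro AE_I2 impI)
    fix \<omega> assume "(\<Sum>n. ennreal (f n \<omega>)) \<noteq> \<infinity>"
    then have "summable (\<lambda>n. f n \<omega>)" using nonneg by (intro summable_suminf_not_top) auto
    then show "(\<lambda>n. f n \<omega>) \<longlonglongrightarrow> 0" by (rule summable_LIMSEQ_zero)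
  qed
qed

text \<open>A monotone sequence of sums is controlled by its values along \<open>\<lfloor>\<rho>\<^sup>m\<rfloor>\<close>, for \<open>\<rho>\<close> close to 1.\<close>

lemma geometric_interpolation:
  fixes U :: "nat \<Rightarrow> real"
  assumes mono: "mono U" and nonneg: "\<And>n. 0 \<le> U n" and \<mu>: "0 \<le> \<mu>"
    and lim: "\<And>r::nat. r \<ge> 1 \<Longrightarrow>
      (\<lambda>m. U (nat \<lfloor>(1 + 1 / real r) ^ m\<rfloor>) / real (nat \<lfloor>(1 + 1 / real r) ^ m\<rfloor>)) \<longlonglongrightarrow> \<mu>"
  shows "(\<lambda>n. U n / real n) \<longlonglongrightarrow> \<mu>"
proof (rule LIMSEQ_I)
  fix e :: real assume e: "e > 0"
  \<comment> \<open>This makes \<open>\<mu> / r\<close> smaller than \<open>e\<close>, so that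
    passing from \<open>\<mu>\<close> to \<open>\<rho> * \<mu>\<close> or
    \<open>\<mu> / \<rho>\<close> costs less than \<open>e\<close>.\<close>
  obtain r0 where r0: "real r0 > 2 * \<mu> / e" using reals_Archimedean2 by blast
  define r where "r = Suc r0"
  have r: "r \<ge> 1" "real r > 2 * \<mu> / e" using r0 by (auto simp: r_def)
  define \<rho> where "\<rho> = 1 + 1 / real r"
  have \<rho>: "\<rho> > 1" using r by (simp add: \<rho>_def)
  define k where "k m = nat \<lfloor>\<rho> ^ m\<rfloor>" for m
  define V where "V m = U (k m) / real (k m)" for m
  have V: "V \<longlonglongrightarrow> \<mu>" unfolding V_def k_def \<rho>_def by (rule lim[OF r(1)])
  have p1: "1 \<le> \<rho> ^ m" for m using \<rho> by simp
  have kle: "real (k m) \<le> \<rho> ^ m" and kge: "real (k m) > \<rho> ^ m - 1" and k1: "k m \<ge> 1" for m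
  proof -
    have "1 \<le> \<lfloor>\<rho> ^ m\<rfloor>" using p1[of m] by simp
    then show "real (k m) \<le> \<rho> ^ m" "real (k m) > \<rho> ^ m - 1" "k m \<ge> 1"
      unfolding k_def using floor_correct[of "\<rho> ^ m"] by (auto simp: le_nat_iff; linarith)+
  qed
  \<comment> \<open>The exponent with \<open>\<rho>^m \<le> n < \<rho>^(m + 1)\<close>. Monotonicity
    compares \<open>U n\<close> with its values at the two ends of this block.\<close>
  define m where "m n = nat \<lfloor>log \<rho> (real n)\<rfloor>" for n
  have mlim: "filterlim m at_top sequentially"
  proof -
    have "filterlim (\<lambda>n. log \<rho> (real n)) at_top sequentially"
    proof -
      have "filterlim (\<lambda>n. ln (real n) * (1 / ln \<rho>)) at_top sequentially"
        using \<rho> by (intro filterlim_at_top_mult_tendsto_pos[OF tendsto_const]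
          filterlim_compose[OF ln_at_top filterlim_real_sequentially]) simp
      then show ?thesis by (simp add: log_def)
    qed
    then show ?thesis unfolding m_def
      by (intro filterlim_compose[OF filterlim_nat_sequentially] filterlim_compose[OF filterlim_floor_sequentially])
  qed
  have pm: "\<rho> ^ m n \<le> real n" "real n < \<rho> ^ (m n + 1)" if n: "n \<ge> 1" for n
  proof -
    have l0: "0 \<le> log \<rho> (real n)" using n \<rho> by simp
    have "real (m n) \<le> log \<rho> (real n)" "log \<rho> (real n) < real (m n + 1)"
      unfolding m_def using l0 floor_correct[of "log \<rho> (real n)"] by (auto; linarith)+
    then have "\<rho> powr real (m n) \<le> real n" "real n < \<rho> powr real (m n + 1)"
      using n \<rho> by (simp_all add: le_log_iff log_less_iff)
    then show "\<rho> ^ m n \<le> real n" "real n < \<rho> ^ (m n + 1)"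
      using \<rho> by (simp_all only: powr_realpow)
  qed
  have up: "U n / real n \<le> \<rho> * V (m n + 1)" if n: "n \<ge> 1" for n
  proof -
    have "n \<le> k (m n + 1)" using pm(2)[OF n] unfolding k_def by (simp add: le_nat_floor)
    then have "U n \<le> U (k (m n + 1))" by (rule monoD[OF mono])
    also have "\<dots> = V (m n + 1) * real (k (m n + 1))" using k1[of "m n + 1"] by (simp add: V_def)
    also have "\<dots> \<le> V (m n + 1) * (\<rho> * real n)"
    proof (intro mult_left_mono)
      have "real (k (m n + 1)) \<le> \<rho> * \<rho> ^ m n" using kle[of "m n + 1"] by simp
      also have "\<dots> \<le> \<rho> * real n" using pm(1)[OF n] \<rho> by (intro mult_left_mono) auto
      finally show "real (k (m n + 1)) \<le> \<rho> * real n" .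
    qed (use nonneg in \<open>simp add: V_def\<close>)
    finally show ?thesis using n by (simp add: field_simps)
  qed
  have low: "V (m n) * ((1 - 1 / \<rho> ^ m n) / \<rho>) \<le> U n / real n" if n: "n \<ge> 1" for n
  proof -
    have "V (m n) * ((1 - 1 / \<rho> ^ m n) / \<rho>) \<le> V (m n) * (real (k (m n)) / real n)"
    proof (intro mult_left_mono)
      have "(1 - 1 / \<rho> ^ m n) / \<rho> = (\<rho> ^ m n - 1) / \<rho> ^ (m n + 1)" using \<rho> by (simp add: field_simps)
      also have "\<dots> \<le> real (k (m n)) / real n"
        using kge[of "m n"] pm(2)[OF n] p1[of "m n"] n by (intro frac_le) auto
      finally show "(1 - 1 / \<rho> ^ m n) / \<rho> \<le> real (k (m n)) / real n" .
    qed (use nonneg in \<open>simp add: V_def\<close>)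
    also have "\<dots> = U (k (m n)) / real n" using k1[of "m n"] by (simp add: V_def)
    also have "\<dots> \<le> U n / real n"
    proof (intro divide_right_mono monoD[OF mono])
      have "real (k (m n)) \<le> real n" using kle[of "m n"] pm(1)[OF n] by simp
      then show "k (m n) \<le> n" by simp
    qed simp
    finally show ?thesis .
  qed
  have lim_up: "(\<lambda>n. \<rho> * V (m n + 1)) \<longlonglongrightarrow> \<rho> * \<mu>"
    by (intro tendsto_mult tendsto_const filterlim_compose[OF LIMSEQ_Suc[OF V], simplified] mlim filterlim_compose[OF LIMSEQ_ignore_initial_segment[OF V, of 1]])
  have "(\<lambda>m. 1 / \<rho> ^ m) \<longlonglongrightarrow> 0"
    using \<rho> LIMSEQ_power_zero[of "1 / \<rho>"] by (simp add: power_one_over)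
  then have "(\<lambda>m. V m * ((1 - 1 / \<rho> ^ m) / \<rho>)) \<longlonglongrightarrow> \<mu> * ((1 - 0) / \<rho>)"
    using \<rho> by (intro tendsto_intros V) auto
  then have lim_low: "(\<lambda>n. V (m n) * ((1 - 1 / \<rho> ^ m n) / \<rho>)) \<longlonglongrightarrow> \<mu> / \<rho>"
    using filterlim_compose[OF _ mlim] by fastforce
  have d: "\<rho> * \<mu> < \<mu> + e" "\<mu> - e < \<mu> / \<rho>"
  proof -
    have 1: "\<mu> / real r < e" using r e \<mu> by (simp add: field_simps)
    then show "\<rho> * \<mu> < \<mu> + e" by (simp add: \<rho>_def distrib_right)
    have "\<mu> - \<mu> / \<rho> = \<mu> / real r / \<rho>" using r by (simp add: \<rho>_def field_simps)
    also have "\<dots> \<le> \<mu> / real r / 1" using \<rho> \<mu> by (intro divide_left_mono) auto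
    finally show "\<mu> - e < \<mu> / \<rho>" using 1 by simp
  qed
  have "\<forall>\<^sub>F n in sequentially. \<rho> * V (m n + 1) < \<mu> + e" using order_tendstoD(2)[OF lim_up d(1)] .
  moreover have "\<forall>\<^sub>F n in sequentially. \<mu> - e < V (m n) * ((1 - 1 / \<rho> ^ m n) / \<rho>)"
    using order_tendstoD(1)[OF lim_low d(2)] .
  ultimately have "\<forall>\<^sub>F n in sequentially. norm (U n / real n - \<mu>) < e"
    using eventually_ge_at_top[of 1]
  proof eventually_elim
    case (elim n)
    then show ?case using up[of n] low[of n] by (simp add: abs_less_iff)
  qed
  then show "\<exists>no. \<forall>n\<ge>no. norm (U n / real n - \<mu>) < e" by (simp add: eventually_sequentially)
qed

text \<open>A geometric series that starts at the first exponent \<open>m0\<close> with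
  \<open>y \<le> \<rho>^m0\<close>, so its sum is at most a constant times \<open>1 / y\<close>. In
  the strong law it turns a sum of truncated second moments along a geometric subsequence into a
  first moment.\<close>

lemma geometric_tail_bound:
  fixes \<rho> y :: real
  assumes \<rho>: "\<rho> > 1" and y: "y > 0"
  shows "(\<Sum>m<n. if y \<le> \<rho> ^ m then 1 / \<rho> ^ m else 0) \<le> \<rho> / (\<rho> - 1) / y"
proof -
  obtain m1 where m1: "y < \<rho> ^ m1" using real_arch_pow[OF \<rho>] by blast
  define m0 where "m0 = (LEAST m. y \<le> \<rho> ^ m)"
  have m0: "y \<le> \<rho> ^ m0" unfolding m0_def by (rule LeastI[where P = "\<lambda>m. y \<le> \<rho> ^ m", OF less_imp_le[OF m1]])
  have least: "m0 \<le> m" if "y \<le> \<rho> ^ m" for m unfolding m0_def using that by (rule Least_le)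
  have q: "0 < 1 / \<rho>" "1 / \<rho> < 1" using \<rho> by auto
  have "(\<Sum>m<n. if y \<le> \<rho> ^ m then 1 / \<rho> ^ m else 0) \<le> (\<Sum>m<n. if m0 \<le> m then (1 / \<rho>) ^ m else 0)"
    using \<rho> least by (intro sum_mono) (auto simp: power_one_over)
  also have "\<dots> = (\<Sum>m\<in>{m0..<n}. (1 / \<rho>) ^ m)"
    by (subst sum.inter_filter[symmetric]) (auto intro!: sum.cong)
  also have "\<dots> \<le> (1 / \<rho>) ^ m0 / (1 - 1 / \<rho>)"
  proof (cases "m0 \<le> n")
    case True
    have gp: "(\<Sum>m\<in>{m0..<n}. q ^ m) * (1 - q) = q ^ m0 - q ^ n" for q :: real
      using True by (induction n rule: dec_induct) (simp_all add: distrib_right, simp add: algebra_simps)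
    have "(\<Sum>m\<in>{m0..<n}. (1 / \<rho>) ^ m) = ((1 / \<rho>) ^ m0 - (1 / \<rho>) ^ n) / (1 - 1 / \<rho>)"
      unfolding gp[of "1 / \<rho>", symmetric] using q by simp
    also have "\<dots> \<le> (1 / \<rho>) ^ m0 / (1 - 1 / \<rho>)"
      using q by (intro divide_right_mono) auto
    finally show ?thesis .
  qed (use q in auto)
  also have "\<dots> \<le> (1 / y) / (1 - 1 / \<rho>)"
    using m0 q y by (intro divide_right_mono) (auto simp: power_one_over intro!: divide_left_mono)
  also have "\<dots> = \<rho> / (\<rho> - 1) / y" using \<rho> by (simp add: field_simps)
  finally show ?thesis .
qed

context prob_space begin

text \<open>Etemadi's argument: truncate, control variances along
  \<open>\<lfloor>\<rho>^m\<rfloor>\<close> by Chebyshev-type summability, and fill the gaps by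
  monotonicity, which is why the summands are nonnegative. Variances only involve pairs, so pairwise
  independence is enough, and integrability is the only moment condition.\<close>

theorem slln_nonneg:
  fixes Y :: "nat \<Rightarrow> 'a \<Rightarrow> real"
  assumes meas: "\<And>k. random_variable borel (Y k)" and nonneg: "\<And>k \<omega>. 0 \<le> Y k \<omega>"
    and indep: "\<And>k m. k \<noteq> m \<Longrightarrow> indep_var borel (Y k) borel (Y m)"
    and ident: "\<And>k. distr M borel (Y k) = distr M borel (Y 0)"
    and int: "integrable M (Y 0)"
  shows "AE \<omega> in M. (\<lambda>n. (\<Sum>k<n. Y k \<omega>) / real n) \<longlonglongrightarrow> expectation (Y 0)"
proof -
  note [measurable] = meas
  define \<mu> where "\<mu> = expectation (Y 0)"
  have \<mu>0: "0 \<le> \<mu>" unfolding \<mu>_def using nonneg by (intro integral_nonneg_AE) auto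
  have same: "expectation (\<lambda>\<omega>. f (Y k \<omega>)) = expectation (\<lambda>\<omega>. f (Y 0 \<omega>))"
    if [measurable]: "f \<in> borel_measurable borel" for f :: "real \<Rightarrow> real" and k
    using integral_distr[of "Y k" M borel f] integral_distr[of "Y 0" M borel f] ident[of k] by simp
  define tr where "tr c y = (if y \<le> c then y else 0)" for c y :: real
  have [measurable]: "tr c \<in> borel_measurable borel" for c unfolding tr_def by measurable
  \<comment> \<open>Indices start at 0. With truncation level \<open>k + 1\<close>, all levels among
    the first \<open>n\<close> terms are at most \<open>n\<close>, as used for the variance
    bound.\<close>
  define T where "T k \<omega> = tr (real k + 1) (Y k \<omega>)" for k \<omega>
  have [measurable]: "T k \<in> borel_measurable M" for k unfolding T_def by measurable
  have T0: "0 \<le> T k \<omega>" "T k \<omega> \<le> real k + 1" for k \<omega>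
    using nonneg[of k \<omega>] by (auto simp: T_def tr_def)
  have Tint: "integrable M (T k)" for k
    using T0 by (intro integrable_const_bound[of _ "real k + 1"]) auto
  have tr_le: "0 \<le> tr c y" "tr c y \<le> y" if "0 \<le> y" for c y using that by (auto simp: tr_def)

  \<comment> \<open>The truncation changes only finitely many terms, because the tail probabilities
    of \<open>Y 0\<close> at the levels \<open>k + 1\<close> sum to at most its mean.\<close>
  have ev: "AE \<omega> in M. \<forall>\<^sub>F k in sequentially. \<omega> \<in> space M - {\<omega> \<in> space M. Y k \<omega> > real k + 1}"
  proof (rule borel_cantelli_AE1)
    show "summable (\<lambda>k. prob {\<omega> \<in> space M. Y k \<omega> > real k + 1})"
    proof (rule summableI_nonneg_bounded)
      fix n
      have "prob {\<omega> \<in> space M. Y k \<omega> > real k + 1} = expectation (\<lambda>\<omega>. indicator {real k + 1<..} (Y 0 \<omega>))" for k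
      proof -
        have "prob {\<omega> \<in> space M. Y k \<omega> > real k + 1} = expectation (indicator {\<omega> \<in> space M. Y k \<omega> > real k + 1})"
          by simp
        also have "\<dots> = expectation (\<lambda>\<omega>. indicator {real k + 1<..} (Y k \<omega>))"
          by (intro Bochner_Integration.integral_cong) (auto simp: indicator_def)
        also have "\<dots> = expectation (\<lambda>\<omega>. indicator {real k + 1<..} (Y 0 \<omega>))" by (rule same) simp
        finally show ?thesis .
      qed
      then have "(\<Sum>k<n. prob {\<omega> \<in> space M. Y k \<omega> > real k + 1}) = expectation (\<lambda>\<omega>. \<Sum>k<n. indicator {real k + 1<..} (Y 0 \<omega>))"
        by (subst Bochner_Integration.integral_sum) (auto intro!: integrable_const_bound[of _ 1])
      also have "\<dots> \<le> expectation (Y 0)"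
      proof (rule integral_mono)
        fix \<omega>
        \<comment> \<open>The number of \<open>k\<close> with \<open>k + 1 < y\<close> is at most
          \<open>y\<close>; the induction removes \<open>k = 0\<close> and lowers \<open>y\<close>
          by 1.\<close>
        have "(\<Sum>k<n. indicator {real k + 1<..} y) \<le> y" if "0 \<le> y" for y :: real and n
          using that
        proof (induction n arbitrary: y)
          case (Suc n)
          show ?case
          proof (cases "y \<le> 1")
            case True
            then have "(\<Sum>k<Suc n. indicator {real k + 1<..} y) = (0::real)" by (intro sum.neutral) (auto simp: indicator_def)
            then show ?thesis using Suc by simp
          next
            case False
            have "(\<Sum>k<Suc n. indicator {real k + 1<..} y) = indicator {1<..} y + (\<Sum>k<n. indicator {real (Suc k) + 1<..} y)"
              by (subst sum.lessThan_Suc_shift) simp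
            also have "(\<Sum>k<n. indicator {real (Suc k) + 1<..} y) = (\<Sum>k<n. indicator {real k + 1<..} (y - 1) :: real)"
              by (intro sum.cong) (auto simp: indicator_def)
            also have "\<dots> \<le> y - 1" using False by (intro Suc.IH) simp
            finally show ?thesis using False by simp
          qed
        qed simp
        then show "(\<Sum>k<n. indicator {real k + 1<..} (Y 0 \<omega>)) \<le> Y 0 \<omega>" using nonneg by blast
      qed (auto intro!: Bochner_Integration.integrable_sum integrable_const_bound[of _ 1] int)
      finally show "(\<Sum>k<n. prob {\<omega> \<in> space M. Y k \<omega> > real k + 1}) \<le> expectation (Y 0)" .
    qed simp
  qed (auto simp: less_top[symmetric])

  have mean: "(\<lambda>k. expectation (T k)) \<longlonglongrightarrow> \<mu>"
  proof -
    have "(\<lambda>k. expectation (\<lambda>\<omega>. tr (real k + 1) (Y 0 \<omega>))) \<longlonglongrightarrow> expectation (Y 0)"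
    proof (rule integral_dominated_convergence[where w = "Y 0"])
      show "AE \<omega> in M. (\<lambda>k. tr (real k + 1) (Y 0 \<omega>)) \<longlonglongrightarrow> Y 0 \<omega>"
      proof (rule AE_I2)
        fix \<omega>
        obtain k0 where k0: "Y 0 \<omega> < real k0" using reals_Archimedean2 by blast
        have "\<forall>\<^sub>F k in sequentially. tr (real k + 1) (Y 0 \<omega>) = Y 0 \<omega>"
          using eventually_ge_at_top[of k0] by eventually_elim (use k0 in \<open>auto simp: tr_def\<close>)
        then show "(\<lambda>k. tr (real k + 1) (Y 0 \<omega>)) \<longlonglongrightarrow> Y 0 \<omega>" by (rule tendsto_eventually)
      qed
      show "AE \<omega> in M. norm (tr (real k + 1) (Y 0 \<omega>)) \<le> Y 0 \<omega>" for k
        using tr_le[OF nonneg] by auto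
    qed (use int in measurable)
    moreover have "expectation (T k) = expectation (\<lambda>\<omega>. tr (real k + 1) (Y 0 \<omega>))" for k
      unfolding T_def by (rule same) measurable
    ultimately show ?thesis by (simp add: \<mu>_def)
  qed

  define c where "c k \<omega> = T k \<omega> - expectation (T k)" for k \<omega>
  have cint: "integrable M (c k)" for k unfolding c_def using Tint by simp
  have cprod_int: "integrable M (\<lambda>\<omega>. c k \<omega> * c m \<omega>)" for k m
  proof -
    have bc: "\<bar>c k \<omega>\<bar> \<le> 2 * (real k + 1)" for k \<omega>
    proof -
      have "0 \<le> expectation (T k)" using T0 by (intro integral_nonneg_AE) auto
      moreover have "expectation (T k) \<le> real k + 1"
        using integral_mono[OF Tint[of k] integrable_const[of "real k + 1"]] T0 by (simp add: prob_space)
      ultimately show ?thesis using T0[of k \<omega>] by (simp add: c_def abs_le_iff)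
    qed
    show ?thesis
    proof (rule integrable_const_bound[of _ "(2 * (real k + 1)) * (2 * (real m + 1))"])
      show "AE \<omega> in M. norm (c k \<omega> * c m \<omega>) \<le> (2 * (real k + 1)) * (2 * (real m + 1))"
        unfolding real_norm_def abs_mult by (intro AE_I2 mult_mono bc) auto
      show "(\<lambda>\<omega>. c k \<omega> * c m \<omega>) \<in> borel_measurable M" unfolding c_def by measurable
    qed
  qed
  have cross: "expectation (\<lambda>\<omega>. c k \<omega> * c m \<omega>) = 0" if "k \<noteq> m" for k m
  proof -
    have "indep_var borel ((\<lambda>y. tr (real k + 1) y - expectation (T k)) \<circ> Y k) borel ((\<lambda>y. tr (real m + 1) y - expectation (T m)) \<circ> Y m)"
      by (rule indep_var_compose[OF indep[OF that]]) measurable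
    then have "indep_var borel (c k) borel (c m)" by (simp add: c_def[abs_def] T_def comp_def)
    then have "expectation (\<lambda>\<omega>. c k \<omega> * c m \<omega>) = expectation (c k) * expectation (c m)"
      using cint[of k] cint[of m] by (rule indep_var_lebesgue_integral)
    also have "expectation (c k) = 0" unfolding c_def using Tint by (simp add: prob_space)
    finally show ?thesis by simp
  qed
  have var: "expectation (\<lambda>\<omega>. (c k \<omega>)\<^sup>2) \<le> expectation (\<lambda>\<omega>. (tr (real n) (Y 0 \<omega>))\<^sup>2)" if "k < n" for k n
  proof -
    have T2: "integrable M (\<lambda>\<omega>. (T k \<omega>)\<^sup>2)"
      using T0 by (intro integrable_const_bound[of _ "(real k + 1)\<^sup>2"]) (auto intro!: power_mono)
    have "expectation (\<lambda>\<omega>. (c k \<omega>)\<^sup>2) = expectation (\<lambda>\<omega>. (T k \<omega>)\<^sup>2) - (expectation (T k))\<^sup>2"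
      unfolding c_def by (rule variance_eq[OF Tint T2])
    also have "\<dots> \<le> expectation (\<lambda>\<omega>. (T k \<omega>)\<^sup>2)" by simp
    also have "\<dots> = expectation (\<lambda>\<omega>. (tr (real k + 1) (Y 0 \<omega>))\<^sup>2)"
      unfolding T_def by (rule same) measurable
    also have "\<dots> \<le> expectation (\<lambda>\<omega>. (tr (real n) (Y 0 \<omega>))\<^sup>2)"
    proof (rule integral_mono)
      have trint: "integrable M (\<lambda>\<omega>. (tr a (Y 0 \<omega>))\<^sup>2)" for a
        using nonneg by (intro integrable_const_bound[of _ "a\<^sup>2"]) (auto simp: tr_def intro!: power_mono)
      show "integrable M (\<lambda>\<omega>. (tr (real k + 1) (Y 0 \<omega>))\<^sup>2)" "integrable M (\<lambda>\<omega>. (tr (real n) (Y 0 \<omega>))\<^sup>2)"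
        by (rule trint)+
      show "(tr (real k + 1) (Y 0 \<omega>))\<^sup>2 \<le> (tr (real n) (Y 0 \<omega>))\<^sup>2" for \<omega>
        using that nonneg[of 0 \<omega>] by (intro power_mono) (auto simp: tr_def)
    qed
    finally show ?thesis .
  qed
  define S where "S n \<omega> = (\<Sum>k<n. c k \<omega>)" for n \<omega>
  have S2: "(S n \<omega>)\<^sup>2 = (\<Sum>k<n. \<Sum>m<n. c k \<omega> * c m \<omega>)" for n \<omega>
    by (simp add: S_def power2_eq_square sum_product)
  have S2int: "integrable M (\<lambda>\<omega>. (S n \<omega>)\<^sup>2)" for n
    unfolding S2 by (intro Bochner_Integration.integrable_sum cprod_int)
  have ES2: "expectation (\<lambda>\<omega>. (S n \<omega>)\<^sup>2) \<le> real n * expectation (\<lambda>\<omega>. (tr (real n) (Y 0 \<omega>))\<^sup>2)" for n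
  proof -
    have "expectation (\<lambda>\<omega>. (S n \<omega>)\<^sup>2) = (\<Sum>k<n. \<Sum>m<n. expectation (\<lambda>\<omega>. c k \<omega> * c m \<omega>))"
      unfolding S2 by (simp add: Bochner_Integration.integral_sum cprod_int)
    also have "\<dots> = (\<Sum>k<n. \<Sum>m<n. if m = k then expectation (\<lambda>\<omega>. (c k \<omega>)\<^sup>2) else 0)"
      by (intro sum.cong refl) (auto simp: cross power2_eq_square)
    also have "\<dots> = (\<Sum>k<n. expectation (\<lambda>\<omega>. (c k \<omega>)\<^sup>2))" by simp
    also have "\<dots> \<le> (\<Sum>k<n. expectation (\<lambda>\<omega>. (tr (real n) (Y 0 \<omega>))\<^sup>2))"
      by (intro sum_mono var) auto
    finally show ?thesis by simp
  qed

  have sub: "AE \<omega> in M. (\<lambda>m. (S (nat \<lfloor>(1 + 1 / real r) ^ m\<rfloor>) \<omega> / real (nat \<lfloor>(1 + 1 / real r) ^ m\<rfloor>))\<^sup>2) \<longlonglongrightarrow> 0"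
    if r: "r \<ge> 1" for r :: nat
  proof (rule AE_tendsto_zero_of_summable)
    define \<rho> where "\<rho> = 1 + 1 / real r"
    have \<rho>: "\<rho> > 1" using r by (simp add: \<rho>_def)
    define k where "k m = nat \<lfloor>\<rho> ^ m\<rfloor>" for m
    have p1: "1 \<le> \<rho> ^ m" for m using \<rho> by simp
    have kle: "real (k m) \<le> \<rho> ^ m" and kge: "real (k m) \<ge> \<rho> ^ m / 2" and k1: "k m \<ge> 1" for m
    proof -
      have "1 \<le> \<lfloor>\<rho> ^ m\<rfloor>" using p1[of m] by simp
      then show "real (k m) \<le> \<rho> ^ m" "real (k m) \<ge> \<rho> ^ m / 2" "k m \<ge> 1"
        unfolding k_def using floor_correct[of "\<rho> ^ m"] by (auto simp: le_nat_iff; linarith)+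
    qed
    show "integrable M (\<lambda>\<omega>. (S (nat \<lfloor>(1 + 1 / real r) ^ m\<rfloor>) \<omega> / real (nat \<lfloor>(1 + 1 / real r) ^ m\<rfloor>))\<^sup>2)" for m
      unfolding power_divide by (intro integrable_divide S2int)
    have trint: "integrable M (\<lambda>\<omega>. (tr (real (k m)) (Y 0 \<omega>))\<^sup>2 / real (k m))" for m
      using nonneg by (intro integrable_divide integrable_const_bound[of _ "(real (k m))\<^sup>2"]) (auto simp: tr_def intro!: power_mono)
    have "summable (\<lambda>m. expectation (\<lambda>\<omega>. (S (k m) \<omega> / real (k m))\<^sup>2))"
    proof (rule summableI_nonneg_bounded)
      fix n
      have "(\<Sum>m<n. expectation (\<lambda>\<omega>. (S (k m) \<omega> / real (k m))\<^sup>2)) \<le> (\<Sum>m<n. expectation (\<lambda>\<omega>. (tr (real (k m)) (Y 0 \<omega>))\<^sup>2 / real (k m)))"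
      proof (rule sum_mono)
        fix m
        have "expectation (\<lambda>\<omega>. (S (k m) \<omega> / real (k m))\<^sup>2) = expectation (\<lambda>\<omega>. (S (k m) \<omega>)\<^sup>2) / (real (k m))\<^sup>2"
          unfolding power_divide by simp
        also have "\<dots> \<le> real (k m) * expectation (\<lambda>\<omega>. (tr (real (k m)) (Y 0 \<omega>))\<^sup>2) / (real (k m))\<^sup>2"
          by (intro divide_right_mono ES2) simp
        also have "\<dots> = expectation (\<lambda>\<omega>. (tr (real (k m)) (Y 0 \<omega>))\<^sup>2 / real (k m))"
          using k1[of m] by (simp add: power2_eq_square)
        finally show "expectation (\<lambda>\<omega>. (S (k m) \<omega> / real (k m))\<^sup>2) \<le> expectation (\<lambda>\<omega>. (tr (real (k m)) (Y 0 \<omega>))\<^sup>2 / real (k m))" .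
      qed
      also have "\<dots> = expectation (\<lambda>\<omega>. \<Sum>m<n. (tr (real (k m)) (Y 0 \<omega>))\<^sup>2 / real (k m))"
        by (rule Bochner_Integration.integral_sum[symmetric]) (rule trint)
      also have "\<dots> \<le> expectation (\<lambda>\<omega>. 2 * (\<rho> / (\<rho> - 1)) * Y 0 \<omega>)"
      proof (rule integral_mono)
        fix \<omega>
        define y where "y = Y 0 \<omega>"
        have y: "0 \<le> y" unfolding y_def by (rule nonneg)
        show "(\<Sum>m<n. (tr (real (k m)) (Y 0 \<omega>))\<^sup>2 / real (k m)) \<le> 2 * (\<rho> / (\<rho> - 1)) * Y 0 \<omega>"
        proof (cases "y = 0")
          case True
          then show ?thesis by (simp add: y_def[symmetric] tr_def)
        next
          case False
          \<comment> \<open>The factor 2 is the price of rounding,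
            \<open>k m \<ge> \<rho>^m / 2\<close>. The factor \<open>y^2\<close> from the square
            meets a geometric tail of order \<open>1 / y\<close>, which leaves an integrable
            multiple of \<open>y\<close>.\<close>
          have "(\<Sum>m<n. (tr (real (k m)) y)\<^sup>2 / real (k m)) \<le> (\<Sum>m<n. 2 * y\<^sup>2 * (if y \<le> \<rho> ^ m then 1 / \<rho> ^ m else 0))"
          proof (rule sum_mono)
            fix m
            show "(tr (real (k m)) y)\<^sup>2 / real (k m) \<le> 2 * y\<^sup>2 * (if y \<le> \<rho> ^ m then 1 / \<rho> ^ m else 0)"
            proof (cases "y \<le> real (k m)")
              case True
              then have "y \<le> \<rho> ^ m" using kle[of m] by simp
              moreover have "y\<^sup>2 / real (k m) \<le> y\<^sup>2 / (\<rho> ^ m / 2)"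
                using kge[of m] p1[of m] k1[of m] by (intro divide_left_mono) auto
              ultimately show ?thesis using True by (simp add: tr_def field_simps)
            next
              case False
              then show ?thesis using p1[of m] by (simp add: tr_def)
            qed
          qed
          also have "\<dots> = 2 * y\<^sup>2 * (\<Sum>m<n. if y \<le> \<rho> ^ m then 1 / \<rho> ^ m else 0)" by (simp add: sum_distrib_left)
          also have "\<dots> \<le> 2 * y\<^sup>2 * (\<rho> / (\<rho> - 1) / y)"
            using False y by (intro mult_left_mono geometric_tail_bound \<rho>) auto
          also have "\<dots> = 2 * (\<rho> / (\<rho> - 1)) * y" using False by (simp add: power2_eq_square)
          finally show ?thesis by (simp add: y_def)
        qed
      qed (intro Bochner_Integration.integrable_sum trint integrable_mult_right int)+
      finally show "(\<Sum>m<n. expectation (\<lambda>\<omega>. (S (k m) \<omega> / real (k m))\<^sup>2)) \<le> expectation (\<lambda>\<omega>. 2 * (\<rho> / (\<rho> - 1)) * Y 0 \<omega>)" .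
    qed simp
    then show "summable (\<lambda>m. expectation (\<lambda>\<omega>. (S (nat \<lfloor>(1 + 1 / real r) ^ m\<rfloor>) \<omega> / real (nat \<lfloor>(1 + 1 / real r) ^ m\<rfloor>))\<^sup>2))"
      by (simp add: k_def \<rho>_def)
  qed simp

  have "AE \<omega> in M. \<forall>r::nat\<ge>1. (\<lambda>m. (S (nat \<lfloor>(1 + 1 / real r) ^ m\<rfloor>) \<omega> / real (nat \<lfloor>(1 + 1 / real r) ^ m\<rfloor>))\<^sup>2) \<longlonglongrightarrow> 0"
    using sub by (subst AE_all_countable) (auto intro!: AE_I2)
  then show ?thesis using ev
  proof eventually_elim
    case (elim \<omega>)
    show ?case unfolding \<mu>_def[symmetric]
    proof (rule geometric_interpolation[OF _ _ \<mu>0])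
      show "mono (\<lambda>n. \<Sum>k<n. Y k \<omega>)" using nonneg by (intro monoI sum_mono2) auto
      show "0 \<le> (\<Sum>k<n. Y k \<omega>)" for n using nonneg by (intro sum_nonneg) auto
      fix r :: nat assume r: "r \<ge> 1"
      define k where "k m = nat \<lfloor>(1 + 1 / real r) ^ m\<rfloor>" for m
      have klim: "filterlim k at_top sequentially"
      proof -
        have "filterlim (\<lambda>m. (1 + 1 / real r) ^ m) at_top sequentially"
          unfolding filterlim_at_top
        proof
          fix B :: real
          obtain m0 where m0: "B < (1 + 1 / real r) ^ m0" using real_arch_pow[of "1 + 1 / real r" B] r by auto
          show "\<forall>\<^sub>F m in sequentially. B \<le> (1 + 1 / real r) ^ m"
            using eventually_ge_at_top[of m0]
          proof eventually_elim
            case (elim m)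
            have "(1 + 1 / real r) ^ m0 \<le> (1 + 1 / real r) ^ m" using elim by (intro power_increasing) auto
            then show ?case using m0 by linarith
          qed
        qed
        then show ?thesis unfolding k_def
          by (intro filterlim_compose[OF filterlim_nat_sequentially] filterlim_compose[OF filterlim_floor_sequentially])
      qed
      have "(\<lambda>m. sqrt ((S (k m) \<omega> / real (k m))\<^sup>2)) \<longlonglongrightarrow> sqrt 0"
        using elim(1) r unfolding k_def by (intro tendsto_real_sqrt) blast
      then have s1: "(\<lambda>m. S (k m) \<omega> / real (k m)) \<longlonglongrightarrow> 0"
        unfolding real_sqrt_abs real_sqrt_zero by (rule tendsto_rabs_zero_cancel)
      have s2: "(\<lambda>m. (\<Sum>i<k m. expectation (T i)) / real (k m)) \<longlonglongrightarrow> \<mu>"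
        by (rule filterlim_compose[OF cesaro_mean[OF mean] klim])
      have "\<forall>\<^sub>F i in sequentially. Y i \<omega> - T i \<omega> = 0"
        using elim(2) by eventually_elim (auto simp: T_def tr_def)
      then have "(\<lambda>i. Y i \<omega> - T i \<omega>) \<longlonglongrightarrow> 0" by (rule tendsto_eventually)
      from filterlim_compose[OF cesaro_mean[OF this] klim]
      have s3: "(\<lambda>m. (\<Sum>i<k m. Y i \<omega> - T i \<omega>) / real (k m)) \<longlonglongrightarrow> 0" .
      \<comment> \<open>Centred truncated sum, mean of the truncated variables, and truncation
        error, averaged over the same block: only the middle one has a nonzero limit.\<close>
      have "(\<lambda>m. S (k m) \<omega> / real (k m) + (\<Sum>i<k m. expectation (T i)) / real (k m) + (\<Sum>i<k m. Y i \<omega> - T i \<omega>) / real (k m)) \<longlonglongrightarrow> 0 + \<mu> + 0"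
        by (intro tendsto_add s1 s2 s3)
      also have "(\<lambda>m. S (k m) \<omega> / real (k m) + (\<Sum>i<k m. expectation (T i)) / real (k m) + (\<Sum>i<k m. Y i \<omega> - T i \<omega>) / real (k m))
          = (\<lambda>m. (\<Sum>i<k m. Y i \<omega>) / real (k m))"
        by (simp add: S_def c_def sum_subtractf add_divide_distrib[symmetric])
      finally show "(\<lambda>m. (\<Sum>i<nat \<lfloor>(1 + 1 / real r) ^ m\<rfloor>. Y i \<omega>) / real (nat \<lfloor>(1 + 1 / real r) ^ m\<rfloor>)) \<longlonglongrightarrow> \<mu>"
        by (simp add: k_def)
    qed
  qed
qed

text \<open>Applied to positive and negative parts separately; pairwise independence and equality of
  laws pass to both.\<close>

theorem slln:
  fixes Y :: "nat \<Rightarrow> 'a \<Rightarrow> real"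
  assumes meas: "\<And>k. random_variable borel (Y k)"
    and indep: "\<And>k m. k \<noteq> m \<Longrightarrow> indep_var borel (Y k) borel (Y m)"
    and ident: "\<And>k. distr M borel (Y k) = distr M borel (Y 0)"
    and int: "integrable M (Y 0)"
  shows "AE \<omega> in M. (\<lambda>n. (\<Sum>k<n. Y k \<omega>) / real n) \<longlonglongrightarrow> expectation (Y 0)"
proof -
  note [measurable] = meas
  have *: "AE \<omega> in M. (\<lambda>n. (\<Sum>k<n. f (Y k \<omega>)) / real n) \<longlonglongrightarrow> expectation (\<lambda>\<omega>. f (Y 0 \<omega>))"
    if f [measurable]: "f \<in> borel_measurable borel" and "\<And>y. 0 \<le> f y" and le: "\<And>y. f y \<le> \<bar>y\<bar>" for f :: "real \<Rightarrow> real"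
  proof (rule slln_nonneg)
    show "indep_var borel (\<lambda>\<omega>. f (Y k \<omega>)) borel (\<lambda>\<omega>. f (Y m \<omega>))" if "k \<noteq> m" for k m
      using indep_var_compose[OF indep[OF that] f f] by (simp add: comp_def)
    show "distr M borel (\<lambda>\<omega>. f (Y k \<omega>)) = distr M borel (\<lambda>\<omega>. f (Y 0 \<omega>))" for k
      using distr_distr[of f borel borel "Y k" M] distr_distr[of f borel borel "Y 0" M] ident[of k]
      by (simp add: comp_def)
    show "integrable M (\<lambda>\<omega>. f (Y 0 \<omega>))"
      using that by (intro Bochner_Integration.integrable_bound[OF int]) auto
  qed (use that in auto)
  have "AE \<omega> in M. (\<lambda>n. (\<Sum>k<n. max 0 (Y k \<omega>)) / real n) \<longlonglongrightarrow> expectation (\<lambda>\<omega>. max 0 (Y 0 \<omega>))"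
    by (rule *) auto
  moreover have "AE \<omega> in M. (\<lambda>n. (\<Sum>k<n. max 0 (- Y k \<omega>)) / real n) \<longlonglongrightarrow> expectation (\<lambda>\<omega>. max 0 (- Y 0 \<omega>))"
    by (rule *) auto
  ultimately show ?thesis
  proof eventually_elim
    case (elim \<omega>)
    have mm: "max 0 y - max 0 (- y) = y" for y :: real by auto
    have "expectation (\<lambda>\<omega>. max 0 (Y 0 \<omega>)) - expectation (\<lambda>\<omega>. max 0 (- Y 0 \<omega>)) = expectation (Y 0)"
      using int by (subst Bochner_Integration.integral_diff[symmetric])
        (auto simp: mm intro!: Bochner_Integration.integrable_bound[OF int])
    moreover have "(\<lambda>n. (\<Sum>k<n. max 0 (Y k \<omega>)) / real n - (\<Sum>k<n. max 0 (- Y k \<omega>)) / real n) = (\<lambda>n. (\<Sum>k<n. Y k \<omega>) / real n)"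
      by (simp only: diff_divide_distrib[symmetric] sum_subtractf[symmetric] mm)
    ultimately show ?case using tendsto_diff[OF elim] by simp
  qed
qed

end

section \<open>The norm of a Gaussian matrix\<close>

text \<open>The linear term is kept exactly, so that it disappears in expectation for centred
  variables.\<close>

lemma exp_le_quadratic: "exp y \<le> 1 + y + y\<^sup>2 * exp \<bar>y\<bar>" for y :: real
proof -
  have "(1 - y) * exp y \<le> exp (- y) * exp y" using exp_ge_add_one_self[of "- y"] by (intro mult_right_mono) auto
  then have 1: "exp y - 1 - y \<le> y * (exp y - 1)" by (simp add: exp_minus algebra_simps)
  have "y * (exp y - 1) \<le> y\<^sup>2 * exp \<bar>y\<bar>"
  proof (cases "y \<ge> 0")
    case True
    have "exp y - 1 \<le> y * exp y" using \<open>(1 - y) * exp y \<le> exp (- y) * exp y\<close> by (simp add: exp_minus algebra_simps)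
    then have "y * (exp y - 1) \<le> y * (y * exp y)" using True by (rule mult_left_mono)
    then show ?thesis using True by (simp add: power2_eq_square mult.assoc)
  next
    case False
    have "1 - exp y \<le> - y" using exp_ge_add_one_self[of y] by linarith
    then have "(- y) * (1 - exp y) \<le> (- y) * (- y)"
      using False by (intro mult_left_mono) auto
    then have "y * (exp y - 1) \<le> y\<^sup>2 * 1" by (simp add: power2_eq_square algebra_simps)
    also have "\<dots> \<le> y\<^sup>2 * exp \<bar>y\<bar>" by (intro mult_left_mono) auto
    finally show ?thesis .
  qed
  then show ?thesis using 1 by linarith
qed

lemma square_le_exp: "t\<^sup>2 \<le> 2 * exp t" if "t \<ge> 0" for t :: real
proof -
  have "(\<Sum>n\<in>{2}. t ^ n /\<^sub>R fact n) \<le> exp t"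
    unfolding exp_def using that by (intro sum_le_suminf summable_exp_generic) auto
  then show ?thesis by (simp add: field_simps)
qed

context prob_space begin

text \<open>For \<open>|\<theta>| \<le> \<theta>1 / 2\<close>, half of the available exponent pays
  for \<open>exp |\<theta> x|\<close> and the other half for \<open>x^2\<close>. The constant is
  \<open>8 = 4 * 2\<close>, from \<open>x^2 = 4 / \<theta>1^2 * (\<theta>1 |x| / 2)^2\<close> and
  \<open>t^2 \<le> 2 exp t\<close>.\<close>

lemma mgf_le:
  fixes X :: "'a \<Rightarrow> real"
  assumes X [measurable]: "random_variable borel X" and mean: "expectation X = 0"
    and \<theta>1: "\<theta>1 > 0" and int: "integrable M (\<lambda>\<omega>. exp (\<theta>1 * \<bar>X \<omega>\<bar>))"
    and A: "expectation (\<lambda>\<omega>. exp (\<theta>1 * \<bar>X \<omega>\<bar>)) \<le> A" and \<theta>: "\<bar>\<theta>\<bar> \<le> \<theta>1 / 2"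
  shows "integrable M (\<lambda>\<omega>. exp (\<theta> * X \<omega>))" "expectation (\<lambda>\<omega>. exp (\<theta> * X \<omega>)) \<le> exp (8 * A / \<theta>1\<^sup>2 * \<theta>\<^sup>2)"
proof -
  have le1: "exp (\<theta> * x) \<le> exp (\<theta>1 * \<bar>x\<bar>)" for x
  proof -
    have "\<theta> * x \<le> \<bar>\<theta>\<bar> * \<bar>x\<bar>" by (simp add: abs_mult[symmetric])
    also have "\<dots> \<le> \<theta>1 * \<bar>x\<bar>" using \<theta> \<theta>1 by (intro mult_right_mono) auto
    finally show ?thesis by simp
  qed
  show i: "integrable M (\<lambda>\<omega>. exp (\<theta> * X \<omega>))"
    using le1 by (intro Bochner_Integration.integrable_bound[OF int]) auto
  have lin: "\<bar>x\<bar> \<le> exp (\<theta>1 * \<bar>x\<bar>) / \<theta>1" for x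
  proof -
    have "\<theta>1 * \<bar>x\<bar> \<le> exp (\<theta>1 * \<bar>x\<bar>)" using exp_ge_add_one_self[of "\<theta>1 * \<bar>x\<bar>"] by linarith
    then show ?thesis using \<theta>1 by (simp add: pos_le_divide_eq mult.commute)
  qed
  have iX: "integrable M X"
    using lin \<theta>1 by (intro Bochner_Integration.integrable_bound[OF integrable_divide[OF int, of \<theta>1]]) auto
  have pt: "exp (\<theta> * x) \<le> 1 + \<theta> * x + 8 / \<theta>1\<^sup>2 * \<theta>\<^sup>2 * exp (\<theta>1 * \<bar>x\<bar>)" for x
  proof -
    have "x\<^sup>2 = 4 / \<theta>1\<^sup>2 * (\<theta>1 / 2 * \<bar>x\<bar>)\<^sup>2" using \<theta>1 by (simp add: power_mult_distrib power_divide)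
    also have "\<dots> \<le> 4 / \<theta>1\<^sup>2 * (2 * exp (\<theta>1 / 2 * \<bar>x\<bar>))"
      using \<theta>1 by (intro mult_left_mono square_le_exp) auto
    finally have x2: "x\<^sup>2 \<le> 8 / \<theta>1\<^sup>2 * exp (\<theta>1 / 2 * \<bar>x\<bar>)" by simp
    have "\<bar>\<theta> * x\<bar> \<le> \<theta>1 / 2 * \<bar>x\<bar>"
      unfolding abs_mult by (rule mult_right_mono[OF \<theta>]) simp
    then have "(\<theta> * x)\<^sup>2 * exp \<bar>\<theta> * x\<bar> \<le> (\<theta>\<^sup>2 * (8 / \<theta>1\<^sup>2 * exp (\<theta>1 / 2 * \<bar>x\<bar>))) * exp (\<theta>1 / 2 * \<bar>x\<bar>)"
      unfolding power_mult_distrib using x2 by (intro mult_mono mult_left_mono) auto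
    also have "\<dots> = 8 / \<theta>1\<^sup>2 * \<theta>\<^sup>2 * exp (\<theta>1 * \<bar>x\<bar>)"
      by (simp add: mult_ac exp_add[symmetric])
    finally show ?thesis using exp_le_quadratic[of "\<theta> * x"] by linarith
  qed
  have "expectation (\<lambda>\<omega>. exp (\<theta> * X \<omega>)) \<le> expectation (\<lambda>\<omega>. 1 + \<theta> * X \<omega> + 8 / \<theta>1\<^sup>2 * \<theta>\<^sup>2 * exp (\<theta>1 * \<bar>X \<omega>\<bar>))"
    using pt iX int by (intro integral_mono i) auto
  also have "\<dots> = 1 + 8 / \<theta>1\<^sup>2 * \<theta>\<^sup>2 * expectation (\<lambda>\<omega>. exp (\<theta>1 * \<bar>X \<omega>\<bar>))"
    using iX int mean by (simp add: prob_space)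
  also have "\<dots> \<le> 1 + 8 / \<theta>1\<^sup>2 * \<theta>\<^sup>2 * A" using A by (intro add_mono mult_left_mono) auto
  also have "\<dots> \<le> exp (8 * A / \<theta>1\<^sup>2 * \<theta>\<^sup>2)"
    using exp_ge_add_one_self[of "8 * A / \<theta>1\<^sup>2 * \<theta>\<^sup>2"] by (simp add: mult_ac)
  finally show "expectation (\<lambda>\<omega>. exp (\<theta> * X \<omega>)) \<le> exp (8 * A / \<theta>1\<^sup>2 * \<theta>\<^sup>2)" .
qed

text \<open>Chernoff's method with \<open>\<theta> = \<plusminus>1 / sqrt n\<close>. The exponential
  moment of the whole sum then stays below a constant, while the threshold \<open>n^(3/4)\<close>
  contributes \<open>- n^(1/4)\<close>: a stretched exponential that beats any polynomial number of
  events. The lower bound on \<open>sqrt n\<close> puts \<open>\<theta>\<close> into the range where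
  \<open>mgf_le\<close> applies.\<close>

lemma sum_tail_bound:
  fixes X :: "nat \<Rightarrow> 'a \<Rightarrow> real"
  assumes ind: "indep_vars (\<lambda>_. borel) X {..<n}" and mean: "\<And>c. c < n \<Longrightarrow> expectation (X c) = 0"
    and \<theta>1: "\<theta>1 > 0" and int: "\<And>c. c < n \<Longrightarrow> integrable M (\<lambda>\<omega>. exp (\<theta>1 * \<bar>X c \<omega>\<bar>))"
    and A: "\<And>c. c < n \<Longrightarrow> expectation (\<lambda>\<omega>. exp (\<theta>1 * \<bar>X c \<omega>\<bar>)) \<le> A"
    and n: "n \<ge> 1" "sqrt (real n) \<ge> 2 / \<theta>1"
  shows "prob {\<omega> \<in> space M. real n powr (3/4) \<le> \<bar>\<Sum>c<n. X c \<omega>\<bar>} \<le> 2 * exp (8 * A / \<theta>1\<^sup>2 - real n powr (1/4))"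
proof -
  have X [measurable]: "random_variable borel (X c)" if "c < n" for c
    using ind that by (simp add: indep_vars_def2)
  have one: "prob {\<omega> \<in> space M. real n powr (3/4) \<le> s * (\<Sum>c<n. X c \<omega>)} \<le> exp (8 * A / \<theta>1\<^sup>2 - real n powr (1/4))"
    if s: "s = 1 \<or> s = -1" for s :: real
  proof -
    define \<theta> where "\<theta> = s / sqrt (real n)"
    have \<theta>: "\<bar>\<theta>\<bar> \<le> \<theta>1 / 2" "\<theta>\<^sup>2 = 1 / real n"
      using s n \<theta>1 by (auto simp: \<theta>_def power_divide field_simps)
    have ind': "indep_vars (\<lambda>_. borel) (\<lambda>c \<omega>. exp (\<theta> * X c \<omega>)) {..<n}"
      by (rule indep_vars_compose2[OF ind]) simp
    note mgf = mgf_le[OF X mean \<theta>1 int A \<theta>(1)]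
    have eprod: "exp (\<theta> * (\<Sum>c<n. X c \<omega>)) = (\<Prod>c<n. exp (\<theta> * X c \<omega>))" for \<omega>
      by (simp add: sum_distrib_left exp_sum)
    have pint: "integrable M (\<lambda>\<omega>. exp (\<theta> * (\<Sum>c<n. X c \<omega>)))"
      unfolding eprod using mgf by (intro indep_vars_integrable[OF _ ind']) auto
    have "expectation (\<lambda>\<omega>. exp (\<theta> * (\<Sum>c<n. X c \<omega>))) = (\<Prod>c<n. expectation (\<lambda>\<omega>. exp (\<theta> * X c \<omega>)))"
      unfolding eprod using mgf by (intro indep_vars_lebesgue_integral[OF _ ind']) auto
    also have "\<dots> \<le> (\<Prod>c<n. exp (8 * A / \<theta>1\<^sup>2 * \<theta>\<^sup>2))"
      using mgf by (intro prod_mono conjI integral_nonneg_AE) auto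
    also have "\<dots> = exp (8 * A / \<theta>1\<^sup>2)"
      using n by (simp add: \<theta>(2) exp_of_nat_mult[symmetric])
    finally have E: "expectation (\<lambda>\<omega>. exp (\<theta> * (\<Sum>c<n. X c \<omega>))) \<le> exp (8 * A / \<theta>1\<^sup>2)" .
    have "prob {\<omega> \<in> space M. real n powr (3/4) \<le> s * (\<Sum>c<n. X c \<omega>)}
      \<le> prob {\<omega> \<in> space M. exp (real n powr (1/4)) \<le> exp (\<theta> * (\<Sum>c<n. X c \<omega>))}"
    proof (intro finite_measure_mono)
      have "real n powr (3/4) / sqrt (real n) = real n powr (1/4)"
        using n by (simp add: powr_half_sqrt[symmetric] powr_diff[symmetric])
      then have "real n powr (1/4) \<le> \<theta> * t" if "real n powr (3/4) \<le> s * t" for t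
        using divide_right_mono[OF that, of "sqrt (real n)"] by (simp add: \<theta>_def)
      then show "{\<omega> \<in> space M. real n powr (3/4) \<le> s * (\<Sum>c<n. X c \<omega>)}
        \<subseteq> {\<omega> \<in> space M. exp (real n powr (1/4)) \<le> exp (\<theta> * (\<Sum>c<n. X c \<omega>))}" by auto
    qed measurable
    also have "\<dots> \<le> expectation (\<lambda>\<omega>. exp (\<theta> * (\<Sum>c<n. X c \<omega>))) / exp (real n powr (1/4))"
      by (rule integral_Markov_inequality_measure[OF pint, of "{}"]) auto
    also have "\<dots> \<le> exp (8 * A / \<theta>1\<^sup>2) / exp (real n powr (1/4))"
      using E by (intro divide_right_mono) auto
    finally show ?thesis by (simp add: exp_diff)
  qed
  have "prob {\<omega> \<in> space M. real n powr (3/4) \<le> \<bar>\<Sum>c<n. X c \<omega>\<bar>}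
    \<le> prob ({\<omega> \<in> space M. real n powr (3/4) \<le> 1 * (\<Sum>c<n. X c \<omega>)} \<union> {\<omega> \<in> space M. real n powr (3/4) \<le> -1 * (\<Sum>c<n. X c \<omega>)})"
    by (intro finite_measure_mono) (auto simp: abs_if split: if_splits)
  also have "\<dots> \<le> prob {\<omega> \<in> space M. real n powr (3/4) \<le> 1 * (\<Sum>c<n. X c \<omega>)} + prob {\<omega> \<in> space M. real n powr (3/4) \<le> -1 * (\<Sum>c<n. X c \<omega>)}"
    by (intro measure_Un_le) measurable
  also have "\<dots> \<le> 2 * exp (8 * A / \<theta>1\<^sup>2 - real n powr (1/4))" using one[of 1] one[of "-1"] by simp
  finally show ?thesis .
qed

text \<open>A product of two Gaussian entries is bounded by the mean of their squared moduli, so at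
  \<open>\<theta>1 = 1 / (2 v)\<close> the exponential moment is at most \<open>2 + 2 = 4\<close>.
  This explains the constants: \<open>128 v^2 = 8 * 4 / \<theta>1^2\<close>, and
  \<open>n \<ge> 16 v^2\<close> is \<open>sqrt n \<ge> 2 / \<theta>1\<close>. The parameter
  \<open>pr\<close> makes the tail bound for real sums applicable.\<close>

lemma gram_entry_tail:
  fixes \<zeta> :: "nat \<Rightarrow> nat \<Rightarrow> 'a \<Rightarrow> complex" and v :: real and pr :: "complex \<Rightarrow> real"
  assumes ind: "indep_vars (\<lambda>_. borel) (\<lambda>(i, c). \<zeta> i c) ({..<m} \<times> {..<n})" and v: "v > 0"
    and dist: "\<And>i c. i < m \<Longrightarrow> c < n \<Longrightarrow> distributed M lborel (\<zeta> i c) (CN_density v)"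
    and i: "i < m" "i' < m" and n: "n \<ge> 1" "real n \<ge> 16 * v\<^sup>2"
    and pr: "pr = Re \<or> pr = Im"
  shows "prob {\<omega> \<in> space M. real n powr (3/4) \<le> \<bar>pr ((\<Sum>c<n. \<zeta> i c \<omega> * cnj (\<zeta> i' c \<omega>)) - (if i = i' then complex_of_real (real n * v) else 0))\<bar>}
    \<le> 2 * exp (128 * v\<^sup>2 - real n powr (1/4))"
proof -
  define \<mu> where "\<mu> = (if i = i' then pr (complex_of_real v) else 0)"
  define X where "X c \<omega> = pr (\<zeta> i c \<omega> * cnj (\<zeta> i' c \<omega>)) - \<mu>" for c \<omega>
  have mom: "all_moments M (\<zeta> k c)" if "k < m" "c < n" for k c by (rule CN_all_moments[OF dist[OF that] v])
  have partmeas [measurable]: "pr \<in> borel_measurable borel" using pr by auto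
  have cnjmeas [measurable]: "cnj \<in> borel_measurable borel"
    by (intro borel_measurable_continuous_onI continuous_intros)
  have lin: "pr (a + b) = pr a + pr b" "pr (a - b) = pr a - pr b" "pr 0 = 0"
     "pr (\<Sum>c<n. f c) = (\<Sum>c<n. pr (f c))" "\<bar>pr a\<bar> \<le> cmod a" for a b f
    using pr by (auto simp: abs_Re_le_cmod abs_Im_le_cmod)
  \<comment> \<open>Different columns use disjoint sets of entries, so the summands are independent
    over \<open>c\<close>, also on the diagonal where \<open>i = i'\<close>.\<close>
  have "indep_vars (\<lambda>c. PiM {(i, c), (i', c)} (\<lambda>_. borel)) (\<lambda>c \<omega>. \<lambda>p\<in>{(i, c), (i', c)}. (case p of (i, c) \<Rightarrow> \<zeta> i c) \<omega>) {..<n}"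
    using i by (intro indep_vars_restrict[OF ind]) (auto simp: disjoint_family_on_def)
  from indep_vars_compose2[OF this, of "\<lambda>c p. pr (p (i, c) * cnj (p (i', c))) - \<mu>" "\<lambda>_. borel"]
  have indX: "indep_vars (\<lambda>_. borel) X {..<n}"
    by (simp add: X_def[abs_def])
  have b\<mu>: "\<bar>\<mu>\<bar> \<le> v" using pr v by (auto simp: \<mu>_def)
  have Xle: "\<bar>X c \<omega>\<bar> \<le> ((cmod (\<zeta> i c \<omega>))\<^sup>2 + (cmod (\<zeta> i' c \<omega>))\<^sup>2) / 2 + v" for c \<omega>
  proof -
    have "\<bar>X c \<omega>\<bar> \<le> \<bar>pr (\<zeta> i c \<omega> * cnj (\<zeta> i' c \<omega>))\<bar> + \<bar>\<mu>\<bar>" unfolding X_def by (rule abs_triangle_ineq4)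
    also have "\<dots> \<le> cmod (\<zeta> i c \<omega>) * cmod (\<zeta> i' c \<omega>) + v"
      using lin(5)[of "\<zeta> i c \<omega> * cnj (\<zeta> i' c \<omega>)"] b\<mu> by (simp add: norm_mult)
    also have "\<dots> \<le> ((cmod (\<zeta> i c \<omega>))\<^sup>2 + (cmod (\<zeta> i' c \<omega>))\<^sup>2) / 2 + v"
      using sum_squares_bound[of "cmod (\<zeta> i c \<omega>)" "cmod (\<zeta> i' c \<omega>)"] by simp
    finally show ?thesis .
  qed
  define \<theta>1 where "\<theta>1 = 1 / (2 * v)"
  have \<theta>1: "\<theta>1 > 0" "\<theta>1 < 1 / v" "\<theta>1 * v = 1 / 2" using v by (simp_all add: \<theta>1_def field_simps)
  have ptle: "exp (\<theta>1 * \<bar>X c \<omega>\<bar>) \<le> exp (\<theta>1 * (cmod (\<zeta> i c \<omega>))\<^sup>2) + exp (\<theta>1 * (cmod (\<zeta> i' c \<omega>))\<^sup>2)" for c \<omega>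
  proof -
    define a b where "a = \<theta>1 * (cmod (\<zeta> i c \<omega>))\<^sup>2" and "b = \<theta>1 * (cmod (\<zeta> i' c \<omega>))\<^sup>2"
    have "\<theta>1 * \<bar>X c \<omega>\<bar> \<le> \<theta>1 * (((cmod (\<zeta> i c \<omega>))\<^sup>2 + (cmod (\<zeta> i' c \<omega>))\<^sup>2) / 2 + v)"
      using \<theta>1 by (intro mult_left_mono Xle) auto
    also have "\<dots> = a / 2 + b / 2 + 1 / 2" using \<theta>1 by (simp add: a_def b_def field_simps)
    finally have "exp (\<theta>1 * \<bar>X c \<omega>\<bar>) \<le> exp (a / 2 + b / 2 + 1 / 2)" by simp
    also have "\<dots> = exp (1 / 2) * (exp (a / 2) * exp (b / 2))" by (simp add: exp_add)
    also have "\<dots> \<le> 2 * (((exp (a / 2))\<^sup>2 + (exp (b / 2))\<^sup>2) / 2)"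
    proof (intro mult_mono)
      have "(exp (1 / 2 :: real))\<^sup>2 \<le> 2\<^sup>2" using exp_le by (simp add: exp_double[symmetric])
      then show "exp (1 / 2 :: real) \<le> 2" by (rule power2_le_imp_le) simp
      show "exp (a / 2) * exp (b / 2) \<le> ((exp (a / 2))\<^sup>2 + (exp (b / 2))\<^sup>2) / 2"
        using sum_squares_bound[of "exp (a / 2)" "exp (b / 2)"] by simp
    qed auto
    also have "\<dots> = exp a + exp b" by (simp add: exp_double[symmetric])
    finally show ?thesis by (simp add: a_def b_def)
  qed
  have eint: "integrable M (\<lambda>\<omega>. exp (\<theta>1 * (cmod (\<zeta> k c \<omega>))\<^sup>2))"
    and eexp: "expectation (\<lambda>\<omega>. exp (\<theta>1 * (cmod (\<zeta> k c \<omega>))\<^sup>2)) = 2" if "k < m" "c < n" for k c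
    using CN_exp_expectation[OF dist[OF that] v \<theta>1(2)] \<theta>1(3) by simp_all
  have Xmeas: "random_variable borel (X c)" if "c < n" for c
    using indX that by (simp add: indep_vars_def2)
  have Xint: "integrable M (\<lambda>\<omega>. exp (\<theta>1 * \<bar>X c \<omega>\<bar>))" if c: "c < n" for c
  proof (rule Bochner_Integration.integrable_bound)
    show "integrable M (\<lambda>\<omega>. exp (\<theta>1 * (cmod (\<zeta> i c \<omega>))\<^sup>2) + exp (\<theta>1 * (cmod (\<zeta> i' c \<omega>))\<^sup>2))"
      using eint i c by auto
    show "(\<lambda>\<omega>. exp (\<theta>1 * \<bar>X c \<omega>\<bar>)) \<in> borel_measurable M" using Xmeas[OF c] by measurable
  qed (use ptle in \<open>auto intro!: AE_I2\<close>)
  have Xexp: "expectation (\<lambda>\<omega>. exp (\<theta>1 * \<bar>X c \<omega>\<bar>)) \<le> 4" if c: "c < n" for c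
  proof -
    have "expectation (\<lambda>\<omega>. exp (\<theta>1 * \<bar>X c \<omega>\<bar>)) \<le> expectation (\<lambda>\<omega>. exp (\<theta>1 * (cmod (\<zeta> i c \<omega>))\<^sup>2) + exp (\<theta>1 * (cmod (\<zeta> i' c \<omega>))\<^sup>2))"
      using eint i c Xint by (intro integral_mono ptle) auto
    also have "\<dots> = 4" using eint eexp i c by simp
    finally show ?thesis .
  qed
  have Xmean: "expectation (X c) = 0" if c: "c < n" for c
  proof -
    have pm: "all_moments M (\<lambda>\<omega>. \<zeta> i c \<omega> * cnj (\<zeta> i' c \<omega>))"
      by (intro all_moments_intros mom i c)
    have E: "expectation (\<lambda>\<omega>. \<zeta> i c \<omega> * cnj (\<zeta> i' c \<omega>)) = (if i = i' then complex_of_real v else 0)"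
    proof (cases "i = i'")
      case True
      have "expectation (\<lambda>\<omega>. \<zeta> i c \<omega> * cnj (\<zeta> i' c \<omega>)) = expectation (\<lambda>\<omega>. complex_of_real ((cmod (\<zeta> i c \<omega>))\<^sup>2))"
        by (simp only: True complex_norm_square)
      also have "\<dots> = complex_of_real (expectation (\<lambda>\<omega>. (cmod (\<zeta> i c \<omega>))\<^sup>2))"
        by (rule integral_of_real[OF all_momentsD(2)[OF mom[OF i(1) c]]])
      finally show ?thesis using True CN_variance[OF dist[OF i(1) c] v] by simp
    next
      case False
      have "indep_var (PiM {(i, c)} (\<lambda>_. borel)) (\<lambda>\<omega>. \<lambda>p\<in>{(i, c)}. (case p of (i, c) \<Rightarrow> \<zeta> i c) \<omega>)
          (PiM {(i', c)} (\<lambda>_. borel)) (\<lambda>\<omega>. \<lambda>p\<in>{(i', c)}. (case p of (i, c) \<Rightarrow> \<zeta> i c) \<omega>)"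
        using i c False by (intro indep_var_restrict[OF ind]) auto
      from indep_var_compose[OF this, of "\<lambda>p. p (i, c)" borel "\<lambda>p. cnj (p (i', c))" borel]
      have "indep_var borel (\<zeta> i c) borel (\<lambda>\<omega>. cnj (\<zeta> i' c \<omega>))" by (simp add: comp_def)
      then have "expectation (\<lambda>\<omega>. \<zeta> i c \<omega> * cnj (\<zeta> i' c \<omega>)) = expectation (\<zeta> i c) * expectation (\<lambda>\<omega>. cnj (\<zeta> i' c \<omega>))"
        using i c by (intro indep_var_lebesgue_integral all_momentsD(3) all_moments_intros mom)
      then show ?thesis using False CN_mean[OF dist[OF i(1) c] v] by simp
    qed
    have "expectation (\<lambda>\<omega>. pr (\<zeta> i c \<omega> * cnj (\<zeta> i' c \<omega>))) = pr (expectation (\<lambda>\<omega>. \<zeta> i c \<omega> * cnj (\<zeta> i' c \<omega>)))"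
      using pr integral_Re[OF all_momentsD(3)[OF pm]] integral_Im[OF all_momentsD(3)[OF pm]] by auto
    also have "\<dots> = \<mu>" unfolding E \<mu>_def using lin by simp
    finally have "expectation (\<lambda>\<omega>. pr (\<zeta> i c \<omega> * cnj (\<zeta> i' c \<omega>))) = \<mu>" .
    moreover have "integrable M (\<lambda>\<omega>. pr (\<zeta> i c \<omega> * cnj (\<zeta> i' c \<omega>)))"
      using pr integrable_Re[OF all_momentsD(3)[OF pm]] integrable_Im[OF all_momentsD(3)[OF pm]] by auto
    ultimately show ?thesis unfolding X_def by (simp add: prob_space)
  qed
  have "4 * v \<le> sqrt (real n)" using n(2) v by (intro real_le_rsqrt) (simp add: power_mult_distrib)
  then have "prob {\<omega> \<in> space M. real n powr (3/4) \<le> \<bar>\<Sum>c<n. X c \<omega>\<bar>} \<le> 2 * exp (8 * 4 / \<theta>1\<^sup>2 - real n powr (1/4))"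
    using n v by (intro sum_tail_bound[OF indX Xmean \<theta>1(1) Xint Xexp]) (auto simp: \<theta>1_def)
  also have "8 * 4 / \<theta>1\<^sup>2 = 128 * v\<^sup>2" by (simp add: \<theta>1_def power_mult_distrib power_divide)
  also have "(\<lambda>\<omega>. \<Sum>c<n. X c \<omega>) = (\<lambda>\<omega>. pr ((\<Sum>c<n. \<zeta> i c \<omega> * cnj (\<zeta> i' c \<omega>)) - (if i = i' then complex_of_real (real n * v) else 0)))"
    using pr by (auto simp: X_def \<mu>_def lin sum_subtractf fun_eq_iff)
  finally show ?thesis .
qed

end

text \<open>The left side is the quadratic form of the Gram matrix. Its main part is
  \<open>n v\<close> times the identity. Each error entry is at most \<open>2 n^(3/4)\<close>, and
  the sum of the moduli \<open>|a i|\<close>, squared, costs a factor \<open>m\<close>: the estimate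
  is good only if \<open>m\<close> is the shorter side.\<close>

lemma gram_operator_bound:
  fixes z :: "nat \<Rightarrow> nat \<Rightarrow> complex" and v :: real
  assumes re: "\<And>i i'. i < m \<Longrightarrow> i' < m \<Longrightarrow> \<bar>Re ((\<Sum>c<n. z i c * cnj (z i' c)) - (if i = i' then complex_of_real (real n * v) else 0))\<bar> < real n powr (3/4)"
    and im: "\<And>i i'. i < m \<Longrightarrow> i' < m \<Longrightarrow> \<bar>Im ((\<Sum>c<n. z i c * cnj (z i' c)) - (if i = i' then complex_of_real (real n * v) else 0))\<bar> < real n powr (3/4)"
  shows "(\<Sum>c<n. (cmod (\<Sum>i<m. a i * z i c))\<^sup>2) \<le> (real n * v + 2 * real m * real n powr (3/4)) * (\<Sum>i<m. (cmod (a i))\<^sup>2)"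
proof -
  define E where "E i i' = (\<Sum>c<n. z i c * cnj (z i' c)) - (if i = i' then complex_of_real (real n * v) else 0)" for i i'
  have E: "cmod (E i i') \<le> 2 * real n powr (3/4)" if "i < m" "i' < m" for i i'
    using cmod_le[of "E i i'"] re[OF that] im[OF that] unfolding E_def by linarith
  have "complex_of_real (\<Sum>c<n. (cmod (\<Sum>i<m. a i * z i c))\<^sup>2) = (\<Sum>c<n. \<Sum>i<m. \<Sum>i'<m. a i * cnj (a i') * (z i c * cnj (z i' c)))"
    unfolding of_real_sum complex_norm_square cnj_sum sum_product by (simp add: mult_ac)
  also have "\<dots> = (\<Sum>i<m. \<Sum>c<n. \<Sum>i'<m. a i * cnj (a i') * (z i c * cnj (z i' c)))"
    by (rule sum.swap)
  also have "\<dots> = (\<Sum>i<m. \<Sum>i'<m. \<Sum>c<n. a i * cnj (a i') * (z i c * cnj (z i' c)))"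
    by (intro sum.cong refl sum.swap)
  also have "\<dots> = (\<Sum>i<m. \<Sum>i'<m. a i * cnj (a i') * (E i i' + (if i = i' then complex_of_real (real n * v) else 0)))"
    by (simp add: E_def sum_distrib_left)
  also have "\<dots> = (\<Sum>i<m. \<Sum>i'<m. a i * cnj (a i') * E i i') + (\<Sum>i<m. a i * cnj (a i) * complex_of_real (real n * v))"
    by (simp add: distrib_left sum.distrib if_distrib[of "\<lambda>x. _ * x"] cong: if_cong)
  also have "(\<Sum>i<m. a i * cnj (a i) * complex_of_real (real n * v)) = complex_of_real (real n * v * (\<Sum>i<m. (cmod (a i))\<^sup>2))"
    by (simp only: of_real_mult of_real_sum complex_norm_square sum_distrib_left mult_ac)
  finally have eq: "complex_of_real ((\<Sum>c<n. (cmod (\<Sum>i<m. a i * z i c))\<^sup>2) - real n * v * (\<Sum>i<m. (cmod (a i))\<^sup>2))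
     = (\<Sum>i<m. \<Sum>i'<m. a i * cnj (a i') * E i i')" by simp
  have "(\<Sum>c<n. (cmod (\<Sum>i<m. a i * z i c))\<^sup>2) - real n * v * (\<Sum>i<m. (cmod (a i))\<^sup>2)
     \<le> cmod (\<Sum>i<m. \<Sum>i'<m. a i * cnj (a i') * E i i')"
    unfolding eq[symmetric] norm_of_real by simp
  also have "\<dots> \<le> (\<Sum>i<m. \<Sum>i'<m. cmod (a i) * cmod (a i') * (2 * real n powr (3/4)))"
    using E by (intro order_trans[OF norm_sum] sum_mono) (auto simp: norm_mult intro!: mult_left_mono)
  also have "\<dots> = (\<Sum>i<m. cmod (a i))\<^sup>2 * (2 * real n powr (3/4))"
    unfolding power2_eq_square sum_product by (simp only: sum_distrib_right)
  also have "\<dots> \<le> (real m * (\<Sum>i<m. (cmod (a i))\<^sup>2)) * (2 * real n powr (3/4))"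
    using sum_squared_le_sum_of_squares[of "\<lambda>i. cmod (a i)" "{..<m}"]
    by (intro mult_right_mono) (simp_all add: mult.commute)
  finally show ?thesis by (simp add: algebra_simps)
qed

text \<open>A matrix and its transpose have the same operator norm: the assumed bound is applied to
  the conjugate of the output vector, and Cauchy-Schwarz leaves one factor \<open>q\<close> to
  cancel.\<close>

lemma operator_bound_transpose:
  fixes z :: "nat \<Rightarrow> nat \<Rightarrow> complex"
  assumes K: "0 \<le> K" and bd: "\<And>a. (\<Sum>c<n. (cmod (\<Sum>i<m. a i * z i c))\<^sup>2) \<le> K * (\<Sum>i<m. (cmod (a i))\<^sup>2)"
  shows "(\<Sum>i<m. (cmod (\<Sum>c<n. b c * z i c))\<^sup>2) \<le> K * (\<Sum>c<n. (cmod (b c))\<^sup>2)"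
proof -
  define S where "S i = (\<Sum>c<n. b c * z i c)" for i
  define q where "q = (\<Sum>i<m. (cmod (S i))\<^sup>2)"
  have q0: "0 \<le> q" by (simp add: q_def sum_nonneg)
  have "complex_of_real q = (\<Sum>i<m. cnj (S i) * (\<Sum>c<n. b c * z i c))"
    unfolding q_def of_real_sum complex_norm_square by (simp add: S_def mult.commute)
  also have "\<dots> = (\<Sum>c<n. b c * (\<Sum>i<m. cnj (S i) * z i c))"
    unfolding sum_distrib_left by (subst sum.swap) (simp add: mult_ac)
  finally have "q = cmod (\<Sum>c<n. b c * (\<Sum>i<m. cnj (S i) * z i c))" using q0 by (metis norm_of_real abs_of_nonneg)
  also have "\<dots> \<le> (\<Sum>c<n. cmod (b c) * cmod (\<Sum>i<m. cnj (S i) * z i c))"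
    by (rule order_trans[OF norm_sum]) (simp add: norm_mult)
  finally have "q\<^sup>2 \<le> (\<Sum>c<n. cmod (b c) * cmod (\<Sum>i<m. cnj (S i) * z i c))\<^sup>2"
    using q0 by (rule power_mono)
  also have "\<dots> \<le> (\<Sum>c<n. (cmod (b c))\<^sup>2) * (\<Sum>c<n. (cmod (\<Sum>i<m. cnj (S i) * z i c))\<^sup>2)"
    by (rule Cauchy_Schwarz_ineq_sum)
  also have "\<dots> \<le> (\<Sum>c<n. (cmod (b c))\<^sup>2) * (K * q)"
    using bd[of "\<lambda>i. cnj (S i)"] by (intro mult_left_mono) (auto simp: q_def sum_nonneg)
  finally have "q * q \<le> q * (K * (\<Sum>c<n. (cmod (b c))\<^sup>2))" by (simp add: power2_eq_square mult_ac)
  then have "q \<le> K * (\<Sum>c<n. (cmod (b c))\<^sup>2)" if "q \<noteq> 0" using that q0 by (simp add: mult_le_cancel_left)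
  moreover have "0 \<le> K * (\<Sum>c<n. (cmod (b c))\<^sup>2)" if "q = 0"
    using K by (simp add: sum_nonneg)
  ultimately show ?thesis unfolding q_def S_def by (cases "q = 0") (auto simp: q_def S_def)
qed


text \<open>Rows are taken along the shorter side. The operator bound is then
  \<open>max * v + 2 * min * max^(3/4)\<close>, which is \<open>m n\<close> times
  \<open>\<epsilon> m n\<close>, and \<open>\<epsilon>\<close> tends to 0 when both dimensions grow,
  in whatever proportion. The second inequality is the transposed one, since the noise acts from
  both sides.\<close>

theorem (in prob_space) gaussian_matrix_bound:
  fixes Z :: "nat \<Rightarrow> nat \<Rightarrow> nat \<Rightarrow> nat \<Rightarrow> 'a \<Rightarrow> complex" and v :: real
  assumes ind: "\<And>m n. m \<ge> 1 \<Longrightarrow> n \<ge> 1 \<Longrightarrow> indep_vars (\<lambda>_. borel) (\<lambda>(i, c). Z m n i c) ({..<m} \<times> {..<n})"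
    and dist: "\<And>m n i c. m \<ge> 1 \<Longrightarrow> n \<ge> 1 \<Longrightarrow> i < m \<Longrightarrow> c < n \<Longrightarrow> distributed M lborel (Z m n i c) (CN_density v)"
    and v: "v > 0"
  defines "\<epsilon> \<equiv> \<lambda>m n. v / real (min m n) + 2 * real (max m n) powr (-1/4)"
  shows "AE \<omega> in M. \<forall>\<^sub>F (m, n) in sequentially \<times>\<^sub>F sequentially.
    (\<forall>a. (\<Sum>c<n. (cmod (\<Sum>i<m. a i * Z m n i c \<omega>))\<^sup>2) \<le> real m * real n * \<epsilon> m n * (\<Sum>i<m. (cmod (a i))\<^sup>2)) \<and>
    (\<forall>b. (\<Sum>i<m. (cmod (\<Sum>c<n. b c * Z m n i c \<omega>))\<^sup>2) \<le> real m * real n * \<epsilon> m n * (\<Sum>c<n. (cmod (b c))\<^sup>2))"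
proof -
  \<comment> \<open>The matrix, transposed if necessary so that its row index runs over the shorter
    side.\<close>
  define W where "W m n i c = (if m \<le> n then Z m n i c else Z m n c i)" for m n i c
  have W_ind: "indep_vars (\<lambda>_. borel) (\<lambda>(i, c). W m n i c) ({..<min m n} \<times> {..<max m n})"
    if mn: "m \<ge> 1" "n \<ge> 1" for m n
  proof (cases "m \<le> n")
    case True
    then show ?thesis using ind[OF mn] by (simp add: W_def min_def max_def)
  next
    case False
    have "indep_vars (\<lambda>p. PiM {(snd p, fst p)} (\<lambda>_. borel))
        (\<lambda>p \<omega>. \<lambda>k\<in>{(snd p, fst p)}. (case k of (i, c) \<Rightarrow> Z m n i c) \<omega>) ({..<n} \<times> {..<m})"
      by (intro indep_vars_restrict[OF ind[OF mn]]) (auto simp: disjoint_family_on_def)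
    from indep_vars_compose2[OF this, of "\<lambda>p f. f (snd p, fst p)" "\<lambda>_. borel"]
    have "indep_vars (\<lambda>_. borel) (\<lambda>p. Z m n (snd p) (fst p)) ({..<n} \<times> {..<m})"
      by simp
    then show ?thesis using False by (simp add: W_def min_def max_def case_prod_unfold)
  qed
  have W_dist: "distributed M lborel (W m n i c) (CN_density v)"
    if "m \<ge> 1" "n \<ge> 1" "i < min m n" "c < max m n" for m n i c
    using that dist[of m n] unfolding W_def by (auto split: if_splits)
  define D where "D m n i i' \<omega> = (\<Sum>c<max m n. W m n i c \<omega> * cnj (W m n i' c \<omega>))
      - (if i = i' then complex_of_real (real (max m n) * v) else 0)" for m n i i' \<omega>
  define E where "E m n i i' pr = {\<omega> \<in> space M. real (max m n) powr (3/4) \<le> \<bar>pr (D m n i i' \<omega>)\<bar>}" for m n i i' and pr :: "complex \<Rightarrow> real"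
  define Bad where "Bad m n = (\<Union>i\<in>{..<min m n}. \<Union>i'\<in>{..<min m n}. \<Union>pr\<in>{Re, Im}.
      E m n i i' pr)" for m n
  have Wmeas: "W m n i c \<in> borel_measurable M" if "m \<ge> 1" "n \<ge> 1" "i < min m n" "c < max m n" for m n i c
    using distributed_measurable[OF W_dist[OF that]] by simp
  have Dmeas: "E m n i i' pr \<in> sets M"
    if "m \<ge> 1" "n \<ge> 1" "i < min m n" "i' < min m n" "pr \<in> {Re, Im}" for m n i i' and pr :: "complex \<Rightarrow> real"
  proof -
    have [measurable]: "cnj \<in> borel_measurable borel"
      by (intro borel_measurable_continuous_onI continuous_intros)
    have [measurable]: "D m n i i' \<in> borel_measurable M"
      unfolding D_def using Wmeas that by (intro borel_measurable_diff borel_measurable_sum borel_measurable_times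
        measurable_compose[OF Wmeas \<open>cnj \<in> borel_measurable borel\<close>]) auto
    have [measurable]: "pr \<in> borel_measurable borel" using that by auto
    show ?thesis unfolding E_def by measurable
  qed
  have Bad_meas: "Bad m n \<in> sets M" if "m \<ge> 1" "n \<ge> 1" for m n
    unfolding Bad_def using Dmeas[OF that] by (intro sets.finite_UN) auto
  define n0 where "n0 = nat \<lceil>16 * v\<^sup>2\<rceil>"
  have Bad_prob: "prob (Bad m n) \<le> 4 * (real (max m n))\<^sup>2 * exp (128 * v\<^sup>2 - real (max m n) powr (1/4))"
    if mn: "m \<ge> 1" "n \<ge> 1" and big: "max m n \<ge> n0" for m n
  proof -
    let ?e = "2 * exp (128 * v\<^sup>2 - real (max m n) powr (1/4))"
    have 1: "prob (E m n i i' pr) \<le> ?e"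
      if "i < min m n" "i' < min m n" "pr \<in> {Re, Im}" for i i' and pr :: "complex \<Rightarrow> real"
      unfolding E_def D_def
    proof (rule gram_entry_tail[OF W_ind[OF mn] v W_dist[OF mn]])
      have "real_of_int \<lceil>16 * v\<^sup>2\<rceil> \<le> real n0" unfolding n0_def by simp
      then have "16 * v\<^sup>2 \<le> real n0" by linarith
      then show "16 * v\<^sup>2 \<le> real (max m n)" using big by linarith
    qed (use that mn in auto)
    have "prob (Bad m n) \<le> (\<Sum>i<min m n. prob (\<Union>i'\<in>{..<min m n}. \<Union>pr\<in>{Re, Im}. E m n i i' pr))"
      unfolding Bad_def by (rule measure_UNION_le) (auto intro!: sets.finite_UN Dmeas[OF mn])
    also have "\<dots> \<le> (\<Sum>i<min m n. \<Sum>i'<min m n. prob (\<Union>pr\<in>{Re, Im}. E m n i i' pr))"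
      by (intro sum_mono measure_UNION_le) (auto intro!: sets.finite_UN Dmeas[OF mn])
    also have "\<dots> \<le> (\<Sum>i<min m n. \<Sum>i'<min m n. \<Sum>pr\<in>{Re, Im}. prob (E m n i i' pr))"
      by (intro sum_mono measure_UNION_le) (auto intro!: Dmeas[OF mn])
    also have "\<dots> \<le> (\<Sum>i<min m n. \<Sum>i'<min m n. \<Sum>pr\<in>{Re, Im}. ?e)"
      by (intro sum_mono 1) auto
    also have "\<dots> = (real (min m n))\<^sup>2 * (real (card {Re, Im}) * ?e)" by (simp add: power2_eq_square)
    also have "\<dots> \<le> (real (max m n))\<^sup>2 * (2 * ?e)"
      by (intro mult_mono power_mono) (auto simp: card_insert_if)
    finally show ?thesis by simp
  qed
  \<comment> \<open>All dimensions with maximum \<open>N\<close> are collected into one event.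
    Borel-Cantelli over the single index \<open>N\<close> then covers every pair of large dimensions
    simultaneously.\<close>
  define B where "B N = (\<Union>p\<in>{p\<in>{1..N} \<times> {1..N}. max (fst p) (snd p) = N}. Bad (fst p) (snd p))" for N
  have B_meas: "B N \<in> sets M" for N
    unfolding B_def by (intro sets.finite_UN Bad_meas) auto
  \<comment> \<open>The factor \<open>4 N^4\<close> counts at most \<open>N^2\<close> pairs,
    \<open>N^2\<close> Gram entries, two parts of a complex number and a two-sided tail.\<close>
  have B_prob: "prob (B N) \<le> 4 * real N ^ 4 * exp (128 * v\<^sup>2 - real N powr (1/4))" if "N \<ge> n0" for N
  proof -
    let ?S = "{p\<in>{1..N} \<times> {1..N}. max (fst p) (snd p) = N}"
    have "prob (B N) \<le> (\<Sum>p\<in>?S. prob (Bad (fst p) (snd p)))"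
      unfolding B_def by (rule measure_UNION_le) (auto intro!: Bad_meas)
    also have "\<dots> \<le> (\<Sum>p\<in>?S. 4 * (real N)\<^sup>2 * exp (128 * v\<^sup>2 - real N powr (1/4)))"
    proof (rule sum_mono)
      fix p assume p: "p \<in> ?S"
      then show "prob (Bad (fst p) (snd p)) \<le> 4 * (real N)\<^sup>2 * exp (128 * v\<^sup>2 - real N powr (1/4))"
        using Bad_prob[of "fst p" "snd p"] that by auto
    qed
    also have "\<dots> = real (card ?S) * (4 * (real N)\<^sup>2 * exp (128 * v\<^sup>2 - real N powr (1/4)))" by simp
    also have "\<dots> \<le> (real N)\<^sup>2 * (4 * (real N)\<^sup>2 * exp (128 * v\<^sup>2 - real N powr (1/4)))"
    proof (rule mult_right_mono)
      have "card ?S \<le> card ({1..N} \<times> {1..N})" by (rule card_mono) auto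
      also have "\<dots> = N * N" by (simp add: card_cartesian_product)
      finally have "real (card ?S) \<le> real (N * N)" by (simp only: of_nat_le_iff)
      then show "real (card ?S) \<le> (real N)\<^sup>2" by (simp add: power2_eq_square)
    qed simp
    finally show ?thesis by (simp add: power4_eq_xxxx power2_eq_square mult_ac)
  qed
  have "AE \<omega> in M. \<forall>\<^sub>F N in sequentially. \<omega> \<in> space M - B N"
  proof (rule borel_cantelli_AE1[OF B_meas])
    have "(\<lambda>N. 4 * real N ^ 4 * exp (128 * v\<^sup>2 - real N powr (1/4))) \<in> O(\<lambda>N. 1 / real N ^ 2)"
      by real_asymp
    then have "summable (\<lambda>N. 4 * real N ^ 4 * exp (128 * v\<^sup>2 - real N powr (1/4)))"
      by (rule summable_comparison_test_bigo[rotated]) (use inverse_power_summable[of 2, where ?'a = real] in \<open>simp add: inverse_eq_divide\<close>)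
    then show "summable (\<lambda>N. prob (B N))"
      using B_prob by (rule_tac summable_comparison_test_ev) (auto intro!: eventually_sequentiallyI[of n0])
  qed (simp add: less_top[symmetric])
  then show ?thesis
  proof eventually_elim
    case (elim \<omega>)
    then obtain N0 where N0: "\<And>N. N \<ge> N0 \<Longrightarrow> \<omega> \<in> space M - B N" by (auto simp: eventually_sequentially)
    have goal: "(\<forall>a. (\<Sum>c<n. (cmod (\<Sum>i<m. a i * Z m n i c \<omega>))\<^sup>2) \<le> real m * real n * \<epsilon> m n * (\<Sum>i<m. (cmod (a i))\<^sup>2)) \<and>
      (\<forall>b. (\<Sum>i<m. (cmod (\<Sum>c<n. b c * Z m n i c \<omega>))\<^sup>2) \<le> real m * real n * \<epsilon> m n * (\<Sum>c<n. (cmod (b c))\<^sup>2))"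
      if mn: "m \<ge> max 1 N0" "n \<ge> max 1 N0" for m n
    proof -
      have mn': "m \<ge> 1" "n \<ge> 1" "max m n \<ge> N0" using mn by auto
      have "\<omega> \<in> space M" "\<omega> \<notin> B (max m n)" using N0[OF mn'(3)] by auto
      then have notbad: "\<omega> \<notin> Bad m n" using mn' by (auto simp: B_def)
      have K: "real (max m n) * v + 2 * real (min m n) * real (max m n) powr (3/4) = real m * real n * \<epsilon> m n"
      proof -
        have "real (min m n) * real (max m n) = real m * real n" by (auto simp: min_def max_def)
        moreover have "real (max m n) * real (max m n) powr (-1/4) = real (max m n) powr (3/4)"
          using mn' powr_add[of "real (max m n)" 1 "-1/4"] by simp
        moreover have "real (min m n) > 0" using mn' by auto
        ultimately show ?thesis by (simp add: \<epsilon>_def flip: \<open>real (min m n) * real (max m n) = real m * real n\<close>)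
            (simp add: field_simps)
      qed
      have nonneg: "0 \<le> real m * real n * \<epsilon> m n" using v by (simp add: \<epsilon>_def)
      have row: "(\<Sum>c<max m n. (cmod (\<Sum>i<min m n. a i * W m n i c \<omega>))\<^sup>2) \<le> real m * real n * \<epsilon> m n * (\<Sum>i<min m n. (cmod (a i))\<^sup>2)" for a
        unfolding K[symmetric] using notbad \<open>\<omega> \<in> space M\<close>
        by (intro gram_operator_bound) (auto simp: Bad_def E_def D_def not_le)
      have col: "(\<Sum>i<min m n. (cmod (\<Sum>c<max m n. b c * W m n i c \<omega>))\<^sup>2) \<le> real m * real n * \<epsilon> m n * (\<Sum>c<max m n. (cmod (b c))\<^sup>2)" for b
        by (rule operator_bound_transpose[OF nonneg row])
      show ?thesis using row col by (cases "m \<le> n") (simp_all add: W_def min_def max_def)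
    qed
    show ?case unfolding eventually_prod_sequentially using goal by (intro exI[of _ "max 1 N0"]) auto
  qed
qed

section \<open>The principal eigenvector\<close>

text \<open>The scalar product of the first \<open>n\<close> values of two functions. Functions on
  all of \<open>nat\<close> take the place of vectors because the dimension varies along the filter;
  no carrier conditions arise in the asymptotic argument.\<close>

definition ip :: "nat \<Rightarrow> (nat \<Rightarrow> complex) \<Rightarrow> (nat \<Rightarrow> complex) \<Rightarrow> complex" where
  "ip n f g = (\<Sum>i<n. f i * cnj (g i))"

definition nrm :: "nat \<Rightarrow> (nat \<Rightarrow> complex) \<Rightarrow> real" where
  "nrm n f = L2_set (\<lambda>i. cmod (f i)) {..<n}"

lemma nrm_nonneg [simp]: "0 \<le> nrm n f"
  by (simp add: nrm_def)

lemma nrm_cong: "(\<And>i. i < n \<Longrightarrow> f i = g i) \<Longrightarrow> nrm n f = nrm n g"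
  unfolding nrm_def by (rule L2_set_cong) auto

lemma nrm_square: "(nrm n f)\<^sup>2 = (\<Sum>i<n. (cmod (f i))\<^sup>2)"
  by (simp add: nrm_def L2_set_def sum_nonneg)

lemma ip_self: "ip n f f = complex_of_real ((nrm n f)\<^sup>2)"
  unfolding nrm_square of_real_sum complex_norm_square by (simp add: ip_def)

lemma nrm_add: "nrm n (\<lambda>i. f i + g i) \<le> nrm n f + nrm n g"
  unfolding nrm_def
  by (rule order_trans[OF L2_set_mono L2_set_triangle_ineq]) (auto intro: norm_triangle_ineq)

lemma nrm_scale: "nrm n (\<lambda>i. c * f i) = cmod c * nrm n f"
  by (simp add: nrm_def norm_mult L2_set_right_distrib)

lemma nrm_cnj: "nrm n (\<lambda>i. cnj (f i)) = nrm n f"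
  by (simp add: nrm_def)

lemma nrm_sum: "nrm n (\<lambda>i. \<Sum>l\<in>I. f l i) \<le> (\<Sum>l\<in>I. nrm n (f l))"
proof (induction I rule: infinite_finite_induct)
  case (insert l I)
  then show ?case using nrm_add[of n "f l" "\<lambda>i. \<Sum>l\<in>I. f l i"] by simp
qed (simp_all add: nrm_def L2_set_def)

lemma nrm_diff_le: "\<bar>nrm n f - nrm n g\<bar> \<le> nrm n (\<lambda>i. f i - g i)"
proof -
  have "nrm n f \<le> nrm n (\<lambda>i. f i - g i) + nrm n g" using nrm_add[of n "\<lambda>i. f i - g i" g] by simp
  moreover have "nrm n g \<le> nrm n (\<lambda>i. f i - g i) + nrm n f"
    using nrm_add[of n "\<lambda>i. (-1) * (f i - g i)" f] nrm_scale[of n "-1" "\<lambda>i. f i - g i"] by simp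
  ultimately show ?thesis by linarith
qed

lemma ip_le: "cmod (ip n f g) \<le> nrm n f * nrm n g"
proof -
  have "cmod (ip n f g) \<le> (\<Sum>i<n. cmod (f i) * cmod (g i))"
    unfolding ip_def by (rule order_trans[OF norm_sum]) (simp add: norm_mult)
  also have "\<dots> \<le> nrm n f * nrm n g"
    unfolding nrm_def using L2_set_mult_ineq[of "\<lambda>i. cmod (f i)" "\<lambda>i. cmod (g i)" "{..<n}"] by simp
  finally show ?thesis .
qed

lemma ip_linear:
  "ip n (\<lambda>i. f i + f' i) g = ip n f g + ip n f' g" "ip n g (\<lambda>i. f i + f' i) = ip n g f + ip n g f'"
  "ip n (\<lambda>i. c * f i) g = c * ip n f g" "ip n g (\<lambda>i. c * f i) = cnj c * ip n g f"
  "ip n (\<lambda>i. \<Sum>l\<in>I. F l i) g = (\<Sum>l\<in>I. ip n (F l) g)" "ip n g (\<lambda>i. \<Sum>l\<in>I. F l i) = (\<Sum>l\<in>I. ip n g (F l))"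
proof -
  show "ip n (\<lambda>i. f i + f' i) g = ip n f g + ip n f' g" "ip n g (\<lambda>i. f i + f' i) = ip n g f + ip n g f'"
    "ip n (\<lambda>i. c * f i) g = c * ip n f g" "ip n g (\<lambda>i. c * f i) = cnj c * ip n g f"
    by (simp_all add: ip_def algebra_simps sum.distrib sum_distrib_left)
  show "ip n (\<lambda>i. \<Sum>l\<in>I. F l i) g = (\<Sum>l\<in>I. ip n (F l) g)"
    unfolding ip_def sum_distrib_right by (rule sum.swap)
  show "ip n g (\<lambda>i. \<Sum>l\<in>I. F l i) = (\<Sum>l\<in>I. ip n g (F l))"
    unfolding ip_def cnj_sum sum_distrib_left by (rule sum.swap)
qed

text \<open>The class \<open>O(1)\<close> along \<open>F\<close>. Several coefficients are only
  known to be bounded, and a bounded factor times a null one is null; this replaces limits that need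
  not exist.\<close>

definition ebdd :: "'t filter \<Rightarrow> ('t \<Rightarrow> 'b::real_normed_vector) \<Rightarrow> bool" where
  "ebdd F f \<longleftrightarrow> (\<exists>K. \<forall>\<^sub>F t in F. norm (f t) \<le> K)"

lemma ebdd_tendsto: "(f \<longlongrightarrow> l) F \<Longrightarrow> ebdd F f"
  unfolding ebdd_def
  by (drule tendsto_norm, drule order_tendstoD(2)[of _ "norm l" _ "norm l + 1"])
    (auto intro!: exI[of _ "norm l + 1"] elim: eventually_mono)

lemma ebdd_le: "ebdd F g \<Longrightarrow> \<forall>\<^sub>F t in F. norm (f t) \<le> norm (g t) \<Longrightarrow> ebdd F f"
  unfolding ebdd_def
proof (elim exE)
  fix K assume "\<forall>\<^sub>F t in F. norm (g t) \<le> K" "\<forall>\<^sub>F t in F. norm (f t) \<le> norm (g t)"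
  then have "\<forall>\<^sub>F t in F. norm (f t) \<le> K" by eventually_elim simp
  then show "\<exists>K. \<forall>\<^sub>F t in F. norm (f t) \<le> K" by blast
qed

lemma ebdd_const [simp]: "ebdd F (\<lambda>_. c)"
  by (rule ebdd_tendsto[OF tendsto_const])

lemma ebdd_mult: "ebdd F f \<Longrightarrow> ebdd F g \<Longrightarrow> ebdd F (\<lambda>t. f t * g t :: 'b::real_normed_algebra)"
  unfolding ebdd_def
proof (elim exE)
  fix K K' assume "\<forall>\<^sub>F t in F. norm (f t) \<le> K" "\<forall>\<^sub>F t in F. norm (g t) \<le> K'"
  then have "\<forall>\<^sub>F t in F. norm (f t * g t) \<le> K * K'"
  proof eventually_elim
    case (elim t)
    have "norm (f t * g t) \<le> norm (f t) * norm (g t)" by (rule norm_mult_ineq)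
    also have "\<dots> \<le> K * K'" using elim by (intro mult_mono) (auto intro: order_trans[OF norm_ge_zero])
    finally show ?case .
  qed
  then show "\<exists>K. \<forall>\<^sub>F t in F. norm (f t * g t) \<le> K" by blast
qed

lemma ebdd_add: "ebdd F f \<Longrightarrow> ebdd F g \<Longrightarrow> ebdd F (\<lambda>t. f t + g t)"
  unfolding ebdd_def
proof (elim exE)
  fix K K' assume "\<forall>\<^sub>F t in F. norm (f t) \<le> K" "\<forall>\<^sub>F t in F. norm (g t) \<le> K'"
  then have "\<forall>\<^sub>F t in F. norm (f t + g t) \<le> K + K'"
    by eventually_elim (meson add_mono norm_triangle_ineq order_trans)
  then show "\<exists>K. \<forall>\<^sub>F t in F. norm (f t + g t) \<le> K" by blast
qed

lemma ebdd_sum: "(\<And>l. l \<in> I \<Longrightarrow> ebdd F (f l)) \<Longrightarrow> ebdd F (\<lambda>t. \<Sum>l\<in>I. f l t)"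
  by (induction I rule: infinite_finite_induct) (auto intro: ebdd_add)

lemma ebdd_norm: "ebdd F f \<Longrightarrow> ebdd F (\<lambda>t. norm (f t))"
  by (simp add: ebdd_def)

lemma ebdd_cnj: "ebdd F f \<Longrightarrow> ebdd F (\<lambda>t. cnj (f t))"
  by (simp add: ebdd_def)

lemma null_mult:
  fixes f g :: "'t \<Rightarrow> 'b::real_normed_algebra"
  assumes "ebdd F f" "(g \<longlongrightarrow> 0) F"
  shows "((\<lambda>t. f t * g t) \<longlongrightarrow> 0) F" "((\<lambda>t. g t * f t) \<longlongrightarrow> 0) F"
proof -
  obtain K where K: "\<forall>\<^sub>F t in F. norm (f t) \<le> K" using assms(1) by (auto simp: ebdd_def)
  have g: "((\<lambda>t. K * norm (g t)) \<longlongrightarrow> 0) F"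
    using tendsto_mult_right_zero[OF tendsto_norm_zero[OF assms(2)]] .
  show "((\<lambda>t. f t * g t) \<longlongrightarrow> 0) F"
  proof (rule Lim_null_comparison[OF _ g])
    show "\<forall>\<^sub>F t in F. norm (f t * g t) \<le> K * norm (g t)" using K
      by eventually_elim (auto intro!: order_trans[OF norm_mult_ineq] mult_right_mono)
  qed
  show "((\<lambda>t. g t * f t) \<longlongrightarrow> 0) F"
  proof (rule Lim_null_comparison[OF _ g])
    show "\<forall>\<^sub>F t in F. norm (g t * f t) \<le> K * norm (g t)" using K
      by eventually_elim (metis mult.commute mult_right_mono norm_ge_zero norm_mult_ineq order_trans)
  qed
qed

text \<open>
  The asymptotic argument, along an arbitrary filter. \<open>G\<close> is the filtered data signal
  (\<open>g l\<close> are the filtered channels and \<open>V\<close> is the filtered noise), \<open>u\<close> its principal left singular vector,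
  \<open>p\<close> the un-filtered direction, and \<open>e\<close> the pilot noise after correlation with the pilot.
\<close>

locale ca_asymptotics =
  fixes F :: "'t filter" and M C :: "'t \<Rightarrow> nat" and L j :: nat and \<alpha> :: "nat \<Rightarrow> real"
    and g h Ph x :: "'t \<Rightarrow> nat \<Rightarrow> nat \<Rightarrow> complex" and Z V :: "'t \<Rightarrow> nat \<Rightarrow> nat \<Rightarrow> complex"
    and u p r e :: "'t \<Rightarrow> nat \<Rightarrow> complex" and lam z :: "'t \<Rightarrow> real" and \<kappa> H :: real
  fixes G :: "'t \<Rightarrow> nat \<Rightarrow> nat \<Rightarrow> complex" and adj :: "'t \<Rightarrow> (nat \<Rightarrow> complex) \<Rightarrow> nat \<Rightarrow> complex"
  defines "G \<equiv> \<lambda>t i c. (\<Sum>l=1..L. g t l i * x t l c) + V t i c"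
    and "adj \<equiv> \<lambda>t v c. \<Sum>i<M t. cnj (G t i c) * v i"
  assumes nontriv: "F \<noteq> bot"
    and dims: "\<forall>\<^sub>F t in F. M t \<ge> 1 \<and> C t \<ge> 1"
    and j: "j \<in> {1..L}" and \<alpha>j: "\<alpha> j > 0" and \<alpha>_less: "\<And>l. l \<in> {1..L} \<Longrightarrow> l \<noteq> j \<Longrightarrow> \<alpha> l < \<alpha> j"
    and gram: "\<And>l k. l \<in> {1..L} \<Longrightarrow> k \<in> {1..L} \<Longrightarrow>
      ((\<lambda>t. ip (M t) (g t l) (g t k) / of_nat (M t)) \<longlongrightarrow> (if l = k then complex_of_real (\<alpha> l) else 0)) F"
    and symbols: "\<And>l k. l \<in> {1..L} \<Longrightarrow> k \<in> {1..L} \<Longrightarrow>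
      ((\<lambda>t. ip (C t) (x t l) (x t k) / of_nat (C t)) \<longlongrightarrow> (if l = k then 1 else 0)) F"
    and z: "(z \<longlongrightarrow> 0) F"
    and noise: "\<forall>\<^sub>F t in F. \<forall>b. nrm (M t) (\<lambda>i. \<Sum>c<C t. Z t i c * b c) \<le> z t * sqrt (M t * C t) * nrm (C t) b"
    and noise_adj: "\<forall>\<^sub>F t in F. \<forall>a. nrm (C t) (\<lambda>c. \<Sum>i<M t. cnj (V t i c) * a i) \<le> z t * sqrt (M t * C t) * nrm (M t) a"
    and unit: "\<forall>\<^sub>F t in F. nrm (M t) (u t) = 1"
    and eigen: "\<forall>\<^sub>F t in F. \<forall>i<M t. complex_of_real (lam t * C t) * u t i = (\<Sum>c<C t. G t i c * adj t (u t) c)"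
    and rayleigh: "\<forall>\<^sub>F t in F. \<forall>v. (nrm (C t) (adj t v))\<^sup>2 \<le> lam t * C t * (nrm (M t) v)\<^sup>2"
    and unfilter: "\<forall>\<^sub>F t in F. \<forall>i<M t. complex_of_real (lam t * C t) * p t i
      = (\<Sum>l=1..L. (\<Sum>c<C t. x t l c * adj t (u t) c) * Ph t l i) + r t i"
    and Ph: "\<forall>\<^sub>F t in F. \<forall>l\<in>{1..L}. nrm (M t) (Ph t l) \<le> nrm (M t) (h t l)"
    and Phj: "\<forall>\<^sub>F t in F. \<forall>i<M t. Ph t j i = h t j i"
    and r: "\<forall>\<^sub>F t in F. nrm (M t) (r t) \<le> nrm (M t) (\<lambda>i. \<Sum>c<C t. Z t i c * adj t (u t) c)"
    and h_le: "\<forall>\<^sub>F t in F. \<forall>l\<in>{1..L}. nrm (M t) (h t l) \<le> H * sqrt (M t)"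
    and e_le: "\<forall>\<^sub>F t in F. nrm (M t) (e t) \<le> H * sqrt (M t)"
    and gh: "\<kappa> > 0" "\<forall>\<^sub>F t in F. nrm (M t) (g t j) \<le> \<kappa> * nrm (M t) (h t j)"
    and h_orth: "\<And>l. l \<in> {1..L} \<Longrightarrow> l \<noteq> j \<Longrightarrow> ((\<lambda>t. ip (M t) (h t l) (h t j) / of_nat (M t)) \<longlongrightarrow> 0) F"
    and e_orth: "((\<lambda>t. ip (M t) (e t) (h t j) / of_nat (M t)) \<longlongrightarrow> 0) F"
begin

section \<open>Correlations with the filtered channels and the norm of \<open>G^H v\<close>\<close>

definition coeff :: "('t \<Rightarrow> nat \<Rightarrow> complex) \<Rightarrow> nat \<Rightarrow> 't \<Rightarrow> complex" where
  "coeff v l t = ip (M t) (v t) (g t l) / complex_of_real (sqrt (M t))"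

text \<open>The matrices \<open>A\<close> become diagonal in the limit, and bounded coefficients
  make the error vanish even though they need not converge. It is used for the Gram matrix of the
  symbols and for that of the filtered channels.\<close>

lemma quadratic_limit:
  fixes A :: "nat \<Rightarrow> nat \<Rightarrow> 't \<Rightarrow> complex" and a :: "nat \<Rightarrow> 't \<Rightarrow> complex"
  assumes A: "\<And>l k. l \<in> {1..L} \<Longrightarrow> k \<in> {1..L} \<Longrightarrow> (A l k \<longlongrightarrow> (if l = k then complex_of_real (\<beta> l) else 0)) F"
    and a: "\<And>l. l \<in> {1..L} \<Longrightarrow> ebdd F (a l)"
  shows "((\<lambda>t. (\<Sum>l=1..L. \<Sum>k=1..L. a l t * cnj (a k t) * A l k t) - complex_of_real (\<Sum>l=1..L. \<beta> l * (cmod (a l t))\<^sup>2)) \<longlongrightarrow> 0) F"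
proof -
  have "((\<lambda>t. \<Sum>l=1..L. \<Sum>k=1..L. a l t * cnj (a k t) * (A l k t - (if l = k then complex_of_real (\<beta> l) else 0))) \<longlongrightarrow> 0) F"
    using A a by (intro tendsto_null_sum null_mult ebdd_mult ebdd_cnj) (auto simp: LIM_zero_iff intro: LIM_zero)
  also have "(\<lambda>t. \<Sum>l=1..L. \<Sum>k=1..L. a l t * cnj (a k t) * (A l k t - (if l = k then complex_of_real (\<beta> l) else 0)))
    = (\<lambda>t. (\<Sum>l=1..L. \<Sum>k=1..L. a l t * cnj (a k t) * A l k t) - complex_of_real (\<Sum>l=1..L. \<beta> l * (cmod (a l t))\<^sup>2))"
  proof
    fix t
    have "(\<Sum>l=1..L. \<Sum>k=1..L. a l t * cnj (a k t) * (if l = k then complex_of_real (\<beta> l) else 0))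
      = complex_of_real (\<Sum>l=1..L. \<beta> l * (cmod (a l t))\<^sup>2)"
      unfolding of_real_sum of_real_mult complex_norm_square
      by (simp add: if_distrib[of "\<lambda>x. _ * x"] mult_ac cong: if_cong)
    then show "(\<Sum>l=1..L. \<Sum>k=1..L. a l t * cnj (a k t) * (A l k t - (if l = k then complex_of_real (\<beta> l) else 0)))
      = (\<Sum>l=1..L. \<Sum>k=1..L. a l t * cnj (a k t) * A l k t) - complex_of_real (\<Sum>l=1..L. \<beta> l * (cmod (a l t))\<^sup>2)"
      by (simp add: right_diff_distrib sum_subtractf)
  qed
  finally show ?thesis .
qed

lemma g_norm_ebdd: "l \<in> {1..L} \<Longrightarrow> ebdd F (\<lambda>t. nrm (M t) (g t l) / sqrt (M t))"
proof -
  assume l: "l \<in> {1..L}"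
  have "((\<lambda>t. sqrt (cmod (ip (M t) (g t l) (g t l) / of_nat (M t)))) \<longlongrightarrow> sqrt (cmod (complex_of_real (\<alpha> l)))) F"
    using gram[OF l l] by (intro tendsto_intros) simp
  moreover have "sqrt (cmod (ip (M t) (g t l) (g t l) / of_nat (M t))) = nrm (M t) (g t l) / sqrt (M t)" for t
    unfolding ip_self norm_divide norm_of_real by (simp add: real_sqrt_divide)
  ultimately show ?thesis by (intro ebdd_tendsto) simp
qed

lemma coeff_ebdd:
  assumes "ebdd F (\<lambda>t. nrm (M t) (v t))" "l \<in> {1..L}"
  shows "ebdd F (coeff v l)"
proof (rule ebdd_le[OF ebdd_mult[OF assms(1) g_norm_ebdd[OF assms(2)]]], intro always_eventually allI)
  fix t
  show "norm (coeff v l t) \<le> norm (nrm (M t) (v t) * (nrm (M t) (g t l) / sqrt (M t)))"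
    unfolding coeff_def norm_divide norm_of_real
    using divide_right_mono[OF ip_le[of "M t" "v t" "g t l"], of "sqrt (M t)"] by simp
qed

text \<open>The signal part of \<open>G^H v\<close> divided by \<open>sqrt M\<close>;
  \<open>rest\<close> is the noise part, and \<open>adj_split\<close> adds them up.\<close>

definition signal :: "('t \<Rightarrow> nat \<Rightarrow> complex) \<Rightarrow> 't \<Rightarrow> nat \<Rightarrow> complex" where
  "signal v t c = (\<Sum>l=1..L. coeff v l t * cnj (x t l c))"

definition rest :: "('t \<Rightarrow> nat \<Rightarrow> complex) \<Rightarrow> 't \<Rightarrow> nat \<Rightarrow> complex" where
  "rest v t c = (\<Sum>i<M t. cnj (V t i c) * v t i)"

lemma adj_split: "\<forall>\<^sub>F t in F. \<forall>c. adj t (v t) c = complex_of_real (sqrt (M t)) * signal v t c + rest v t c"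
  using dims
proof eventually_elim
  case (elim t)
  show ?case
  proof
    fix c
    have "adj t (v t) c = (\<Sum>i<M t. \<Sum>l=1..L. cnj (x t l c) * (v t i * cnj (g t l i))) + rest v t c"
    proof -
      have "cnj (G t i c) * v t i = (\<Sum>l=1..L. cnj (x t l c) * (v t i * cnj (g t l i))) + cnj (V t i c) * v t i" for i
        by (simp add: G_def sum_distrib_right sum_distrib_left algebra_simps)
      then show ?thesis by (simp only: adj_def rest_def sum.distrib)
    qed
    also have "(\<Sum>i<M t. \<Sum>l=1..L. cnj (x t l c) * (v t i * cnj (g t l i))) = (\<Sum>l=1..L. cnj (x t l c) * ip (M t) (v t) (g t l))"
      unfolding ip_def sum_distrib_left by (rule sum.swap)
    also have "\<dots> = complex_of_real (sqrt (M t)) * signal v t c"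
      using elim by (simp add: signal_def coeff_def sum_distrib_left mult_ac)
    finally show "adj t (v t) c = complex_of_real (sqrt (M t)) * signal v t c + rest v t c" .
  qed
qed

lemma rest_small:
  assumes "ebdd F (\<lambda>t. nrm (M t) (v t))"
  shows "((\<lambda>t. nrm (C t) (rest v t) / sqrt (M t * C t)) \<longlongrightarrow> 0) F"
proof (rule Lim_null_comparison)
  show "\<forall>\<^sub>F t in F. norm (nrm (C t) (rest v t) / sqrt (M t * C t)) \<le> nrm (M t) (v t) * z t"
    using noise_adj dims
  proof eventually_elim
    case (elim t)
    have "0 < sqrt (M t * C t)" using elim by simp
    moreover have "nrm (C t) (rest v t) \<le> z t * sqrt (M t * C t) * nrm (M t) (v t)"
      unfolding rest_def[abs_def] using elim by blast
    ultimately show ?case by (simp add: divide_le_eq mult_ac)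
  qed
  show "((\<lambda>t. nrm (M t) (v t) * z t) \<longlongrightarrow> 0) F" by (rule null_mult(1)[OF assms z])
qed

lemma signal_norm:
  assumes "ebdd F (\<lambda>t. nrm (M t) (v t))"
  shows "((\<lambda>t. (nrm (C t) (signal v t))\<^sup>2 / C t - (\<Sum>l=1..L. (cmod (coeff v l t))\<^sup>2)) \<longlongrightarrow> 0) F"
proof -
  define A where "A l k t = cnj (ip (C t) (x t l) (x t k) / of_nat (C t))" for l k t
  have "((\<lambda>t. (\<Sum>l=1..L. \<Sum>k=1..L. coeff v l t * cnj (coeff v k t) * A l k t)
      - complex_of_real (\<Sum>l=1..L. 1 * (cmod (coeff v l t))\<^sup>2)) \<longlongrightarrow> 0) F"
  proof (rule quadratic_limit)
    fix l k assume "l \<in> {1..L}" "k \<in> {1..L}"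
    from tendsto_cnj[OF symbols[OF this]]
    show "(A l k \<longlongrightarrow> (if l = k then complex_of_real 1 else 0)) F"
      by (simp add: A_def[abs_def] if_distrib[of cnj] cong: if_cong)
  qed (rule coeff_ebdd[OF assms])
  moreover have "(\<Sum>l=1..L. \<Sum>k=1..L. coeff v l t * cnj (coeff v k t) * A l k t) = complex_of_real ((nrm (C t) (signal v t))\<^sup>2 / C t)" for t
  proof -
    have c: "ip (C t) (\<lambda>c. cnj (x t l c)) (\<lambda>c. cnj (x t k c)) = cnj (ip (C t) (x t l) (x t k))" for l k
      by (simp add: ip_def)
    have "complex_of_real ((nrm (C t) (signal v t))\<^sup>2 / C t) = ip (C t) (signal v t) (signal v t) / of_nat (C t)"
      by (simp add: ip_self)
    also have "ip (C t) (signal v t) (signal v t)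
        = (\<Sum>l=1..L. \<Sum>k=1..L. coeff v l t * (cnj (coeff v k t) * cnj (ip (C t) (x t l) (x t k))))"
      unfolding signal_def[abs_def] ip_linear c sum_distrib_left ..
    finally show ?thesis by (simp add: A_def sum_divide_distrib mult_ac)
  qed
  ultimately have "((\<lambda>t. complex_of_real ((nrm (C t) (signal v t))\<^sup>2 / C t - (\<Sum>l=1..L. (cmod (coeff v l t))\<^sup>2))) \<longlongrightarrow> complex_of_real 0) F"
    by simp
  then show ?thesis by (simp only: tendsto_of_real_iff)
qed

text \<open>On vectors of bounded norm, \<open>G G^H / (M C)\<close> acts like the sum of the
  rank-one matrices \<open>g l (g l)^H / M\<close>: the symbols are asymptotically orthonormal, and
  the noise contributes a vanishing norm.\<close>

lemma adj_norm:
  assumes v: "ebdd F (\<lambda>t. nrm (M t) (v t))"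
  shows "((\<lambda>t. (nrm (C t) (adj t (v t)))\<^sup>2 / (M t * C t) - (\<Sum>l=1..L. (cmod (coeff v l t))\<^sup>2)) \<longlongrightarrow> 0) F"
proof -
  define A where "A t = nrm (C t) (adj t (v t)) / sqrt (M t * C t)" for t
  define B where "B t = nrm (C t) (signal v t) / sqrt (C t)" for t
  define S where "S t = (\<Sum>l=1..L. (cmod (coeff v l t))\<^sup>2)" for t
  have B: "((\<lambda>t. (B t)\<^sup>2 - S t) \<longlongrightarrow> 0) F"
    using signal_norm[OF v] by (simp add: B_def S_def power_divide)
  have AB: "((\<lambda>t. A t - B t) \<longlongrightarrow> 0) F"
  proof (rule Lim_null_comparison[OF _ rest_small[OF v]])
    show "\<forall>\<^sub>F t in F. norm (A t - B t) \<le> nrm (C t) (rest v t) / sqrt (M t * C t)"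
      using adj_split[of v] dims
    proof eventually_elim
      case (elim t)
      have s: "sqrt (M t) > 0" "sqrt (C t) > 0" using elim by auto
      have "B t = nrm (C t) (\<lambda>c. complex_of_real (sqrt (M t)) * signal v t c) / sqrt (M t * C t)"
        using s unfolding nrm_scale B_def by (simp add: real_sqrt_mult)
      then have "norm (A t - B t) = \<bar>nrm (C t) (adj t (v t)) - nrm (C t) (\<lambda>c. complex_of_real (sqrt (M t)) * signal v t c)\<bar> / sqrt (M t * C t)"
        by (simp add: A_def diff_divide_distrib[symmetric])
      also have "\<dots> \<le> nrm (C t) (\<lambda>c. adj t (v t) c - complex_of_real (sqrt (M t)) * signal v t c) / sqrt (M t * C t)"
        by (intro divide_right_mono nrm_diff_le) simp
      also have "(\<lambda>c. adj t (v t) c - complex_of_real (sqrt (M t)) * signal v t c) = rest v t"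
        using elim by auto
      finally show ?case .
    qed
  qed
  have Sb: "ebdd F S" unfolding S_def
    using coeff_ebdd[OF v] by (intro ebdd_sum) (auto simp: power2_eq_square intro!: ebdd_mult ebdd_norm)
  have Bb: "ebdd F B"
  proof -
    \<comment> \<open>Only \<open>B^2\<close> is known to be bounded at this point;
      \<open>|B| \<le> B^2 + 1\<close> transfers it to \<open>B\<close>.\<close>
    have "ebdd F (\<lambda>t. ((B t)\<^sup>2 - S t) + S t + 1)"
      by (intro ebdd_add ebdd_tendsto[OF B] Sb ebdd_const)
    then show ?thesis
    proof (rule ebdd_le, intro always_eventually allI)
      fix t
      have "\<bar>B t\<bar> \<le> (B t)\<^sup>2 + 1" using sum_squares_bound[of "\<bar>B t\<bar>" 1] abs_ge_zero[of "B t"]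
        by (simp; linarith)
      then show "norm (B t) \<le> norm ((B t)\<^sup>2 - S t + S t + 1)" by simp
    qed
  qed
  have "((\<lambda>t. (A t + B t) * (A t - B t)) \<longlongrightarrow> 0) F"
  proof (rule null_mult(1)[OF _ AB])
    have "ebdd F (\<lambda>t. (A t - B t) + B t + B t)" by (intro ebdd_add ebdd_tendsto[OF AB] Bb)
    then show "ebdd F (\<lambda>t. A t + B t)" by simp
  qed
  from tendsto_add[OF this B] have "((\<lambda>t. (A t)\<^sup>2 - S t) \<longlongrightarrow> 0) F"
    by (simp add: power2_eq_square algebra_simps)
  then show ?thesis by (simp add: A_def S_def power_divide)
qed


section \<open>Alignment of the principal eigenvector with \<open>g j\<close>\<close>

definition a :: "nat \<Rightarrow> 't \<Rightarrow> complex" where "a = coeff u"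

definition s :: "'t \<Rightarrow> real" where "s t = (\<Sum>l=1..L. (cmod (a l t))\<^sup>2)"

text \<open>The eigenvalue of \<open>G G^H / (M C)\<close>. The sample covariance carries the factor
  \<open>1 / C\<close> already, so \<open>lam\<close> is divided by \<open>M\<close> only.\<close>

definition \<Lambda> :: "'t \<Rightarrow> real" where "\<Lambda> t = lam t / M t"

lemma unit_ebdd: "ebdd F (\<lambda>t. nrm (M t) (u t))"
  using unit by (intro ebdd_tendsto[of _ 1] tendsto_eventually)

lemma a_ebdd: "l \<in> {1..L} \<Longrightarrow> ebdd F (a l)"
  unfolding a_def by (rule coeff_ebdd[OF unit_ebdd])

lemma s_nonneg: "0 \<le> s t"
  by (simp add: s_def sum_nonneg)

lemma s_ebdd: "ebdd F s"
proof -
  have "ebdd F (\<lambda>t. \<Sum>l=1..L. cmod (a l t) * cmod (a l t))"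
    by (intro ebdd_sum ebdd_mult ebdd_norm a_ebdd)
  then show ?thesis by (simp add: s_def[abs_def] power2_eq_square)
qed

text \<open>The scalar product of the eigenvalue equation with the unit vector
  \<open>u\<close>.\<close>

lemma \<Lambda>_eq: "\<forall>\<^sub>F t in F. \<Lambda> t = (nrm (C t) (adj t (u t)))\<^sup>2 / (M t * C t)"
  using eigen unit dims
proof eventually_elim
  case (elim t)
  have "complex_of_real (lam t * C t) = complex_of_real (lam t * C t) * ip (M t) (u t) (u t)"
    using elim by (simp add: ip_self)
  also have "\<dots> = (\<Sum>i<M t. (complex_of_real (lam t * C t) * u t i) * cnj (u t i))"
    by (simp add: ip_def sum_distrib_left mult.assoc)
  also have "\<dots> = (\<Sum>i<M t. \<Sum>c<C t. G t i c * adj t (u t) c * cnj (u t i))"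
    using elim by (simp add: sum_distrib_right)
  also have "\<dots> = (\<Sum>c<C t. \<Sum>i<M t. G t i c * adj t (u t) c * cnj (u t i))"
    by (rule sum.swap)
  also have "\<dots> = ip (C t) (adj t (u t)) (adj t (u t))"
  proof -
    have "cnj (adj t (u t) c) = (\<Sum>i<M t. G t i c * cnj (u t i))" for c
      by (simp add: adj_def)
    then show ?thesis by (simp add: ip_def sum_distrib_left mult_ac)
  qed
  finally have "lam t * C t = (nrm (C t) (adj t (u t)))\<^sup>2"
    unfolding ip_self of_real_eq_iff .
  then show ?case using elim by (simp add: \<Lambda>_def field_simps)
qed

lemma \<Lambda>_s: "((\<lambda>t. \<Lambda> t - s t) \<longlongrightarrow> 0) F"
proof (rule Lim_transform_eventually)
  show "((\<lambda>t. (nrm (C t) (adj t (u t)))\<^sup>2 / (M t * C t) - (\<Sum>l=1..L. (cmod (coeff u l t))\<^sup>2)) \<longlongrightarrow> 0) F"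
    by (rule adj_norm[OF unit_ebdd])
  show "\<forall>\<^sub>F t in F. (nrm (C t) (adj t (u t)))\<^sup>2 / (M t * C t) - (\<Sum>l=1..L. (cmod (coeff u l t))\<^sup>2) = \<Lambda> t - s t"
    using \<Lambda>_eq by eventually_elim (simp add: s_def a_def)
qed

text \<open>The Rayleigh quotient at \<open>g\<^sub>j\<close> bounds the largest eigenvalue from below.\<close>

lemma \<Lambda>_lower: "\<exists>low. (low \<longlongrightarrow> \<alpha> j) F \<and> (\<forall>\<^sub>F t in F. low t \<le> \<Lambda> t)"
proof -
  define v where "v t i = complex_of_real (1 / sqrt (M t)) * g t j i" for t i
  have nv: "nrm (M t) (v t) = nrm (M t) (g t j) / sqrt (M t)" for t
    unfolding v_def[abs_def] nrm_scale by (simp add: norm_divide)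
  have vb: "ebdd F (\<lambda>t. nrm (M t) (v t))" unfolding nv by (rule g_norm_ebdd[OF j])
  have gj: "((\<lambda>t. ip (M t) (g t j) (g t j) / of_nat (M t)) \<longlongrightarrow> complex_of_real (\<alpha> j)) F"
    using gram[OF j j] by simp
  define \<nu> where "\<nu> t = (nrm (M t) (v t))\<^sup>2" for t
  have "((\<lambda>t. complex_of_real (\<nu> t)) \<longlongrightarrow> complex_of_real (\<alpha> j)) F"
    using gj by (simp add: \<nu>_def nv power_divide ip_self)
  then have \<nu>: "(\<nu> \<longlongrightarrow> \<alpha> j) F" by (simp only: tendsto_of_real_iff)
  have cv: "coeff v j t = ip (M t) (g t j) (g t j) / of_nat (M t)" for t
    unfolding coeff_def v_def[abs_def] ip_linear
  proof -
    have "complex_of_real (sqrt (M t)) * complex_of_real (sqrt (M t)) = of_nat (M t)"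
      by (simp flip: of_real_mult)
    then show "complex_of_real (1 / sqrt (M t)) * ip (M t) (g t j) (g t j) / complex_of_real (sqrt (M t)) = ip (M t) (g t j) (g t j) / of_nat (M t)"
      by (simp add: divide_divide_eq_left)
  qed
  then have cj: "((\<lambda>t. (cmod (coeff v j t))\<^sup>2) \<longlongrightarrow> (\<alpha> j)\<^sup>2) F"
  proof -
    have "((\<lambda>t. (cmod (ip (M t) (g t j) (g t j) / of_nat (M t)))\<^sup>2) \<longlongrightarrow> (cmod (complex_of_real (\<alpha> j)))\<^sup>2) F"
      by (intro tendsto_intros gj)
    then show ?thesis by (simp only: cv norm_of_real power2_abs)
  qed
  \<comment> \<open>A lower bound of the Rayleigh quotient is sought, so it suffices to keep the
    term \<open>l = j\<close> of the sum. The numerator tends to \<open>(\<alpha> j)^2\<close> and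
    \<open>\<nu>\<close> to \<open>\<alpha> j\<close>.\<close>
  define \<beta> where "\<beta> t = ((nrm (C t) (adj t (v t)))\<^sup>2 / (M t * C t) - (\<Sum>l=1..L. (cmod (coeff v l t))\<^sup>2)) + (cmod (coeff v j t))\<^sup>2" for t
  have \<beta>: "(\<beta> \<longlongrightarrow> 0 + (\<alpha> j)\<^sup>2) F"
    unfolding \<beta>_def[abs_def] by (intro tendsto_add adj_norm[OF vb] cj)
  have "((\<lambda>t. \<beta> t / \<nu> t) \<longlongrightarrow> (0 + (\<alpha> j)\<^sup>2) / \<alpha> j) F"
    using \<alpha>j by (intro tendsto_divide \<beta> \<nu>) simp
  then have lim: "((\<lambda>t. \<beta> t / \<nu> t) \<longlongrightarrow> \<alpha> j) F" using \<alpha>j by (simp add: power2_eq_square)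
  moreover have "\<forall>\<^sub>F t in F. \<beta> t / \<nu> t \<le> \<Lambda> t"
    using order_tendstoD(1)[OF \<nu> \<alpha>j] rayleigh dims
  proof eventually_elim
    case (elim t)
    have "(cmod (coeff v j t))\<^sup>2 \<le> (\<Sum>l=1..L. (cmod (coeff v l t))\<^sup>2)"
      using j by (intro member_le_sum) auto
    then have "\<beta> t \<le> (nrm (C t) (adj t (v t)))\<^sup>2 / (M t * C t)" by (simp add: \<beta>_def)
    also have "\<dots> \<le> (lam t * C t * \<nu> t) / (M t * C t)"
      using elim unfolding \<nu>_def by (intro divide_right_mono) auto
    also have "\<dots> = \<Lambda> t * \<nu> t" using elim by (simp add: \<Lambda>_def)
    finally show ?case using elim by (simp add: divide_le_eq)
  qed
  ultimately show ?thesis by blast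
qed

text \<open>\<open>s\<close> is the scalar product of \<open>u\<close> with the combination
  \<open>P\<close> of the filtered channels that has coefficients \<open>a l / sqrt M\<close>.
  Cauchy-Schwarz bounds it by the norm of \<open>P\<close>, and the asymptotic orthogonality of the
  \<open>g l\<close> makes \<open>nrm P ^ 2\<close> diagonal in the \<open>a l\<close>.\<close>

lemma s_square_le: "\<exists>o1. (o1 \<longlongrightarrow> 0) F \<and> (\<forall>\<^sub>F t in F. (s t)\<^sup>2 \<le> (\<Sum>l=1..L. \<alpha> l * (cmod (a l t))\<^sup>2) + o1 t)"
proof -
  define P where "P t i = (\<Sum>l=1..L. (a l t / complex_of_real (sqrt (M t))) * g t l i)" for t i
  define o1 where "o1 t = (nrm (M t) (P t))\<^sup>2 - (\<Sum>l=1..L. \<alpha> l * (cmod (a l t))\<^sup>2)" for t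
  have "((\<lambda>t. (\<Sum>l=1..L. \<Sum>k=1..L. a l t * cnj (a k t) * (ip (M t) (g t l) (g t k) / of_nat (M t)))
      - complex_of_real (\<Sum>l=1..L. \<alpha> l * (cmod (a l t))\<^sup>2)) \<longlongrightarrow> 0) F"
    by (rule quadratic_limit[OF gram a_ebdd])
  moreover have "(\<Sum>l=1..L. \<Sum>k=1..L. a l t * cnj (a k t) * (ip (M t) (g t l) (g t k) / of_nat (M t))) = complex_of_real ((nrm (M t) (P t))\<^sup>2)" for t
  proof -
    have sq: "complex_of_real (sqrt (M t)) * complex_of_real (sqrt (M t)) = of_nat (M t)"
      by (simp flip: of_real_mult)
    have "complex_of_real ((nrm (M t) (P t))\<^sup>2) = (\<Sum>l=1..L. \<Sum>k=1..L. a l t / complex_of_real (sqrt (M t)) * (cnj (a k t / complex_of_real (sqrt (M t))) * ip (M t) (g t l) (g t k)))"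
      unfolding ip_self[symmetric] P_def[abs_def] ip_linear sum_distrib_left ..
    also have "\<dots> = (\<Sum>l=1..L. \<Sum>k=1..L. a l t * cnj (a k t) * (ip (M t) (g t l) (g t k) / of_nat (M t)))"
      by (intro sum.cong refl) (simp add: sq[symmetric])
    finally show ?thesis by simp
  qed
  ultimately have "((\<lambda>t. complex_of_real (o1 t)) \<longlongrightarrow> complex_of_real 0) F"
    by (simp add: o1_def)
  then have "(o1 \<longlongrightarrow> 0) F" by (simp only: tendsto_of_real_iff)
  moreover have "\<forall>\<^sub>F t in F. (s t)\<^sup>2 \<le> (\<Sum>l=1..L. \<alpha> l * (cmod (a l t))\<^sup>2) + o1 t"
    using unit
  proof eventually_elim
    case (elim t)
    have "ip (M t) (u t) (P t) = (\<Sum>l=1..L. cnj (a l t) * a l t)"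
      unfolding P_def[abs_def] ip_linear by (intro sum.cong refl) (simp add: a_def coeff_def)
    also have "\<dots> = complex_of_real (s t)"
      unfolding s_def of_real_sum complex_norm_square by (simp add: mult.commute)
    finally have "cmod (complex_of_real (s t)) \<le> nrm (M t) (u t) * nrm (M t) (P t)"
      using ip_le[of "M t" "u t" "P t"] by simp
    then have "s t \<le> nrm (M t) (P t)" using elim s_nonneg[of t] by simp
    then have "(s t)\<^sup>2 \<le> (nrm (M t) (P t))\<^sup>2" using s_nonneg by (intro power_mono)
    then show ?case by (simp add: o1_def)
  qed
  ultimately show ?thesis by blast
qed

text \<open>Put \<open>D = \<Sum>l (\<alpha> j - \<alpha> l) |a l|^2\<close>, which is nonnegative.
  The Cauchy-Schwarz bound reads \<open>s (s - \<alpha> j) + D \<le> o(1)\<close>, while the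
  Rayleigh bound gives \<open>s \<ge> \<alpha> j - o(1)\<close>. Together they force
  \<open>D\<close> to 0 and \<open>s\<close> to \<open>\<alpha> j\<close>, and the strict gaps in
  \<open>D\<close> remove every \<open>a l\<close> with \<open>l \<noteq> j\<close>.\<close>

lemma a_limits:
  shows "l \<in> {1..L} \<Longrightarrow> l \<noteq> j \<Longrightarrow> (a l \<longlongrightarrow> 0) F"
    and "((\<lambda>t. (cmod (a j t))\<^sup>2) \<longlongrightarrow> \<alpha> j) F" and "(\<Lambda> \<longlongrightarrow> \<alpha> j) F"
proof -
  obtain low where low: "(low \<longlongrightarrow> \<alpha> j) F" "\<forall>\<^sub>F t in F. low t \<le> \<Lambda> t" using \<Lambda>_lower by blast
  obtain o1 where o1: "(o1 \<longlongrightarrow> 0) F" "\<forall>\<^sub>F t in F. (s t)\<^sup>2 \<le> (\<Sum>l=1..L. \<alpha> l * (cmod (a l t))\<^sup>2) + o1 t"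
    using s_square_le by blast
  define o2 where "o2 t = low t - (\<Lambda> t - s t) - \<alpha> j" for t
  have o2: "(o2 \<longlongrightarrow> 0) F"
    unfolding o2_def[abs_def] using tendsto_diff[OF tendsto_diff[OF low(1) \<Lambda>_s] tendsto_const[of "\<alpha> j"]] by simp
  have slow: "\<forall>\<^sub>F t in F. \<alpha> j + o2 t \<le> s t"
    using low(2) by eventually_elim (simp add: o2_def)
  define D where "D t = (\<Sum>l=1..L. (\<alpha> j - \<alpha> l) * (cmod (a l t))\<^sup>2)" for t
  have Dpos: "0 \<le> (\<alpha> j - \<alpha> l) * (cmod (a l t))\<^sup>2" if "l \<in> {1..L}" for l t
    using \<alpha>_less[OF that] by (cases "l = j") auto
  have D0: "0 \<le> D t" for t unfolding D_def by (intro sum_nonneg Dpos)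
  have Deq: "(\<Sum>l=1..L. \<alpha> l * (cmod (a l t))\<^sup>2) = \<alpha> j * s t - D t" for t
    by (simp add: D_def s_def left_diff_distrib sum_subtractf sum_distrib_left)
  have sD: "\<forall>\<^sub>F t in F. s t * (s t - \<alpha> j) + D t \<le> o1 t"
    using o1(2) by eventually_elim (simp only: Deq, simp add: power2_eq_square algebra_simps)
  have bound: "((\<lambda>t. o1 t + s t * \<bar>o2 t\<bar>) \<longlongrightarrow> 0) F"
    using tendsto_add[OF o1(1) null_mult(1)[OF s_ebdd tendsto_rabs_zero[OF o2]]] by simp
  have Dle: "\<forall>\<^sub>F t in F. D t \<le> o1 t + s t * \<bar>o2 t\<bar>"
    using sD slow
  proof eventually_elim
    case (elim t)
    have "s t * (- \<bar>o2 t\<bar>) \<le> s t * (s t - \<alpha> j)"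
      using elim(2) s_nonneg[of t] by (intro mult_left_mono) auto
    then show ?case using elim(1) by simp
  qed
  have D: "(D \<longlongrightarrow> 0) F"
    using Dle D0 by (intro Lim_null_comparison[OF _ bound]) auto
  have al2: "((\<lambda>t. (cmod (a l t))\<^sup>2) \<longlongrightarrow> 0) F" if l: "l \<in> {1..L}" "l \<noteq> j" for l
  proof -
    have pos: "\<alpha> j - \<alpha> l > 0" using \<alpha>_less[OF l] by simp
    have "((\<lambda>t. D t / (\<alpha> j - \<alpha> l)) \<longlongrightarrow> 0) F" using tendsto_divide[OF D tendsto_const] pos by fastforce
    then show ?thesis
    proof (rule Lim_null_comparison[rotated], intro always_eventually allI)
      fix t
      have "(\<alpha> j - \<alpha> l) * (cmod (a l t))\<^sup>2 \<le> D t"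
        unfolding D_def using l Dpos by (intro member_le_sum) auto
      then show "norm ((cmod (a l t))\<^sup>2) \<le> D t / (\<alpha> j - \<alpha> l)" using pos by (simp add: field_simps)
    qed
  qed
  show "(a l \<longlongrightarrow> 0) F" if "l \<in> {1..L}" "l \<noteq> j"
  proof -
    have "((\<lambda>t. sqrt ((cmod (a l t))\<^sup>2)) \<longlongrightarrow> sqrt 0) F" by (intro tendsto_real_sqrt al2 that)
    then show ?thesis by (simp add: tendsto_norm_zero_iff)
  qed
  have s_lim: "(s \<longlongrightarrow> \<alpha> j) F"
  proof -
    have "((\<lambda>t. 2 / \<alpha> j * \<bar>o1 t\<bar> + \<bar>o2 t\<bar>) \<longlongrightarrow> 2 / \<alpha> j * 0 + 0) F"
      by (intro tendsto_intros tendsto_rabs_zero o1(1) o2)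
    then have "((\<lambda>t. 2 / \<alpha> j * \<bar>o1 t\<bar> + \<bar>o2 t\<bar>) \<longlongrightarrow> 0) F" by simp
    then have "((\<lambda>t. s t - \<alpha> j) \<longlongrightarrow> 0) F"
    proof (rule Lim_null_comparison[rotated])
      have "\<forall>\<^sub>F t in F. - (\<alpha> j / 2) < o2 t" using \<alpha>j by (intro order_tendstoD(1)[OF o2]) simp
      then show "\<forall>\<^sub>F t in F. norm (s t - \<alpha> j) \<le> 2 / \<alpha> j * \<bar>o1 t\<bar> + \<bar>o2 t\<bar>"
        using sD slow
      proof eventually_elim
        case (elim t)
        \<comment> \<open>Only \<open>s \<ge> \<alpha> j\<close> needs an argument. There
          \<open>s \<ge> \<alpha> j / 2\<close>, so the excess is at most
          \<open>2 / \<alpha> j\<close> times the error of the quadratic inequality.\<close>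
        have "s t - \<alpha> j \<le> 2 / \<alpha> j * \<bar>o1 t\<bar>"
        proof (cases "s t \<ge> \<alpha> j")
          case True
          have "\<alpha> j / 2 * (s t - \<alpha> j) \<le> s t * (s t - \<alpha> j)" using True \<alpha>j by (intro mult_right_mono) auto
          also have "\<dots> \<le> \<bar>o1 t\<bar>" using elim(2) D0[of t] by linarith
          finally show ?thesis using \<alpha>j by (simp add: field_simps)
        next
          case False
          have "0 \<le> 2 / \<alpha> j * \<bar>o1 t\<bar>" using \<alpha>j by simp
          then show ?thesis using False by linarith
        qed
        moreover have "0 \<le> 2 / \<alpha> j * \<bar>o1 t\<bar>" using \<alpha>j by simp
        ultimately show ?case using elim(3) by (simp only: real_norm_def abs_le_iff) (auto; linarith)
      qed
    qed
    then show ?thesis by (simp only: LIM_zero_iff)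
  qed
  have "((\<lambda>t. s t - (\<Sum>l\<in>{1..L} - {j}. (cmod (a l t))\<^sup>2)) \<longlongrightarrow> \<alpha> j - 0) F"
    by (intro tendsto_diff s_lim tendsto_null_sum al2) auto
  moreover have "s t - (\<Sum>l\<in>{1..L} - {j}. (cmod (a l t))\<^sup>2) = (cmod (a j t))\<^sup>2" for t
    unfolding s_def by (subst sum.remove[OF _ j]) auto
  ultimately show "((\<lambda>t. (cmod (a j t))\<^sup>2) \<longlongrightarrow> \<alpha> j) F" by simp
  show "(\<Lambda> \<longlongrightarrow> \<alpha> j) F" using tendsto_add[OF \<Lambda>_s s_lim] by simp
qed

lemma x_norm_ebdd: "l \<in> {1..L} \<Longrightarrow> ebdd F (\<lambda>t. nrm (C t) (x t l) / sqrt (C t))"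
proof -
  assume l: "l \<in> {1..L}"
  have "((\<lambda>t. sqrt (cmod (ip (C t) (x t l) (x t l) / of_nat (C t)))) \<longlongrightarrow> sqrt (cmod 1)) F"
    using symbols[OF l l] by (intro tendsto_intros) simp
  moreover have "sqrt (cmod (ip (C t) (x t l) (x t l) / of_nat (C t))) = nrm (C t) (x t l) / sqrt (C t)" for t
    unfolding ip_self norm_divide norm_of_real by (simp add: real_sqrt_divide)
  ultimately show ?thesis by (intro ebdd_tendsto) simp
qed

text \<open>The coefficient of channel \<open>l\<close> when the eigenvalue equation expresses
  \<open>u\<close> through the filtered channels, on the same scale as \<open>a l\<close>.\<close>

definition b :: "nat \<Rightarrow> 't \<Rightarrow> complex" where
  "b l t = (\<Sum>c<C t. x t l c * adj t (u t) c) / complex_of_real (C t * sqrt (M t))"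

text \<open>Inserting \<open>adj_split\<close> turns \<open>b l\<close> into the sum of
  \<open>a k\<close> times the symbol correlations of users \<open>l\<close> and \<open>k\<close>,
  plus a noise term. Asymptotic orthonormality of the symbols picks out \<open>a l\<close>.\<close>

lemma b_a: "l \<in> {1..L} \<Longrightarrow> ((\<lambda>t. b l t - a l t) \<longlongrightarrow> 0) F"
proof -
  assume l: "l \<in> {1..L}"
  define A where "A t = (\<Sum>k=1..L. a k t * (ip (C t) (x t l) (x t k) / of_nat (C t) - (if l = k then 1 else 0)))" for t
  define E where "E t = (\<Sum>c<C t. x t l c * rest u t c) / complex_of_real (C t * sqrt (M t))" for t
  have A: "(A \<longlongrightarrow> 0) F"
    unfolding A_def[abs_def] using symbols[OF l] a_ebdd by (intro tendsto_null_sum null_mult LIM_zero) auto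
  have E: "(E \<longlongrightarrow> 0) F"
  proof (rule Lim_null_comparison)
    show "((\<lambda>t. (nrm (C t) (x t l) / sqrt (C t)) * (nrm (C t) (rest u t) / sqrt (M t * C t))) \<longlongrightarrow> 0) F"
      by (rule null_mult(1)[OF x_norm_ebdd[OF l] rest_small[OF unit_ebdd]])
    show "\<forall>\<^sub>F t in F. norm (E t) \<le> (nrm (C t) (x t l) / sqrt (C t)) * (nrm (C t) (rest u t) / sqrt (M t * C t))"
      using dims
    proof eventually_elim
      case (elim t)
      have "(\<Sum>c<C t. x t l c * rest u t c) = ip (C t) (x t l) (\<lambda>c. cnj (rest u t c))" by (simp add: ip_def)
      then have "cmod (\<Sum>c<C t. x t l c * rest u t c) \<le> nrm (C t) (x t l) * nrm (C t) (rest u t)"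
        using ip_le[of "C t" "x t l" "\<lambda>c. cnj (rest u t c)"] by (simp add: nrm_cnj)
      then have "norm (E t) \<le> nrm (C t) (x t l) * nrm (C t) (rest u t) / (C t * sqrt (M t))"
        unfolding E_def norm_divide norm_of_real by (simp add: divide_right_mono)
      also have "\<dots> = (nrm (C t) (x t l) / sqrt (C t)) * (nrm (C t) (rest u t) / sqrt (M t * C t))"
        using elim by (simp add: real_sqrt_mult field_simps)
      finally show ?case .
    qed
  qed
  have "\<forall>\<^sub>F t in F. A t + E t = b l t - a l t"
    using dims adj_split[of u]
  proof eventually_elim
    case (elim t)
    have nz: "complex_of_real (sqrt (M t)) \<noteq> 0" "of_nat (C t) \<noteq> (0::complex)" using elim by auto
    have "(\<Sum>c<C t. x t l c * adj t (u t) c) = (\<Sum>c<C t. x t l c * (complex_of_real (sqrt (M t)) * signal u t c)) + (\<Sum>c<C t. x t l c * rest u t c)"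
      using elim by (simp add: distrib_left sum.distrib)
    also have "(\<Sum>c<C t. x t l c * (complex_of_real (sqrt (M t)) * signal u t c))
        = complex_of_real (sqrt (M t)) * (\<Sum>c<C t. \<Sum>k=1..L. a k t * (x t l c * cnj (x t k c)))"
      by (simp add: signal_def a_def sum_distrib_left mult_ac)
    also have "(\<Sum>c<C t. \<Sum>k=1..L. a k t * (x t l c * cnj (x t k c))) = (\<Sum>k=1..L. a k t * ip (C t) (x t l) (x t k))"
      unfolding ip_def sum_distrib_left by (rule sum.swap)
    finally have "b l t = (\<Sum>k=1..L. a k t * ip (C t) (x t l) (x t k)) / of_nat (C t) + E t"
      using nz by (simp add: b_def E_def add_divide_distrib)
    also have "(\<Sum>k=1..L. a k t * ip (C t) (x t l) (x t k)) / of_nat (C t) = A t + a l t"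
      using l by (simp add: A_def right_diff_distrib sum_subtractf sum_divide_distrib if_distrib[of "\<lambda>x. _ * x"] cong: if_cong)
    finally show ?case by simp
  qed
  from Lim_transform_eventually[OF tendsto_add[OF A E] this] show ?thesis by simp
qed


section \<open>Alignment of the un-filtered direction with \<open>h j\<close>\<close>

definition \<eta> :: "'t \<Rightarrow> nat \<Rightarrow> complex" where
  "\<eta> t i = complex_of_real (1 / sqrt (M t)) * h t j i"

text \<open>The un-filtered direction times the eigenvalue: the form in which the eigenvalue
  equation delivers it. The factor does not change the line spanned once \<open>\<Lambda>\<close> is
  positive.\<close>

definition w :: "'t \<Rightarrow> nat \<Rightarrow> complex" where
  "w t i = complex_of_real (\<Lambda> t) * p t i"

definition err :: "'t \<Rightarrow> nat \<Rightarrow> complex" where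
  "err t i = w t i - a j t * \<eta> t i"

lemma \<eta>_le: "\<forall>\<^sub>F t in F. nrm (M t) (\<eta> t) \<le> H"
  using h_le dims
proof eventually_elim
  case (elim t)
  have "nrm (M t) (\<eta> t) = nrm (M t) (h t j) / sqrt (M t)"
    unfolding \<eta>_def[abs_def] nrm_scale by (simp add: norm_divide)
  then show ?case using elim j by (simp add: divide_le_eq)
qed

text \<open>The filter expands by at most \<open>\<kappa>\<close>, and
  \<open>nrm (g j) ^ 2 / M\<close> tends to \<open>\<alpha> j > 0\<close>; so \<open>h j\<close> has
  at least order \<open>sqrt M\<close>. This is what permits the division by
  \<open>nrm (h j) ^ 2\<close> in the relative error.\<close>

lemma \<eta>_lower: "\<exists>c>0. \<forall>\<^sub>F t in F. c \<le> nrm (M t) (\<eta> t)"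
proof -
  define c where "c = sqrt (\<alpha> j) / (2 * \<kappa>)"
  have c: "c > 0" using \<alpha>j gh(1) by (simp add: c_def)
  have "((\<lambda>t. sqrt (cmod (ip (M t) (g t j) (g t j) / of_nat (M t)))) \<longlongrightarrow> sqrt (cmod (complex_of_real (\<alpha> j)))) F"
    using gram[OF j j] by (intro tendsto_intros) simp
  moreover have "sqrt (cmod (ip (M t) (g t j) (g t j) / of_nat (M t))) = nrm (M t) (g t j) / sqrt (M t)" for t
    unfolding ip_self norm_divide norm_of_real by (simp add: real_sqrt_divide)
  ultimately have "((\<lambda>t. nrm (M t) (g t j) / sqrt (M t)) \<longlongrightarrow> sqrt (\<alpha> j)) F"
    using \<alpha>j by simp
  then have "\<forall>\<^sub>F t in F. sqrt (\<alpha> j) / 2 < nrm (M t) (g t j) / sqrt (M t)"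
    using \<alpha>j by (intro order_tendstoD(1)) auto
  then have "\<forall>\<^sub>F t in F. c \<le> nrm (M t) (\<eta> t)"
    using gh(2) dims
  proof eventually_elim
    case (elim t)
    have n\<eta>: "nrm (M t) (\<eta> t) = nrm (M t) (h t j) / sqrt (M t)"
      unfolding \<eta>_def[abs_def] nrm_scale by (simp add: norm_divide)
    have "nrm (M t) (g t j) / sqrt (M t) \<le> \<kappa> * nrm (M t) (h t j) / sqrt (M t)"
      using elim by (intro divide_right_mono) auto
    then have "sqrt (\<alpha> j) / 2 \<le> \<kappa> * nrm (M t) (\<eta> t)" unfolding n\<eta> times_divide_eq_right using elim(1) by linarith
    then show ?case using gh(1) by (simp add: c_def field_simps)
  qed
  then show ?thesis using c by blast
qed

text \<open>In the expansion of \<open>w\<close>, user \<open>j\<close> contributes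
  \<open>b j\<close> times \<eta> because \<open>Ph\<close> fixes \<open>h j\<close>, and
  \<open>b j\<close> is close to \<open>a j\<close>. The others have \<open>b l\<close> tending to 0
  in front of vectors of bounded norm, and the noise term is bounded by
  \<open>y * z\<close>.\<close>

lemma err_small: "((\<lambda>t. nrm (M t) (err t)) \<longlongrightarrow> 0) F"
proof -
  define y where "y t = nrm (C t) (adj t (u t)) / sqrt (M t * C t)" for t
  have y: "ebdd F y"
  proof (rule ebdd_le[OF ebdd_add[OF ebdd_tendsto[OF a_limits(3)] ebdd_const[of _ 1]]])
    show "\<forall>\<^sub>F t in F. norm (y t) \<le> norm (\<Lambda> t + 1)"
      using \<Lambda>_eq
    proof eventually_elim
      case (elim t)
      have "\<Lambda> t = (y t)\<^sup>2" using elim by (simp add: y_def power_divide)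
      moreover have "\<bar>y t\<bar> \<le> (y t)\<^sup>2 + 1" using sum_squares_bound[of "\<bar>y t\<bar>" 1] abs_ge_zero[of "y t"]
        by (simp; linarith)
      ultimately show ?case by simp
    qed
  qed
  have "\<forall>\<^sub>F t in F. nrm (M t) (err t) \<le> cmod (b j t - a j t) * H + (\<Sum>l\<in>{1..L} - {j}. cmod (b l t) * H) + y t * z t"
    using unfilter Phj Ph r h_le noise dims \<eta>_le
  proof eventually_elim
    case (elim t)
    define m where "m = complex_of_real (sqrt (M t))"
    have m: "m \<noteq> 0" "m * m = of_nat (M t)" "of_nat (C t) \<noteq> (0::complex)" "of_nat (M t) \<noteq> (0::complex)"
      using elim by (auto simp: m_def simp flip: of_real_mult)
    have eq: "err t i = (b j t - a j t) * \<eta> t i + (\<Sum>l\<in>{1..L} - {j}. b l t / m * Ph t l i) + complex_of_real (1 / (M t * C t)) * r t i"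
      if i: "i < M t" for i
    proof -
      have bl: "(\<Sum>c<C t. x t l c * adj t (u t) c) = of_nat (C t) * of_nat (M t) * (b l t / m)" for l
        unfolding b_def using m by (simp add: m_def[symmetric] m(2)[symmetric])
      have lamC: "complex_of_real (lam t * C t) = of_nat (C t) * of_nat (M t) * complex_of_real (\<Lambda> t)"
        using m by (simp add: \<Lambda>_def)
      have "complex_of_real (lam t * C t) * p t i = (\<Sum>l=1..L. of_nat (C t) * of_nat (M t) * (b l t / m) * Ph t l i) + r t i"
        using elim(1) i unfolding bl by blast
      then have "of_nat (C t) * of_nat (M t) * w t i = (\<Sum>l=1..L. of_nat (C t) * of_nat (M t) * (b l t / m) * Ph t l i) + r t i"
        by (simp only: lamC w_def mult.assoc)
      also have "(\<Sum>l=1..L. of_nat (C t) * of_nat (M t) * (b l t / m) * Ph t l i) = of_nat (C t) * of_nat (M t) * (\<Sum>l=1..L. b l t / m * Ph t l i)"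
        by (simp add: sum_distrib_left mult.assoc)
      finally have "w t i = (\<Sum>l=1..L. b l t / m * Ph t l i) + complex_of_real (1 / (M t * C t)) * r t i"
        using m by (simp add: field_simps)
      also have "(\<Sum>l=1..L. b l t / m * Ph t l i) = b j t / m * Ph t j i + (\<Sum>l\<in>{1..L} - {j}. b l t / m * Ph t l i)"
        using j by (subst sum.remove[of _ j]) auto
      also have "b j t / m * Ph t j i = b j t * \<eta> t i" using elim(2) i by (simp add: \<eta>_def m_def)
      finally show ?thesis by (simp add: err_def left_diff_distrib)
    qed
    have Phl: "nrm (M t) (\<lambda>i. b l t / m * Ph t l i) \<le> cmod (b l t) * H" if l: "l \<in> {1..L}" for l
    proof -
      have "nrm (M t) (Ph t l) \<le> H * sqrt (M t)" using elim l by (meson order_trans)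
      then have "nrm (M t) (Ph t l) / sqrt (M t) \<le> H" using elim by (simp add: divide_le_eq)
      then have "cmod (b l t) * (nrm (M t) (Ph t l) / sqrt (M t)) \<le> cmod (b l t) * H" by (rule mult_left_mono) simp
      then show ?thesis unfolding nrm_scale by (simp add: norm_divide m_def)
    qed
    have rn: "nrm (M t) (\<lambda>i. complex_of_real (1 / (M t * C t)) * r t i) \<le> y t * z t"
    proof -
      have "nrm (M t) (r t) \<le> z t * sqrt (M t * C t) * nrm (C t) (adj t (u t))"
        using elim by (meson order_trans)
      then have "nrm (M t) (r t) / (M t * C t) \<le> z t * sqrt (M t * C t) * nrm (C t) (adj t (u t)) / (sqrt (M t * C t) * sqrt (M t * C t))"
        by (simp add: divide_right_mono)
      also have "\<dots> = y t * z t" using elim by (simp add: y_def del: real_sqrt_mult_self)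
      finally show ?thesis unfolding nrm_scale by (simp add: norm_divide norm_mult)
    qed
    have "nrm (M t) (err t) = nrm (M t) (\<lambda>i. ((b j t - a j t) * \<eta> t i + (\<Sum>l\<in>{1..L} - {j}. b l t / m * Ph t l i)) + complex_of_real (1 / (M t * C t)) * r t i)"
      by (rule nrm_cong) (rule eq)
    also have "\<dots> \<le> nrm (M t) (\<lambda>i. (b j t - a j t) * \<eta> t i + (\<Sum>l\<in>{1..L} - {j}. b l t / m * Ph t l i)) + y t * z t"
      by (rule order_trans[OF nrm_add]) (intro add_left_mono rn)
    also have "nrm (M t) (\<lambda>i. (b j t - a j t) * \<eta> t i + (\<Sum>l\<in>{1..L} - {j}. b l t / m * Ph t l i))
        \<le> nrm (M t) (\<lambda>i. (b j t - a j t) * \<eta> t i) + nrm (M t) (\<lambda>i. \<Sum>l\<in>{1..L} - {j}. b l t / m * Ph t l i)"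
      by (rule nrm_add)
    also have "nrm (M t) (\<lambda>i. (b j t - a j t) * \<eta> t i) \<le> cmod (b j t - a j t) * H"
      unfolding nrm_scale using elim by (intro mult_left_mono) auto
    also have "nrm (M t) (\<lambda>i. \<Sum>l\<in>{1..L} - {j}. b l t / m * Ph t l i) \<le> (\<Sum>l\<in>{1..L} - {j}. cmod (b l t) * H)"
      by (rule order_trans[OF nrm_sum]) (intro sum_mono Phl, simp)
    finally show ?case by simp
  qed
  moreover have "((\<lambda>t. cmod (b j t - a j t) * H + (\<Sum>l\<in>{1..L} - {j}. cmod (b l t) * H) + y t * z t) \<longlongrightarrow> 0) F"
  proof -
    have bl: "(b l \<longlongrightarrow> 0) F" if "l \<in> {1..L} - {j}" for l
      using tendsto_add[OF b_a[of l] a_limits(1)[of l]] that by simp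
    have "((\<lambda>t. cmod (b j t - a j t) * H) \<longlongrightarrow> 0) F"
      by (intro tendsto_mult_left_zero tendsto_norm_zero b_a j)
    moreover have "((\<lambda>t. \<Sum>l\<in>{1..L} - {j}. cmod (b l t) * H) \<longlongrightarrow> 0) F"
      by (intro tendsto_null_sum tendsto_mult_left_zero tendsto_norm_zero bl)
    ultimately have "((\<lambda>t. cmod (b j t - a j t) * H + (\<Sum>l\<in>{1..L} - {j}. cmod (b l t) * H) + y t * z t) \<longlongrightarrow> 0 + 0 + 0) F"
      by (intro tendsto_add null_mult(1)[OF y z])
    then show ?thesis by simp
  qed
  ultimately show ?thesis
    by (intro Lim_null_comparison[of "\<lambda>t. nrm (M t) (err t)"]) auto
qed

section \<open>The projected training signal\<close>

definition q :: "'t \<Rightarrow> nat \<Rightarrow> complex" where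
  "q t i = (\<Sum>l=1..L. h t l i) + e t i"

text \<open>The orthogonal projection of the despread training signal \<open>q\<close> onto the line
  of \<open>p\<close>. It is invariant under scaling of \<open>p\<close>, so \<open>w\<close> may be
  used in its place.\<close>

definition est :: "'t \<Rightarrow> nat \<Rightarrow> complex" where
  "est t i = p t i * ip (M t) (q t) (p t) / complex_of_real ((nrm (M t) (p t))\<^sup>2)"

text \<open>With \<open>w = A \<eta> + err\<close>, projecting onto \<open>w\<close> is nearly
  projecting onto \<eta>. The projection coefficient has numerator
  \<open>cnj A * n\<eta>^2 + o(1)\<close> and denominator \<open>|A|^2 n\<eta>^2 + o(1)\<close>, the
  latter bounded away from 0, so \<eta> is reproduced with factor \<open>1 + o(1)\<close>.\<close>

theorem estimate_consistent:
  "((\<lambda>t. (nrm (M t) (\<lambda>i. est t i - h t j i))\<^sup>2 / (nrm (M t) (h t j))\<^sup>2) \<longlongrightarrow> 0) F"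
proof -
  obtain c where c: "c > 0" "\<forall>\<^sub>F t in F. c \<le> nrm (M t) (\<eta> t)" using \<eta>_lower by blast
  define n\<eta> where "n\<eta> t = nrm (M t) (\<eta> t)" for t
  define A where "A t = a j t" for t
  define \<rho> where "\<rho> t i = complex_of_real (1 / sqrt (M t)) * ((\<Sum>l\<in>{1..L} - {j}. h t l i) + e t i)" for t i
  define N where "N t = (nrm (M t) (w t))\<^sup>2" for t
  define \<delta> where "\<delta> t = cnj (A t) * ip (M t) (\<rho> t) (\<eta> t) + ip (M t) (\<lambda>i. \<eta> t i + \<rho> t i) (err t)" for t
  have n\<eta>b: "ebdd F n\<eta>" unfolding ebdd_def using \<eta>_le by (auto simp: n\<eta>_def)
  have Ab: "ebdd F A" unfolding A_def by (rule a_ebdd[OF j])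
  have A2: "((\<lambda>t. (cmod (A t))\<^sup>2) \<longlongrightarrow> \<alpha> j) F" unfolding A_def by (rule a_limits(2))
  have errb: "ebdd F (\<lambda>t. nrm (M t) (err t))" by (rule ebdd_tendsto[OF err_small])
  have n\<rho>b: "ebdd F (\<lambda>t. nrm (M t) (\<rho> t))"
  proof -
    have "\<forall>\<^sub>F t in F. norm (nrm (M t) (\<rho> t)) \<le> (\<Sum>l\<in>{1..L} - {j}. H) + H"
      using h_le e_le dims
    proof eventually_elim
      case (elim t)
      have "nrm (M t) (\<lambda>i. (\<Sum>l\<in>{1..L} - {j}. h t l i) + e t i) \<le> (\<Sum>l\<in>{1..L} - {j}. H * sqrt (M t)) + H * sqrt (M t)"
        using elim by (intro order_trans[OF nrm_add] add_mono order_trans[OF nrm_sum] sum_mono) auto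
      also have "\<dots> = ((\<Sum>l\<in>{1..L} - {j}. H) + H) * sqrt (M t)" by (simp add: algebra_simps)
      finally show ?case unfolding \<rho>_def[abs_def] nrm_scale using elim by (simp add: norm_divide divide_le_eq)
    qed
    then show ?thesis unfolding ebdd_def by blast
  qed
  have \<rho>\<eta>: "((\<lambda>t. ip (M t) (\<rho> t) (\<eta> t)) \<longlongrightarrow> 0) F"
  proof -
    have "((\<lambda>t. (\<Sum>l\<in>{1..L} - {j}. ip (M t) (h t l) (h t j) / of_nat (M t)) + ip (M t) (e t) (h t j) / of_nat (M t)) \<longlongrightarrow> 0 + 0) F"
      by (intro tendsto_add tendsto_null_sum h_orth e_orth) auto
    moreover have "(\<Sum>l\<in>{1..L} - {j}. ip (M t) (h t l) (h t j) / of_nat (M t)) + ip (M t) (e t) (h t j) / of_nat (M t) = ip (M t) (\<rho> t) (\<eta> t)" for t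
    proof -
      have sq: "complex_of_real (sqrt (M t)) * complex_of_real (sqrt (M t)) = of_nat (M t)"
        by (simp flip: of_real_mult)
      show ?thesis
        unfolding \<rho>_def[abs_def] \<eta>_def[abs_def] ip_linear
        by (simp add: sq[symmetric] add_divide_distrib sum_divide_distrib)
    qed
    ultimately show ?thesis by simp
  qed
  have \<delta>: "(\<delta> \<longlongrightarrow> 0) F"
  proof -
    have "((\<lambda>t. (nrm (M t) (\<eta> t) + nrm (M t) (\<rho> t)) * nrm (M t) (err t)) \<longlongrightarrow> 0) F"
      using n\<eta>b unfolding n\<eta>_def by (intro null_mult(1)[OF _ err_small] ebdd_add n\<rho>b)
    then have "((\<lambda>t. ip (M t) (\<lambda>i. \<eta> t i + \<rho> t i) (err t)) \<longlongrightarrow> 0) F"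
      by (rule Lim_null_comparison[rotated])
        (intro always_eventually allI order_trans[OF ip_le] mult_right_mono nrm_add nrm_nonneg)
    then have "((\<lambda>t. cnj (A t) * ip (M t) (\<rho> t) (\<eta> t) + ip (M t) (\<lambda>i. \<eta> t i + \<rho> t i) (err t)) \<longlongrightarrow> 0 + 0) F"
      by (intro tendsto_add null_mult(1)[OF ebdd_cnj[OF Ab] \<rho>\<eta>])
    then show ?thesis by (simp add: \<delta>_def[abs_def])
  qed
  have w: "w t i = A t * \<eta> t i + err t i" for t i by (simp add: err_def A_def)
  have ipw: "ip (M t) (\<lambda>i. \<eta> t i + \<rho> t i) (w t) = cnj (A t) * complex_of_real ((n\<eta> t)\<^sup>2) + \<delta> t" for t
  proof -
    have "w t = (\<lambda>i. A t * \<eta> t i + err t i)" using w by auto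
    then have "ip (M t) (\<lambda>i. \<eta> t i + \<rho> t i) (w t) = cnj (A t) * ip (M t) (\<lambda>i. \<eta> t i + \<rho> t i) (\<eta> t) + ip (M t) (\<lambda>i. \<eta> t i + \<rho> t i) (err t)"
      by (simp only: ip_linear(2,4))
    also have "ip (M t) (\<lambda>i. \<eta> t i + \<rho> t i) (\<eta> t) = ip (M t) (\<eta> t) (\<eta> t) + ip (M t) (\<rho> t) (\<eta> t)"
      by (rule ip_linear(1))
    finally show ?thesis by (simp add: \<delta>_def ip_self n\<eta>_def algebra_simps)
  qed
  have Nlim: "((\<lambda>t. N t - (cmod (A t))\<^sup>2 * (n\<eta> t)\<^sup>2) \<longlongrightarrow> 0) F"
  proof -
    define k where "k t = nrm (M t) (w t) - cmod (A t) * n\<eta> t" for t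
    have k: "(k \<longlongrightarrow> 0) F"
    proof (rule Lim_null_comparison[OF _ err_small], intro always_eventually allI)
      fix t
      have "\<bar>nrm (M t) (w t) - nrm (M t) (\<lambda>i. A t * \<eta> t i)\<bar> \<le> nrm (M t) (\<lambda>i. w t i - A t * \<eta> t i)" by (rule nrm_diff_le)
      then show "norm (k t) \<le> nrm (M t) (err t)" by (simp add: k_def nrm_scale n\<eta>_def err_def[abs_def] A_def)
    qed
    have "((\<lambda>t. (k t + 2 * (cmod (A t) * n\<eta> t)) * k t) \<longlongrightarrow> 0) F"
      by (intro null_mult(1)[OF _ k] ebdd_add ebdd_tendsto[OF k] ebdd_mult ebdd_const ebdd_norm Ab n\<eta>b)
    then show ?thesis by (simp add: N_def k_def power2_eq_square algebra_simps)
  qed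
  define c1 where "c1 = \<alpha> j / 2 * c\<^sup>2 / 2"
  have c1: "c1 > 0" using \<alpha>j c by (simp add: c1_def)
  have Nlow: "\<forall>\<^sub>F t in F. c1 \<le> N t"
  proof -
    have "\<forall>\<^sub>F t in F. \<alpha> j / 2 < (cmod (A t))\<^sup>2" using \<alpha>j by (intro order_tendstoD(1)[OF A2]) simp
    moreover have "\<forall>\<^sub>F t in F. - c1 < N t - (cmod (A t))\<^sup>2 * (n\<eta> t)\<^sup>2" using c1 by (intro order_tendstoD(1)[OF Nlim]) simp
    ultimately show ?thesis using c(2)
    proof eventually_elim
      case (elim t)
      have "\<alpha> j / 2 * c\<^sup>2 \<le> (cmod (A t))\<^sup>2 * (n\<eta> t)\<^sup>2"
        using elim c \<alpha>j by (intro mult_mono power_mono) (auto simp: n\<eta>_def)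
      then show ?case using elim(2) by (simp add: c1_def)
    qed
  qed
  have Ninv: "ebdd F (\<lambda>t. 1 / complex_of_real (N t))"
    unfolding ebdd_def
  proof (intro exI[of _ "1 / c1"])
    show "\<forall>\<^sub>F t in F. norm (1 / complex_of_real (N t)) \<le> 1 / c1"
      using Nlow by eventually_elim (use c1 in \<open>auto simp: norm_divide intro!: divide_left_mono\<close>)
  qed
  \<comment> \<open>\<open>k1\<close> and \<open>k2\<close> are the coefficients of the scaled
    estimation error along \<eta> and along \<open>err\<close>. The first tends to 0; for the second
    boundedness suffices.\<close>
  define k1 where "k1 t = 1 / complex_of_real (N t) * (complex_of_real ((cmod (A t))\<^sup>2 * (n\<eta> t)\<^sup>2 - N t) + A t * \<delta> t)" for t
  define k2 where "k2 t = 1 / complex_of_real (N t) * (cnj (A t) * complex_of_real ((n\<eta> t)\<^sup>2) + \<delta> t)" for t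
  have k1: "(k1 \<longlongrightarrow> 0) F"
  proof -
    have "((\<lambda>t. complex_of_real (- (N t - (cmod (A t))\<^sup>2 * (n\<eta> t)\<^sup>2)) + A t * \<delta> t) \<longlongrightarrow> complex_of_real (- 0) + 0) F"
      by (intro tendsto_add tendsto_of_real tendsto_minus Nlim null_mult(1)[OF Ab \<delta>])
    then show ?thesis unfolding k1_def[abs_def] by (intro null_mult(1)[OF Ninv]) simp
  qed
  have k2: "ebdd F k2"
  proof -
    have "ebdd F (\<lambda>t. complex_of_real ((n\<eta> t)\<^sup>2))"
      using ebdd_mult[OF n\<eta>b n\<eta>b] by (simp add: ebdd_def power2_eq_square norm_mult)
    then show ?thesis
      unfolding k2_def[abs_def] by (intro ebdd_mult[OF Ninv] ebdd_add ebdd_mult ebdd_cnj Ab ebdd_tendsto[OF \<delta>])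
  qed
  have le: "\<forall>\<^sub>F t in F. (nrm (M t) (\<lambda>i. est t i - h t j i))\<^sup>2 / (nrm (M t) (h t j))\<^sup>2
      \<le> ((cmod (k1 t) * n\<eta> t + cmod (k2 t) * nrm (M t) (err t)) / c)\<^sup>2"
    using dims Nlow c(2) order_tendstoD(1)[OF a_limits(3) \<alpha>j]
  proof eventually_elim
    case (elim t)
    define m where "m = complex_of_real (sqrt (M t))"
    have m: "m \<noteq> 0" "m * m = of_nat (M t)" "cmod m = sqrt (M t)" using elim by (auto simp: m_def simp flip: of_real_mult)
    have N0: "N t > 0" using elim c1 by linarith
    have \<Lambda>0: "complex_of_real (\<Lambda> t) \<noteq> 0" using elim by simp
    have h\<eta>: "h t j = (\<lambda>i. m * \<eta> t i)" using m by (auto simp: \<eta>_def m_def)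
    have q: "q t = (\<lambda>i. m * (\<eta> t i + \<rho> t i))"
    proof
      fix i
      have "(\<Sum>l=1..L. h t l i) = h t j i + (\<Sum>l\<in>{1..L} - {j}. h t l i)"
        using j by (subst sum.remove[of _ j]) auto
      then show "q t i = m * (\<eta> t i + \<rho> t i)" using m by (simp add: q_def \<eta>_def \<rho>_def m_def distrib_left add_divide_distrib)
    qed
    have wp: "w t = (\<lambda>i. complex_of_real (\<Lambda> t) * p t i)" by (auto simp: w_def)
    have Np: "complex_of_real (N t) = complex_of_real (\<Lambda> t) * complex_of_real (\<Lambda> t) * complex_of_real ((nrm (M t) (p t))\<^sup>2)"
      unfolding N_def wp nrm_scale using elim by (simp add: power_mult_distrib power2_eq_square)
    then have p0: "complex_of_real ((nrm (M t) (p t))\<^sup>2) \<noteq> 0" using N0 by auto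
    have est: "est t i = m * (w t i * ip (M t) (\<lambda>i. \<eta> t i + \<rho> t i) (w t) / complex_of_real (N t))" for i
    proof -
      have "ip (M t) (\<lambda>i. \<eta> t i + \<rho> t i) (w t) = complex_of_real (\<Lambda> t) * ip (M t) (\<lambda>i. \<eta> t i + \<rho> t i) (p t)"
        unfolding wp ip_linear(4) by simp
      moreover have "ip (M t) (q t) (p t) = m * ip (M t) (\<lambda>i. \<eta> t i + \<rho> t i) (p t)"
        unfolding q by (rule ip_linear(3))
      ultimately show ?thesis unfolding est_def w_def Np using \<Lambda>0 p0 by (simp add: field_simps)
    qed
    have diff: "est t i - h t j i = m * (k1 t * \<eta> t i + k2 t * err t i)" for i
    proof -
      have "k1 t * \<eta> t i + k2 t * err t i = w t i * (cnj (A t) * complex_of_real ((n\<eta> t)\<^sup>2) + \<delta> t) / complex_of_real (N t) - \<eta> t i"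
      proof -
        have "complex_of_real ((cmod (A t))\<^sup>2) = A t * cnj (A t)" by (rule complex_norm_square)
        then show ?thesis unfolding k1_def k2_def w using N0 by (simp add: field_simps)
      qed
      then show ?thesis unfolding est ipw h\<eta> by (simp add: right_diff_distrib)
    qed
    have "nrm (M t) (\<lambda>i. est t i - h t j i) = sqrt (M t) * nrm (M t) (\<lambda>i. k1 t * \<eta> t i + k2 t * err t i)"
      unfolding diff nrm_scale m(3) ..
    moreover have "nrm (M t) (h t j) = sqrt (M t) * n\<eta> t" unfolding h\<eta> nrm_scale m(3) n\<eta>_def ..
    ultimately have "(nrm (M t) (\<lambda>i. est t i - h t j i))\<^sup>2 / (nrm (M t) (h t j))\<^sup>2 = (nrm (M t) (\<lambda>i. k1 t * \<eta> t i + k2 t * err t i) / n\<eta> t)\<^sup>2"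
      using elim by (simp add: power_mult_distrib power_divide)
    also have "\<dots> \<le> ((cmod (k1 t) * n\<eta> t + cmod (k2 t) * nrm (M t) (err t)) / c)\<^sup>2"
    proof (intro power_mono frac_le)
      show "nrm (M t) (\<lambda>i. k1 t * \<eta> t i + k2 t * err t i) \<le> cmod (k1 t) * n\<eta> t + cmod (k2 t) * nrm (M t) (err t)"
        by (rule order_trans[OF nrm_add]) (simp add: nrm_scale n\<eta>_def)
    qed (use elim c in \<open>auto simp: n\<eta>_def\<close>)
    finally show ?case .
  qed
  have lim: "((\<lambda>t. ((cmod (k1 t) * n\<eta> t + cmod (k2 t) * nrm (M t) (err t)) / c)\<^sup>2) \<longlongrightarrow> 0) F"
  proof -
    have "((\<lambda>t. ((cmod (k1 t) * n\<eta> t + cmod (k2 t) * nrm (M t) (err t)) / c)\<^sup>2) \<longlongrightarrow> ((0 + 0) / c)\<^sup>2) F"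
      using c by (intro tendsto_power tendsto_divide tendsto_add tendsto_const null_mult(2)[OF n\<eta>b tendsto_norm_zero[OF k1]]
        null_mult(1)[OF ebdd_norm[OF k2] err_small]) auto
    then show ?thesis by simp
  qed
  show ?thesis
  proof (rule Lim_null_comparison[OF _ lim])
    show "\<forall>\<^sub>F t in F. norm ((nrm (M t) (\<lambda>i. est t i - h t j i))\<^sup>2 / (nrm (M t) (h t j))\<^sup>2)
        \<le> ((cmod (k1 t) * n\<eta> t + cmod (k2 t) * nrm (M t) (err t)) / c)\<^sup>2"
      using le by simp
  qed
qed

end

section \<open>Limits in the signal model\<close>

context prob_space begin

text \<open>One term of the exponential series at \<open>s = 1 / (2 v)\<close>, where the
  exponential moment is 2, gives \<open>2 * 2! * (2 v)^2 = 16 v^2\<close> and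
  \<open>2 * 4! * (2 v)^4 = 768 v^4\<close>; centring adds \<open>v^4\<close>.\<close>

lemma CN_fourth_moments:
  assumes d: "distributed M lborel X (CN_density v)" and v: "v > 0"
  shows "expectation (\<lambda>\<omega>. cmod (X \<omega>) ^ 4) \<le> 16 * v\<^sup>2"
    "expectation (\<lambda>\<omega>. ((cmod (X \<omega>))\<^sup>2 - v) ^ 4) \<le> 769 * v ^ 4"
proof -
  define s where "s = 1 / (2 * v)"
  have s: "s > 0" "s < 1 / v" "s * v = 1 / 2" using v by (simp_all add: s_def field_simps)
  note e = CN_exp_expectation[OF d v s(2)]
  have X: "all_moments M X" by (rule CN_all_moments[OF d v])
  have pw: "y ^ k \<le> fact k / s ^ k * exp (s * y)" if "y \<ge> 0" for y :: real and k
  proof -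
    have "(\<Sum>n\<in>{k}. (s * y) ^ n /\<^sub>R fact n) \<le> exp (s * y)"
      unfolding exp_def using s that by (intro sum_le_suminf summable_exp_generic) auto
    then have "(s * y) ^ k \<le> fact k * exp (s * y)" by (simp add: field_simps)
    then show ?thesis using s by (simp add: power_mult_distrib field_simps)
  qed
  have mom: "expectation (\<lambda>\<omega>. ((cmod (X \<omega>))\<^sup>2) ^ k) \<le> fact k / s ^ k * 2" for k
  proof -
    have "expectation (\<lambda>\<omega>. ((cmod (X \<omega>))\<^sup>2) ^ k) \<le> expectation (\<lambda>\<omega>. fact k / s ^ k * exp (s * (cmod (X \<omega>))\<^sup>2))"
    proof (rule integral_mono)
      show "integrable M (\<lambda>\<omega>. ((cmod (X \<omega>))\<^sup>2) ^ k)" by (intro all_momentsD(3) all_moments_intros X)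
      show "integrable M (\<lambda>\<omega>. fact k / s ^ k * exp (s * (cmod (X \<omega>))\<^sup>2))" by (intro integrable_mult_right e(1))
      show "((cmod (X \<omega>))\<^sup>2) ^ k \<le> fact k / s ^ k * exp (s * (cmod (X \<omega>))\<^sup>2)" for \<omega> by (rule pw) simp
    qed
    then show ?thesis using e(2) s(3) by simp
  qed
  show "expectation (\<lambda>\<omega>. cmod (X \<omega>) ^ 4) \<le> 16 * v\<^sup>2"
    using mom[of 2] by (simp add: s_def power_mult_distrib power_divide flip: power_mult)
  have "expectation (\<lambda>\<omega>. ((cmod (X \<omega>))\<^sup>2 - v) ^ 4) \<le> expectation (\<lambda>\<omega>. ((cmod (X \<omega>))\<^sup>2) ^ 4 + v ^ 4)"
  proof (intro integral_mono all_momentsD(3) all_moments_intros X)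
    fix \<omega>
    have le: "(y - v) ^ 4 \<le> y ^ 4 + v ^ 4" if "y \<ge> 0" for y
    proof -
      have "(y - v) ^ 4 = \<bar>y - v\<bar> ^ 4" by simp
      also have "\<dots> \<le> (max y v) ^ 4" using that v by (intro power_mono) auto
      also have "\<dots> \<le> y ^ 4 + v ^ 4" using that v by (simp add: max_def)
      finally show ?thesis .
    qed
    show "((cmod (X \<omega>))\<^sup>2 - v) ^ 4 \<le> ((cmod (X \<omega>))\<^sup>2) ^ 4 + v ^ 4" by (rule le) simp
  qed
  also have "\<dots> = expectation (\<lambda>\<omega>. ((cmod (X \<omega>))\<^sup>2) ^ 4) + v ^ 4"
  proof -
    have "integrable M (\<lambda>\<omega>. ((cmod (X \<omega>))\<^sup>2) ^ 4)" by (intro all_momentsD(3) all_moments_intros X)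
    then show ?thesis by (simp add: prob_space)
  qed
  also have "\<dots> \<le> 769 * v ^ 4"
    using mom[of 4] by (simp add: s_def power_mult_distrib power_divide fact_numeral)
  finally show "expectation (\<lambda>\<omega>. ((cmod (X \<omega>))\<^sup>2 - v) ^ 4) \<le> 769 * v ^ 4" .
qed

text \<open>The fourth moment of the centred form is of order \<open>n^2\<close>; divided by
  \<open>n^4\<close> it is summable, and \<open>AE_tendsto_zero_of_summable\<close> finishes without
  any relation between different \<open>n\<close>. The variables must be Gaussian only to supply
  uniform moment bounds.\<close>

lemma quadratic_form_limit:
  fixes \<xi> :: "nat \<Rightarrow> 'i \<Rightarrow> 'a \<Rightarrow> complex" and a :: "nat \<Rightarrow> 'i \<Rightarrow> 'i \<Rightarrow> complex" and m :: "'i \<Rightarrow> real"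
  assumes ind: "\<And>n. n \<ge> 1 \<Longrightarrow> indep_vars (\<lambda>_. borel) (\<xi> n) (I n)" and fin: "\<And>n. n \<ge> 1 \<Longrightarrow> finite (I n)"
    and card: "\<And>n. n \<ge> 1 \<Longrightarrow> card (I n) \<le> k * n"
    and dist: "\<And>n i. n \<ge> 1 \<Longrightarrow> i \<in> I n \<Longrightarrow> distributed M lborel (\<xi> n i) (CN_density (m i))"
    and m: "\<And>n i. n \<ge> 1 \<Longrightarrow> i \<in> I n \<Longrightarrow> 0 < m i \<and> m i \<le> V"
    and row: "\<And>n i. n \<ge> 1 \<Longrightarrow> i \<in> I n \<Longrightarrow> (\<Sum>k\<in>I n. (cmod (a n i k))\<^sup>2) \<le> \<kappa>"
    and col: "\<And>n i. n \<ge> 1 \<Longrightarrow> i \<in> I n \<Longrightarrow> (\<Sum>k\<in>I n. (cmod (a n k i))\<^sup>2) \<le> \<kappa>"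
  shows "AE \<omega> in M. (\<lambda>n. ((\<Sum>i\<in>I n. \<Sum>k\<in>I n. a n i k * cnj (\<xi> n i \<omega>) * \<xi> n k \<omega>)
      - (\<Sum>i\<in>I n. a n i i * complex_of_real (m i))) / of_nat n) \<longlonglongrightarrow> 0"
proof -
  define S where "S n \<omega> = (\<Sum>i\<in>I n. \<Sum>k\<in>I n. a n i k * cnj (\<xi> n i \<omega>) * \<xi> n k \<omega>)
      - (\<Sum>i\<in>I n. a n i i * complex_of_real (m i))" for n \<omega>
  define K where "K = 1 + \<bar>V\<bar> + 16 * V\<^sup>2 + 769 * V ^ 4"
  have Sb: "all_moments M (S n)"
    "expectation (\<lambda>\<omega>. cmod (S n \<omega>) ^ 4) \<le> 167616 * K ^ 3 * \<kappa>\<^sup>2 * (real (card (I n)))\<^sup>2" if n: "n \<ge> 1" for n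
  proof -
    note d = dist[OF n] and mp = m[OF n]
    have V: "0 \<le> 16 * V\<^sup>2" "0 \<le> 769 * V ^ 4" "0 \<le> \<bar>V\<bar>" by auto
    have K1: "m i \<le> K" if "i \<in> I n" for i using mp[OF that] V unfolding K_def by linarith
    have K2: "expectation (\<lambda>\<omega>. cmod (\<xi> n i \<omega>) ^ 4) \<le> K" if i: "i \<in> I n" for i
    proof -
      have "expectation (\<lambda>\<omega>. cmod (\<xi> n i \<omega>) ^ 4) \<le> 16 * (m i)\<^sup>2" using CN_fourth_moments(1)[OF d[OF i]] mp[OF i] by simp
      also have "\<dots> \<le> 16 * V\<^sup>2" using mp[OF i] by (intro mult_left_mono power_mono) auto
      also have "\<dots> \<le> K" using V unfolding K_def by linarith
      finally show ?thesis .
    qed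
    have K3: "expectation (\<lambda>\<omega>. ((cmod (\<xi> n i \<omega>))\<^sup>2 - m i) ^ 4) \<le> K" if i: "i \<in> I n" for i
    proof -
      have "expectation (\<lambda>\<omega>. ((cmod (\<xi> n i \<omega>))\<^sup>2 - m i) ^ 4) \<le> 769 * (m i) ^ 4" using CN_fourth_moments(2)[OF d[OF i]] mp[OF i] by simp
      also have "\<dots> \<le> 769 * V ^ 4" using mp[OF i] by (intro mult_left_mono power_mono) auto
      also have "\<dots> \<le> K" using V unfolding K_def by linarith
      finally show ?thesis .
    qed
    have K0: "1 \<le> K" using V unfolding K_def by linarith
    have mom: "all_moments M (\<xi> n i)" "expectation (\<xi> n i) = 0" "expectation (\<lambda>\<omega>. (cmod (\<xi> n i \<omega>))\<^sup>2) = m i"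
      if i: "i \<in> I n" for i
      using CN_all_moments[OF d[OF i]] CN_mean[OF d[OF i]] CN_variance[OF d[OF i]] mp[OF i] by simp_all
    show "all_moments M (S n)"
      unfolding S_def by (rule quadratic_form_fourth_moment(1)[OF ind[OF n] fin[OF n] mom K0 K1 K2 K3 row[OF n] col[OF n]])
    show "expectation (\<lambda>\<omega>. cmod (S n \<omega>) ^ 4) \<le> 167616 * K ^ 3 * \<kappa>\<^sup>2 * (real (card (I n)))\<^sup>2"
      unfolding S_def by (rule quadratic_form_fourth_moment(2)[OF ind[OF n] fin[OF n] mom K0 K1 K2 K3 row[OF n] col[OF n]])
  qed
  \<comment> \<open>Shifted by one: the moment bounds are available for dimensions at least 1, and
    the divisor must not be 0.\<close>
  define f where "f n \<omega> = cmod (S (Suc n) \<omega>) ^ 4 / real (Suc n) ^ 4" for n \<omega>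
  have "AE \<omega> in M. (\<lambda>n. f n \<omega>) \<longlonglongrightarrow> 0"
  proof (rule AE_tendsto_zero_of_summable)
    show "integrable M (f n)" for n
      unfolding f_def using all_momentsD(2)[OF Sb(1)[of "Suc n"]] by simp
    show "0 \<le> f n \<omega>" for n \<omega> by (simp add: f_def)
    define B where "B = 167616 * K ^ 3 * \<kappa>\<^sup>2 * (real k)\<^sup>2"
    have up: "expectation (f n) \<le> B * (1 / real (Suc n) ^ 2)" for n
    proof -
      have "expectation (f n) = expectation (\<lambda>\<omega>. cmod (S (Suc n) \<omega>) ^ 4) / real (Suc n) ^ 4"
        unfolding f_def by (rule integral_divide_zero)
      also have "\<dots> \<le> 167616 * K ^ 3 * \<kappa>\<^sup>2 * (real (card (I (Suc n))))\<^sup>2 / real (Suc n) ^ 4"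
        by (intro divide_right_mono Sb(2)) auto
      also have "\<dots> \<le> 167616 * K ^ 3 * \<kappa>\<^sup>2 * (real (k * Suc n))\<^sup>2 / real (Suc n) ^ 4"
      proof (intro divide_right_mono mult_left_mono power_mono)
        show "real (card (I (Suc n))) \<le> real (k * Suc n)" using card[of "Suc n"] by (simp only: of_nat_le_iff)
        have "0 \<le> K" by (simp add: K_def)
        then show "0 \<le> 167616 * K ^ 3 * \<kappa>\<^sup>2" by simp
      qed auto
      also have "\<dots> = B * (1 / real (Suc n) ^ 2)"
      proof -
        define y where "y = real (Suc n)"
        have "y > 0" by (simp add: y_def)
        then have "167616 * K ^ 3 * \<kappa>\<^sup>2 * (real k * y)\<^sup>2 / y ^ 4 = B * (1 / y\<^sup>2)"
          by (simp add: B_def power_mult_distrib power4_eq_xxxx power2_eq_square)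
        then show ?thesis by (simp only: y_def of_nat_mult)
      qed
      finally show ?thesis .
    qed
    have sm: "summable (\<lambda>n. B * (1 / real (Suc n) ^ 2))"
    proof -
      have "summable (\<lambda>n. inverse (real n ^ 2))" by (rule inverse_power_summable) simp
      from iffD2[OF summable_Suc_iff this] show ?thesis unfolding inverse_eq_divide by (rule summable_mult)
    qed
    have low: "0 \<le> expectation (f n)" for n by (intro integral_nonneg_AE) (simp add: f_def)
    show "summable (\<lambda>n. expectation (f n))"
    proof (rule summable_comparison_test'[OF sm])
      fix n :: nat
      show "norm (expectation (f n)) \<le> B * (1 / real (Suc n) ^ 2)"
        unfolding real_norm_def abs_of_nonneg[OF low] by (rule up)
    qed
  qed
  then show ?thesis
  proof eventually_elim
    case (elim \<omega>)
    have "(\<lambda>n. sqrt (sqrt (f n \<omega>))) \<longlonglongrightarrow> sqrt (sqrt 0)" by (intro tendsto_real_sqrt elim)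
    moreover have "sqrt (sqrt (f n \<omega>)) = cmod (S (Suc n) \<omega> / of_nat (Suc n))" for n
    proof -
      have "f n \<omega> = ((cmod (S (Suc n) \<omega> / of_nat (Suc n)))\<^sup>2)\<^sup>2"
        unfolding f_def norm_divide norm_of_nat by (simp add: power_divide flip: power_mult)
      then show ?thesis by (simp only: real_sqrt_abs abs_power2 abs_norm_cancel)
    qed
    ultimately have "(\<lambda>n. S (Suc n) \<omega> / of_nat (Suc n)) \<longlonglongrightarrow> 0"
      by (simp only: real_sqrt_zero tendsto_norm_zero_iff)
    then have "(\<lambda>n. S n \<omega> / of_nat n) \<longlonglongrightarrow> 0" by (simp only: filterlim_sequentially_Suc[of "\<lambda>n. S n \<omega> / of_nat n"])
    then show ?case by (simp only: S_def)
  qed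
qed

end

text \<open>The Gaussian sources that do not depend on the number of data symbols.\<close>

definition gsources :: "nat \<Rightarrow> nat \<Rightarrow> nat \<Rightarrow> source set" where
  "gsources L M \<tau> = (\<lambda>(l, i). Chan l i) ` ({1..L} \<times> {..<M}) \<union> (\<lambda>(i, t). PilotNoise i t) ` ({..<M} \<times> {..<\<tau>})"

lemma gsources_iff [simp]:
  "Chan l i \<in> gsources L M \<tau> \<longleftrightarrow> l \<in> {1..L} \<and> i < M" "PilotNoise i t \<in> gsources L M \<tau> \<longleftrightarrow> i < M \<and> t < \<tau>"
  "Sym l c \<notin> gsources L M \<tau>" "DataNoise i c \<notin> gsources L M \<tau>"
  by (auto simp: gsources_def image_iff)

lemma finite_gsources: "finite (gsources L M \<tau>)"
  by (simp add: gsources_def)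

lemma sum_gsources:
  "sum f (gsources L M \<tau>) = (\<Sum>l\<in>{1..L}. \<Sum>i<M. f (Chan l i)) + (\<Sum>i<M. \<Sum>t<\<tau>. f (PilotNoise i t))"
proof -
  have "sum f (gsources L M \<tau>) = sum f ((\<lambda>(l, i). Chan l i) ` ({1..L} \<times> {..<M})) + sum f ((\<lambda>(i, t). PilotNoise i t) ` ({..<M} \<times> {..<\<tau>}))"
    unfolding gsources_def by (rule sum.union_disjoint) auto
  also have "sum f ((\<lambda>(l, i). Chan l i) ` ({1..L} \<times> {..<M})) = (\<Sum>l\<in>{1..L}. \<Sum>i<M. f (Chan l i))"
    by (subst sum.reindex) (auto simp: inj_on_def sum.cartesian_product case_prod_unfold intro!: sum.cong)
  also have "sum f ((\<lambda>(i, t). PilotNoise i t) ` ({..<M} \<times> {..<\<tau>})) = (\<Sum>i<M. \<Sum>t<\<tau>. f (PilotNoise i t))"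
    by (subst sum.reindex) (auto simp: inj_on_def sum.cartesian_product case_prod_unfold intro!: sum.cong)
  finally show ?thesis .
qed

lemma sum_gsources_Chan:
  assumes "l \<in> {1..L}" "\<And>s. (\<And>p. s \<noteq> Chan l p) \<Longrightarrow> f s = 0"
  shows "sum f (gsources L M \<tau>) = (\<Sum>p<M. f (Chan l p))"
proof -
  have z: "f (PilotNoise i t) = 0" for i t by (rule assms(2)) simp
  have "(\<Sum>l'\<in>{1..L}. \<Sum>i<M. f (Chan l' i)) = (\<Sum>l'\<in>{1..L}. if l' = l then \<Sum>p<M. f (Chan l p) else 0)"
    by (intro sum.cong refl) (auto intro!: sum.neutral assms(2))
  then show ?thesis using assms(1) unfolding sum_gsources z by simp
qed

lemma sum_gsources_PilotNoise:
  assumes "\<And>l p. f (Chan l p) = 0"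
  shows "sum f (gsources L M \<tau>) = (\<Sum>i<M. \<Sum>t<\<tau>. f (PilotNoise i t))"
  by (simp add: sum_gsources assms)

lemma card_gsources: "card (gsources L M \<tau>) = (L + \<tau>) * M"
  using sum_gsources[of "\<lambda>_. 1 :: nat" L M \<tau>] by (simp add: algebra_simps)

lemma gsources_subset: "gsources L M \<tau> \<subseteq> sources L M \<tau> C"
  by (auto simp: gsources_def sources_def)

text \<open>The value 1 outside channels and pilot noise is a default: \<open>gsources\<close>
  contains these two kinds only.\<close>

definition source_variance :: "real \<Rightarrow> source \<Rightarrow> real" where
  "source_variance \<sigma> s = (case s of PilotNoise i t \<Rightarrow> \<sigma>\<^sup>2 | _ \<Rightarrow> 1)"

lemma source_variance_simps [simp]:
  "source_variance \<sigma> (Chan l i) = 1" "source_variance \<sigma> (PilotNoise i t) = \<sigma>\<^sup>2"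
  "source_variance \<sigma> (Sym l c) = 1" "source_variance \<sigma> (DataNoise i c) = 1"
  by (simp_all add: source_variance_def)

lemma mimo_modelD:
  assumes "mimo_model P L \<tau> \<sigma> hW x N Z"
  shows "prob_space P"
    "n \<ge> 1 \<Longrightarrow> C \<ge> 1 \<Longrightarrow> prob_space.indep_vars P (\<lambda>_. borel) (source_var (hW n) x (N n) (Z n C)) (sources L n \<tau> C)"
    "n \<ge> 1 \<Longrightarrow> l \<in> {1..L} \<Longrightarrow> i < n \<Longrightarrow> distributed P lborel (hW n l i) (CN_density 1)"
    "n \<ge> 1 \<Longrightarrow> i < n \<Longrightarrow> t < \<tau> \<Longrightarrow> distributed P lborel (N n i t) (CN_density (\<sigma>\<^sup>2))"
    "n \<ge> 1 \<Longrightarrow> C \<ge> 1 \<Longrightarrow> i < n \<Longrightarrow> c < C \<Longrightarrow> distributed P lborel (Z n C i c) (CN_density (\<sigma>\<^sup>2))"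
    "l \<in> {1..L} \<Longrightarrow> l' \<in> {1..L} \<Longrightarrow> distr P borel (x l c) = distr P borel (x l' c')"
    "l \<in> {1..L} \<Longrightarrow> integrable P (\<lambda>\<omega>. (cmod (x l c \<omega>))\<^sup>2)"
    "l \<in> {1..L} \<Longrightarrow> prob_space.expectation P (x l c) = 0"
    "l \<in> {1..L} \<Longrightarrow> prob_space.expectation P (\<lambda>\<omega>. (cmod (x l c \<omega>))\<^sup>2) = 1"
proof -
  note m = assms[unfolded mimo_model_def]
  note 1 = m[THEN conjunct1]
  note 2 = m[THEN conjunct2, THEN conjunct1]
  note 3 = m[THEN conjunct2, THEN conjunct2, THEN conjunct1]
  note 4 = m[THEN conjunct2, THEN conjunct2, THEN conjunct2, THEN conjunct1]
  note 5 = m[THEN conjunct2, THEN conjunct2, THEN conjunct2, THEN conjunct2, THEN conjunct1]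
  note 6 = m[THEN conjunct2, THEN conjunct2, THEN conjunct2, THEN conjunct2, THEN conjunct2, THEN conjunct1]
  note 7 = m[THEN conjunct2, THEN conjunct2, THEN conjunct2, THEN conjunct2, THEN conjunct2, THEN conjunct2]
  show "prob_space P" by (rule 1)
  show "prob_space.indep_vars P (\<lambda>_. borel) (source_var (hW n) x (N n) (Z n C)) (sources L n \<tau> C)"
    if "n \<ge> 1" "C \<ge> 1" by (rule 2[rule_format, OF that])
  show "distributed P lborel (hW n l i) (CN_density 1)" if "n \<ge> 1" "l \<in> {1..L}" "i < n"
    by (rule 3[rule_format, OF that])
  show "distributed P lborel (N n i t) (CN_density (\<sigma>\<^sup>2))" if "n \<ge> 1" "i < n" "t < \<tau>"
    by (rule 4[rule_format, OF that])
  show "distributed P lborel (Z n C i c) (CN_density (\<sigma>\<^sup>2))" if "n \<ge> 1" "C \<ge> 1" "i < n" "c < C"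
    by (rule 5[rule_format, OF that])
  show "distr P borel (x l c) = distr P borel (x l' c')" if "l \<in> {1..L}" "l' \<in> {1..L}"
    by (rule 6[rule_format, OF that])
  assume l: "l \<in> {1..L}"
  note 8 = bspec[OF 7 l, THEN spec, of c]
  show "integrable P (\<lambda>\<omega>. (cmod (x l c \<omega>))\<^sup>2)" by (rule 8[THEN conjunct1])
  show "prob_space.expectation P (x l c) = 0" by (rule 8[THEN conjunct2, THEN conjunct1])
  show "prob_space.expectation P (\<lambda>\<omega>. (cmod (x l c \<omega>))\<^sup>2) = 1" by (rule 8[THEN conjunct2, THEN conjunct2])
qed

text \<open>Independence of the sources is taken from the model with a single data symbol and
  restricted to \<open>gsources\<close>. These variables are the same for every \<open>C\<close>, so
  one almost sure event serves all of them.\<close>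

lemma mimo_quadratic_limit:
  assumes model: "mimo_model P L \<tau> \<sigma> hW x N Z" and \<sigma>: "\<sigma>\<^sup>2 > 0"
    and row: "\<And>n i. n \<ge> 1 \<Longrightarrow> i \<in> gsources L n \<tau> \<Longrightarrow> (\<Sum>k\<in>gsources L n \<tau>. (cmod (a n i k))\<^sup>2) \<le> \<kappa>"
    and col: "\<And>n i. n \<ge> 1 \<Longrightarrow> i \<in> gsources L n \<tau> \<Longrightarrow> (\<Sum>k\<in>gsources L n \<tau>. (cmod (a n k i))\<^sup>2) \<le> \<kappa>"
  defines "\<xi> \<equiv> \<lambda>n. source_var (hW n) x (N n) (Z n 1)"
  shows "AE \<omega> in P. (\<lambda>n. ((\<Sum>i\<in>gsources L n \<tau>. \<Sum>k\<in>gsources L n \<tau>. a n i k * cnj (\<xi> n i \<omega>) * \<xi> n k \<omega>)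
      - (\<Sum>i\<in>gsources L n \<tau>. a n i i * complex_of_real (source_variance \<sigma> i))) / of_nat n) \<longlonglongrightarrow> 0"
proof -
  interpret prob_space P by (rule mimo_modelD(1)[OF model])
  show ?thesis
  proof (rule quadratic_form_limit[where \<xi> = \<xi> and I = "\<lambda>n. gsources L n \<tau>" and a = a
        and m = "source_variance \<sigma>" and k = "L + \<tau>" and V = "max 1 (\<sigma>\<^sup>2)" and \<kappa> = \<kappa>])
    fix n :: nat assume n: "n \<ge> 1"
    show "indep_vars (\<lambda>_. borel) (\<xi> n) (gsources L n \<tau>)"
      unfolding \<xi>_def by (rule indep_vars_subset[OF mimo_modelD(2)[OF model n order_refl] gsources_subset])
    show "finite (gsources L n \<tau>)" by (rule finite_gsources)
    show "card (gsources L n \<tau>) \<le> (L + \<tau>) * n" by (simp add: card_gsources)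
    fix i assume i: "i \<in> gsources L n \<tau>"
    show "distributed P lborel (\<xi> n i) (CN_density (source_variance \<sigma> i))"
    proof (cases i)
      case (Chan l p)
      then show ?thesis using mimo_modelD(3)[OF model n, of l p] i by (simp add: \<xi>_def)
    next
      case (PilotNoise p t)
      then show ?thesis using mimo_modelD(4)[OF model n, of p t] i by (simp add: \<xi>_def)
    qed (use i in simp_all)
    show "0 < source_variance \<sigma> i \<and> source_variance \<sigma> i \<le> max 1 (\<sigma>\<^sup>2)"
      using \<sigma> by (cases i) auto
    show "(\<Sum>k\<in>gsources L n \<tau>. (cmod (a n i k))\<^sup>2) \<le> \<kappa>" by (rule row[OF n i])
    show "(\<Sum>k\<in>gsources L n \<tau>. (cmod (a n k i))\<^sup>2) \<le> \<kappa>" by (rule col[OF n i])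
  qed
qed

text \<open>Columns are images of unit vectors, and rows are columns of the adjoint. This converts
  an operator bound into the row and column sums that the moment estimate asks for.\<close>

lemma operator_bound_entries:
  assumes B: "B \<in> carrier_mat n n" and k: "0 \<le> k"
    and bd: "\<And>v. v \<in> carrier_vec n \<Longrightarrow> norm2 (B *\<^sub>v v) \<le> k * norm2 v" and q: "q < n"
  shows "(\<Sum>p<n. (cmod (B $$ (p, q)))\<^sup>2) \<le> k\<^sup>2" "(\<Sum>p<n. (cmod (B $$ (q, p)))\<^sup>2) \<le> k\<^sup>2"
proof -
  have unit: "norm2 (unit_vec n q) = 1"
    using q by (simp add: norm2_def if_distrib[of cmod] if_distrib[of "\<lambda>x. x ^ 2"] sum.delta cong: if_cong)
  have *: "(\<Sum>p<n. (cmod (A $$ (p, q)))\<^sup>2) \<le> k\<^sup>2"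
    if A: "A \<in> carrier_mat n n" and le: "norm2 (A *\<^sub>v unit_vec n q) \<le> k * norm2 (unit_vec n q)" for A
  proof -
    have "col A q = A *\<^sub>v unit_vec n q"
      using col_mult2[OF A one_carrier_mat q] A q by simp
    then have "(norm2 (col A q))\<^sup>2 \<le> k\<^sup>2" using le unit by (intro power_mono) auto
    moreover have "(norm2 (col A q))\<^sup>2 = (\<Sum>p<n. (cmod (A $$ (p, q)))\<^sup>2)"
      using A q by (simp add: norm2_def sum_nonneg)
    ultimately show ?thesis by simp
  qed
  show "(\<Sum>p<n. (cmod (B $$ (p, q)))\<^sup>2) \<le> k\<^sup>2" by (rule *[OF B bd]) simp
  have "(\<Sum>p<n. (cmod (mat_adjoint B $$ (p, q)))\<^sup>2) \<le> k\<^sup>2"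
    using k by (intro * adj_carrier[OF B] adjoint_bound[OF B _ k bd]) auto
  then show "(\<Sum>p<n. (cmod (B $$ (q, p)))\<^sup>2) \<le> k\<^sup>2" using B q by simp
qed

text \<open>The bilinear form is a quadratic form over all sources whose matrix is
  \<open>B n\<close> in the block of users \<open>l\<close> and \<open>k\<close> and 0 elsewhere.
  Its diagonal meets this block only for \<open>l = k\<close>, which is where the trace comes
  from.\<close>

lemma channel_form_limit:
  assumes model: "mimo_model P L \<tau> \<sigma> hW x N Z" and \<sigma>: "\<sigma>\<^sup>2 > 0"
    and l: "l \<in> {1..L}" "k \<in> {1..L}"
    and B: "\<And>n. n \<ge> 1 \<Longrightarrow> B n \<in> carrier_mat n n" and K: "0 \<le> K"
    and bd: "\<And>n v. n \<ge> 1 \<Longrightarrow> v \<in> carrier_vec n \<Longrightarrow> norm2 (B n *\<^sub>v v) \<le> K * norm2 v"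
  shows "AE \<omega> in P. (\<lambda>n. ((B n *\<^sub>v vec n (\<lambda>i. hW n k i \<omega>)) \<bullet>c vec n (\<lambda>i. hW n l i \<omega>)
     - (if l = k then mtrace (B n) else 0)) / of_nat n) \<longlonglongrightarrow> 0"
proof -
  define a where "a n s s' = (case s of Chan l' p \<Rightarrow> (case s' of Chan k' q \<Rightarrow>
      (if l' = l \<and> k' = k then B n $$ (p, q) else 0) | _ \<Rightarrow> 0) | _ \<Rightarrow> 0)" for n s s'
  have "AE \<omega> in P. (\<lambda>n. ((\<Sum>i\<in>gsources L n \<tau>. \<Sum>k\<in>gsources L n \<tau>. a n i k * cnj (source_var (hW n) x (N n) (Z n 1) i \<omega>) * source_var (hW n) x (N n) (Z n 1) k \<omega>)
      - (\<Sum>i\<in>gsources L n \<tau>. a n i i * complex_of_real (source_variance \<sigma> i))) / of_nat n) \<longlonglongrightarrow> 0"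
  proof (rule mimo_quadratic_limit[OF model \<sigma>, of a "K\<^sup>2"])
    fix n :: nat and i assume n: "n \<ge> 1" and i: "i \<in> gsources L n \<tau>"
    note ent = operator_bound_entries[OF B[OF n] K bd[OF n]]
    show "(\<Sum>k\<in>gsources L n \<tau>. (cmod (a n i k))\<^sup>2) \<le> K\<^sup>2"
    proof (cases "\<exists>p. i = Chan l p")
      case True
      then obtain p where p: "i = Chan l p" by blast
      have "(\<Sum>k'\<in>gsources L n \<tau>. (cmod (a n i k'))\<^sup>2) = (\<Sum>q<n. (cmod (a n i (Chan k q)))\<^sup>2)"
        by (rule sum_gsources_Chan[OF l(2)]) (auto simp: a_def split: source.splits)
      also have "\<dots> = (\<Sum>q<n. (cmod (B n $$ (p, q)))\<^sup>2)" by (simp add: a_def p)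
      also have "\<dots> \<le> K\<^sup>2" using i p by (intro ent) auto
      finally show ?thesis .
    next
      case False
      then have "a n i k = 0" for k by (auto simp: a_def split: source.splits)
      then show ?thesis by simp
    qed
    show "(\<Sum>k\<in>gsources L n \<tau>. (cmod (a n k i))\<^sup>2) \<le> K\<^sup>2"
    proof (cases "\<exists>p. i = Chan k p")
      case True
      then obtain p where p: "i = Chan k p" by blast
      have "(\<Sum>k'\<in>gsources L n \<tau>. (cmod (a n k' i))\<^sup>2) = (\<Sum>q<n. (cmod (a n (Chan l q) i))\<^sup>2)"
        by (rule sum_gsources_Chan[OF l(1)]) (auto simp: a_def split: source.splits)
      also have "\<dots> = (\<Sum>q<n. (cmod (B n $$ (q, p)))\<^sup>2)" by (simp add: a_def p)
      also have "\<dots> \<le> K\<^sup>2" using i p by (intro ent) auto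
      finally show ?thesis .
    next
      case False
      then have "a n k i = 0" for k by (auto simp: a_def split: source.splits)
      then show ?thesis by simp
    qed
  qed
  then show ?thesis
  proof eventually_elim
    case (elim \<omega>)
    have e1: "(\<Sum>i\<in>gsources L n \<tau>. \<Sum>k\<in>gsources L n \<tau>. a n i k * cnj (source_var (hW n) x (N n) (Z n 1) i \<omega>) * source_var (hW n) x (N n) (Z n 1) k \<omega>)
        = (B n *\<^sub>v vec n (\<lambda>i. hW n k i \<omega>)) \<bullet>c vec n (\<lambda>i. hW n l i \<omega>)" if n: "n \<ge> 1" for n
    proof -
      let ?\<xi> = "\<lambda>s. source_var (hW n) x (N n) (Z n 1) s \<omega>"
      have "(\<Sum>i\<in>gsources L n \<tau>. \<Sum>k\<in>gsources L n \<tau>. a n i k * cnj (?\<xi> i) * ?\<xi> k)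
          = (\<Sum>p<n. \<Sum>s\<in>gsources L n \<tau>. a n (Chan l p) s * cnj (?\<xi> (Chan l p)) * ?\<xi> s)"
        by (rule sum_gsources_Chan[OF l(1)]) (auto simp: a_def split: source.splits intro!: sum.neutral)
      also have "\<dots> = (\<Sum>p<n. \<Sum>q<n. a n (Chan l p) (Chan k q) * cnj (?\<xi> (Chan l p)) * ?\<xi> (Chan k q))"
        by (intro sum.cong refl sum_gsources_Chan[OF l(2)]) (auto simp: a_def split: source.splits)
      also have "\<dots> = (\<Sum>p<n. \<Sum>q<n. B n $$ (p, q) * cnj (hW n l p \<omega>) * hW n k q \<omega>)" by (simp add: a_def)
      also have "\<dots> = (B n *\<^sub>v vec n (\<lambda>i. hW n k i \<omega>)) \<bullet>c vec n (\<lambda>i. hW n l i \<omega>)"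
        using B[OF n] by (auto simp: scalar_prod_def lessThan_atLeast0 sum_distrib_right sum_distrib_left mult_ac intro!: sum.cong)
      finally show ?thesis .
    qed
    have e2: "(\<Sum>i\<in>gsources L n \<tau>. a n i i * complex_of_real (source_variance \<sigma> i)) = (if l = k then mtrace (B n) else 0)" if n: "n \<ge> 1" for n
    proof -
      have "(\<Sum>i\<in>gsources L n \<tau>. a n i i * complex_of_real (source_variance \<sigma> i))
          = (\<Sum>p<n. a n (Chan l p) (Chan l p) * complex_of_real (source_variance \<sigma> (Chan l p)))"
        by (rule sum_gsources_Chan[OF l(1)]) (auto simp: a_def split: source.splits)
      also have "\<dots> = (if l = k then \<Sum>p<n. B n $$ (p, p) else 0)" by (simp add: a_def)
      finally have "(\<Sum>i\<in>gsources L n \<tau>. a n i i * complex_of_real (source_variance \<sigma> i)) = (if l = k then \<Sum>p<n. B n $$ (p, p) else 0)" .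
      then show ?thesis using l B[OF n] by (simp add: mtrace_def)
    qed
    show ?case
      by (rule Lim_transform_eventually[OF elim eventually_mono[OF eventually_ge_at_top[of 1]]]) (simp only: e1 e2)
  qed
qed

text \<open>The same device with a block between the channel of user \<open>j\<close> and the pilot
  noise. The block is off the diagonal, so nothing has to be subtracted; the weights
  \<open>c\<close> enter the row bound through the sum of their squares.\<close>

lemma pilot_noise_cross_limit:
  assumes model: "mimo_model P L \<tau> \<sigma> hW x N Z" and \<sigma>: "\<sigma>\<^sup>2 > 0" and j: "j \<in> {1..L}"
    and B: "\<And>n. n \<ge> 1 \<Longrightarrow> B n \<in> carrier_mat n n" and K: "0 \<le> K"
    and bd: "\<And>n v. n \<ge> 1 \<Longrightarrow> v \<in> carrier_vec n \<Longrightarrow> norm2 (B n *\<^sub>v v) \<le> K * norm2 v"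
  shows "AE \<omega> in P. (\<lambda>n. ((B n *\<^sub>v vec n (\<lambda>i. \<Sum>t<\<tau>. c t * N n i t \<omega>)) \<bullet>c vec n (\<lambda>i. hW n j i \<omega>)) / of_nat n) \<longlonglongrightarrow> 0"
proof -
  define a where "a n s s' = (case s of Chan l' p \<Rightarrow> (case s' of PilotNoise q t \<Rightarrow>
      (if l' = j then B n $$ (p, q) * c t else 0) | _ \<Rightarrow> 0) | _ \<Rightarrow> 0)" for n s s'
  define \<kappa> where "\<kappa> = K\<^sup>2 * (\<Sum>t<\<tau>. (cmod (c t))\<^sup>2)"
  have \<kappa>: "0 \<le> \<kappa>" by (simp add: \<kappa>_def sum_nonneg)
  have "AE \<omega> in P. (\<lambda>n. ((\<Sum>i\<in>gsources L n \<tau>. \<Sum>k\<in>gsources L n \<tau>. a n i k * cnj (source_var (hW n) x (N n) (Z n 1) i \<omega>) * source_var (hW n) x (N n) (Z n 1) k \<omega>)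
      - (\<Sum>i\<in>gsources L n \<tau>. a n i i * complex_of_real (source_variance \<sigma> i))) / of_nat n) \<longlonglongrightarrow> 0"
  proof (rule mimo_quadratic_limit[OF model \<sigma>, of a \<kappa>])
    fix n :: nat and i assume n: "n \<ge> 1" and i: "i \<in> gsources L n \<tau>"
    note ent = operator_bound_entries[OF B[OF n] K bd[OF n]]
    show "(\<Sum>k\<in>gsources L n \<tau>. (cmod (a n i k))\<^sup>2) \<le> \<kappa>"
    proof (cases "\<exists>p. i = Chan j p")
      case True
      then obtain p where p: "i = Chan j p" by blast
      have "(\<Sum>k'\<in>gsources L n \<tau>. (cmod (a n i k'))\<^sup>2) = (\<Sum>q<n. \<Sum>t<\<tau>. (cmod (a n i (PilotNoise q t)))\<^sup>2)"
        by (rule sum_gsources_PilotNoise) (simp add: a_def p)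
      also have "\<dots> = (\<Sum>q<n. \<Sum>t<\<tau>. (cmod (B n $$ (p, q)))\<^sup>2 * (cmod (c t))\<^sup>2)"
        by (simp add: a_def p norm_mult power_mult_distrib)
      also have "\<dots> = (\<Sum>q<n. (cmod (B n $$ (p, q)))\<^sup>2) * (\<Sum>t<\<tau>. (cmod (c t))\<^sup>2)" by (simp add: sum_product)
      also have "\<dots> \<le> \<kappa>" unfolding \<kappa>_def using i p by (intro mult_right_mono ent) (auto simp: sum_nonneg)
      finally show ?thesis .
    next
      case False
      then have "a n i k = 0" for k by (auto simp: a_def split: source.splits)
      then show ?thesis using \<kappa> by simp
    qed
    show "(\<Sum>k\<in>gsources L n \<tau>. (cmod (a n k i))\<^sup>2) \<le> \<kappa>"
    proof (cases "\<exists>q t. i = PilotNoise q t")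
      case True
      then obtain q t where p: "i = PilotNoise q t" by blast
      have "(\<Sum>k'\<in>gsources L n \<tau>. (cmod (a n k' i))\<^sup>2) = (\<Sum>q'<n. (cmod (a n (Chan j q') i))\<^sup>2)"
        by (rule sum_gsources_Chan[OF j]) (auto simp: a_def split: source.splits)
      also have "\<dots> = (\<Sum>p<n. (cmod (B n $$ (p, q)))\<^sup>2) * (cmod (c t))\<^sup>2"
        by (simp add: a_def p norm_mult power_mult_distrib sum_distrib_right)
      also have "\<dots> \<le> \<kappa>" unfolding \<kappa>_def using i p
        by (intro mult_mono ent member_le_sum) (auto simp: sum_nonneg)
      finally show ?thesis .
    next
      case False
      then have "a n k i = 0" for k by (auto simp: a_def split: source.splits)
      then show ?thesis using \<kappa> by simp
    qed
  qed
  then show ?thesis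
  proof eventually_elim
    case (elim \<omega>)
    have e1: "(\<Sum>i\<in>gsources L n \<tau>. \<Sum>k\<in>gsources L n \<tau>. a n i k * cnj (source_var (hW n) x (N n) (Z n 1) i \<omega>) * source_var (hW n) x (N n) (Z n 1) k \<omega>)
        = (B n *\<^sub>v vec n (\<lambda>i. \<Sum>t<\<tau>. c t * N n i t \<omega>)) \<bullet>c vec n (\<lambda>i. hW n j i \<omega>)" if n: "n \<ge> 1" for n
    proof -
      let ?\<xi> = "\<lambda>s. source_var (hW n) x (N n) (Z n 1) s \<omega>"
      have "(\<Sum>i\<in>gsources L n \<tau>. \<Sum>k\<in>gsources L n \<tau>. a n i k * cnj (?\<xi> i) * ?\<xi> k)
          = (\<Sum>p<n. \<Sum>s\<in>gsources L n \<tau>. a n (Chan j p) s * cnj (?\<xi> (Chan j p)) * ?\<xi> s)"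
        by (rule sum_gsources_Chan[OF j]) (auto simp: a_def split: source.splits intro!: sum.neutral)
      also have "\<dots> = (\<Sum>p<n. \<Sum>q<n. \<Sum>t<\<tau>. a n (Chan j p) (PilotNoise q t) * cnj (?\<xi> (Chan j p)) * ?\<xi> (PilotNoise q t))"
        by (intro sum.cong refl sum_gsources_PilotNoise) (simp add: a_def)
      also have "\<dots> = (\<Sum>p<n. \<Sum>q<n. \<Sum>t<\<tau>. B n $$ (p, q) * c t * cnj (hW n j p \<omega>) * N n q t \<omega>)" by (simp add: a_def)
      also have "\<dots> = (B n *\<^sub>v vec n (\<lambda>i. \<Sum>t<\<tau>. c t * N n i t \<omega>)) \<bullet>c vec n (\<lambda>i. hW n j i \<omega>)"
        using B[OF n] by (auto simp: scalar_prod_def lessThan_atLeast0 sum_distrib_right sum_distrib_left mult_ac intro!: sum.cong)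
      finally show ?thesis .
    qed
    have e2: "(\<Sum>i\<in>gsources L n \<tau>. a n i i * complex_of_real (source_variance \<sigma> i)) = 0" for n
      unfolding sum_gsources by (simp add: a_def)
    show ?case
      by (rule Lim_transform_eventually[OF elim eventually_mono[OF eventually_ge_at_top[of 1]]]) (simp only: e1 e2 diff_zero)
  qed
qed

text \<open>The quadratic form with the identity on the pilot noise labels; its diagonal sum is
  \<open>n \<tau> \<sigma>^2\<close>.\<close>

lemma pilot_noise_norm_limit:
  assumes model: "mimo_model P L \<tau> \<sigma> hW x N Z" and \<sigma>: "\<sigma>\<^sup>2 > 0"
  shows "AE \<omega> in P. (\<lambda>n. (\<Sum>i<n. \<Sum>t<\<tau>. (cmod (N n i t \<omega>))\<^sup>2) / real n) \<longlonglongrightarrow> real \<tau> * \<sigma>\<^sup>2"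
proof -
  define a :: "nat \<Rightarrow> source \<Rightarrow> source \<Rightarrow> complex" where
    "a n s s' = (case s of PilotNoise i t \<Rightarrow> (if s' = s then 1 else 0) | _ \<Rightarrow> 0)" for n s s'
  have "AE \<omega> in P. (\<lambda>n. ((\<Sum>i\<in>gsources L n \<tau>. \<Sum>k\<in>gsources L n \<tau>. a n i k * cnj (source_var (hW n) x (N n) (Z n 1) i \<omega>) * source_var (hW n) x (N n) (Z n 1) k \<omega>)
      - (\<Sum>i\<in>gsources L n \<tau>. a n i i * complex_of_real (source_variance \<sigma> i))) / of_nat n) \<longlonglongrightarrow> 0"
  proof (rule mimo_quadratic_limit[OF model \<sigma>, of a 1])
    fix n :: nat and i assume i: "i \<in> gsources L n \<tau>"
    have "(\<Sum>k\<in>gsources L n \<tau>. (cmod (a n i k))\<^sup>2) \<le> (\<Sum>k\<in>gsources L n \<tau>. if k = i then 1 else 0)"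
      by (intro sum_mono) (auto simp: a_def split: source.splits)
    then show "(\<Sum>k\<in>gsources L n \<tau>. (cmod (a n i k))\<^sup>2) \<le> 1" using i by (simp add: finite_gsources)
    have "(\<Sum>k\<in>gsources L n \<tau>. (cmod (a n k i))\<^sup>2) \<le> (\<Sum>k\<in>gsources L n \<tau>. if k = i then 1 else 0)"
      by (intro sum_mono) (auto simp: a_def split: source.splits)
    then show "(\<Sum>k\<in>gsources L n \<tau>. (cmod (a n k i))\<^sup>2) \<le> 1" using i by (simp add: finite_gsources)
  qed
  then show ?thesis
  proof eventually_elim
    case (elim \<omega>)
    define q where "q n = (\<Sum>i<n. \<Sum>t<\<tau>. (cmod (N n i t \<omega>))\<^sup>2)" for n
    have e1: "(\<Sum>i\<in>gsources L n \<tau>. \<Sum>k\<in>gsources L n \<tau>. a n i k * cnj (source_var (hW n) x (N n) (Z n 1) i \<omega>) * source_var (hW n) x (N n) (Z n 1) k \<omega>)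
        = complex_of_real (q n)" for n
    proof -
      have inner: "(\<Sum>k\<in>gsources L n \<tau>. a n i k * cnj (source_var (hW n) x (N n) (Z n 1) i \<omega>) * source_var (hW n) x (N n) (Z n 1) k \<omega>)
         = a n i i * complex_of_real ((cmod (source_var (hW n) x (N n) (Z n 1) i \<omega>))\<^sup>2)" if i: "i \<in> gsources L n \<tau>" for i
      proof -
        have "(\<Sum>k\<in>gsources L n \<tau>. a n i k * cnj (source_var (hW n) x (N n) (Z n 1) i \<omega>) * source_var (hW n) x (N n) (Z n 1) k \<omega>)
          = (\<Sum>k\<in>gsources L n \<tau>. if k = i then a n i i * (cnj (source_var (hW n) x (N n) (Z n 1) i \<omega>) * source_var (hW n) x (N n) (Z n 1) i \<omega>) else 0)"
          by (intro sum.cong refl) (auto simp: a_def split: source.splits)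
        then show ?thesis unfolding complex_norm_square using i by (simp add: finite_gsources mult_ac)
      qed
      have "(\<Sum>i\<in>gsources L n \<tau>. \<Sum>k\<in>gsources L n \<tau>. a n i k * cnj (source_var (hW n) x (N n) (Z n 1) i \<omega>) * source_var (hW n) x (N n) (Z n 1) k \<omega>)
         = (\<Sum>i\<in>gsources L n \<tau>. a n i i * complex_of_real ((cmod (source_var (hW n) x (N n) (Z n 1) i \<omega>))\<^sup>2))"
        by (intro sum.cong refl inner)
      also have "\<dots> = complex_of_real (q n)" unfolding sum_gsources by (simp add: a_def q_def)
      finally show ?thesis .
    qed
    have e2: "(\<Sum>i\<in>gsources L n \<tau>. a n i i * complex_of_real (source_variance \<sigma> i)) = complex_of_real (real n * (real \<tau> * \<sigma>\<^sup>2))" for n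
      unfolding sum_gsources by (simp add: a_def)
    have "(\<lambda>n. complex_of_real ((q n - real n * (real \<tau> * \<sigma>\<^sup>2)) / real n)) \<longlonglongrightarrow> complex_of_real 0"
      using elim unfolding e1 e2 by simp
    then have "(\<lambda>n. (q n - real n * (real \<tau> * \<sigma>\<^sup>2)) / real n) \<longlonglongrightarrow> 0" by (simp only: tendsto_of_real_iff)
    from tendsto_add[OF this tendsto_const[of "real \<tau> * \<sigma>\<^sup>2"]]
    have "(\<lambda>n. (q n - real n * (real \<tau> * \<sigma>\<^sup>2)) / real n + real \<tau> * \<sigma>\<^sup>2) \<longlonglongrightarrow> real \<tau> * \<sigma>\<^sup>2" by simp
    moreover have "\<forall>\<^sub>F n in sequentially. (q n - real n * (real \<tau> * \<sigma>\<^sup>2)) / real n + real \<tau> * \<sigma>\<^sup>2 = q n / real n"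
      using eventually_ge_at_top[of 1] by eventually_elim (simp add: field_simps)
    ultimately have "(\<lambda>n. q n / real n) \<longlonglongrightarrow> real \<tau> * \<sigma>\<^sup>2" by (rule Lim_transform_eventually)
    then show ?case by (simp add: q_def)
  qed
qed

text \<open>Products of two square-integrable symbols are integrable, so the strong law applies to
  their real and imaginary parts. One antenna is enough to speak about the symbols. For
  \<open>l \<noteq> k\<close> the law of a product does not depend on \<open>c\<close>, because
  independence makes the joint law of its factors a product measure.\<close>

lemma symbols_limit:
  assumes model: "mimo_model P L \<tau> \<sigma> hW x N Z" and l: "l \<in> {1..L}" "k \<in> {1..L}"
  shows "AE \<omega> in P. (\<lambda>n. ip n (\<lambda>c. x l c \<omega>) (\<lambda>c. x k c \<omega>) / of_nat n) \<longlonglongrightarrow> (if l = k then 1 else 0)"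
proof -
  interpret prob_space P by (rule mimo_modelD(1)[OF model])
  have cnj_meas [measurable]: "cnj \<in> borel_measurable borel"
    by (intro borel_measurable_continuous_onI continuous_intros)
  have ind: "indep_vars (\<lambda>_. borel) (source_var (hW 1) x (N 1) (Z 1 C)) (sources L 1 \<tau> C)" if "C \<ge> 1" for C
    by (rule mimo_modelD(2)[OF model order_refl that])
  have meas: "x l c \<in> borel_measurable P" if "l \<in> {1..L}" for l c
  proof -
    have "Sym l c \<in> sources L 1 \<tau> (Suc c)" using that by (auto simp: sources_def)
    moreover have "1 \<le> Suc c" by simp
    ultimately have "source_var (hW 1) x (N 1) (Z 1 (Suc c)) (Sym l c) \<in> borel_measurable P"
      by (rule bspec[OF conjunct1[OF ind[unfolded indep_vars_def2]], rotated])
    then show ?thesis by simp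
  qed
  note [measurable] = meas[OF l(1)] meas[OF l(2)]
  have sq: "integrable P (\<lambda>\<omega>. (cmod (x l c \<omega>))\<^sup>2)" if "l \<in> {1..L}" for l c
    by (rule mimo_modelD(7)[OF model that])
  have int: "integrable P (\<lambda>\<omega>. x l c \<omega> * cnj (x k c \<omega>))" for c
  proof (rule Bochner_Integration.integrable_bound[OF Bochner_Integration.integrable_add[OF sq[OF l(1), of c] sq[OF l(2), of c]]])
    show "(\<lambda>\<omega>. x l c \<omega> * cnj (x k c \<omega>)) \<in> borel_measurable P" by measurable
    have "a * b \<le> a\<^sup>2 + b\<^sup>2" if "0 \<le> a" "0 \<le> b" for a b :: real
      using sum_squares_bound[of a b] mult_nonneg_nonneg[OF that] by linarith
    then show "AE \<omega> in P. norm (x l c \<omega> * cnj (x k c \<omega>)) \<le> norm ((cmod (x l c \<omega>))\<^sup>2 + (cmod (x k c \<omega>))\<^sup>2)"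
      by (intro AE_I2) (simp add: norm_mult)
  qed
  have indep_pair: "indep_var borel (x l c) borel (x k c)" if "l \<noteq> k" for c
  proof -
    have "indep_var (PiM {Sym l c} (\<lambda>_. borel)) (\<lambda>\<omega>. \<lambda>s\<in>{Sym l c}. source_var (hW 1) x (N 1) (Z 1 (Suc c)) s \<omega>)
        (PiM {Sym k c} (\<lambda>_. borel)) (\<lambda>\<omega>. \<lambda>s\<in>{Sym k c}. source_var (hW 1) x (N 1) (Z 1 (Suc c)) s \<omega>)"
      using l that by (intro indep_var_restrict[OF ind]) (auto simp: sources_def)
    from indep_var_compose[OF this, of "\<lambda>f. f (Sym l c)" borel "\<lambda>f. f (Sym k c)" borel]
    show ?thesis by (simp add: comp_def)
  qed
  have mean: "expectation (\<lambda>\<omega>. x l c \<omega> * cnj (x k c \<omega>)) = (if l = k then 1 else 0)" for c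
  proof (cases "l = k")
    case True
    have "expectation (\<lambda>\<omega>. x l c \<omega> * cnj (x k c \<omega>)) = expectation (\<lambda>\<omega>. complex_of_real ((cmod (x l c \<omega>))\<^sup>2))"
      by (simp only: True complex_norm_square)
    also have "\<dots> = complex_of_real (expectation (\<lambda>\<omega>. (cmod (x l c \<omega>))\<^sup>2))"
      by (rule integral_of_real[OF sq[OF l(1)]])
    finally show ?thesis using True mimo_modelD(9)[OF model l(1)] by simp
  next
    case False
    have ix: "integrable P (x l c)" if l: "l \<in> {1..L}" for l c
    proof (rule Bochner_Integration.integrable_bound[OF Bochner_Integration.integrable_add[OF sq[OF l, of c] integrable_const[of 1]]])
      show "x l c \<in> borel_measurable P" by (rule meas[OF l])
      have "a \<le> a\<^sup>2 + 1" if "0 \<le> a" for a :: real using sum_squares_bound[of a 1] that by (simp; linarith)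
      then show "AE \<omega> in P. norm (x l c \<omega>) \<le> norm ((cmod (x l c \<omega>))\<^sup>2 + 1)" by (intro AE_I2) simp
    qed
    have "indep_var borel (\<lambda>\<omega>. x l c \<omega>) borel (\<lambda>\<omega>. cnj (x k c \<omega>))"
      using indep_var_compose[OF indep_pair[OF False], of "\<lambda>z. z" borel cnj borel] by (simp add: comp_def)
    then have "expectation (\<lambda>\<omega>. x l c \<omega> * cnj (x k c \<omega>)) = expectation (x l c) * expectation (\<lambda>\<omega>. cnj (x k c \<omega>))"
      using ix[OF l(1)] ix[OF l(2)] by (intro indep_var_lebesgue_integral) auto
    then show ?thesis using False mimo_modelD(8)[OF model l(1)] by simp
  qed
  have key: "AE \<omega> in P. (\<lambda>n. (\<Sum>c<n. pr (x l c \<omega> * cnj (x k c \<omega>))) / real n) \<longlonglongrightarrow> expectation (\<lambda>\<omega>. pr (x l 0 \<omega> * cnj (x k 0 \<omega>)))"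
    if pr: "pr = Re \<or> pr = Im" for pr :: "complex \<Rightarrow> real"
  proof (rule slln)
    have [measurable]: "pr \<in> borel_measurable borel" using pr by auto
    show "(\<lambda>\<omega>. pr (x l c \<omega> * cnj (x k c \<omega>))) \<in> borel_measurable P" for c by measurable
    show "integrable P (\<lambda>\<omega>. pr (x l 0 \<omega> * cnj (x k 0 \<omega>)))"
      using pr integrable_Re[OF int[of 0]] integrable_Im[OF int[of 0]] by auto
    show "indep_var borel (\<lambda>\<omega>. pr (x l c \<omega> * cnj (x k c \<omega>))) borel (\<lambda>\<omega>. pr (x l c' \<omega> * cnj (x k c' \<omega>)))"
      if c: "c \<noteq> c'" for c c'
    proof -
      \<comment> \<open>Symbols are numbered from 0, so this many data times are needed for both
        \<open>c\<close> and \<open>c'\<close> to occur among the sources.\<close>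
      define C where "C = Suc (max c c')"
      have "indep_var (PiM {Sym l c, Sym k c} (\<lambda>_. borel)) (\<lambda>\<omega>. \<lambda>s\<in>{Sym l c, Sym k c}. source_var (hW 1) x (N 1) (Z 1 C) s \<omega>)
          (PiM {Sym l c', Sym k c'} (\<lambda>_. borel)) (\<lambda>\<omega>. \<lambda>s\<in>{Sym l c', Sym k c'}. source_var (hW 1) x (N 1) (Z 1 C) s \<omega>)"
        using l c by (intro indep_var_restrict[OF ind[of C]]) (auto simp: sources_def C_def)
      from indep_var_compose[OF this, of "\<lambda>f. pr (f (Sym l c) * cnj (f (Sym k c)))" borel "\<lambda>f. pr (f (Sym l c') * cnj (f (Sym k c')))" borel]
      show ?thesis by (simp add: comp_def)
    qed
    show "distr P borel (\<lambda>\<omega>. pr (x l c \<omega> * cnj (x k c \<omega>))) = distr P borel (\<lambda>\<omega>. pr (x l 0 \<omega> * cnj (x k 0 \<omega>)))" for c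
    proof (cases "l = k")
      case True
      have "distr P borel (\<lambda>\<omega>. pr (x l c \<omega> * cnj (x l c \<omega>))) = distr (distr P borel (x l c)) borel (\<lambda>z. pr (z * cnj z))" for c
        by (subst distr_distr) (auto simp: comp_def)
      then show ?thesis using True mimo_modelD(6)[OF model l(1) l(1), of c 0] by simp
    next
      case False
      have "distr P borel (\<lambda>\<omega>. pr (x l c \<omega> * cnj (x k c \<omega>)))
          = distr (distr P borel (x l c) \<Otimes>\<^sub>M distr P borel (x k c)) borel (\<lambda>p. pr (fst p * cnj (snd p)))" for c
      proof -
        have "distr P borel (x l c) \<Otimes>\<^sub>M distr P borel (x k c) = distr P (borel \<Otimes>\<^sub>M borel) (\<lambda>\<omega>. (x l c \<omega>, x k c \<omega>))"
          using indep_pair[OF False, of c] unfolding indep_var_distribution_eq by blast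
        moreover have "distr (distr P (borel \<Otimes>\<^sub>M borel) (\<lambda>\<omega>. (x l c \<omega>, x k c \<omega>))) borel (\<lambda>p. pr (fst p * cnj (snd p)))
            = distr P borel (\<lambda>\<omega>. pr (x l c \<omega> * cnj (x k c \<omega>)))"
          by (subst distr_distr) (auto simp: comp_def)
        ultimately show ?thesis by simp
      qed
      then show ?thesis
        using mimo_modelD(6)[OF model l(1) l(1), of c 0] mimo_modelD(6)[OF model l(2) l(2), of c 0] by simp
    qed
  qed
  have "AE \<omega> in P. (\<lambda>n. (\<Sum>c<n. Re (x l c \<omega> * cnj (x k c \<omega>))) / real n) \<longlonglongrightarrow> Re (if l = k then 1 else 0)"
    using key[of Re] integral_Re[OF int[of 0]] mean[of 0] by simp
  moreover have "AE \<omega> in P. (\<lambda>n. (\<Sum>c<n. Im (x l c \<omega> * cnj (x k c \<omega>))) / real n) \<longlonglongrightarrow> Im (if l = k then 1 else 0)"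
    using key[of Im] integral_Im[OF int[of 0]] mean[of 0] by simp
  ultimately show ?thesis
  proof eventually_elim
    case (elim \<omega>)
    then show ?case unfolding tendsto_complex_iff ip_def Re_divide_of_nat Im_divide_of_nat Re_sum Im_sum by blast
  qed
qed

section \<open>From vectors and matrices to finite sums\<close>

lemma ip_vec: "v \<in> carrier_vec n \<Longrightarrow> w \<in> carrier_vec n \<Longrightarrow> v \<bullet>c w = ip n (\<lambda>i. v $ i) (\<lambda>i. w $ i)"
  by (simp add: scalar_prod_def ip_def lessThan_atLeast0)

lemma nrm_vec: "v \<in> carrier_vec n \<Longrightarrow> nrm n (\<lambda>i. v $ i) = norm2 v"
  by (simp add: nrm_def L2_set_def norm2_def)

lemma smult_mat_vec: "v \<in> carrier_vec m \<Longrightarrow> A \<in> carrier_mat n m \<Longrightarrow> (k \<cdot>\<^sub>m A) *\<^sub>v v = k \<cdot>\<^sub>v (A *\<^sub>v (v :: complex vec))"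
  by (intro eq_vecI) (auto simp: scalar_prod_def sum_distrib_left mult.assoc)

text \<open>Extracts the two properties of a principal eigenvector on which the asymptotics rest:
  the eigenvalue equation for \<open>u\<close>, and the Rayleigh bound for every other vector with
  the same \<open>lam\<close>. Multiplying by \<open>C\<close> clears the normalization of the
  sample covariance.\<close>

lemma sample_cov_eigen:
  assumes W: "W \<in> carrier_mat n C" and C: "C \<ge> 1" and u: "principal_eigenvector (sample_cov C W) u"
  shows "u \<in> carrier_vec n" "norm2 u = 1"
    "\<exists>lam::real. W *\<^sub>v (mat_adjoint W *\<^sub>v u) = complex_of_real (lam * C) \<cdot>\<^sub>v u \<and>
      (\<forall>v\<in>carrier_vec n. (norm2 (mat_adjoint W *\<^sub>v v))\<^sup>2 \<le> lam * C * (norm2 v)\<^sup>2)"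
proof -
  define A where "A = sample_cov C W"
  have A: "A \<in> carrier_mat n n" using W by (auto simp: A_def sample_cov_def)
  have Av: "A *\<^sub>v v = complex_of_real (1 / C) \<cdot>\<^sub>v (W *\<^sub>v (mat_adjoint W *\<^sub>v v))" if v: "v \<in> carrier_vec n" for v
    unfolding A_def sample_cov_def using W v
    by (subst smult_mat_vec[OF v]) (auto simp: assoc_mult_mat_vec[OF W adj_carrier[OF W] v])
  have Aadj: "mat_adjoint A = A"
  proof -
    have s: "mat_adjoint (complex_of_real a \<cdot>\<^sub>m B) = complex_of_real a \<cdot>\<^sub>m mat_adjoint B" for a B
      by (intro eq_matI) auto
    show ?thesis unfolding A_def sample_cov_def s using W by (simp add: adj_mult)
  qed
  obtain k where k: "eigenvector A u (complex_of_real k)" "\<And>k'. eigenvalue A (complex_of_real k') \<Longrightarrow> k' \<le> k"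
    and nu: "norm2 u = 1" using u unfolding principal_eigenvector_def A_def by blast
  show "norm2 u = 1" by (rule nu)
  show uc: "u \<in> carrier_vec n" using k(1) A by (simp add: eigenvector_def)
  have "complex_of_real C \<cdot>\<^sub>v (complex_of_real (1 / C) \<cdot>\<^sub>v (W *\<^sub>v (mat_adjoint W *\<^sub>v u))) = complex_of_real C \<cdot>\<^sub>v (complex_of_real k \<cdot>\<^sub>v u)"
    using k(1) Av[OF uc] by (simp add: eigenvector_def)
  then have 1: "W *\<^sub>v (mat_adjoint W *\<^sub>v u) = complex_of_real (k * C) \<cdot>\<^sub>v u"
    using C by (simp add: smult_smult_assoc mult.commute)
  have 2: "(norm2 (mat_adjoint W *\<^sub>v v))\<^sup>2 \<le> k * C * (norm2 v)\<^sup>2" if v: "v \<in> carrier_vec n" for v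
  proof -
    have c: "mat_adjoint W *\<^sub>v v \<in> carrier_vec C" using W by (intro carrier_vecI) simp
    have d: "dim_vec (W *\<^sub>v (mat_adjoint W *\<^sub>v v)) = dim_vec v" using W v by simp
    have "(A *\<^sub>v v) \<bullet>c v = complex_of_real (1 / C) * ((W *\<^sub>v (mat_adjoint W *\<^sub>v v)) \<bullet>c v)"
      unfolding Av[OF v] by (rule smult_vec_scalar[OF d])
    also have "(W *\<^sub>v (mat_adjoint W *\<^sub>v v)) \<bullet>c v = complex_of_real ((norm2 (mat_adjoint W *\<^sub>v v))\<^sup>2)"
      unfolding cscalar_prod_adj[OF W c v] by (rule cscalar_prod_self)
    finally have "Re ((A *\<^sub>v v) \<bullet>c v) = (norm2 (mat_adjoint W *\<^sub>v v))\<^sup>2 / C" by simp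
    then have "(norm2 (mat_adjoint W *\<^sub>v v))\<^sup>2 / C \<le> k * (norm2 v)\<^sup>2"
      using rayleigh_le[OF A Aadj v k(2)] by simp
    then show ?thesis using C by (simp add: divide_le_eq mult_ac)
  qed
  show "\<exists>lam::real. W *\<^sub>v (mat_adjoint W *\<^sub>v u) = complex_of_real (lam * C) \<cdot>\<^sub>v u \<and>
      (\<forall>v\<in>carrier_vec n. (norm2 (mat_adjoint W *\<^sub>v v))\<^sup>2 \<le> lam * C * (norm2 v)\<^sup>2)"
    using 1 2 by blast
qed

lemma received_carrier: "received L n m h x noise \<in> carrier_mat n m"
  by (simp add: received_def mat_sum_def)

lemma received_index:
  assumes "\<And>l. l \<in> {1..L} \<Longrightarrow> h l \<in> carrier_vec n" "\<And>l. l \<in> {1..L} \<Longrightarrow> x l \<in> carrier_vec m" "i < n" "c < m"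
  shows "received L n m h x noise $$ (i, c) = (\<Sum>l=1..L. h l $ i * x l $ c) + noise i c"
proof -
  have "outer (h l) (x l) $$ (i, c) = h l $ i * x l $ c" if "l \<in> {1..L}" for l
    using assms(1,2)[OF that] assms(3,4) by (simp add: outer_def)
  then show ?thesis using assms(3,4) by (simp add: received_def mat_sum_def)
qed

lemma received_mult:
  assumes "\<And>l. l \<in> {1..L} \<Longrightarrow> h l \<in> carrier_vec n" "\<And>l. l \<in> {1..L} \<Longrightarrow> x l \<in> carrier_vec m" "i < n"
    and y: "y \<in> carrier_vec m"
  shows "(received L n m h x noise *\<^sub>v y) $ i = (\<Sum>l=1..L. (\<Sum>c<m. x l $ c * y $ c) * h l $ i) + (\<Sum>c<m. noise i c * y $ c)"
proof -
  have "(received L n m h x noise *\<^sub>v y) $ i = (\<Sum>c<m. received L n m h x noise $$ (i, c) * y $ c)"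
    using assms(3) y received_carrier[of L n m h x noise] by (simp add: scalar_prod_def lessThan_atLeast0)
  also have "\<dots> = (\<Sum>c<m. (\<Sum>l=1..L. x l $ c * y $ c * h l $ i) + noise i c * y $ c)"
  proof (intro sum.cong refl)
    fix c assume "c \<in> {..<m}"
    then have "received L n m h x noise $$ (i, c) = (\<Sum>l=1..L. h l $ i * x l $ c) + noise i c"
      using assms by (intro received_index) auto
    then show "received L n m h x noise $$ (i, c) * y $ c = (\<Sum>l=1..L. x l $ c * y $ c * h l $ i) + noise i c * y $ c"
      by (simp add: algebra_simps sum_distrib_left)
  qed
  also have "\<dots> = (\<Sum>c<m. \<Sum>l=1..L. x l $ c * y $ c * h l $ i) + (\<Sum>c<m. noise i c * y $ c)"
    by (rule sum.distrib)
  also have "(\<Sum>c<m. \<Sum>l=1..L. x l $ c * y $ c * h l $ i) = (\<Sum>l=1..L. (\<Sum>c<m. x l $ c * y $ c) * h l $ i)"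
    unfolding sum_distrib_right by (rule sum.swap)
  finally show ?thesis .
qed

lemma outer_mult_index:
  fixes v q :: "complex vec"
  assumes "v \<in> carrier_vec n" "q \<in> carrier_vec n" "i < n"
  shows "(outer v (conjugate v) *\<^sub>v q) $ i = (\<Sum>k<n. v $ i * cnj (v $ k) * q $ k)"
  using assms by (simp add: outer_def scalar_prod_def lessThan_atLeast0)

text \<open>The two normalizations in \<open>u u^H\<close> combine to \<open>1 / nrm p ^ 2\<close>.
  The formula also holds when \<open>p\<close> vanishes, both sides being 0 by the convention for
  division by 0.\<close>

lemma CA_estimate_index:
  assumes F: "F \<in> carrier_mat n n" and u: "u \<in> carrier_vec n" and Y: "Y \<in> carrier_mat n \<tau>" and s: "s \<in> carrier_vec \<tau>"
  defines "p \<equiv> F *\<^sub>v u"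
  shows "CA_estimate \<tau> F Y s u \<in> carrier_vec n"
    "i < n \<Longrightarrow> CA_estimate \<tau> F Y s u $ i
      = p $ i * ip n (\<lambda>i. (Y *\<^sub>v conjugate s) $ i / of_nat \<tau>) (\<lambda>i. p $ i) / complex_of_real ((nrm n (\<lambda>i. p $ i))\<^sup>2)"
proof -
  have p: "p \<in> carrier_vec n" using F u by (auto simp: p_def)
  define a where "a = 1 / norm2 p"
  have ub: "normalized p = complex_of_real a \<cdot>\<^sub>v p" by (simp add: normalized_def a_def)
  have q: "Y *\<^sub>v conjugate s \<in> carrier_vec n" using Y by (intro carrier_vecI) simp
  define v where "v = normalized p"
  have v: "v \<in> carrier_vec n" using p by (simp add: v_def ub)
  have CA: "CA_estimate \<tau> F Y s u = complex_of_real (1 / real \<tau>) \<cdot>\<^sub>v (outer v (conjugate v) *\<^sub>v (Y *\<^sub>v conjugate s))"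
    by (simp add: CA_estimate_def Let_def v_def p_def)
  show "CA_estimate \<tau> F Y s u \<in> carrier_vec n"
    unfolding CA using v by (intro carrier_vecI) (simp add: outer_def)
  assume i: "i < n"
  have "CA_estimate \<tau> F Y s u $ i = complex_of_real (1 / real \<tau>) * (\<Sum>k<n. v $ i * cnj (v $ k) * (Y *\<^sub>v conjugate s) $ k)"
    unfolding CA using i outer_mult_index[OF v q i] v by (simp add: outer_def del: index_mult_mat_vec)
  also have "\<dots> = complex_of_real (1 / real \<tau>) * (\<Sum>k<n. complex_of_real a * p $ i * cnj (complex_of_real a * p $ k) * (Y *\<^sub>v conjugate s) $ k)"
    using i p by (simp add: v_def ub)
  also have "\<dots> = complex_of_real a * complex_of_real a * (p $ i * (\<Sum>k<n. (Y *\<^sub>v conjugate s) $ k / of_nat \<tau> * cnj (p $ k)))"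
    unfolding sum_distrib_left by (intro sum.cong refl) (simp add: mult_ac)
  also have "complex_of_real a * complex_of_real a = 1 / complex_of_real ((nrm n (\<lambda>i. p $ i))\<^sup>2)"
    unfolding nrm_vec[OF p] by (simp add: a_def power2_eq_square)
  finally show "CA_estimate \<tau> F Y s u $ i
      = p $ i * ip n (\<lambda>i. (Y *\<^sub>v conjugate s) $ i / of_nat \<tau>) (\<lambda>i. p $ i) / complex_of_real ((nrm n (\<lambda>i. p $ i))\<^sup>2)"
    by (simp add: ip_def)
qed

text \<open>For each pair of dimensions the joint independence of all sources is restricted to the
  data noise labels, which gives independent matrix entries as \<open>gaussian_matrix_bound\<close>
  requires.\<close>

lemma data_noise_bound:
  assumes model: "mimo_model P L \<tau> \<sigma> hW x N Z" and \<sigma>: "\<sigma>\<^sup>2 > 0"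
  defines "\<epsilon> \<equiv> \<lambda>m n. \<sigma>\<^sup>2 / real (min m n) + 2 * real (max m n) powr (-1/4)"
  shows "AE \<omega> in P. \<forall>\<^sub>F (m, n) in sequentially \<times>\<^sub>F sequentially.
    (\<forall>a. (\<Sum>c<n. (cmod (\<Sum>i<m. a i * Z m n i c \<omega>))\<^sup>2) \<le> real m * real n * \<epsilon> m n * (\<Sum>i<m. (cmod (a i))\<^sup>2)) \<and>
    (\<forall>b. (\<Sum>i<m. (cmod (\<Sum>c<n. b c * Z m n i c \<omega>))\<^sup>2) \<le> real m * real n * \<epsilon> m n * (\<Sum>c<n. (cmod (b c))\<^sup>2))"
proof -
  interpret prob_space P by (rule mimo_modelD(1)[OF model])
  show ?thesis unfolding \<epsilon>_def
  proof (rule gaussian_matrix_bound)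
    fix m n :: nat assume mn: "m \<ge> 1" "n \<ge> 1"
    have "indep_vars (\<lambda>p. PiM {DataNoise (fst p) (snd p)} (\<lambda>_. borel))
        (\<lambda>p \<omega>. \<lambda>s\<in>{DataNoise (fst p) (snd p)}. source_var (hW m) x (N m) (Z m n) s \<omega>) ({..<m} \<times> {..<n})"
      by (intro indep_vars_restrict[OF mimo_modelD(2)[OF model mn]]) (auto simp: disjoint_family_on_def sources_def)
    from indep_vars_compose2[OF this, of "\<lambda>p f. f (DataNoise (fst p) (snd p))" "\<lambda>_. borel"]
    have "indep_vars (\<lambda>_. borel) (\<lambda>p. Z m n (fst p) (snd p)) ({..<m} \<times> {..<n})" by simp
    then show "indep_vars (\<lambda>_. borel) (\<lambda>(i, c). Z m n i c) ({..<m} \<times> {..<n})" by (simp add: case_prod_unfold)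
    show "distributed P lborel (Z m n i c) (CN_density (\<sigma>\<^sup>2))" if "i < m" "c < n" for i c
      by (rule mimo_modelD(5)[OF model mn that])
  qed (rule \<sigma>)
qed

lemma mtrace_commute:
  assumes "A \<in> carrier_mat n m" "B \<in> carrier_mat m n"
  shows "mtrace (A * B) = mtrace (B * A)"
proof -
  have "mtrace (A * B) = (\<Sum>i<n. \<Sum>k<m. A $$ (i, k) * B $$ (k, i))"
    using assms by (auto simp: mtrace_def scalar_prod_def lessThan_atLeast0 intro!: sum.cong)
  also have "\<dots> = (\<Sum>k<m. \<Sum>i<n. B $$ (k, i) * A $$ (i, k))"
    by (subst sum.swap) (simp add: mult.commute)
  also have "\<dots> = mtrace (B * A)"
    using assms by (auto simp: mtrace_def scalar_prod_def lessThan_atLeast0 intro!: sum.cong)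
  finally show ?thesis .
qed

lemma mtrace_mult_adjoint_nonneg:
  assumes "A \<in> carrier_mat n m"
  shows "0 \<le> Re (mtrace (A * mat_adjoint A))"
proof -
  have "mtrace (A * mat_adjoint A) = (\<Sum>i<n. \<Sum>k<m. A $$ (i, k) * cnj (A $$ (i, k)))"
    using assms by (auto simp: mtrace_def scalar_prod_def lessThan_atLeast0 intro!: sum.cong)
  also have "\<dots> = complex_of_real (\<Sum>i<n. \<Sum>k<m. (cmod (A $$ (i, k)))\<^sup>2)"
    by (simp only: of_real_sum complex_norm_square)
  finally show ?thesis by (simp add: sum_nonneg)
qed

lemma mult_mat_vec_sum_index:
  fixes Q :: "complex mat"
  assumes Q: "Q \<in> carrier_mat n n" and h: "\<And>l. l \<in> {1..L} \<Longrightarrow> h l \<in> carrier_vec n" and z: "z \<in> carrier_vec n"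
    and d: "d \<in> carrier_vec n" "\<And>k. k < n \<Longrightarrow> d $ k = (\<Sum>l=1..L. b l * h l $ k) + z $ k" and i: "i < n"
  shows "(Q *\<^sub>v d) $ i = (\<Sum>l=1..L. b l * (Q *\<^sub>v h l) $ i) + (Q *\<^sub>v z) $ i"
proof -
  have idx: "(Q *\<^sub>v v) $ i = (\<Sum>k<n. Q $$ (i, k) * v $ k)" if "v \<in> carrier_vec n" for v
    using Q i that by (simp add: scalar_prod_def lessThan_atLeast0)
  have "(Q *\<^sub>v d) $ i = (\<Sum>k<n. (\<Sum>l=1..L. b l * (Q $$ (i, k) * h l $ k)) + Q $$ (i, k) * z $ k)"
    unfolding idx[OF d(1)] using d(2) by (intro sum.cong refl) (simp add: distrib_left sum_distrib_left mult_ac)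
  also have "\<dots> = (\<Sum>k<n. \<Sum>l=1..L. b l * (Q $$ (i, k) * h l $ k)) + (Q *\<^sub>v z) $ i"
    unfolding idx[OF z] by (rule sum.distrib)
  also have "(\<Sum>k<n. \<Sum>l=1..L. b l * (Q $$ (i, k) * h l $ k)) = (\<Sum>l=1..L. \<Sum>k<n. b l * (Q $$ (i, k) * h l $ k))"
    by (rule sum.swap)
  also have "\<dots> = (\<Sum>l=1..L. b l * (Q *\<^sub>v h l) $ i)"
    using h by (intro sum.cong refl) (simp only: idx sum_distrib_left)
  finally show ?thesis .
qed

lemma nrm_of_square_bound:
  assumes "(\<Sum>i<m. (cmod (f i))\<^sup>2) \<le> a * e * (\<Sum>i<n. (cmod (b i))\<^sup>2)" "0 \<le> a" "0 \<le> e"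
  shows "nrm m f \<le> sqrt e * sqrt a * nrm n b"
proof -
  have "(nrm m f)\<^sup>2 \<le> (sqrt e * sqrt a * nrm n b)\<^sup>2"
    using assms by (simp add: nrm_square power_mult_distrib mult_ac)
  then show ?thesis by (rule power2_le_imp_le) (use assms in simp)
qed

section \<open>Consistency of the estimate\<close>

text \<open>The eigenvalue equation writes a multiple of \<open>u\<close> as \<open>X\<close>
  applied to a vector. Multiplication by \<open>Q\<close> therefore involves \<open>Q\<close> only
  through \<open>Q X\<close>; for the filters this product is a projection, so a large norm of
  \<open>Q\<close> does no harm. The eigenvalue is kept as a factor and never divided by.\<close>

lemma filtered_data_eigen:
  fixes x :: "nat \<Rightarrow> nat \<Rightarrow> complex" and X Q :: "complex mat"
  assumes m: "m \<ge> 1" and X: "X \<in> carrier_mat n n" and Q: "Q \<in> carrier_mat n n"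
    and h: "\<And>l. l \<in> {1..L} \<Longrightarrow> h l \<in> carrier_vec n"
    and pe: "principal_eigenvector (sample_cov m (X * received L n m h (\<lambda>l. vec m (x l)) Z)) u"
  defines "Zm \<equiv> mat n m (\<lambda>(i, c). Z i c)"
  defines "G \<equiv> \<lambda>i c. (\<Sum>l=1..L. (X *\<^sub>v h l) $ i * x l c) + (X * Zm) $$ (i, c)"
  defines "adj \<equiv> \<lambda>v c. \<Sum>i<n. cnj (G i c) * v i"
  shows "u \<in> carrier_vec n" "nrm n (\<lambda>i. u $ i) = 1"
    "\<exists>lam::real. (\<forall>i<n. complex_of_real (lam * m) * u $ i = (\<Sum>c<m. G i c * adj (\<lambda>i. u $ i) c)) \<and>
      (\<forall>v. (nrm m (adj v))\<^sup>2 \<le> lam * m * (nrm n v)\<^sup>2) \<and>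
      (\<forall>i<n. complex_of_real (lam * m) * (Q *\<^sub>v u) $ i
        = (\<Sum>l=1..L. (\<Sum>c<m. x l c * adj (\<lambda>i. u $ i) c) * (Q *\<^sub>v (X *\<^sub>v h l)) $ i)
          + (Q *\<^sub>v (X *\<^sub>v (Zm *\<^sub>v vec m (adj (\<lambda>i. u $ i))))) $ i)"
proof -
  define W0 where "W0 = received L n m h (\<lambda>l. vec m (x l)) Z"
  define W where "W = X * W0"
  have Zc: "Zm \<in> carrier_mat n m" by (simp add: Zm_def)
  have W0: "W0 \<in> carrier_mat n m" unfolding W0_def by (rule received_carrier)
  have W: "W \<in> carrier_mat n m" unfolding W_def by (rule mult_carrier_mat[OF X W0])
  have WG: "W $$ (i, c) = G i c" if i: "i < n" and c: "c < m" for i c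
  proof -
    have "W $$ (i, c) = (X *\<^sub>v col W0 c) $ i"
      unfolding W_def using X W0 i c by simp
    also have "\<dots> = (\<Sum>l=1..L. x l c * (X *\<^sub>v h l) $ i) + (X *\<^sub>v col Zm c) $ i"
    proof (rule mult_mat_vec_sum_index[OF X h _ _ _ i])
      fix k assume k: "k < n"
      have "col W0 c $ k = W0 $$ (k, c)" using W0 k c by simp
      also have "\<dots> = (\<Sum>l=1..L. h l $ k * vec m (x l) $ c) + Z k c"
        unfolding W0_def by (rule received_index[OF h _ k c]) auto
      finally show "col W0 c $ k = (\<Sum>l=1..L. x l c * h l $ k) + col Zm c $ k"
        using k c by (simp add: Zm_def mult.commute)
    qed (use W0 Zc in auto)
    also have "\<dots> = G i c" using X Zc i c by (simp add: G_def mult.commute)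
    finally show ?thesis .
  qed
  have adj: "adj v c = (mat_adjoint W *\<^sub>v vec n v) $ c" if c: "c < m" for v c
    using W c by (simp add: adj_def scalar_prod_def adj_index WG lessThan_atLeast0)
  have adjn: "nrm m (adj v) = norm2 (mat_adjoint W *\<^sub>v vec n v)" for v
    using nrm_vec[OF mult_mat_vec_carrier[OF adj_carrier[OF W] vec_carrier[of n v]]] nrm_cong[of m, OF adj] by simp
  note e = sample_cov_eigen[OF W m pe[folded W0_def, folded W_def]]
  show u: "u \<in> carrier_vec n" by (rule e(1))
  show "nrm n (\<lambda>i. u $ i) = 1" using e(2) nrm_vec[OF u] by simp
  obtain lam :: real where lam: "W *\<^sub>v (mat_adjoint W *\<^sub>v u) = complex_of_real (lam * m) \<cdot>\<^sub>v u"
      "\<And>v. v \<in> carrier_vec n \<Longrightarrow> (norm2 (mat_adjoint W *\<^sub>v v))\<^sup>2 \<le> lam * m * (norm2 v)\<^sup>2"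
    using e(3) by blast
  define y where "y = mat_adjoint W *\<^sub>v u"
  have y: "y \<in> carrier_vec m" unfolding y_def by (rule mult_mat_vec_carrier[OF adj_carrier[OF W] u])
  have vu: "vec n (\<lambda>i. u $ i) = u" using u by (intro eq_vecI) auto
  have ay: "adj (\<lambda>i. u $ i) c = y $ c" if "c < m" for c
    using adj[OF that, of "\<lambda>i. u $ i"] by (simp only: vu y_def)
  have vy: "vec m (adj (\<lambda>i. u $ i)) = y" using y ay by (intro eq_vecI) auto
  have 1: "complex_of_real (lam * m) * u $ i = (\<Sum>c<m. G i c * adj (\<lambda>i. u $ i) c)" if i: "i < n" for i
  proof -
    have "complex_of_real (lam * m) * u $ i = (complex_of_real (lam * m) \<cdot>\<^sub>v u) $ i" using u i by simp
    also have "\<dots> = (W *\<^sub>v y) $ i" by (simp only: lam(1) y_def)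
    also have "\<dots> = (\<Sum>c<m. G i c * y $ c)"
      using W y i by (simp add: scalar_prod_def WG lessThan_atLeast0)
    finally show ?thesis by (simp add: ay)
  qed
  have 2: "(nrm m (adj v))\<^sup>2 \<le> lam * m * (nrm n v)\<^sup>2" for v
    using lam(2)[OF vec_carrier[of n v]] nrm_vec[OF vec_carrier[of n v]] nrm_cong[of n "\<lambda>i. vec n v $ i" v]
    by (simp add: adjn)
  have Xv: "X *\<^sub>v v \<in> carrier_vec n" if "v \<in> carrier_vec n" for v by (rule mult_mat_vec_carrier[OF X that])
  have QX: "(Q * X) *\<^sub>v v = Q *\<^sub>v (X *\<^sub>v v)" if "v \<in> carrier_vec n" for v
    by (rule assoc_mult_mat_vec[OF Q X that])
  have Zy: "Zm *\<^sub>v y \<in> carrier_vec n" and Wy: "W0 *\<^sub>v y \<in> carrier_vec n"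
    by (rule mult_mat_vec_carrier[OF Zc y], rule mult_mat_vec_carrier[OF W0 y])
  have 3: "complex_of_real (lam * m) * (Q *\<^sub>v u) $ i
        = (\<Sum>l=1..L. (\<Sum>c<m. x l c * adj (\<lambda>i. u $ i) c) * (Q *\<^sub>v (X *\<^sub>v h l)) $ i)
          + (Q *\<^sub>v (X *\<^sub>v (Zm *\<^sub>v vec m (adj (\<lambda>i. u $ i))))) $ i" if i: "i < n" for i
  proof -
    have "complex_of_real (lam * m) * (Q *\<^sub>v u) $ i = (Q *\<^sub>v (complex_of_real (lam * m) \<cdot>\<^sub>v u)) $ i"
      using Q u i by (subst mult_mat_vec[OF Q u]) simp
    \<comment> \<open>Here \<open>u\<close>, up to its eigenvalue, is replaced by an element of the
      range of \<open>X\<close>.\<close>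
    also have "complex_of_real (lam * m) \<cdot>\<^sub>v u = X *\<^sub>v (W0 *\<^sub>v y)"
      unfolding lam(1)[symmetric] y_def[symmetric] by (simp add: W_def assoc_mult_mat_vec[OF X W0 y])
    also have "(Q *\<^sub>v (X *\<^sub>v (W0 *\<^sub>v y))) $ i = ((Q * X) *\<^sub>v (W0 *\<^sub>v y)) $ i" by (simp add: QX Wy)
    also have "\<dots> = (\<Sum>l=1..L. (\<Sum>c<m. x l c * y $ c) * ((Q * X) *\<^sub>v h l) $ i) + ((Q * X) *\<^sub>v (Zm *\<^sub>v y)) $ i"
    proof (rule mult_mat_vec_sum_index[OF mult_carrier_mat[OF Q X] h Zy Wy _ i])
      fix k assume k: "k < n"
      show "(W0 *\<^sub>v y) $ k = (\<Sum>l=1..L. (\<Sum>c<m. x l c * y $ c) * h l $ k) + (Zm *\<^sub>v y) $ k"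
        using received_mult[where x = "\<lambda>l. vec m (x l)", OF h _ k y, where noise = Z] k y
        by (simp add: W0_def Zm_def scalar_prod_def lessThan_atLeast0)
    qed
    also have "\<dots> = (\<Sum>l=1..L. (\<Sum>c<m. x l c * y $ c) * (Q *\<^sub>v (X *\<^sub>v h l)) $ i) + (Q *\<^sub>v (X *\<^sub>v (Zm *\<^sub>v y))) $ i"
      by (simp add: QX h Zy)
    finally show ?thesis by (simp add: ay vy)
  qed
  show "\<exists>lam::real. (\<forall>i<n. complex_of_real (lam * m) * u $ i = (\<Sum>c<m. G i c * adj (\<lambda>i. u $ i) c)) \<and>
      (\<forall>v. (nrm m (adj v))\<^sup>2 \<le> lam * m * (nrm n v)\<^sup>2) \<and>
      (\<forall>i<n. complex_of_real (lam * m) * (Q *\<^sub>v u) $ i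
        = (\<Sum>l=1..L. (\<Sum>c<m. x l c * adj (\<lambda>i. u $ i) c) * (Q *\<^sub>v (X *\<^sub>v h l)) $ i)
          + (Q *\<^sub>v (X *\<^sub>v (Zm *\<^sub>v vec m (adj (\<lambda>i. u $ i))))) $ i)"
    using 1 2 3 by blast
qed

text \<open>\<open>(X Z)^H a = Z^H (X^H a)\<close>, so the noise bound is applied to
  \<open>b\<close>, the conjugate of \<open>X^H a\<close>, and \<open>adjoint_bound\<close> controls
  the norm of the latter.\<close>

lemma filtered_noise_bound:
  fixes X :: "complex mat"
  assumes X: "X \<in> carrier_mat n n" and k: "0 \<le> k" "\<And>v. v \<in> carrier_vec n \<Longrightarrow> norm2 (X *\<^sub>v v) \<le> k * norm2 v"
    and bound: "\<And>a. nrm m (\<lambda>c. \<Sum>i<n. a i * Z i c) \<le> d * nrm n a" and d: "0 \<le> d"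
  shows "nrm m (\<lambda>c. \<Sum>i<n. cnj ((X * mat n m (\<lambda>(i, c). Z i c)) $$ (i, c)) * a i) \<le> k * d * nrm n a"
proof -
  define b where "b = (\<lambda>q. \<Sum>i<n. X $$ (i, q) * cnj (a i))"
  have "(\<Sum>i<n. cnj ((X * mat n m (\<lambda>(i, c). Z i c)) $$ (i, c)) * a i) = cnj (\<Sum>q<n. b q * Z q c)" if c: "c < m" for c
  proof -
    have "(\<Sum>i<n. cnj ((X * mat n m (\<lambda>(i, c). Z i c)) $$ (i, c)) * a i)
        = (\<Sum>i<n. \<Sum>q<n. cnj (X $$ (i, q)) * cnj (Z q c) * a i)"
      using X c by (simp add: scalar_prod_def sum_distrib_right lessThan_atLeast0)
    also have "\<dots> = (\<Sum>q<n. \<Sum>i<n. cnj (X $$ (i, q)) * cnj (Z q c) * a i)" by (rule sum.swap)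
    also have "\<dots> = cnj (\<Sum>q<n. b q * Z q c)"
      by (simp add: b_def sum_distrib_left sum_distrib_right mult_ac)
    finally show ?thesis .
  qed
  then have "nrm m (\<lambda>c. \<Sum>i<n. cnj ((X * mat n m (\<lambda>(i, c). Z i c)) $$ (i, c)) * a i) = nrm m (\<lambda>c. \<Sum>q<n. b q * Z q c)"
    using nrm_cnj[of m "\<lambda>c. \<Sum>q<n. b q * Z q c"] by (simp cong: nrm_cong)
  also have "\<dots> \<le> d * nrm n b" by (rule bound)
  also have "nrm n b = nrm n (\<lambda>q. (mat_adjoint X *\<^sub>v vec n a) $ q)"
  proof -
    have "(mat_adjoint X *\<^sub>v vec n a) $ q = cnj (b q)" if "q < n" for q
      using X that by (simp add: b_def scalar_prod_def adj_index lessThan_atLeast0)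
    then show ?thesis using nrm_cnj[of n b] by (simp cong: nrm_cong)
  qed
  also have "\<dots> = norm2 (mat_adjoint X *\<^sub>v vec n a)"
    by (rule nrm_vec[OF mult_mat_vec_carrier[OF adj_carrier[OF X] vec_carrier]])
  also have "d * \<dots> \<le> d * (k * norm2 (vec n a))"
    using d by (intro mult_left_mono adjoint_bound[OF X vec_carrier k])
  also have "norm2 (vec n a) = nrm n a"
    using nrm_vec[OF vec_carrier[of n a]] nrm_cong[of n "\<lambda>i. vec n a $ i" a] by simp
  finally show ?thesis by (simp add: mult_ac)
qed

text \<open>Despreading: \<open>s^T s^* = \<tau>\<close> turns the training signal into the plain
  sum of all channels plus an averaged noise.\<close>

lemma CA_estimate_received:
  assumes Q: "Q \<in> carrier_mat n n" and u: "u \<in> carrier_vec n" and h: "\<And>l. l \<in> {1..L} \<Longrightarrow> h l \<in> carrier_vec n"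
    and s: "\<tau> \<ge> 1" "s \<in> carrier_vec \<tau>" "scalar_prod s (conjugate s) = of_nat \<tau>" and i: "i < n"
  shows "CA_estimate \<tau> Q (received L n \<tau> h (\<lambda>l. s) N) s u $ i
    = (Q *\<^sub>v u) $ i * ip n (\<lambda>i. (\<Sum>l=1..L. h l $ i) + (\<Sum>t<\<tau>. cnj (s $ t) / of_nat \<tau> * N i t)) (\<lambda>i. (Q *\<^sub>v u) $ i)
      / complex_of_real ((nrm n (\<lambda>i. (Q *\<^sub>v u) $ i))\<^sup>2)"
proof -
  have cs: "conjugate s \<in> carrier_vec \<tau>" using s(2) by simp
  have ss: "(\<Sum>t<\<tau>. s $ t * conjugate s $ t) = of_nat \<tau>"
    using s(2,3) by (simp add: scalar_prod_def lessThan_atLeast0)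
  have "(received L n \<tau> h (\<lambda>l. s) N *\<^sub>v conjugate s) $ k / of_nat \<tau>
      = (\<Sum>l=1..L. h l $ k) + (\<Sum>t<\<tau>. cnj (s $ t) / of_nat \<tau> * N k t)" if k: "k < n" for k
  proof -
    have "(received L n \<tau> h (\<lambda>l. s) N *\<^sub>v conjugate s) $ k
       = (\<Sum>l=1..L. (\<Sum>c<\<tau>. s $ c * conjugate s $ c) * h l $ k) + (\<Sum>c<\<tau>. N k c * conjugate s $ c)"
      by (rule received_mult[OF h s(2) k cs])
    also have "\<dots> = of_nat \<tau> * (\<Sum>l=1..L. h l $ k) + of_nat \<tau> * (\<Sum>t<\<tau>. cnj (s $ t) / of_nat \<tau> * N k t)"
      unfolding ss using s(1,2) by (simp add: sum_distrib_left mult.commute)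
    finally show ?thesis using s(1) by (simp add: field_simps)
  qed
  then have "ip n (\<lambda>i. (received L n \<tau> h (\<lambda>l. s) N *\<^sub>v conjugate s) $ i / of_nat \<tau>) (\<lambda>i. (Q *\<^sub>v u) $ i)
      = ip n (\<lambda>i. (\<Sum>l=1..L. h l $ i) + (\<Sum>t<\<tau>. cnj (s $ t) / of_nat \<tau> * N i t)) (\<lambda>i. (Q *\<^sub>v u) $ i)"
    unfolding ip_def by (intro sum.cong refl) simp
  then show ?thesis
    unfolding CA_estimate_index(2)[OF Q u received_carrier s(2) i] by simp
qed

text \<open>The limit is almost sure along the product filter, so \<open>M\<close> and
  \<open>C\<close> tend to infinity independently of each other. \<open>u\<close> is an arbitrary
  choice of principal eigenvectors, which covers the undetermined phase and multiple eigenvalues.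
  \<open>single_cell\<close> states positivity of \<open>\<alpha> j\<close> in the case where the
  comparison with other cells is vacuous.\<close>

theorem theorem1:
  fixes P :: "'a measure" and L j \<tau> :: nat and \<sigma> \<zeta> :: real and s :: "complex Matrix.vec"
    and R :: "nat \<Rightarrow> nat \<Rightarrow> complex mat" and \<alpha> :: "nat \<Rightarrow> real"
    and hW :: "nat \<Rightarrow> nat \<Rightarrow> nat \<Rightarrow> 'a \<Rightarrow> complex" and x :: "nat \<Rightarrow> nat \<Rightarrow> 'a \<Rightarrow> complex"
    and N :: "nat \<Rightarrow> nat \<Rightarrow> nat \<Rightarrow> 'a \<Rightarrow> complex" and Z :: "nat \<Rightarrow> nat \<Rightarrow> nat \<Rightarrow> nat \<Rightarrow> 'a \<Rightarrow> complex"
    and u :: "nat \<Rightarrow> nat \<Rightarrow> 'a \<Rightarrow> complex Matrix.vec"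
  assumes target: "j \<in> {1..L}"
    and noise_var: "\<sigma>\<^sup>2 > 0"
    and pilot: "\<tau> \<ge> 1" "s \<in> carrier_vec \<tau>" "scalar_prod s (conjugate s) = of_nat \<tau>"
    and cov: "\<And>M l. M \<ge> 1 \<Longrightarrow> l \<in> {1..L} \<Longrightarrow> R M l \<in> carrier_mat M M \<and> psd (R M l)"
    and model: "mimo_model P L \<tau> \<sigma> hW x N Z"
    and eigvec: "\<And>M C \<omega>. M \<ge> 1 \<Longrightarrow> C \<ge> 1 \<Longrightarrow> \<omega> \<in> space P \<Longrightarrow>
      principal_eigenvector (sample_cov C (Xi L M \<sigma> (R M) j * W_mat L R hW x Z M C \<omega>)) (u M C \<omega>)"
    and bounded: "\<And>M l. M \<ge> 1 \<Longrightarrow> l \<in> {1..L} \<Longrightarrow> spectral_norm (R M l) < \<zeta>"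
    and alpha: "\<And>l. l \<in> {1..L} \<Longrightarrow>
      (\<lambda>M. complex_of_real (1 / real M) *
             mtrace (Xi L M \<sigma> (R M) j * R M l * mat_adjoint (Xi L M \<sigma> (R M) j)))
        \<longlonglongrightarrow> complex_of_real (\<alpha> l)"
    and alpha_less: "\<And>l. l \<in> {1..L} \<Longrightarrow> l \<noteq> j \<Longrightarrow> \<alpha> j > \<alpha> l"
    and single_cell: "L = 1 \<Longrightarrow> \<alpha> j > 0"
  shows "AE \<omega> in P.
    ((\<lambda>(M, C).
        (norm2 (CA_estimate \<tau> (Xi' L M \<sigma> (R M) j) (Y_mat L \<tau> s R hW N M \<omega>) s (u M C \<omega>)
                - h_vec R hW M j \<omega>))\<^sup>2 / (norm2 (h_vec R hW M j \<omega>))\<^sup>2)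
      \<longlongrightarrow> 0) (sequentially \<times>\<^sub>F sequentially)"
proof -
  interpret P: prob_space P by (rule mimo_modelD(1)[OF model])
  define Xm where "Xm n = Xi L n \<sigma> (R n) j" for n
  define Xp where "Xp n = Xi' L n \<sigma> (R n) j" for n
  define S where "S n l = psd_sqrt (R n l)" for n l
  \<comment> \<open>The filter composed with the square root of the covariance. The filtered channel
    is \<open>K n l\<close> times a white vector, and \<open>K K^H\<close> is the matrix whose
    normalized trace defines \<open>\<alpha> l\<close>.\<close>
  define K where "K n l = Xm n * S n l" for n l
  define \<kappa> where "\<kappa> = \<zeta> / \<sigma>\<^sup>2"
  define w where "w n l \<omega> = vec n (\<lambda>i. hW n l i \<omega>)" for n l \<omega>
  define hv where "hv n l \<omega> = h_vec R hW n l \<omega>" for n l \<omega>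
  have hv: "hv n l \<omega> = S n l *\<^sub>v w n l \<omega>" for n l \<omega>
    by (simp add: hv_def h_vec_def channel_def S_def w_def)
  have wc: "w n l \<omega> \<in> carrier_vec n" for n l \<omega> by (simp add: w_def)
  have Rc: "R n l \<in> carrier_mat n n" "psd (R n l)" if "n \<ge> 1" "l \<in> {1..L}" for n l
    using cov[OF that] by auto
  have \<zeta>: "0 < \<zeta>"
    using spectral_norm_nonneg[OF Rc(1)[OF order_refl target]] bounded[OF order_refl target] by simp
  have \<kappa>: "0 < \<kappa>" using \<zeta> noise_var by (simp add: \<kappa>_def)
  have Sc: "S n l \<in> carrier_mat n n" and Sadj: "mat_adjoint (S n l) = S n l" and SS: "S n l * S n l = R n l"
    and Sbd: "\<And>v. v \<in> carrier_vec n \<Longrightarrow> norm2 (S n l *\<^sub>v v) \<le> sqrt \<zeta> * norm2 v"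
    if nl: "n \<ge> 1" "l \<in> {1..L}" for n l
    using psd_sqrt[OF Rc(2,1)[OF nl]] psdD(1)[OF psd_sqrt(2,1)[OF Rc(2,1)[OF nl]]]
      psd_sqrt_bound[OF Rc[OF nl] bounded[OF nl]] by (simp_all add: S_def)
  have Xmc: "Xm n \<in> carrier_mat n n" and Xmbd: "\<And>v. v \<in> carrier_vec n \<Longrightarrow> norm2 (Xm n *\<^sub>v v) \<le> \<kappa> * norm2 v"
    if n: "n \<ge> 1" for n
    using Xi_bound[where M = n and R = "R n", OF noise_var cov[OF n] target bounded[OF n target]] by (simp_all add: Xm_def \<kappa>_def)
  have Xpc: "Xp n \<in> carrier_mat n n"
    and Xp_le: "\<And>v. v \<in> carrier_vec n \<Longrightarrow> norm2 (Xp n *\<^sub>v (Xm n *\<^sub>v v)) \<le> norm2 v"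
    and Xp_fix: "\<And>v. v \<in> carrier_vec n \<Longrightarrow> Xp n *\<^sub>v (Xm n *\<^sub>v (S n j *\<^sub>v v)) = S n j *\<^sub>v v"
    if n: "n \<ge> 1" for n
    using Xi'_Xi[where M = n and R = "R n", OF noise_var cov[OF n] target] by (simp_all add: Xm_def Xp_def S_def)
  have Kc: "K n l \<in> carrier_mat n n" and Kbd: "\<And>v. v \<in> carrier_vec n \<Longrightarrow> norm2 (K n l *\<^sub>v v) \<le> \<kappa> * sqrt \<zeta> * norm2 v"
    if nl: "n \<ge> 1" "l \<in> {1..L}" for n l
  proof -
    show "K n l \<in> carrier_mat n n" unfolding K_def by (rule mult_carrier_mat[OF Xmc[OF nl(1)] Sc[OF nl]])
    fix v :: "complex Matrix.vec" assume v: "v \<in> carrier_vec n"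
    have Sv: "S n l *\<^sub>v v \<in> carrier_vec n" by (rule mult_mat_vec_carrier[OF Sc[OF nl] v])
    have "norm2 (K n l *\<^sub>v v) = norm2 (Xm n *\<^sub>v (S n l *\<^sub>v v))"
      unfolding K_def assoc_mult_mat_vec[OF Xmc[OF nl(1)] Sc[OF nl] v] ..
    also have "\<dots> \<le> \<kappa> * norm2 (S n l *\<^sub>v v)" by (rule Xmbd[OF nl(1) Sv])
    also have "\<dots> \<le> \<kappa> * (sqrt \<zeta> * norm2 v)" using \<kappa> by (intro mult_left_mono Sbd nl v) auto
    finally show "norm2 (K n l *\<^sub>v v) \<le> \<kappa> * sqrt \<zeta> * norm2 v" by simp
  qed
  have hvc: "hv n l \<omega> \<in> carrier_vec n" if "n \<ge> 1" "l \<in> {1..L}" for n l \<omega>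
    unfolding hv by (rule mult_mat_vec_carrier[OF Sc[OF that] wc])
  have Xhv: "Xm n *\<^sub>v hv n l \<omega> = K n l *\<^sub>v w n l \<omega>" if nl: "n \<ge> 1" "l \<in> {1..L}" for n l \<omega>
    unfolding hv K_def assoc_mult_mat_vec[OF Xmc[OF nl(1)] Sc[OF nl] wc] ..
  have KK: "Xm n * R n l * mat_adjoint (Xm n) = K n l * mat_adjoint (K n l)" if nl: "n \<ge> 1" "l \<in> {1..L}" for n l
  proof -
    note c = Xmc[OF nl(1)] Sc[OF nl]
    have "K n l * mat_adjoint (K n l) = Xm n * (S n l * S n l) * mat_adjoint (Xm n)"
      using c by (simp add: K_def adj_mult Sadj[OF nl] mult_assoc)
    then show ?thesis by (simp add: SS[OF nl])
  qed
  have trace: "(\<lambda>n. mtrace (mat_adjoint (K n l) * K n l) / of_nat n) \<longlonglongrightarrow> complex_of_real (\<alpha> l)" if l: "l \<in> {1..L}" for l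
  proof (rule Lim_transform_eventually[OF alpha[OF l]])
    show "\<forall>\<^sub>F n in sequentially. complex_of_real (1 / real n) * mtrace (Xi L n \<sigma> (R n) j * R n l * mat_adjoint (Xi L n \<sigma> (R n) j))
        = mtrace (mat_adjoint (K n l) * K n l) / of_nat n"
      using eventually_ge_at_top[of 1]
    proof eventually_elim
      case (elim n)
      show ?case
        unfolding Xm_def[symmetric] KK[OF elim l] mtrace_commute[OF Kc[OF elim l] adj_carrier[OF Kc[OF elim l]]] by simp
    qed
  qed
  have \<alpha>_nonneg: "0 \<le> \<alpha> l" if l: "l \<in> {1..L}" for l
  proof (rule tendsto_lowerbound)
    show "(\<lambda>n. Re (complex_of_real (1 / real n) * mtrace (Xi L n \<sigma> (R n) j * R n l * mat_adjoint (Xi L n \<sigma> (R n) j)))) \<longlonglongrightarrow> \<alpha> l"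
      using tendsto_Re[OF alpha[OF l]] by simp
    show "\<forall>\<^sub>F n in sequentially. 0 \<le> Re (complex_of_real (1 / real n) * mtrace (Xi L n \<sigma> (R n) j * R n l * mat_adjoint (Xi L n \<sigma> (R n) j)))"
      using eventually_ge_at_top[of 1]
    proof eventually_elim
      case (elim n)
      show ?case unfolding Xm_def[symmetric] KK[OF elim l]
        using mtrace_mult_adjoint_nonneg[OF Kc[OF elim l]] by simp
    qed
  qed simp
  \<comment> \<open>With at least two cells, some other \<open>\<alpha> l\<close> is nonnegative and
    strictly smaller.\<close>
  have \<alpha>j: "0 < \<alpha> j"
  proof (cases "L = 1")
    case False
    then obtain l where l: "l \<in> {1..L}" "l \<noteq> j" using target by (metis One_nat_def Suc_leI atLeastAtMost_iff le_less le_neq_implies_less nat_le_linear not_less_eq_eq order_refl)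
    then show ?thesis using \<alpha>_nonneg[OF l(1)] alpha_less[OF l] by simp
  qed (rule single_cell)

  have gramAE: "AE \<omega> in P. \<forall>l\<in>{1..L}. \<forall>k\<in>{1..L}. (\<lambda>n. (((mat_adjoint (K n k) * K n l) *\<^sub>v w n l \<omega>) \<bullet>c w n k \<omega>
      - (if k = l then mtrace (mat_adjoint (K n k) * K n l) else 0)) / of_nat n) \<longlonglongrightarrow> 0"
  proof (intro AE_finite_allI finite_atLeastAtMost)
    fix l k assume l: "l \<in> {1..L}" "k \<in> {1..L}"
    define c where "c = \<kappa> * sqrt \<zeta>"
    have c: "0 \<le> c" using \<kappa> \<zeta> by (simp add: c_def)
    show "AE \<omega> in P. (\<lambda>n. (((mat_adjoint (K n k) * K n l) *\<^sub>v w n l \<omega>) \<bullet>c w n k \<omega>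
      - (if k = l then mtrace (mat_adjoint (K n k) * K n l) else 0)) / of_nat n) \<longlonglongrightarrow> 0"
      unfolding w_def
    proof (rule channel_form_limit[OF model noise_var l(2,1)])
      show "mat_adjoint (K n k) * K n l \<in> carrier_mat n n" if "n \<ge> 1" for n
        by (rule mult_carrier_mat[OF adj_carrier[OF Kc[OF that l(2)]] Kc[OF that l(1)]])
      show "0 \<le> c * c" using c by simp
      show "norm2 ((mat_adjoint (K n k) * K n l) *\<^sub>v v) \<le> c * c * norm2 v" if n: "n \<ge> 1" and v: "v \<in> carrier_vec n" for n v
      proof -
        have Kv: "K n l *\<^sub>v v \<in> carrier_vec n" by (rule mult_mat_vec_carrier[OF Kc[OF n l(1)] v])
        have "norm2 (mat_adjoint (K n k) *\<^sub>v (K n l *\<^sub>v v)) \<le> c * norm2 (K n l *\<^sub>v v)"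
          unfolding c_def by (rule adjoint_bound[OF Kc[OF n l(2)] Kv c[unfolded c_def] Kbd[OF n l(2)]])
        also have "\<dots> \<le> c * (c * norm2 v)" using Kbd[OF n l(1) v] c by (intro mult_left_mono) (auto simp: c_def)
        finally show ?thesis
          unfolding assoc_mult_mat_vec[OF adj_carrier[OF Kc[OF n l(2)]] Kc[OF n l(1)] v] by (simp add: mult.assoc)
      qed
    qed
  qed
  have orthAE: "AE \<omega> in P. \<forall>l\<in>{1..L} - {j}. (\<lambda>n. (((mat_adjoint (S n j) * S n l) *\<^sub>v w n l \<omega>) \<bullet>c w n j \<omega>) / of_nat n) \<longlonglongrightarrow> 0"
  proof (intro AE_finite_allI finite_Diff finite_atLeastAtMost)
    fix l assume "l \<in> {1..L} - {j}"
    then have l: "l \<in> {1..L}" "j \<noteq> l" by auto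
    have "AE \<omega> in P. (\<lambda>n. (((mat_adjoint (S n j) * S n l) *\<^sub>v vec n (\<lambda>i. hW n l i \<omega>)) \<bullet>c vec n (\<lambda>i. hW n j i \<omega>)
      - (if j = l then mtrace (mat_adjoint (S n j) * S n l) else 0)) / of_nat n) \<longlonglongrightarrow> 0"
    proof (rule channel_form_limit[OF model noise_var target l(1)])
      show "mat_adjoint (S n j) * S n l \<in> carrier_mat n n" if "n \<ge> 1" for n
        by (rule mult_carrier_mat[OF adj_carrier[OF Sc[OF that target]] Sc[OF that l(1)]])
      show "0 \<le> sqrt \<zeta> * sqrt \<zeta>" using \<zeta> by simp
      show "norm2 ((mat_adjoint (S n j) * S n l) *\<^sub>v v) \<le> sqrt \<zeta> * sqrt \<zeta> * norm2 v" if n: "n \<ge> 1" and v: "v \<in> carrier_vec n" for n v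
      proof -
        have Sv: "S n l *\<^sub>v v \<in> carrier_vec n" by (rule mult_mat_vec_carrier[OF Sc[OF n l(1)] v])
        have "norm2 (S n j *\<^sub>v (S n l *\<^sub>v v)) \<le> sqrt \<zeta> * norm2 (S n l *\<^sub>v v)" by (rule Sbd[OF n target Sv])
        also have "\<dots> \<le> sqrt \<zeta> * (sqrt \<zeta> * norm2 v)" using \<zeta> by (intro mult_left_mono Sbd n l v) auto
        finally show ?thesis
          unfolding Sadj[OF n target] assoc_mult_mat_vec[OF Sc[OF n target] Sc[OF n l(1)] v] by (simp only: mult.assoc)
      qed
    qed
    then show "AE \<omega> in P. (\<lambda>n. (((mat_adjoint (S n j) * S n l) *\<^sub>v w n l \<omega>) \<bullet>c w n j \<omega>) / of_nat n) \<longlonglongrightarrow> 0"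
      using l(2) by (simp add: w_def)
  qed
  have normAE: "AE \<omega> in P. \<forall>l\<in>{1..L}. (\<lambda>n. ((1\<^sub>m n *\<^sub>v w n l \<omega>) \<bullet>c w n l \<omega> - (if l = l then mtrace (1\<^sub>m n) else 0)) / of_nat n) \<longlonglongrightarrow> 0"
    unfolding w_def
    by (intro AE_finite_allI finite_atLeastAtMost channel_form_limit[OF model noise_var, of _ _ "\<lambda>n. 1\<^sub>m n" 1]) auto
  \<comment> \<open>Despreading weights, chosen so that \<open>e n \<omega>\<close> is the pilot
    noise after multiplication by \<open>s^* / \<tau>\<close>.\<close>
  define c where "c t = cnj (s $ t) / of_nat \<tau>" for t
  define e where "e n \<omega> = vec n (\<lambda>i. \<Sum>t<\<tau>. c t * N n i t \<omega>)" for n \<omega>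
  have crossAE: "AE \<omega> in P. (\<lambda>n. ((S n j *\<^sub>v e n \<omega>) \<bullet>c w n j \<omega>) / of_nat n) \<longlonglongrightarrow> 0"
    unfolding e_def w_def
    by (rule pilot_noise_cross_limit[OF model noise_var target Sc[OF _ target] _ Sbd[OF _ target]]) (use \<zeta> in auto)
  note pilotAE = pilot_noise_norm_limit[OF model noise_var]
  have symAE: "AE \<omega> in P. \<forall>l\<in>{1..L}. \<forall>k\<in>{1..L}. (\<lambda>n. ip n (\<lambda>c. x l c \<omega>) (\<lambda>c. x k c \<omega>) / of_nat n) \<longlonglongrightarrow> (if l = k then 1 else 0)"
    by (intro AE_finite_allI finite_atLeastAtMost symbols_limit[OF model])
  show ?thesis
    using gramAE orthAE normAE crossAE pilotAE symAE data_noise_bound[OF model noise_var] AE_space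
  proof eventually_elim
    case (elim \<omega>)
    note gram = elim(1) and orth = elim(2) and norm = elim(3) and cross = elim(4) and pil = elim(5)
      and sym = elim(6) and dnoise = elim(7) and \<omega> = elim(8)

    \<comment> \<open>From here on \<omega> is fixed. Limits in \<open>M\<close> alone or in
      \<open>C\<close> alone are transported to the product filter along its projections.\<close>
    define F where "F = (sequentially \<times>\<^sub>F sequentially :: (nat \<times> nat) filter)"
    have evn: "\<forall>\<^sub>F t in F. Q (fst t)" if "\<forall>\<^sub>F n in sequentially. Q n" for Q
      unfolding F_def by (rule eventually_compose_filterlim[OF that filterlim_fst])
    have evm: "\<forall>\<^sub>F t in F. Q (snd t)" if "\<forall>\<^sub>F n in sequentially. Q n" for Q
      unfolding F_def by (rule eventually_compose_filterlim[OF that filterlim_snd])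
    have limn: "((\<lambda>t. f (fst t)) \<longlongrightarrow> l) F" if "f \<longlonglongrightarrow> l" for f :: "nat \<Rightarrow> 'z::topological_space" and l
      unfolding F_def by (rule filterlim_compose[OF that filterlim_fst])
    have limm: "((\<lambda>t. f (snd t)) \<longlongrightarrow> l) F" if "f \<longlonglongrightarrow> l" for f :: "nat \<Rightarrow> 'z::topological_space" and l
      unfolding F_def by (rule filterlim_compose[OF that filterlim_snd])
    have evF: "\<forall>\<^sub>F t in F. fst t \<ge> 1 \<and> snd t \<ge> 1"
      by (intro eventually_conj evn evm eventually_ge_at_top)
    define gv where "gv n l = Xm n *\<^sub>v hv n l \<omega>" for n l
    have gvc: "gv n l \<in> carrier_vec n" if "n \<ge> 1" "l \<in> {1..L}" for n l
      unfolding gv_def by (rule mult_mat_vec_carrier[OF Xmc hvc]) (use that in auto)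
    have gram': "(\<lambda>n. ip n (\<lambda>i. gv n l $ i) (\<lambda>i. gv n k $ i) / of_nat n) \<longlonglongrightarrow> (if l = k then complex_of_real (\<alpha> l) else 0)"
      if l: "l \<in> {1..L}" "k \<in> {1..L}" for l k
    proof -
      have "(\<lambda>n. (if k = l then mtrace (mat_adjoint (K n k) * K n l) else 0) / of_nat n) \<longlonglongrightarrow> (if l = k then complex_of_real (\<alpha> l) else 0)"
        using trace[OF l(1)] by (cases "k = l") auto
      from tendsto_add[OF gram[rule_format, OF l] this]
      have "(\<lambda>n. (((mat_adjoint (K n k) * K n l) *\<^sub>v w n l \<omega>) \<bullet>c w n k \<omega>) / of_nat n) \<longlonglongrightarrow> (if l = k then complex_of_real (\<alpha> l) else 0)"
        by (simp add: diff_divide_distrib)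
      moreover have "((mat_adjoint (K n k) * K n l) *\<^sub>v w n l \<omega>) \<bullet>c w n k \<omega> = ip n (\<lambda>i. gv n l $ i) (\<lambda>i. gv n k $ i)" if n: "n \<ge> 1" for n
      proof -
        have Kl: "K n l *\<^sub>v w n l \<omega> \<in> carrier_vec n" by (rule mult_mat_vec_carrier[OF Kc[OF n l(1)] wc])
        have "((mat_adjoint (K n k) * K n l) *\<^sub>v w n l \<omega>) \<bullet>c w n k \<omega> = (K n l *\<^sub>v w n l \<omega>) \<bullet>c (K n k *\<^sub>v w n k \<omega>)"
          unfolding assoc_mult_mat_vec[OF adj_carrier[OF Kc[OF n l(2)]] Kc[OF n l(1)] wc]
          using cscalar_prod_adj[OF adj_carrier[OF Kc[OF n l(2)]] Kl wc] by (simp add: adj_adj)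
        then show ?thesis
          unfolding gv_def Xhv[OF n l(1)] Xhv[OF n l(2)]
          using ip_vec[OF Kl mult_mat_vec_carrier[OF Kc[OF n l(2)] wc]] by simp
      qed
      ultimately show ?thesis
        by (elim Lim_transform_eventually) (auto intro!: eventually_mono[OF eventually_ge_at_top[of 1]])
    qed
    have orth': "(\<lambda>n. ip n (\<lambda>i. hv n l \<omega> $ i) (\<lambda>i. hv n j \<omega> $ i) / of_nat n) \<longlonglongrightarrow> 0"
      if l: "l \<in> {1..L}" "l \<noteq> j" for l
    proof (rule Lim_transform_eventually)
      show "(\<lambda>n. (((mat_adjoint (S n j) * S n l) *\<^sub>v w n l \<omega>) \<bullet>c w n j \<omega>) / of_nat n) \<longlonglongrightarrow> 0" using orth l by blast
      show "\<forall>\<^sub>F n in sequentially. (((mat_adjoint (S n j) * S n l) *\<^sub>v w n l \<omega>) \<bullet>c w n j \<omega>) / of_nat n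
          = ip n (\<lambda>i. hv n l \<omega> $ i) (\<lambda>i. hv n j \<omega> $ i) / of_nat n"
        using eventually_ge_at_top[of 1]
      proof eventually_elim
        case n: (elim n)
        have "((mat_adjoint (S n j) * S n l) *\<^sub>v w n l \<omega>) \<bullet>c w n j \<omega> = hv n l \<omega> \<bullet>c hv n j \<omega>"
          unfolding assoc_mult_mat_vec[OF adj_carrier[OF Sc[OF n target]] Sc[OF n l(1)] wc] hv[symmetric]
          using cscalar_prod_adj[OF adj_carrier[OF Sc[OF n target]] hvc[OF n l(1)] wc] by (simp add: adj_adj hv)
        then show ?case by (simp add: ip_vec[OF hvc[OF n l(1)] hvc[OF n target]])
      qed
    qed
    have ec: "e n \<omega> \<in> carrier_vec n" for n by (simp add: e_def)
    have eorth: "(\<lambda>n. ip n (\<lambda>i. e n \<omega> $ i) (\<lambda>i. hv n j \<omega> $ i) / of_nat n) \<longlonglongrightarrow> 0"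
    proof (rule Lim_transform_eventually[OF cross])
      show "\<forall>\<^sub>F n in sequentially. ((S n j *\<^sub>v e n \<omega>) \<bullet>c w n j \<omega>) / of_nat n
          = ip n (\<lambda>i. e n \<omega> $ i) (\<lambda>i. hv n j \<omega> $ i) / of_nat n"
        using eventually_ge_at_top[of 1]
      proof eventually_elim
        case n: (elim n)
        have "(S n j *\<^sub>v e n \<omega>) \<bullet>c w n j \<omega> = e n \<omega> \<bullet>c hv n j \<omega>"
          using cscalar_prod_adj[OF Sc[OF n target] ec wc] by (simp add: Sadj[OF n target] hv)
        then show ?case by (simp add: ip_vec[OF ec hvc[OF n target]])
      qed
    qed
    \<comment> \<open>One constant for both norm bounds. The first summand serves the channels,
      whose white vectors eventually satisfy \<open>norm2 w ^ 2 \<le> 2 n\<close>; the second serves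
      the despread pilot noise.\<close>
    define H where "H = sqrt \<zeta> * sqrt 2 + sqrt (\<sigma>\<^sup>2 + 1)"
    have hle: "\<forall>\<^sub>F n in sequentially. \<forall>l\<in>{1..L}. norm2 (hv n l \<omega>) \<le> H * sqrt n"
    proof (intro eventually_ball_finite finite_atLeastAtMost ballI)
      fix l assume l: "l \<in> {1..L}"
      have "\<forall>\<^sub>F n in sequentially. dist (((1\<^sub>m n *\<^sub>v w n l \<omega>) \<bullet>c w n l \<omega> - mtrace (1\<^sub>m n)) / of_nat n) 0 < 1"
        using tendstoD[OF norm[rule_format, OF l], of 1] by simp
      then show "\<forall>\<^sub>F n in sequentially. norm2 (hv n l \<omega>) \<le> H * sqrt n"
        using eventually_ge_at_top[of 1]
      proof eventually_elim
        case (elim n)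
        note n = elim(2)
        have "((1\<^sub>m n *\<^sub>v w n l \<omega>) \<bullet>c w n l \<omega> - mtrace (1\<^sub>m n)) / of_nat n
            = complex_of_real (((norm2 (w n l \<omega>))\<^sup>2 - real n) / real n)"
          by (simp add: one_mult_mat_vec[OF wc] cscalar_prod_self mtrace_def)
        then have "\<bar>((norm2 (w n l \<omega>))\<^sup>2 - real n) / real n\<bar> < 1" using elim(1) by (simp only: dist_norm diff_zero norm_of_real)
        then have "(norm2 (w n l \<omega>))\<^sup>2 \<le> 2 * real n" using n by (simp add: abs_less_iff field_simps)
        then have w: "norm2 (w n l \<omega>) \<le> sqrt 2 * sqrt n"
          by (metis real_le_rsqrt real_sqrt_mult)
        have "norm2 (hv n l \<omega>) \<le> sqrt \<zeta> * norm2 (w n l \<omega>)" unfolding hv by (rule Sbd[OF n l wc])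
        also have "\<dots> \<le> sqrt \<zeta> * (sqrt 2 * sqrt n)" using w \<zeta> by (intro mult_left_mono) auto
        also have "\<dots> \<le> H * sqrt n" by (simp add: H_def distrib_right mult.assoc)
        finally show ?case .
      qed
    qed
    \<comment> \<open>The energy \<open>\<tau>\<close> of the pilot makes the weights have squared
      norm \<open>1 / \<tau>\<close>, which offsets the \<open>\<tau>\<close> noise samples per
      antenna.\<close>
    have c_norm: "(nrm \<tau> c)\<^sup>2 = 1 / real \<tau>"
    proof -
      have "complex_of_real ((nrm \<tau> (\<lambda>t. s $ t))\<^sup>2) = of_nat \<tau>"
        using ip_vec[OF pilot(2,2)] pilot(3) by (simp add: ip_self)
      then have "(nrm \<tau> (\<lambda>t. s $ t))\<^sup>2 = real \<tau>" by (metis of_real_eq_iff of_real_of_nat_eq)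
      moreover have "nrm \<tau> c = nrm \<tau> (\<lambda>t. s $ t) / real \<tau>"
        using nrm_scale[of \<tau> "1 / of_nat \<tau>" "\<lambda>t. cnj (s $ t)"] nrm_cnj[of \<tau> "\<lambda>t. s $ t"] by (simp add: c_def[abs_def] norm_divide)
      ultimately show ?thesis using pilot(1) by (simp add: power_divide power2_eq_square)
    qed
    have ele: "\<forall>\<^sub>F n in sequentially. norm2 (e n \<omega>) \<le> H * sqrt n"
    proof -
      have "\<forall>\<^sub>F n in sequentially. (\<Sum>i<n. \<Sum>t<\<tau>. (cmod (N n i t \<omega>))\<^sup>2) / real n < real \<tau> * (\<sigma>\<^sup>2 + 1)"
        by (rule order_tendstoD(2)[OF pil]) (use pilot(1) in simp)
      then show ?thesis using eventually_ge_at_top[of 1]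
      proof eventually_elim
        case (elim n)
        note n = elim(2)
        have 1: "(cmod (\<Sum>t<\<tau>. c t * N n i t \<omega>))\<^sup>2 \<le> (\<Sum>t<\<tau>. (cmod (N n i t \<omega>))\<^sup>2) / real \<tau>" for i
        proof -
          have "cmod (\<Sum>t<\<tau>. c t * N n i t \<omega>) \<le> nrm \<tau> c * nrm \<tau> (\<lambda>t. N n i t \<omega>)"
            using ip_le[of \<tau> c "\<lambda>t. cnj (N n i t \<omega>)"] by (simp add: ip_def nrm_cnj)
          then have "(cmod (\<Sum>t<\<tau>. c t * N n i t \<omega>))\<^sup>2 \<le> (nrm \<tau> c * nrm \<tau> (\<lambda>t. N n i t \<omega>))\<^sup>2"
            by (intro power_mono) auto
          then show ?thesis by (simp add: power_mult_distrib c_norm nrm_square[of \<tau> "\<lambda>t. N n i t \<omega>"])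
        qed
        have "(norm2 (e n \<omega>))\<^sup>2 = (\<Sum>i<n. (cmod (\<Sum>t<\<tau>. c t * N n i t \<omega>))\<^sup>2)"
          unfolding nrm_vec[OF ec, symmetric] nrm_square by (simp add: e_def)
        also have "\<dots> \<le> (\<Sum>i<n. (\<Sum>t<\<tau>. (cmod (N n i t \<omega>))\<^sup>2) / real \<tau>)" by (intro sum_mono 1)
        also have "\<dots> = (\<Sum>i<n. \<Sum>t<\<tau>. (cmod (N n i t \<omega>))\<^sup>2) / real \<tau>" by (simp add: sum_divide_distrib)
        also have "\<dots> \<le> (\<sigma>\<^sup>2 + 1) * n" using elim pilot(1) by (simp add: field_simps)
        finally have "norm2 (e n \<omega>) \<le> sqrt (\<sigma>\<^sup>2 + 1) * sqrt n" by (metis real_le_rsqrt real_sqrt_mult)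
        also have "\<dots> \<le> H * sqrt n" using \<zeta> by (simp add: H_def distrib_right)
        finally show ?case .
      qed
    qed
    define eps where "eps t = \<sigma>\<^sup>2 / real (min (fst t) (snd t)) + 2 * real (max (fst t) (snd t)) powr (-1/4)" for t :: "nat \<times> nat"
    have eps0: "0 \<le> eps t" for t by (simp add: eps_def)
    \<comment> \<open>The reciprocal of the minimum is at most the sum of the two reciprocals, and
      the power of the maximum is dominated by that of \<open>fst t\<close>, so one-variable limits
      suffice.\<close>
    have eps: "(eps \<longlongrightarrow> 0) F"
    proof (rule tendsto_sandwich)
      show "\<forall>\<^sub>F t in F. 0 \<le> eps t" using eps0 by simp
      show "\<forall>\<^sub>F t in F. eps t \<le> \<sigma>\<^sup>2 / real (fst t) + \<sigma>\<^sup>2 / real (snd t) + 2 * real (fst t) powr (-1/4)"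
        using evF
      proof eventually_elim
        case (elim t)
        have "\<sigma>\<^sup>2 / real (min (fst t) (snd t)) \<le> \<sigma>\<^sup>2 / real (fst t) + \<sigma>\<^sup>2 / real (snd t)"
          by (cases "fst t \<le> snd t") (simp_all add: min_def)
        moreover have "real (max (fst t) (snd t)) powr (-1/4) \<le> real (fst t) powr (-1/4)"
          using elim by (intro powr_mono2') auto
        ultimately show ?case unfolding eps_def by linarith
      qed
      have "(\<lambda>n. \<sigma>\<^sup>2 / real n) \<longlonglongrightarrow> 0" by real_asymp
      note a = limn[OF this] limm[OF this]
      have "(\<lambda>n. 2 * real n powr (-1/4)) \<longlonglongrightarrow> 0" by real_asymp
      from tendsto_add[OF tendsto_add[OF a] limn[OF this]]
      show "((\<lambda>t. \<sigma>\<^sup>2 / real (fst t) + \<sigma>\<^sup>2 / real (snd t) + 2 * real (fst t) powr (-1/4)) \<longlongrightarrow> 0) F" by simp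
    qed simp
    \<comment> \<open>The factor \<open>max 1 \<kappa>\<close> lets one null function bound both the
      raw noise and the noise after the filter of norm at most \<kappa>.\<close>
    define z where "z t = max 1 \<kappa> * sqrt (eps t)" for t
    have z: "(z \<longlongrightarrow> 0) F" unfolding z_def[abs_def]
      using tendsto_mult[OF tendsto_const tendsto_real_sqrt[OF eps]] by simp

    define Zm where "Zm t = mat (fst t) (snd t) (\<lambda>(i, c). Z (fst t) (snd t) i c \<omega>)" for t
    define G where "G t i c = (\<Sum>l=1..L. gv (fst t) l $ i * x l c \<omega>) + (Xm (fst t) * Zm t) $$ (i, c)" for t i c
    define adj where "adj t v c = (\<Sum>i<fst t. cnj (G t i c) * v i)" for t v c
    define uu where "uu t i = u (fst t) (snd t) \<omega> $ i" for t i
    define p where "p t i = (Xp (fst t) *\<^sub>v u (fst t) (snd t) \<omega>) $ i" for t i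
    define Ph where "Ph t l i = (Xp (fst t) *\<^sub>v gv (fst t) l) $ i" for t :: "nat \<times> nat" and l i
    define y where "y t = vec (snd t) (adj t (uu t))" for t
    define r where "r t i = (Xp (fst t) *\<^sub>v (Xm (fst t) *\<^sub>v (Zm t *\<^sub>v y t))) $ i" for t i
    have step: "u (fst t) (snd t) \<omega> \<in> carrier_vec (fst t) \<and> nrm (fst t) (uu t) = 1 \<and> (\<exists>lam::real.
        (\<forall>i<fst t. complex_of_real (lam * real (snd t)) * uu t i = (\<Sum>c<snd t. G t i c * adj t (uu t) c)) \<and>
        (\<forall>v. (nrm (snd t) (adj t v))\<^sup>2 \<le> lam * real (snd t) * (nrm (fst t) v)\<^sup>2) \<and>
        (\<forall>i<fst t. complex_of_real (lam * real (snd t)) * p t i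
          = (\<Sum>l=1..L. (\<Sum>c<snd t. x l c \<omega> * adj t (uu t) c) * Ph t l i) + r t i))"
      if t: "fst t \<ge> 1" "snd t \<ge> 1" for t
    proof -
      have "principal_eigenvector (sample_cov (snd t) (Xm (fst t) * received L (fst t) (snd t) (\<lambda>l. hv (fst t) l \<omega>)
          (\<lambda>l. vec (snd t) (\<lambda>c. x l c \<omega>)) (\<lambda>i c. Z (fst t) (snd t) i c \<omega>))) (u (fst t) (snd t) \<omega>)"
        using eigvec[OF t \<omega>] by (simp only: Xm_def W_mat_def hv_def)
      note f = filtered_data_eigen[OF t(2) Xmc[OF t(1)] Xpc[OF t(1)] hvc[OF t(1)] this]
      show ?thesis
        unfolding uu_def[abs_def] p_def r_def y_def Ph_def gv_def G_def adj_def[abs_def] Zm_def by (intro conjI f)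
    qed
    obtain lam :: "nat \<times> nat \<Rightarrow> real" where lam:
      "\<And>t. fst t \<ge> 1 \<Longrightarrow> snd t \<ge> 1 \<Longrightarrow>
        (\<forall>i<fst t. complex_of_real (lam t * real (snd t)) * uu t i = (\<Sum>c<snd t. G t i c * adj t (uu t) c)) \<and>
        (\<forall>v. (nrm (snd t) (adj t v))\<^sup>2 \<le> lam t * real (snd t) * (nrm (fst t) v)\<^sup>2) \<and>
        (\<forall>i<fst t. complex_of_real (lam t * real (snd t)) * p t i
          = (\<Sum>l=1..L. (\<Sum>c<snd t. x l c \<omega> * adj t (uu t) c) * Ph t l i) + r t i)"
    proof -
      \<comment> \<open>The eigenvalue is chosen separately for every pair of dimensions; pairs with
        a zero component carry no condition, and \<open>F\<close> eventually avoids them.\<close>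
      have "\<exists>lam::nat \<times> nat \<Rightarrow> real. \<forall>t. fst t \<ge> 1 \<and> snd t \<ge> 1 \<longrightarrow>
        (\<forall>i<fst t. complex_of_real (lam t * real (snd t)) * uu t i = (\<Sum>c<snd t. G t i c * adj t (uu t) c)) \<and>
        (\<forall>v. (nrm (snd t) (adj t v))\<^sup>2 \<le> lam t * real (snd t) * (nrm (fst t) v)\<^sup>2) \<and>
        (\<forall>i<fst t. complex_of_real (lam t * real (snd t)) * p t i
          = (\<Sum>l=1..L. (\<Sum>c<snd t. x l c \<omega> * adj t (uu t) c) * Ph t l i) + r t i)"
        by (rule choice) (use step in blast)
      then show ?thesis using that by blast
    qed
    have zbound: "\<forall>\<^sub>F t in F. (\<forall>a. nrm (snd t) (\<lambda>c. \<Sum>i<fst t. a i * Z (fst t) (snd t) i c \<omega>) \<le> sqrt (eps t) * sqrt (real (fst t * snd t)) * nrm (fst t) a)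
      \<and> (\<forall>b. nrm (fst t) (\<lambda>i. \<Sum>c<snd t. b c * Z (fst t) (snd t) i c \<omega>) \<le> sqrt (eps t) * sqrt (real (fst t * snd t)) * nrm (snd t) b)"
      using dnoise unfolding F_def case_prod_unfold
    proof eventually_elim
      case (elim t)
      show ?case
        using elim eps0[of t] unfolding of_nat_mult
        by (intro conjI allI nrm_of_square_bound) (simp_all add: eps_def)
    qed
    have eigen: "\<forall>\<^sub>F t in F. \<forall>i<fst t. complex_of_real (lam t * real (snd t)) * uu t i = (\<Sum>c<snd t. G t i c * adj t (uu t) c)"
      using evF by eventually_elim (use lam in blast)
    have rayleigh: "\<forall>\<^sub>F t in F. \<forall>v. (nrm (snd t) (adj t v))\<^sup>2 \<le> lam t * real (snd t) * (nrm (fst t) v)\<^sup>2"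
      using evF by eventually_elim (use lam in blast)
    have unfilter: "\<forall>\<^sub>F t in F. \<forall>i<fst t. complex_of_real (lam t * real (snd t)) * p t i
        = (\<Sum>l=1..L. (\<Sum>c<snd t. x l c \<omega> * adj t (uu t) c) * Ph t l i) + r t i"
      using evF by eventually_elim (use lam in blast)
    have rle: "\<forall>\<^sub>F t in F. nrm (fst t) (r t) \<le> nrm (fst t) (\<lambda>i. \<Sum>c<snd t. Z (fst t) (snd t) i c \<omega> * adj t (uu t) c)"
      using evF
    proof eventually_elim
      case (elim t)
      have Zc: "Zm t \<in> carrier_mat (fst t) (snd t)" and yc: "y t \<in> carrier_vec (snd t)" by (simp_all add: Zm_def y_def)
      have Zy: "Zm t *\<^sub>v y t \<in> carrier_vec (fst t)" by (rule mult_mat_vec_carrier[OF Zc yc])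
      have n: "1 \<le> fst t" using elim by simp
      have "nrm (fst t) (r t) = norm2 (Xp (fst t) *\<^sub>v (Xm (fst t) *\<^sub>v (Zm t *\<^sub>v y t)))"
        unfolding r_def[abs_def] by (rule nrm_vec[OF mult_mat_vec_carrier[OF Xpc[OF n] mult_mat_vec_carrier[OF Xmc[OF n] Zy]]])
      also have "\<dots> \<le> norm2 (Zm t *\<^sub>v y t)" by (rule Xp_le[OF n Zy])
      also have "\<dots> = nrm (fst t) (\<lambda>i. (Zm t *\<^sub>v y t) $ i)" by (rule nrm_vec[OF Zy, symmetric])
      also have "\<dots> = nrm (fst t) (\<lambda>i. \<Sum>c<snd t. Z (fst t) (snd t) i c \<omega> * adj t (uu t) c)"
        by (rule nrm_cong) (simp add: Zm_def y_def scalar_prod_def lessThan_atLeast0)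
      finally show ?case .
    qed
    interpret CA: ca_asymptotics F fst snd L j \<alpha> "\<lambda>t l i. gv (fst t) l $ i" "\<lambda>t l i. hv (fst t) l \<omega> $ i" Ph
      "\<lambda>t l c. x l c \<omega>" "\<lambda>t i c. Z (fst t) (snd t) i c \<omega>" "\<lambda>t i c. (Xm (fst t) * Zm t) $$ (i, c)"
      uu p r "\<lambda>t i. e (fst t) \<omega> $ i" lam z \<kappa> H G adj
    proof unfold_locales
      show "G \<equiv> \<lambda>t i c. (\<Sum>l=1..L. gv (fst t) l $ i * x l c \<omega>) + (Xm (fst t) * Zm t) $$ (i, c)"
        by (intro eq_reflection ext) (simp only: G_def)
      show "adj \<equiv> \<lambda>t v c. \<Sum>i<fst t. cnj (G t i c) * v i"
        by (intro eq_reflection ext) (simp only: adj_def)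
      show "F \<noteq> bot" by (simp add: F_def prod_filter_eq_bot)
      show "\<forall>\<^sub>F t in F. 1 \<le> fst t \<and> 1 \<le> snd t" by (rule evF)
      show "j \<in> {1..L}" by (rule target)
      show "0 < \<alpha> j" by (rule \<alpha>j)
      show "\<alpha> l < \<alpha> j" if "l \<in> {1..L}" "l \<noteq> j" for l by (rule alpha_less[OF that])
      show "((\<lambda>t. ip (fst t) (\<lambda>i. gv (fst t) l $ i) (\<lambda>i. gv (fst t) k $ i) / of_nat (fst t)) \<longlongrightarrow> (if l = k then complex_of_real (\<alpha> l) else 0)) F"
        if "l \<in> {1..L}" "k \<in> {1..L}" for l k
        by (rule limn[OF gram'[OF that]])
      show "((\<lambda>t. ip (snd t) (\<lambda>c. x l c \<omega>) (\<lambda>c. x k c \<omega>) / of_nat (snd t)) \<longlongrightarrow> (if l = k then 1 else 0)) F"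
        if "l \<in> {1..L}" "k \<in> {1..L}" for l k
        by (rule limm[OF sym[rule_format, OF that]])
      show "(z \<longlongrightarrow> 0) F" by (rule z)
      show "\<forall>\<^sub>F t in F. \<forall>b. nrm (fst t) (\<lambda>i. \<Sum>c<snd t. Z (fst t) (snd t) i c \<omega> * b c) \<le> z t * sqrt (real (fst t * snd t)) * nrm (snd t) b"
        using zbound
      proof eventually_elim
        case (elim t)
        have "sqrt (eps t) \<le> z t" using eps0[of t] mult_right_mono[of 1 "max 1 \<kappa>" "sqrt (eps t)"] by (simp add: z_def)
        then have "sqrt (eps t) * sqrt (real (fst t * snd t)) * nrm (snd t) b \<le> z t * sqrt (real (fst t * snd t)) * nrm (snd t) b" for b
          by (intro mult_right_mono) auto
        moreover have "nrm (fst t) (\<lambda>i. \<Sum>c<snd t. Z (fst t) (snd t) i c \<omega> * b c) \<le> sqrt (eps t) * sqrt (real (fst t * snd t)) * nrm (snd t) b" for b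
          using conjunct2[OF elim, rule_format, of b] by (simp only: mult.commute[of "Z _ _ _ _ _"])
        ultimately show ?case by (intro allI) (rule order_trans)
      qed
      show "\<forall>\<^sub>F t in F. \<forall>a. nrm (snd t) (\<lambda>c. \<Sum>i<fst t. cnj ((Xm (fst t) * Zm t) $$ (i, c)) * a i) \<le> z t * sqrt (real (fst t * snd t)) * nrm (fst t) a"
        using zbound evF
      proof eventually_elim
        case (elim t)
        have "\<kappa> * sqrt (eps t) \<le> z t" using eps0[of t] by (simp add: z_def mult_right_mono)
        then have le: "\<kappa> * (sqrt (eps t) * sqrt (real (fst t * snd t))) * nrm (fst t) a \<le> z t * sqrt (real (fst t * snd t)) * nrm (fst t) a" for a
          unfolding mult.assoc[symmetric] by (intro mult_right_mono) auto
        show ?case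
        proof
          fix a
          have "nrm (snd t) (\<lambda>c. \<Sum>i<fst t. cnj ((Xm (fst t) * Zm t) $$ (i, c)) * a i) \<le> \<kappa> * (sqrt (eps t) * sqrt (real (fst t * snd t))) * nrm (fst t) a"
            unfolding Zm_def
            by (rule filtered_noise_bound[OF Xmc _ Xmbd]) (use elim \<kappa> eps0[of t] in auto)
          then show "nrm (snd t) (\<lambda>c. \<Sum>i<fst t. cnj ((Xm (fst t) * Zm t) $$ (i, c)) * a i) \<le> z t * sqrt (real (fst t * snd t)) * nrm (fst t) a"
            using le[of a] by simp
        qed
      qed
      show "\<forall>\<^sub>F t in F. nrm (fst t) (uu t) = 1" using evF by eventually_elim (use step in blast)
      have Ph: "nrm (fst t) (Ph t l) \<le> nrm (fst t) (\<lambda>i. hv (fst t) l \<omega> $ i)" if t: "fst t \<ge> 1" and l: "l \<in> {1..L}" for t l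
        using Xp_le[OF t hvc[OF t l]]
        by (simp add: Ph_def[abs_def] gv_def nrm_vec[OF hvc[OF t l]] nrm_vec[OF mult_mat_vec_carrier[OF Xpc[OF t] gvc[OF t l, unfolded gv_def]]])
      show "\<forall>\<^sub>F t in F. \<forall>l\<in>{1..L}. nrm (fst t) (Ph t l) \<le> nrm (fst t) (\<lambda>i. hv (fst t) l \<omega> $ i)"
        using evF by eventually_elim (use Ph in blast)
      show "\<forall>\<^sub>F t in F. \<forall>i<fst t. Ph t j i = hv (fst t) j \<omega> $ i"
        using evF by eventually_elim (simp add: Ph_def gv_def hv Xp_fix wc)
      show "\<forall>\<^sub>F t in F. \<forall>l\<in>{1..L}. nrm (fst t) (\<lambda>i. hv (fst t) l \<omega> $ i) \<le> H * sqrt (real (fst t))"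
        using evF evn[OF hle] by eventually_elim (simp add: nrm_vec[OF hvc])
      show "\<forall>\<^sub>F t in F. nrm (fst t) (\<lambda>i. e (fst t) \<omega> $ i) \<le> H * sqrt (real (fst t))"
        using evn[OF ele] by eventually_elim (simp add: nrm_vec[OF ec])
      show "0 < \<kappa>" by (rule \<kappa>)
      show "\<forall>\<^sub>F t in F. nrm (fst t) (\<lambda>i. gv (fst t) j $ i) \<le> \<kappa> * nrm (fst t) (\<lambda>i. hv (fst t) j \<omega> $ i)"
        using evF
      proof eventually_elim
        case (elim t)
        then have n: "1 \<le> fst t" by simp
        show ?case unfolding nrm_vec[OF gvc[OF n target]] nrm_vec[OF hvc[OF n target]]
          unfolding gv_def by (rule Xmbd[OF n hvc[OF n target]])
      qed
      show "((\<lambda>t. ip (fst t) (\<lambda>i. hv (fst t) l \<omega> $ i) (\<lambda>i. hv (fst t) j \<omega> $ i) / of_nat (fst t)) \<longlongrightarrow> 0) F"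
        if "l \<in> {1..L}" "l \<noteq> j" for l by (rule limn[OF orth'[OF that]])
      show "((\<lambda>t. ip (fst t) (\<lambda>i. e (fst t) \<omega> $ i) (\<lambda>i. hv (fst t) j \<omega> $ i) / of_nat (fst t)) \<longlongrightarrow> 0) F"
        by (rule limn[OF eorth])
    qed (fact eigen[unfolded adj_def[abs_def] G_def[abs_def]] rayleigh[unfolded adj_def[abs_def] G_def[abs_def]]
        unfilter[unfolded adj_def[abs_def] G_def[abs_def]] rle[unfolded adj_def[abs_def] G_def[abs_def]])+
    show ?case unfolding F_def[symmetric] case_prod_unfold
    proof (rule Lim_transform_eventually[OF CA.estimate_consistent])
      show "\<forall>\<^sub>F t in F. (nrm (fst t) (\<lambda>i. CA.est t i - hv (fst t) j \<omega> $ i))\<^sup>2 / (nrm (fst t) (\<lambda>i. hv (fst t) j \<omega> $ i))\<^sup>2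
        = (norm2 (CA_estimate \<tau> (Xi' L (fst t) \<sigma> (R (fst t)) j) (Y_mat L \<tau> s R hW N (fst t) \<omega>) s (u (fst t) (snd t) \<omega>)
                - h_vec R hW (fst t) j \<omega>))\<^sup>2 / (norm2 (h_vec R hW (fst t) j \<omega>))\<^sup>2"
        using evF
      proof eventually_elim
        case (elim t)
        then have n: "1 \<le> fst t" by simp
        have uc: "u (fst t) (snd t) \<omega> \<in> carrier_vec (fst t)" using step elim by blast
        define D where "D = CA_estimate \<tau> (Xp (fst t)) (received L (fst t) \<tau> (\<lambda>l. hv (fst t) l \<omega>) (\<lambda>l. s) (\<lambda>i k. N (fst t) i k \<omega>)) s (u (fst t) (snd t) \<omega>)"
        have Dc: "D \<in> carrier_vec (fst t)"
          unfolding D_def by (rule CA_estimate_index(1)[OF Xpc[OF n] uc received_carrier pilot(2)])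
        have De: "D $ i = CA.est t i" if i: "i < fst t" for i
        proof -
          have "ip (fst t) (\<lambda>i. (\<Sum>l=1..L. hv (fst t) l \<omega> $ i) + (\<Sum>k<\<tau>. cnj (s $ k) / of_nat \<tau> * N (fst t) i k \<omega>)) (p t)
              = ip (fst t) (CA.q t) (p t)"
            unfolding ip_def by (intro sum.cong refl, unfold CA.q_def) (simp add: e_def c_def)
          moreover have "D $ i = (Xp (fst t) *\<^sub>v u (fst t) (snd t) \<omega>) $ i
              * ip (fst t) (\<lambda>i. (\<Sum>l=1..L. hv (fst t) l \<omega> $ i) + (\<Sum>k<\<tau>. cnj (s $ k) / of_nat \<tau> * N (fst t) i k \<omega>))
                (\<lambda>i. (Xp (fst t) *\<^sub>v u (fst t) (snd t) \<omega>) $ i)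
              / complex_of_real ((nrm (fst t) (\<lambda>i. (Xp (fst t) *\<^sub>v u (fst t) (snd t) \<omega>) $ i))\<^sup>2)"
            unfolding D_def by (rule CA_estimate_received[OF Xpc[OF n] uc hvc[OF n] pilot i])
          ultimately show ?thesis unfolding CA.est_def unfolding p_def[abs_def] by (simp only:)
        qed
        have hj: "hv (fst t) j \<omega> \<in> carrier_vec (fst t)" by (rule hvc[OF n target])
        have "norm2 (D - hv (fst t) j \<omega>) = nrm (fst t) (\<lambda>i. (D - hv (fst t) j \<omega>) $ i)"
          by (rule nrm_vec[symmetric]) (use Dc hj in simp)
        also have "\<dots> = nrm (fst t) (\<lambda>i. CA.est t i - hv (fst t) j \<omega> $ i)"
          by (rule nrm_cong) (use Dc hj De in auto)
        finally show ?case
          using nrm_vec[OF hj] by (simp add: D_def Xp_def Y_mat_def hv_def)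
      qed
    qed
  qed
qed

end
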